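(* Let $Q$ be a finite acyclic quiver. Then there is a quasi-isomorphism of dg algebras $$\Gamma_Q\to\bigoplus_{n\ge 0}\mathcal P_{dg}(Q)(kQ,\tau^{-n}kQ).$$
   Context: $k$ is an algebraically closed field of characteristic $0$. Paths $\alpha_1\cdots\alpha_n$ satisfy $t(\alpha_i)=s(\alpha_{i+1})$; modules are right modules. Gradings are homological (differentials of degree $-1$, $V[1]_n=V_{n-1}$). Ginzburg algebra. Let $\widehat Q$ be obtained from $Q$ by adjoining for each arrow $\alpha:i\to j$ of $Q$ a reversed arrow $\alpha^*:j\to i$, and for each vertex $i$ a loop $t_i$. Then $\Gamma_Q=k\widehat Q$, bigraded with $\alpha,\alpha^*,t_i$ of bidegrees $(0,0),(1,0),(1,1)$ (first component weight, second component degree). The differential has bidegree $(0,-1)$: $d\alpha=d\alpha^*=0$, $dt_i=\sum_{\alpha:i\to j\text{ in }Q}\alpha\alpha^*-\sum_{\beta:j\to i\text{ in }Q}\beta^*\beta$, extended by $d(xy)=d(x)y+(-1)^{\deg x}x\,d(y)$. $\Gamma_Q$ is viewed as a dg algebra by degree. $\mathcal P_{dg}(Q)$ is the dg category of bounded complexes of projective $kQ$-modules: degree-$n$ morphisms are homogeneous $kQ$-linear maps of degree $n$, with differential $d(f)=d_Y\circ f-(-1)^{|f|}f\circ d_X$. $\tau$ is the Auslander–Reiten translate of the derived category; $\tau^{-n}kQ$ is to be replaced by a chosen projective resolution (bounded complex of projectives representing $\tau^{-n}kQ$ in $D^b(Q)$), i.e. the right-hand side means the resulting dg algebra, well defined up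 to quasi-isomorphism. The product of $f:kQ\to\tau^{-p}kQ$ and $g:kQ\to\tau^{-q}kQ$ is $f\cdot g=\tau^{-q}(f)\circ g$. *)

theory Defs
  imports
    "Graph_Theory.Graph_Theory"
    "HOL-Library.Poly_Mapping"
    "HOL-Library.Function_Algebras"
    "HOL-Computational_Algebra.Polynomial"
begin

section \<open>Path algebras\<close>

text \<open>
  A quiver is a \<^typ>\<open>('v, 'e) pre_digraph\<close>.  A path is a pair of its source and its list of
  arrows, composed from left to right, so that the trivial path at \<open>u\<close> is \<open>(u, [])\<close>.
\<close>

definition acyclic_quiver :: "('v, 'e) pre_digraph \<Rightarrow> bool" where
  "acyclic_quiver Q \<longleftrightarrow> (\<nexists>p. pre_digraph.cycle Q p)"

definition is_path :: "('v, 'e) pre_digraph \<Rightarrow> 'v \<times> 'e list \<Rightarrow> bool" where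
  "is_path Q p \<longleftrightarrow> (\<exists>v. pre_digraph.awalk Q (fst p) (snd p) v)"

definition path_target :: "('v, 'e) pre_digraph \<Rightarrow> 'v \<times> 'e list \<Rightarrow> 'v" where
  "path_target Q p = (if snd p = [] then fst p else head Q (last (snd p)))"

definition pscale :: "'k \<Rightarrow> ('a \<Rightarrow>\<^sub>0 'k) \<Rightarrow> ('a \<Rightarrow>\<^sub>0 'k::field)" (infixr "\<odot>" 75) where
  "c \<odot> x = Poly_Mapping.map ((*) c) x"

lemma lookup_pscale: "Poly_Mapping.lookup (c \<odot> x) a = c * Poly_Mapping.lookup x a"
  by (simp add: pscale_def Poly_Mapping.map.rep_eq when_def)

interpretation pscale: vector_space "pscale :: 'k::field \<Rightarrow> ('a \<Rightarrow>\<^sub>0 'k) \<Rightarrow> ('a \<Rightarrow>\<^sub>0 'k)"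
  by unfold_locales
    (auto intro!: poly_mapping_eqI simp: lookup_pscale lookup_add algebra_simps)

definition linear_on :: "('a \<Rightarrow>\<^sub>0 'k::field) set \<Rightarrow> (('a \<Rightarrow>\<^sub>0 'k) \<Rightarrow> ('b \<Rightarrow>\<^sub>0 'k)) \<Rightarrow> bool" where
  "linear_on S f \<longleftrightarrow>
     (\<forall>x\<in>S. \<forall>y\<in>S. f (x + y) = f x + f y) \<and> (\<forall>c. \<forall>x\<in>S. f (c \<odot> x) = c \<odot> f x)"

definition path_algebra :: "('v, 'e) pre_digraph \<Rightarrow> (('v \<times> 'e list) \<Rightarrow>\<^sub>0 'k::field) set" where
  "path_algebra Q = {x. \<forall>p\<in>Poly_Mapping.keys x. is_path Q p}"

definition pmult ::
  "('v, 'e) pre_digraph \<Rightarrow> (('v \<times> 'e list) \<Rightarrow>\<^sub>0 'k::field) \<Rightarrow> (('v \<times> 'e list) \<Rightarrow>\<^sub>0 'k) \<Rightarrow>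
   (('v \<times> 'e list) \<Rightarrow>\<^sub>0 'k)" where
  "pmult Q x y =
     (\<Sum>p\<in>Poly_Mapping.keys x. \<Sum>q\<in>Poly_Mapping.keys y.
        if path_target Q p = fst q
        then Poly_Mapping.single (fst p, snd p @ snd q)
               (Poly_Mapping.lookup x p * Poly_Mapping.lookup y q)
        else 0)"

definition punit :: "('v, 'e) pre_digraph \<Rightarrow> (('v \<times> 'e list) \<Rightarrow>\<^sub>0 'k::field)" where
  "punit Q = (\<Sum>v\<in>verts Q. Poly_Mapping.single (v, []) 1)"


section \<open>Differential graded algebras\<close>

text \<open>
  Homological grading.  A graded vector space is a family of subspaces of one ambient abelian
  group, indexed by the degree; the operations take the degrees of their homogeneous arguments
  as parameters, and nothing is required of them outside the indicated components.
\<close>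

record ('k, 'a) dga =
  dcomp :: "int \<Rightarrow> 'a set"
  dscale :: "'k \<Rightarrow> 'a \<Rightarrow> 'a"
  dmult :: "int \<Rightarrow> int \<Rightarrow> 'a \<Rightarrow> 'a \<Rightarrow> 'a"
  dunit :: 'a
  ddiff :: "int \<Rightarrow> 'a \<Rightarrow> 'a"

text \<open>The Koszul sign \<open>(-1)\<^sup>m\<close>.\<close>

definition koszul :: "int \<Rightarrow> 'a \<Rightarrow> 'a::ab_group_add" where
  "koszul m x = (if even m then x else - x)"

locale dg_algebra =
  fixes A :: "('k::field, 'a::ab_group_add) dga"
  assumes zero_closed: "0 \<in> dcomp A m"
    and add_closed: "\<lbrakk>x \<in> dcomp A m; y \<in> dcomp A m\<rbrakk> \<Longrightarrow> x + y \<in> dcomp A m"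
    and scale_closed: "x \<in> dcomp A m \<Longrightarrow> dscale A c x \<in> dcomp A m"
    and scale_add_right: "\<lbrakk>x \<in> dcomp A m; y \<in> dcomp A m\<rbrakk> \<Longrightarrow>
          dscale A c (x + y) = dscale A c x + dscale A c y"
    and scale_add_left: "x \<in> dcomp A m \<Longrightarrow> dscale A (b + c) x = dscale A b x + dscale A c x"
    and scale_scale: "x \<in> dcomp A m \<Longrightarrow> dscale A b (dscale A c x) = dscale A (b * c) x"
    and scale_one: "x \<in> dcomp A m \<Longrightarrow> dscale A 1 x = x"
    and mult_closed: "\<lbrakk>x \<in> dcomp A m; y \<in> dcomp A n\<rbrakk> \<Longrightarrow> dmult A m n x y \<in> dcomp A (m + n)"
    and mult_add_left: "\<lbrakk>x \<in> dcomp A m; x' \<in> dcomp A m; y \<in> dcomp A n\<rbrakk> \<Longrightarrow>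
          dmult A m n (x + x') y = dmult A m n x y + dmult A m n x' y"
    and mult_add_right: "\<lbrakk>x \<in> dcomp A m; y \<in> dcomp A n; y' \<in> dcomp A n\<rbrakk> \<Longrightarrow>
          dmult A m n x (y + y') = dmult A m n x y + dmult A m n x y'"
    and mult_scale_left: "\<lbrakk>x \<in> dcomp A m; y \<in> dcomp A n\<rbrakk> \<Longrightarrow>
          dmult A m n (dscale A c x) y = dscale A c (dmult A m n x y)"
    and mult_scale_right: "\<lbrakk>x \<in> dcomp A m; y \<in> dcomp A n\<rbrakk> \<Longrightarrow>
          dmult A m n x (dscale A c y) = dscale A c (dmult A m n x y)"
    and mult_assoc: "\<lbrakk>x \<in> dcomp A m; y \<in> dcomp A n; z \<in> dcomp A l\<rbrakk> \<Longrightarrow>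
          dmult A (m + n) l (dmult A m n x y) z = dmult A m (n + l) x (dmult A n l y z)"
    and unit_closed: "dunit A \<in> dcomp A 0"
    and mult_unit_left: "x \<in> dcomp A m \<Longrightarrow> dmult A 0 m (dunit A) x = x"
    and mult_unit_right: "x \<in> dcomp A m \<Longrightarrow> dmult A m 0 x (dunit A) = x"
    and diff_closed: "x \<in> dcomp A m \<Longrightarrow> ddiff A m x \<in> dcomp A (m - 1)"
    and diff_add: "\<lbrakk>x \<in> dcomp A m; y \<in> dcomp A m\<rbrakk> \<Longrightarrow>
          ddiff A m (x + y) = ddiff A m x + ddiff A m y"
    and diff_scale: "x \<in> dcomp A m \<Longrightarrow> ddiff A m (dscale A c x) = dscale A c (ddiff A m x)"
    and diff_diff: "x \<in> dcomp A m \<Longrightarrow> ddiff A (m - 1) (ddiff A m x) = 0"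
    and leibniz: "\<lbrakk>x \<in> dcomp A m; y \<in> dcomp A n\<rbrakk> \<Longrightarrow>
          ddiff A (m + n) (dmult A m n x y) =
          dmult A (m - 1) n (ddiff A m x) y + koszul m (dmult A m (n - 1) x (ddiff A n y))"

definition dcycles :: "('k, 'a::ab_group_add) dga \<Rightarrow> int \<Rightarrow> 'a set" where
  "dcycles A m = {x \<in> dcomp A m. ddiff A m x = 0}"

definition dboundaries :: "('k, 'a::ab_group_add) dga \<Rightarrow> int \<Rightarrow> 'a set" where
  "dboundaries A m = ddiff A (m + 1) ` dcomp A (m + 1)"

definition dga_hom ::
  "('k::field, 'a::ab_group_add) dga \<Rightarrow> ('k, 'b::ab_group_add) dga \<Rightarrow> (int \<Rightarrow> 'a \<Rightarrow> 'b) \<Rightarrow> bool" where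
  "dga_hom A B \<phi> \<longleftrightarrow>
     dg_algebra A \<and> dg_algebra B \<and>
     (\<forall>m. \<forall>x\<in>dcomp A m. \<phi> m x \<in> dcomp B m) \<and>
     (\<forall>m. \<forall>x\<in>dcomp A m. \<forall>y\<in>dcomp A m. \<phi> m (x + y) = \<phi> m x + \<phi> m y) \<and>
     (\<forall>m c. \<forall>x\<in>dcomp A m. \<phi> m (dscale A c x) = dscale B c (\<phi> m x)) \<and>
     (\<forall>m n. \<forall>x\<in>dcomp A m. \<forall>y\<in>dcomp A n.
        \<phi> (m + n) (dmult A m n x y) = dmult B m n (\<phi> m x) (\<phi> n y)) \<and>
     \<phi> 0 (dunit A) = dunit B \<and>
     (\<forall>m. \<forall>x\<in>dcomp A m. \<phi> (m - 1) (ddiff A m x) = ddiff B m (\<phi> m x))"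

text \<open>The last two clauses are injectivity and surjectivity of \<open>H\<^sub>m(\<phi>)\<close>.\<close>

definition dga_quasi_iso ::
  "('k::field, 'a::ab_group_add) dga \<Rightarrow> ('k, 'b::ab_group_add) dga \<Rightarrow> (int \<Rightarrow> 'a \<Rightarrow> 'b) \<Rightarrow> bool" where
  "dga_quasi_iso A B \<phi> \<longleftrightarrow>
     dga_hom A B \<phi> \<and>
     (\<forall>m. \<forall>x\<in>dcycles A m. \<phi> m x \<in> dboundaries B m \<longrightarrow> x \<in> dboundaries A m) \<and>
     (\<forall>m. \<forall>y\<in>dcycles B m. \<exists>x\<in>dcycles A m. y - \<phi> m x \<in> dboundaries B m)"


section \<open>The Ginzburg algebra\<close>

datatype ('v, 'e) garc = Arr 'e | Rev 'e | Loop 'v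

definition ginzburg_quiver :: "('v, 'e) pre_digraph \<Rightarrow> ('v, ('v, 'e) garc) pre_digraph" where
  "ginzburg_quiver Q =
     \<lparr>verts = verts Q,
      arcs = Arr ` arcs Q \<union> Rev ` arcs Q \<union> Loop ` verts Q,
      tail = (\<lambda>a. case a of Arr \<alpha> \<Rightarrow> tail Q \<alpha> | Rev \<alpha> \<Rightarrow> head Q \<alpha> | Loop i \<Rightarrow> i),
      head = (\<lambda>a. case a of Arr \<alpha> \<Rightarrow> head Q \<alpha> | Rev \<alpha> \<Rightarrow> tail Q \<alpha> | Loop i \<Rightarrow> i)\<rparr>"

fun garc_degree :: "('v, 'e) garc \<Rightarrow> int" where
  "garc_degree (Arr \<alpha>) = 0"
| "garc_degree (Rev \<alpha>) = 0"
| "garc_degree (Loop i) = 1"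

definition gpath_degree :: "'v \<times> ('v, 'e) garc list \<Rightarrow> int" where
  "gpath_degree p = sum_list (map garc_degree (snd p))"

fun garc_diff ::
  "('v, 'e) pre_digraph \<Rightarrow> ('v, 'e) garc \<Rightarrow> (('v \<times> ('v, 'e) garc list) \<Rightarrow>\<^sub>0 'k::field)" where
  "garc_diff Q (Arr \<alpha>) = 0"
| "garc_diff Q (Rev \<alpha>) = 0"
| "garc_diff Q (Loop i) =
     (\<Sum>\<alpha> | \<alpha> \<in> arcs Q \<and> tail Q \<alpha> = i. Poly_Mapping.single (i, [Arr \<alpha>, Rev \<alpha>]) 1) -
     (\<Sum>\<beta> | \<beta> \<in> arcs Q \<and> head Q \<beta> = i. Poly_Mapping.single (i, [Rev \<beta>, Arr \<beta>]) 1)"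

text \<open>
  \<open>gpath_diff Q u as\<close> is the differential of the path \<open>(u, as)\<close>, by the Leibniz rule for the
  factorisation into its first arrow and the remaining path.
\<close>

fun gpath_diff ::
  "('v, 'e) pre_digraph \<Rightarrow> 'v \<Rightarrow> ('v, 'e) garc list \<Rightarrow>
   (('v \<times> ('v, 'e) garc list) \<Rightarrow>\<^sub>0 'k::field)" where
  "gpath_diff Q u [] = 0"
| "gpath_diff Q u (a # as) =
     (let G = ginzburg_quiver Q; v = head G a in
        pmult G (garc_diff Q a) (Poly_Mapping.single (v, as) 1) +
        koszul (garc_degree a) (pmult G (Poly_Mapping.single (u, [a]) 1) (gpath_diff Q v as)))"

definition ginzburg_algebra ::
  "('v, 'e) pre_digraph \<Rightarrow> ('k::field, ('v \<times> ('v, 'e) garc list) \<Rightarrow>\<^sub>0 'k) dga" where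
  "ginzburg_algebra Q =
     \<lparr>dcomp = (\<lambda>m. {x \<in> path_algebra (ginzburg_quiver Q).
                      \<forall>p\<in>Poly_Mapping.keys x. gpath_degree p = m}),
      dscale = pscale,
      dmult = (\<lambda>m n. pmult (ginzburg_quiver Q)),
      dunit = punit (ginzburg_quiver Q),
      ddiff = (\<lambda>m x. \<Sum>p\<in>Poly_Mapping.keys x.
                  Poly_Mapping.lookup x p \<odot> gpath_diff Q (fst p) (snd p))\<rparr>"


section \<open>Modules over the path algebra\<close>

text \<open>
  All modules live on subspaces of the single vector space \<open>('v \<times> 'e list) \<Rightarrow>\<^sub>0 'k\<close>.  It contains
  the path algebra and is infinite-dimensional for all types \<open>'v\<close> and \<open>'e\<close>, so every
  finite-dimensional module is isomorphic to one of this form.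
\<close>

type_synonym ('v, 'e, 'k) pvec = "('v \<times> 'e list) \<Rightarrow>\<^sub>0 'k"

record (overloaded) ('v, 'e, 'k) rmodule =
  rcarrier :: "('v, 'e, 'k) pvec set"
  ract :: "('v, 'e, 'k) pvec \<Rightarrow> ('v, 'e, 'k) pvec \<Rightarrow> ('v, 'e, 'k) pvec"

definition right_module :: "('v, 'e) pre_digraph \<Rightarrow> ('v, 'e, 'k::field) rmodule \<Rightarrow> bool" where
  "right_module Q M \<longleftrightarrow>
     pscale.subspace (rcarrier M) \<and>
     (\<forall>x\<in>rcarrier M. \<forall>a\<in>path_algebra Q. ract M x a \<in> rcarrier M) \<and>
     (\<forall>a\<in>path_algebra Q. linear_on (rcarrier M) (\<lambda>x. ract M x a)) \<and>
     (\<forall>x\<in>rcarrier M. linear_on (path_algebra Q) (ract M x)) \<and>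
     (\<forall>x\<in>rcarrier M. ract M x (punit Q) = x) \<and>
     (\<forall>x\<in>rcarrier M. \<forall>a\<in>path_algebra Q. \<forall>b\<in>path_algebra Q.
        ract M (ract M x a) b = ract M x (pmult Q a b))"

text \<open>
  Module homomorphisms are normalised to be \<open>0\<close> outside the carrier of their domain, so that
  equal homomorphisms are equal functions.
\<close>

definition module_homs ::
  "('v, 'e) pre_digraph \<Rightarrow> ('v, 'e, 'k::field) rmodule \<Rightarrow> ('v, 'e, 'k) rmodule \<Rightarrow>
   (('v, 'e, 'k) pvec \<Rightarrow> ('v, 'e, 'k) pvec) set" where
  "module_homs Q M N =
     {f. f ` rcarrier M \<subseteq> rcarrier N \<and> linear_on (rcarrier M) f \<and>
         (\<forall>x\<in>rcarrier M. \<forall>a\<in>path_algebra Q. f (ract M x a) = ract N (f x) a) \<and>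
         (\<forall>x. x \<notin> rcarrier M \<longrightarrow> f x = 0)}"

definition finitely_generated ::
  "('v, 'e) pre_digraph \<Rightarrow> ('v, 'e, 'k::field) rmodule \<Rightarrow> bool" where
  "finitely_generated Q M \<longleftrightarrow>
     (\<exists>G. finite G \<and> G \<subseteq> rcarrier M \<and>
        (\<forall>x\<in>rcarrier M. \<exists>c. (\<forall>g\<in>G. c g \<in> path_algebra Q) \<and> x = (\<Sum>g\<in>G. ract M g (c g))))"

definition projective_module ::
  "('v, 'e) pre_digraph \<Rightarrow> ('v, 'e, 'k::field) rmodule \<Rightarrow> bool" where
  "projective_module Q P \<longleftrightarrow>
     right_module Q P \<and>
     (\<forall>M N. \<forall>g\<in>module_homs Q M N. \<forall>f\<in>module_homs Q P N.
        right_module Q M \<and> right_module Q N \<and> g ` rcarrier M = rcarrier N \<longrightarrow>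
        (\<exists>h\<in>module_homs Q P M. \<forall>x\<in>rcarrier P. g (h x) = f x))"


section \<open>The dg category of bounded complexes of projectives\<close>

record (overloaded) ('v, 'e, 'k) cpx =
  grade :: "int \<Rightarrow> ('v, 'e, 'k) rmodule"
  dif :: "int \<Rightarrow> ('v, 'e, 'k) pvec \<Rightarrow> ('v, 'e, 'k) pvec"

text \<open>
  A graded map \<open>f\<close> of degree \<open>m\<close> from \<open>X\<close> to \<open>Y\<close> has components \<open>f i : X\<^sub>i \<rightarrow> Y\<^sub>i\<^sub>+\<^sub>m\<close>.
\<close>

type_synonym ('v, 'e, 'k) gmap = "int \<Rightarrow> ('v, 'e, 'k) pvec \<Rightarrow> ('v, 'e, 'k) pvec"

definition hom ::
  "('v, 'e) pre_digraph \<Rightarrow> ('v, 'e, 'k::field) cpx \<Rightarrow> ('v, 'e, 'k) cpx \<Rightarrow> int \<Rightarrow>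
   ('v, 'e, 'k) gmap set" where
  "hom Q X Y m = {f. \<forall>i. f i \<in> module_homs Q (grade X i) (grade Y (i + m))}"

definition proj_complex :: "('v, 'e) pre_digraph \<Rightarrow> ('v, 'e, 'k::field) cpx \<Rightarrow> bool" where
  "proj_complex Q X \<longleftrightarrow>
     (\<forall>i. projective_module Q (grade X i) \<and> finitely_generated Q (grade X i)) \<and>
     (\<exists>N. \<forall>i. \<bar>i\<bar> > N \<longrightarrow> rcarrier (grade X i) = {0}) \<and>
     dif X \<in> hom Q X X (- 1) \<and>
     (\<forall>i. \<forall>x\<in>rcarrier (grade X i). dif X (i - 1) (dif X i x) = 0)"

text \<open>\<open>gcomp m g f\<close> is \<open>g \<circ> f\<close> for \<open>f\<close> of degree \<open>m\<close>.\<close>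

definition gcomp :: "int \<Rightarrow> ('v, 'e, 'k) gmap \<Rightarrow> ('v, 'e, 'k) gmap \<Rightarrow> ('v, 'e, 'k) gmap" where
  "gcomp m g f = (\<lambda>i x. g (i + m) (f i x))"

definition gscale :: "'k \<Rightarrow> ('v, 'e, 'k::field) gmap \<Rightarrow> ('v, 'e, 'k) gmap" where
  "gscale c f = (\<lambda>i x. c \<odot> f i x)"

definition gid :: "('v, 'e, 'k::field) cpx \<Rightarrow> ('v, 'e, 'k) gmap" where
  "gid X = (\<lambda>i x. if x \<in> rcarrier (grade X i) then x else 0)"

definition dhom ::
  "('v, 'e, 'k::field) cpx \<Rightarrow> ('v, 'e, 'k) cpx \<Rightarrow> int \<Rightarrow> ('v, 'e, 'k) gmap \<Rightarrow>
   ('v, 'e, 'k) gmap" where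
  "dhom X Y m f = gcomp m (dif Y) f - koszul m (gcomp (- 1) f (dif X))"

definition shift_cpx :: "('v, 'e, 'k::field) cpx \<Rightarrow> ('v, 'e, 'k) cpx" where
  "shift_cpx X = \<lparr>grade = (\<lambda>i. grade X (i - 1)), dif = (\<lambda>i x. - dif X (i - 1) x)\<rparr>"

definition shift_map :: "('v, 'e, 'k) gmap \<Rightarrow> ('v, 'e, 'k) gmap" where
  "shift_map f = (\<lambda>i. f (i - 1))"

definition regular_cpx :: "('v, 'e) pre_digraph \<Rightarrow> ('v, 'e, 'k::field) cpx" where
  "regular_cpx Q =
     \<lparr>grade = (\<lambda>i. if i = 0 then \<lparr>rcarrier = path_algebra Q, ract = pmult Q\<rparr>
                   else \<lparr>rcarrier = {0}, ract = (\<lambda>_ _. 0)\<rparr>),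
      dif = (\<lambda>_ _. 0)\<rparr>"


section \<open>The derived category and its Auslander--Reiten translate\<close>

text \<open>
  The derived category is the homotopy category of bounded complexes of finitely generated
  projectives, \<open>H\<^sub>0\<close> of the dg category above.  Its morphisms are represented by chain maps, and
  equalities of morphisms become homotopies of chain maps.
\<close>

definition chain_maps ::
  "('v, 'e) pre_digraph \<Rightarrow> ('v, 'e, 'k::field) cpx \<Rightarrow> ('v, 'e, 'k) cpx \<Rightarrow>
   ('v, 'e, 'k) gmap set" where
  "chain_maps Q X Y = {f \<in> hom Q X Y 0. dhom X Y 0 f = 0}"

definition homotopic ::
  "('v, 'e) pre_digraph \<Rightarrow> ('v, 'e, 'k::field) cpx \<Rightarrow> ('v, 'e, 'k) cpx \<Rightarrow>
   ('v, 'e, 'k) gmap \<Rightarrow> ('v, 'e, 'k) gmap \<Rightarrow> bool" where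
  "homotopic Q X Y f g \<longleftrightarrow> (\<exists>h\<in>hom Q X Y 1. f - g = dhom X Y 1 h)"

record (overloaded) ('v, 'e, 'k) hfunctor =
  hob :: "('v, 'e, 'k) cpx \<Rightarrow> ('v, 'e, 'k) cpx"
  hmor :: "('v, 'e, 'k) cpx \<Rightarrow> ('v, 'e, 'k) cpx \<Rightarrow> ('v, 'e, 'k) gmap \<Rightarrow> ('v, 'e, 'k) gmap"

definition is_hfunctor ::
  "('v, 'e) pre_digraph \<Rightarrow> ('v, 'e, 'k::field) hfunctor \<Rightarrow> bool" where
  "is_hfunctor Q F \<longleftrightarrow>
     (\<forall>X. proj_complex Q X \<longrightarrow> proj_complex Q (hob F X)) \<and>
     (\<forall>X Y. proj_complex Q X \<and> proj_complex Q Y \<longrightarrow>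
        (\<forall>f\<in>chain_maps Q X Y. hmor F X Y f \<in> chain_maps Q (hob F X) (hob F Y)) \<and>
        (\<forall>f\<in>chain_maps Q X Y. \<forall>g\<in>chain_maps Q X Y.
           homotopic Q X Y f g \<longrightarrow>
           homotopic Q (hob F X) (hob F Y) (hmor F X Y f) (hmor F X Y g)) \<and>
        (\<forall>f\<in>chain_maps Q X Y. \<forall>g\<in>chain_maps Q X Y.
           homotopic Q (hob F X) (hob F Y) (hmor F X Y (f + g)) (hmor F X Y f + hmor F X Y g)) \<and>
        (\<forall>c. \<forall>f\<in>chain_maps Q X Y.
           homotopic Q (hob F X) (hob F Y) (hmor F X Y (gscale c f)) (gscale c (hmor F X Y f)))) \<and>
     (\<forall>X. proj_complex Q X \<longrightarrow>
        homotopic Q (hob F X) (hob F X) (hmor F X X (gid X)) (gid (hob F X))) \<and>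
     (\<forall>X Y Z. proj_complex Q X \<and> proj_complex Q Y \<and> proj_complex Q Z \<longrightarrow>
        (\<forall>f\<in>chain_maps Q X Y. \<forall>g\<in>chain_maps Q Y Z.
           homotopic Q (hob F X) (hob F Z) (hmor F X Z (gcomp 0 g f))
             (gcomp 0 (hmor F Y Z g) (hmor F X Y f))))"

definition hfunctor_id :: "('v, 'e, 'k) hfunctor" where
  "hfunctor_id = \<lparr>hob = (\<lambda>X. X), hmor = (\<lambda>X Y f. f)\<rparr>"

definition hfunctor_comp ::
  "('v, 'e, 'k) hfunctor \<Rightarrow> ('v, 'e, 'k) hfunctor \<Rightarrow> ('v, 'e, 'k) hfunctor" where
  "hfunctor_comp G F =
     \<lparr>hob = (\<lambda>X. hob G (hob F X)),
      hmor = (\<lambda>X Y f. hmor G (hob F X) (hob F Y) (hmor F X Y f))\<rparr>"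

definition hnat_isomorphic ::
  "('v, 'e) pre_digraph \<Rightarrow> ('v, 'e, 'k::field) hfunctor \<Rightarrow> ('v, 'e, 'k) hfunctor \<Rightarrow> bool" where
  "hnat_isomorphic Q F G \<longleftrightarrow>
     (\<exists>\<eta>.
        (\<forall>X. proj_complex Q X \<longrightarrow>
           \<eta> X \<in> chain_maps Q (hob F X) (hob G X) \<and>
           (\<exists>\<theta>\<in>chain_maps Q (hob G X) (hob F X).
              homotopic Q (hob F X) (hob F X) (gcomp 0 \<theta> (\<eta> X)) (gid (hob F X)) \<and>
              homotopic Q (hob G X) (hob G X) (gcomp 0 (\<eta> X) \<theta>) (gid (hob G X)))) \<and>
        (\<forall>X Y. proj_complex Q X \<and> proj_complex Q Y \<longrightarrow>
           (\<forall>f\<in>chain_maps Q X Y.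
              homotopic Q (hob F X) (hob G Y)
                (gcomp 0 (\<eta> Y) (hmor F X Y f)) (gcomp 0 (hmor G X Y f) (\<eta> X)))))"

text \<open>Linear functionals on the space of morphisms \<open>X \<rightarrow> Y\<close> of the derived category.\<close>

definition hom_functional ::
  "('v, 'e) pre_digraph \<Rightarrow> ('v, 'e, 'k::field) cpx \<Rightarrow> ('v, 'e, 'k) cpx \<Rightarrow>
   (('v, 'e, 'k) gmap \<Rightarrow> 'k) \<Rightarrow> bool" where
  "hom_functional Q X Y l \<longleftrightarrow>
     (\<forall>f\<in>chain_maps Q X Y. \<forall>g\<in>chain_maps Q X Y. l (f + g) = l f + l g) \<and>
     (\<forall>c. \<forall>f\<in>chain_maps Q X Y. l (gscale c f) = c * l f) \<and>
     (\<forall>f\<in>chain_maps Q X Y. \<forall>g\<in>chain_maps Q X Y. homotopic Q X Y f g \<longrightarrow> l f = l g)"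

text \<open>
  \<open>\<tau>\<close> is the endofunctor for which \<open>S = \<tau>[1]\<close> is a Serre functor: there are isomorphisms
  \<open>Hom(X, Y) \<cong> D Hom(Y, \<tau>X[1])\<close>, \<open>f \<mapsto> \<beta> X Y f\<close>, natural in \<open>X\<close> and \<open>Y\<close>.  The conjuncts
  for \<open>\<beta> X Y\<close> are: values, well-definedness together with injectivity, additivity, homogeneity
  and surjectivity.
\<close>

definition AR_translate :: "('v, 'e) pre_digraph \<Rightarrow> ('v, 'e, 'k::field) hfunctor \<Rightarrow> bool" where
  "AR_translate Q \<tau> \<longleftrightarrow>
     is_hfunctor Q \<tau> \<and>
     (\<exists>\<beta>.
        (\<forall>X Y. proj_complex Q X \<and> proj_complex Q Y \<longrightarrow>
           (let S = shift_cpx (hob \<tau> X) in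
              (\<forall>f\<in>chain_maps Q X Y. hom_functional Q Y S (\<beta> X Y f)) \<and>
              (\<forall>f\<in>chain_maps Q X Y. \<forall>g\<in>chain_maps Q X Y.
                 homotopic Q X Y f g \<longleftrightarrow> (\<forall>u\<in>chain_maps Q Y S. \<beta> X Y f u = \<beta> X Y g u)) \<and>
              (\<forall>f\<in>chain_maps Q X Y. \<forall>g\<in>chain_maps Q X Y. \<forall>u\<in>chain_maps Q Y S.
                 \<beta> X Y (f + g) u = \<beta> X Y f u + \<beta> X Y g u) \<and>
              (\<forall>c. \<forall>f\<in>chain_maps Q X Y. \<forall>u\<in>chain_maps Q Y S.
                 \<beta> X Y (gscale c f) u = c * \<beta> X Y f u) \<and>
              (\<forall>l. hom_functional Q Y S l \<longrightarrow>
                 (\<exists>f\<in>chain_maps Q X Y. \<forall>u\<in>chain_maps Q Y S. \<beta> X Y f u = l u)))) \<and>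
        (\<forall>X Y Y'. proj_complex Q X \<and> proj_complex Q Y \<and> proj_complex Q Y' \<longrightarrow>
           (\<forall>f\<in>chain_maps Q X Y. \<forall>g\<in>chain_maps Q Y Y'.
              \<forall>u\<in>chain_maps Q Y' (shift_cpx (hob \<tau> X)).
                \<beta> X Y' (gcomp 0 g f) u = \<beta> X Y f (gcomp 0 u g))) \<and>
        (\<forall>X' X Y. proj_complex Q X' \<and> proj_complex Q X \<and> proj_complex Q Y \<longrightarrow>
           (\<forall>e\<in>chain_maps Q X' X. \<forall>f\<in>chain_maps Q X Y.
              \<forall>u\<in>chain_maps Q Y (shift_cpx (hob \<tau> X')).
                \<beta> X' Y (gcomp 0 f e) u =
                \<beta> X Y f (gcomp 0 (shift_map (hmor \<tau> X' X e)) u))))"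


section \<open>Dg lifts of the inverse translate and the orbit algebra\<close>

record (overloaded) ('v, 'e, 'k) dg_functor =
  fob :: "('v, 'e, 'k) cpx \<Rightarrow> ('v, 'e, 'k) cpx"
  fmor :: "('v, 'e, 'k) cpx \<Rightarrow> ('v, 'e, 'k) cpx \<Rightarrow> int \<Rightarrow> ('v, 'e, 'k) gmap \<Rightarrow> ('v, 'e, 'k) gmap"

definition is_dg_functor ::
  "('v, 'e) pre_digraph \<Rightarrow> ('v, 'e, 'k::field) dg_functor \<Rightarrow> bool" where
  "is_dg_functor Q T \<longleftrightarrow>
     (\<forall>X. proj_complex Q X \<longrightarrow> proj_complex Q (fob T X)) \<and>
     (\<forall>X Y m. proj_complex Q X \<and> proj_complex Q Y \<longrightarrow>
        (\<forall>f\<in>hom Q X Y m. fmor T X Y m f \<in> hom Q (fob T X) (fob T Y) m) \<and>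
        (\<forall>f\<in>hom Q X Y m. \<forall>g\<in>hom Q X Y m.
           fmor T X Y m (f + g) = fmor T X Y m f + fmor T X Y m g) \<and>
        (\<forall>c. \<forall>f\<in>hom Q X Y m. fmor T X Y m (gscale c f) = gscale c (fmor T X Y m f)) \<and>
        (\<forall>f\<in>hom Q X Y m.
           fmor T X Y (m - 1) (dhom X Y m f) = dhom (fob T X) (fob T Y) m (fmor T X Y m f))) \<and>
     (\<forall>X. proj_complex Q X \<longrightarrow> fmor T X X 0 (gid X) = gid (fob T X)) \<and>
     (\<forall>X Y Z m n. proj_complex Q X \<and> proj_complex Q Y \<and> proj_complex Q Z \<longrightarrow>
        (\<forall>f\<in>hom Q X Y m. \<forall>g\<in>hom Q Y Z n.
           fmor T X Z (m + n) (gcomp m g f) = gcomp m (fmor T Y Z n g) (fmor T X Y m f)))"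

definition H0_functor :: "('v, 'e, 'k) dg_functor \<Rightarrow> ('v, 'e, 'k) hfunctor" where
  "H0_functor T = \<lparr>hob = fob T, hmor = (\<lambda>X Y. fmor T X Y 0)\<rparr>"

text \<open>
  A choice of complexes of projectives representing \<open>\<tau>\<^sup>-\<^sup>nX\<close>, compatible with morphisms: a dg
  endofunctor that induces on the derived category a quasi-inverse of \<open>\<tau>\<close>.  Its \<open>n\<close>-th iterate
  represents \<open>\<tau>\<^sup>-\<^sup>n\<close>.
\<close>

definition inverse_translate_lift ::
  "('v, 'e) pre_digraph \<Rightarrow> ('v, 'e, 'k::field) dg_functor \<Rightarrow> bool" where
  "inverse_translate_lift Q T \<longleftrightarrow>
     is_dg_functor Q T \<and>
     (\<exists>\<tau>. AR_translate Q \<tau> \<and>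
        hnat_isomorphic Q (hfunctor_comp (H0_functor T) \<tau>) hfunctor_id \<and>
        hnat_isomorphic Q (hfunctor_comp \<tau> (H0_functor T)) hfunctor_id)"

definition pow_ob :: "('v, 'e, 'k) dg_functor \<Rightarrow> nat \<Rightarrow> ('v, 'e, 'k) cpx \<Rightarrow> ('v, 'e, 'k) cpx" where
  "pow_ob T n X = (fob T ^^ n) X"

fun pow_mor ::
  "('v, 'e, 'k) dg_functor \<Rightarrow> nat \<Rightarrow> ('v, 'e, 'k) cpx \<Rightarrow> ('v, 'e, 'k) cpx \<Rightarrow> int \<Rightarrow>
   ('v, 'e, 'k) gmap \<Rightarrow> ('v, 'e, 'k) gmap" where
  "pow_mor T 0 X Y m f = f"
| "pow_mor T (Suc n) X Y m f = fmor T (pow_ob T n X) (pow_ob T n Y) m (pow_mor T n X Y m f)"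

text \<open>
  The dg algebra \<open>\<Oplus>\<^sub>n Hom(kQ, \<tau>\<^sup>-\<^sup>nkQ)\<close>; the coefficient of an element at \<open>n\<close> is its component in
  the \<open>n\<close>-th summand.  The product is \<open>f \<cdot> g = \<tau>\<^sup>-\<^sup>q(f) \<circ> g\<close>.
\<close>

definition orbit_algebra ::
  "('v, 'e) pre_digraph \<Rightarrow> ('v, 'e, 'k) dg_functor \<Rightarrow>
   ('k::field, nat \<Rightarrow>\<^sub>0 ('v, 'e, 'k) gmap) dga" where
  "orbit_algebra Q T =
     (let A = regular_cpx Q; P = (\<lambda>n. pow_ob T n A) in
       \<lparr>dcomp = (\<lambda>m. {f. \<forall>n. Poly_Mapping.lookup f n \<in> hom Q A (P n) m}),
        dscale = (\<lambda>c. Poly_Mapping.map (gscale c)),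
        dmult = (\<lambda>a b f g.
          \<Sum>p\<in>Poly_Mapping.keys f. \<Sum>q\<in>Poly_Mapping.keys g.
            Poly_Mapping.single (p + q)
              (gcomp b (pow_mor T q A (P p) a (Poly_Mapping.lookup f p))
                 (Poly_Mapping.lookup g q))),
        dunit = Poly_Mapping.single 0 (gid A),
        ddiff = (\<lambda>m f.
          \<Sum>n\<in>Poly_Mapping.keys f.
            Poly_Mapping.single n (dhom A (P n) m (Poly_Mapping.lookup f n)))\<rparr>)"

end

theory Submission
  imports Defs "HOL-Library.Product_Plus"
begin

text \<open>
  Write \<open>A = kQ\<close> and let \<open>T\<close> be the dg lift of \<open>\<tau>\<^sup>-\<^sup>1\<close>.  Serre duality turns the functor into a
  trace form on the cycles of degree \<open>-1\<close> in \<open>Hom(TA, A)\<close>, whose pairing with \<open>A\<close> is perfect,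
  and makes the remaining homology of \<open>Hom(TA, A)\<close> vanish.  Representing the trace form by
  elements of \<open>TA\<close> gives degree one elements \<open>mL i\<close>, the images of the loops \<open>t\<^sub>i\<close>; the standard
  resolution of the bimodule \<open>DA\<close> then gives cycles \<open>mR \<beta>\<close>, the images of the reversed arrows, with
  \<open>d (mL i) = \<Sum> \<alpha> mR \<alpha> - \<Sum> mR \<beta> \<beta>\<close>.

  Let \<open>\<Theta>\<close> be the weight one part of the Ginzburg algebra.  The induced map
  \<open>X \<otimes>\<^sub>A \<Theta> \<rightarrow> TX\<close> is a quasi-isomorphism for every bounded complex \<open>X\<close> of projectives: for
  \<open>X = A\<close> because its cone has an exact dual, and in general by filtering \<open>X\<close>.
  Since the weight \<open>n + 1\<close> part of the Ginzburg algebra is the weight \<open>n\<close> part tensored with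
  \<open>\<Theta>\<close>, induction on the weight shows that the comparison map is a quasi-isomorphism.
\<close>

text \<open>Abstractly, \<Theta> is a two-term complex of bimodules for which Hom_A(\<Theta>, A)
  resolves DA, and weight one of the theorem says that TA and \<Theta> are quasi-isomorphic
  bimodules. The obstacle is that this is not what Serre duality provides: \<open>T\<close> is an
  arbitrary dg endofunctor, and the duality is only a natural isomorphism between Hom spaces of the
  homotopy category. All of it is therefore condensed into one functional, the Serre pairing with
  the identity of TA, whose cyclicity records the left and the right action of A at once. Elements
  of TA are never computed. They are found and compared through the A-linear maps from the modules
  of TA to A, which suffice because these modules have finite dual bases. No coherence data is
  needed for the comparison map: the Ginzburg algebra is a tensor algebra over A on the weight one
  generators, so its differential is the only condition on their images, and \<open>T\<close> is
  strict, so products can be evaluated path by path. The weight one statement is wanted for all X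
  because the induction applies it to X = T^n A.\<close>

type_synonym ('v, 'e, 'k) gvec = "('v \<times> ('v, 'e) garc list) \<Rightarrow>\<^sub>0 'k"
type_synonym ('v, 'e) wpath = "('v, 'e) garc \<times> ('v \<times> 'e list)"

section \<open>Exactness of complexes\<close>

text \<open>Quasi-isomorphisms are handled as exactness of mapping cones until the homology classes
  of the two algebras are compared at the very end, so this notion serves every comparison in
  between.\<close>

definition exact_cpx :: "(int \<Rightarrow> 'a::ab_group_add set) \<Rightarrow> (int \<Rightarrow> 'a \<Rightarrow> 'a) \<Rightarrow> bool" where
  "exact_cpx G D \<longleftrightarrow> (\<forall>m. \<forall>x\<in>G m. D m x = 0 \<longrightarrow> (\<exists>y\<in>G (m + 1). D (m + 1) y = x))"

lemma exact_cpxD: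
  assumes "exact_cpx G D" "x \<in> G m" "D m x = 0"
  obtains y where "y \<in> G (m + 1)" "D (m + 1) y = x"
  using assms unfolding exact_cpx_def by blast

locale ab_complex =
  fixes G :: "int \<Rightarrow> 'a::ab_group_add set" and D :: "int \<Rightarrow> 'a \<Rightarrow> 'a"
  assumes zero: "0 \<in> G m"
    and diff: "x \<in> G m \<Longrightarrow> y \<in> G m \<Longrightarrow> x - y \<in> G m"
    and D_in: "x \<in> G m \<Longrightarrow> D m x \<in> G (m - 1)"
    and D_diff: "x \<in> G m \<Longrightarrow> y \<in> G m \<Longrightarrow> D m (x - y) = D m x - D m y"
    and D_D: "x \<in> G m \<Longrightarrow> D (m - 1) (D m x) = 0"
begin

lemma uminus: "x \<in> G m \<Longrightarrow> - x \<in> G m"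
  using diff[OF zero, of x m] by simp

lemma add: "x \<in> G m \<Longrightarrow> y \<in> G m \<Longrightarrow> x + y \<in> G m"
  using diff[of x m "- y"] uminus[of y m] by simp

lemma D_zero [simp]: "D m 0 = 0"
  using D_diff[OF zero zero, of m] by simp

lemma D_uminus: "x \<in> G m \<Longrightarrow> D m (- x) = - D m x"
  using D_diff[OF zero, of x m] by simp

lemma D_add: "x \<in> G m \<Longrightarrow> y \<in> G m \<Longrightarrow> D m (x + y) = D m x + D m y"
  using D_diff[of x m "- y"] by (simp add: uminus D_uminus)

lemma sum_in: "(\<And>i. i \<in> I \<Longrightarrow> f i \<in> G m) \<Longrightarrow> sum f I \<in> G m"
  by (induction I rule: infinite_finite_induct) (auto simp: zero add)

lemma D_sum: "(\<And>i. i \<in> I \<Longrightarrow> f i \<in> G m) \<Longrightarrow> D m (sum f I) = (\<Sum>i\<in>I. D m (f i))"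
  by (induction I rule: infinite_finite_induct) (auto simp: D_add sum_in)

end

text \<open>
  A complex with finitely many coordinates \<open>V k\<close>, with sections \<open>U k\<close>, is exact if it is
  filtered by the rank \<open>\<rho>\<close> of the coordinates and each graded piece is a product of exact complexes.
\<close>

lemma devissage:
  fixes \<rho> :: "'k \<Rightarrow> int"
  assumes G: "ab_complex G D"
    and fin: "finite I"
    and exact: "\<And>k. k \<in> I \<Longrightarrow> exact_cpx (H k) (DH k)"
    and V_in: "\<And>k m x. k \<in> I \<Longrightarrow> x \<in> G m \<Longrightarrow> V k m x \<in> H k m"
    and V_diff: "\<And>k m x y. k \<in> I \<Longrightarrow> x \<in> G m \<Longrightarrow> y \<in> G m \<Longrightarrow> V k m (x - y) = V k m x - V k m y"
    and U_in: "\<And>k m h. k \<in> I \<Longrightarrow> h \<in> H k m \<Longrightarrow> U k m h \<in> G m"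
    and U_zero: "\<And>k m. k \<in> I \<Longrightarrow> U k m 0 = 0"
    and UV: "\<And>m x. x \<in> G m \<Longrightarrow> x = (\<Sum>k\<in>I. U k m (V k m x))"
    and VU: "\<And>k l m h. \<lbrakk>k \<in> I; l \<in> I; h \<in> H k m; \<rho> k < \<rho> l\<rbrakk> \<Longrightarrow> V l m (U k m h) = 0"
    and DU: "\<And>k l m h. \<lbrakk>k \<in> I; l \<in> I; h \<in> H k (m + 1); \<rho> k \<le> \<rho> l\<rbrakk> \<Longrightarrow>
      V l m (D (m + 1) (U k (m + 1) h)) = V l m (U k m (DH k (m + 1) h))"
    and DH_in: "\<And>k m h. k \<in> I \<Longrightarrow> h \<in> H k m \<Longrightarrow> DH k m h \<in> H k (m - 1)"
    and VD: "\<And>k m x. \<lbrakk>k \<in> I; x \<in> G m; D m x = 0; \<forall>l\<in>I. \<rho> k < \<rho> l \<longrightarrow> V l m x = 0\<rbrakk> \<Longrightarrow>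
      DH k m (V k m x) = 0"
  shows "exact_cpx G D"
proof -
  interpret ab_complex G D by (rule G)
  define F where "F N m = {x \<in> G m. \<forall>k\<in>I. N < \<rho> k \<longrightarrow> V k m x = 0}" for N m
  have V_zero: "V k m 0 = 0" if "k \<in> I" for k m
    using V_diff[OF that zero zero, of m] by simp
  have F0: "0 \<in> F N m" for N m
    by (simp add: F_def zero V_zero)
  have Fd: "x - y \<in> F N m" if "x \<in> F N m" "y \<in> F N m" for x y N m
    using that by (auto simp: F_def diff V_diff)
  have Fa: "x + y \<in> F N m" if "x \<in> F N m" "y \<in> F N m" for x y N m
    using Fd[OF that(1) Fd[OF F0 that(2)]] by simp
  have Fs: "sum f J \<in> F N m" if "\<And>i. i \<in> J \<Longrightarrow> f i \<in> F N m" for f J N m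
    using that by (induction J rule: infinite_finite_induct) (auto simp: F0 Fa)
  obtain N0 where N0: "\<And>k. k \<in> I \<Longrightarrow> N0 < \<rho> k"
  proof -
    have "\<exists>N0. \<forall>k\<in>I. N0 \<le> \<rho> k"
      using fin by (meson finite_imageI bdd_below_finite bdd_below.unfold imageI)
    then obtain N0 where "\<And>k. k \<in> I \<Longrightarrow> N0 \<le> \<rho> k" by blast
    then have "\<exists>N0. \<forall>k\<in>I. N0 < \<rho> k" by (intro exI[of _ "N0 - 1"]) force
    then show ?thesis using that by blast
  qed
  \<comment> \<open>Induction on the rank bound. It starts at \<open>N0\<close>, strictly below
    every rank, where all coordinates vanish and \<open>UV\<close> forces x = 0.\<close>
  have main: "\<forall>m x. x \<in> F (N0 + int n) m \<longrightarrow> D m x = 0 \<longrightarrow> (\<exists>y\<in>G (m + 1). D (m + 1) y = x)" for n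
  proof (induction n)
    case 0
    show ?case
    proof (intro allI impI)
      fix m x assume x: "x \<in> F (N0 + int 0) m"
      have "x = (\<Sum>k\<in>I. U k m (V k m x))" using x by (intro UV) (auto simp: F_def)
      also have "\<dots> = 0" using x N0 by (intro sum.neutral) (auto simp: F_def U_zero)
      finally show "\<exists>y\<in>G (m + 1). D (m + 1) y = x" using zero[of "m + 1"] by (intro bexI[of _ 0]) auto
    qed
  next
    case (Suc n)
    show ?case
    proof (intro allI impI)
      fix m x assume x: "x \<in> F (N0 + int (Suc n)) m" and Dx: "D m x = 0"
      define N where "N = N0 + int (Suc n)"
      have xG: "x \<in> G m" using x by (simp add: F_def)
      define K where "K = {k \<in> I. \<rho> k = N}"
      have "\<forall>k\<in>K. \<exists>h. h \<in> H k (m + 1) \<and> DH k (m + 1) h = V k m x"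
      proof
        fix k assume k: "k \<in> K"
        then have "DH k m (V k m x) = 0" "V k m x \<in> H k m" "exact_cpx (H k) (DH k)"
          using x xG Dx by (auto simp: K_def N_def F_def intro!: VD V_in exact)
        then show "\<exists>h. h \<in> H k (m + 1) \<and> DH k (m + 1) h = V k m x"
          by (metis exact_cpx_def)
      qed
      then obtain h where h: "\<And>k. k \<in> K \<Longrightarrow> h k \<in> H k (m + 1)" "\<And>k. k \<in> K \<Longrightarrow> DH k (m + 1) (h k) = V k m x"
        by metis
      \<comment> \<open>\<open>U\<close> and \<open>V\<close> need not be inverse to each other,
        since dual bases of projective modules only give idempotents. Hence y0 is not a preimage of
        the top layer of x; \<open>DU\<close> and the choice of h merely make all coordinates of x -
        D y0 of rank at least N vanish.\<close>
      define y0 where "y0 = (\<Sum>k\<in>K. U k (m + 1) (h k))"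
      have KI: "K \<subseteq> I" by (auto simp: K_def)
      have UG: "U k (m + 1) (h k) \<in> G (m + 1)" if "k \<in> K" for k
        using that h KI by (intro U_in) auto
      have y0: "y0 \<in> G (m + 1)" unfolding y0_def by (intro sum_in UG)
      have Dy0: "D (m + 1) y0 = (\<Sum>k\<in>K. D (m + 1) (U k (m + 1) (h k)))"
        unfolding y0_def by (intro D_sum UG)
      have DUG: "D (m + 1) (U k (m + 1) (h k)) \<in> G m" if "k \<in> K" for k
        using D_in[OF UG[OF that]] by simp
      have UD: "U k m (V k m x) - D (m + 1) (U k (m + 1) (h k)) \<in> F (N - 1) m" if k: "k \<in> K" for k
      proof -
        have *: "DH k (m + 1) (h k) \<in> H k m" using DH_in[of k "h k" "m + 1"] k KI h by auto
        have "V l m (U k m (V k m x)) = V l m (D (m + 1) (U k (m + 1) (h k)))" if "l \<in> I" "N - 1 < \<rho> l" for l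
          using DU[of k l "h k" m] k KI h(1)[OF k] that by (auto simp: h(2)[OF k] K_def)
        then show ?thesis
          using * k KI h DUG[OF k] by (auto simp: F_def V_diff diff U_in V_in xG subset_eq)
      qed
      have rest: "U k m (V k m x) \<in> F (N - 1) m" if "k \<in> I - K" for k
      proof (cases "\<rho> k > N")
        case True
        then have "V k m x = 0" using x that by (auto simp: F_def N_def)
        then show ?thesis using that by (simp add: U_zero F0)
      next
        case False
        then have "\<rho> k < N" using that by (auto simp: K_def)
        then show ?thesis using that xG by (auto simp: F_def intro!: U_in V_in VU)
      qed
      have "x - D (m + 1) y0 = (\<Sum>k\<in>I - K. U k m (V k m x)) +
          (\<Sum>k\<in>K. U k m (V k m x) - D (m + 1) (U k (m + 1) (h k)))"
        using UV[OF xG] sum.subset_diff[OF KI fin, of "\<lambda>k. U k m (V k m x)"]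
        by (simp add: Dy0 sum_subtractf)
      also have "\<dots> \<in> F (N - 1) m" by (intro Fa Fs UD rest)
      finally have z: "x - D (m + 1) y0 \<in> F (N0 + int n) m" by (simp add: N_def)
      have "D m (D (m + 1) y0) = 0" using D_D[OF y0] by simp
      then have "D m (x - D (m + 1) y0) = 0"
        using xG D_in[OF y0] Dx by (simp add: D_diff)
      then obtain y1 where "y1 \<in> G (m + 1)" "D (m + 1) y1 = x - D (m + 1) y0"
        using Suc z by blast
      then show "\<exists>y\<in>G (m + 1). D (m + 1) y = x"
        using y0 by (intro bexI[of _ "y0 + y1"]) (auto simp: D_add add)
    qed
  qed
  show ?thesis unfolding exact_cpx_def
  proof (intro allI ballI impI)
    fix m x assume x: "x \<in> G m" "D m x = 0"
    obtain N1 where N1: "\<And>k. k \<in> I \<Longrightarrow> \<rho> k \<le> N1"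
      using fin by (meson finite_imageI bdd_above_finite bdd_above.unfold imageI)
    have "x \<in> F (N0 + int (nat (N1 - N0))) m"
      using x N1 by (force simp: F_def)
    then show "\<exists>y\<in>G (m + 1). D (m + 1) y = x" using main x(2) by blast
  qed
qed

text \<open>
  For a bounded complex with finite dual bases (a complex of finitely generated projective
  modules, with \<open>\<Lambda>\<close> the dual complex), exactness of the dual complex yields a contraction,
  constructed by descending induction on the degree.
\<close>

lemma exact_if_dual_exact:
  fixes \<Lambda> :: "int \<Rightarrow> ('a::ab_group_add \<Rightarrow> 'r::ab_group_add) set"
  assumes C: "ab_complex C D"
    and lam_diff: "\<And>m v x y. \<lbrakk>v \<in> \<Lambda> m; x \<in> C m; y \<in> C m\<rbrakk> \<Longrightarrow> v (x - y) = v x - v y"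
    and lam_zero: "\<And>m. (\<lambda>_. 0) \<in> \<Lambda> m"
    and lam_minus: "\<And>m v w. v \<in> \<Lambda> m \<Longrightarrow> w \<in> \<Lambda> m \<Longrightarrow> (\<lambda>x. v x - w x) \<in> \<Lambda> m"
    and lam_cong: "\<And>m v w. v \<in> \<Lambda> m \<Longrightarrow> (\<And>x. x \<in> C m \<Longrightarrow> w x = v x) \<Longrightarrow> w \<in> \<Lambda> m"
    and lam_D: "\<And>m v. v \<in> \<Lambda> m \<Longrightarrow> (\<lambda>x. v (D (m + 1) x)) \<in> \<Lambda> (m + 1)"
    and fin: "\<And>m. finite (J m)"
    and W_in: "\<And>m j. j \<in> J m \<Longrightarrow> W j \<in> \<Lambda> m"
    and lamR: "\<And>m v x. v \<in> \<Lambda> m \<Longrightarrow> x \<in> C m \<Longrightarrow> v x \<in> Rg"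
    and U_in: "\<And>m j r. j \<in> J m \<Longrightarrow> r \<in> Rg \<Longrightarrow> U j r \<in> C m"
    and U_zero: "\<And>m j. j \<in> J m \<Longrightarrow> U j 0 = 0"
    and UW: "\<And>m x. x \<in> C m \<Longrightarrow> x = (\<Sum>j\<in>J m. U j (W j x))"
    and lamU: "\<And>m m' j v w. \<lbrakk>j \<in> J m; v \<in> \<Lambda> m; w \<in> \<Lambda> m'\<rbrakk> \<Longrightarrow> (\<lambda>x. v (U j (w x))) \<in> \<Lambda> m'"
    and exact: "\<And>m v. \<lbrakk>v \<in> \<Lambda> m; \<forall>x\<in>C (m + 1). v (D (m + 1) x) = 0\<rbrakk> \<Longrightarrow>
      \<exists>w\<in>\<Lambda> (m - 1). \<forall>x\<in>C m. v x = w (D m x)"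
    and bounded: "\<And>m. m > N \<Longrightarrow> C m = {0}"
  shows "exact_cpx C D"
proof -
  interpret ab_complex C D by (rule C)
  \<comment> \<open>The last clause, that composing with s preserves the dual, takes the place of
    linearity over the ring, which the abstract groups cannot express.\<close>
  define good where "good s m \<longleftrightarrow> s 0 = 0 \<and> (\<forall>x\<in>C m. s x \<in> C (m + 1)) \<and> (\<forall>v\<in>\<Lambda> (m + 1). (\<lambda>x. v (s x)) \<in> \<Lambda> m)"
    for s m
  have lam_0: "v 0 = 0" if "v \<in> \<Lambda> m" for v m
    using lam_diff[OF that zero zero] by simp
  have lam_um: "v (- x) = - v x" if "v \<in> \<Lambda> m" "x \<in> C m" for v m x
    using lam_diff[OF that(1) zero that(2)] by (simp add: lam_0[OF that(1)])
  have lam_a: "v (x + y) = v x + v y" if "v \<in> \<Lambda> m" "x \<in> C m" "y \<in> C m" for v m x y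
    using lam_diff[OF that(1,2) uminus[OF that(3)]] by (simp add: lam_um[OF that(1,3)])
  have lam_s: "v (sum f A) = (\<Sum>i\<in>A. v (f i))" if "v \<in> \<Lambda> m" "\<And>i. i \<in> A \<Longrightarrow> f i \<in> C m" for v m f A
    using that by (induction A rule: infinite_finite_induct) (auto simp: lam_0 lam_a sum_in)
  have lam_plus: "(\<lambda>x. v x + w x) \<in> \<Lambda> m" if "v \<in> \<Lambda> m" "w \<in> \<Lambda> m" for v w m
    using lam_minus[OF that(1) lam_minus[OF lam_zero that(2)]] by simp
  have lam_sum: "(\<lambda>x. \<Sum>i\<in>A. f i x) \<in> \<Lambda> m" if "\<And>i. i \<in> A \<Longrightarrow> f i \<in> \<Lambda> m" for f m and A :: "'x set"
    using that by (induction A rule: infinite_finite_induct) (auto simp: lam_zero lam_plus)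
  \<comment> \<open>A contraction of C in degree m + 1, built downwards. For n = 0 it concerns
    degree N + 1, where C is zero.\<close>
  have main: "\<exists>s s'. good s m \<and> good s' (m + 1) \<and> (\<forall>c\<in>C (m + 1). c = s (D (m + 1) c) + D (m + 2) (s' c))"
    if "m = N - int n" for n m
    using that
  proof (induction n arbitrary: m)
    case 0
    have "good (\<lambda>_. 0) m'" for m' by (auto simp: good_def zero lam_0 lam_zero)
    then show ?case using bounded 0 by (intro exI[of _ "\<lambda>_. 0"]) auto
  next
    case (Suc n)
    obtain s s' where s: "good s (m + 1)" "good s' (m + 1 + 1)"
      "\<forall>c\<in>C (m + 1 + 1). c = s (D (m + 1 + 1) c) + D (m + 1 + 2) (s' c)"
      using Suc.IH[of "m + 1"] Suc.prems by auto
    define M where "M = m + 1"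
    have s: "good s M" "good s' (M + 1)" "\<forall>c\<in>C (M + 1). c = s (D (M + 1) c) + D (M + 2) (s' c)"
      using s by (auto simp: M_def)
    have sC: "s x \<in> C (M + 1)" if "x \<in> C M" for x using that s by (simp add: good_def)
    have DsC: "D (M + 1) (s x) \<in> C M" if "x \<in> C M" for x using D_in[OF sC[OF that]] by simp
    \<comment> \<open>By the contraction one degree above, id - D s kills boundaries. So does its
      composite with each \<open>W j\<close>, and exactness of the dual complex factors this
      composite through D.\<close>
    have "\<forall>j\<in>J M. \<exists>w. w \<in> \<Lambda> (M - 1) \<and> (\<forall>x\<in>C M. W j (x - D (M + 1) (s x)) = w (D M x))"
    proof
      fix j assume j: "j \<in> J M"
      have 1: "(\<lambda>x. W j (D (M + 1) (s x))) \<in> \<Lambda> M"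
        using s(1) lam_D[OF W_in[OF j]] by (auto simp: good_def)
      have 2: "(\<lambda>x. W j (x - D (M + 1) (s x))) \<in> \<Lambda> M"
        by (rule lam_cong[OF lam_minus[OF W_in[OF j] 1]]) (auto intro!: lam_diff[OF W_in[OF j]] DsC)
      have "W j (D (M + 1) c - D (M + 1) (s (D (M + 1) c))) = 0" if c: "c \<in> C (M + 1)" for c
      proof -
        have Dc: "D (M + 1) c \<in> C M" using D_in[OF c] by simp
        have s'c: "s' c \<in> C (M + 2)" using s(2) c by (auto simp: good_def add.assoc)
        have "c - s (D (M + 1) c) = D (M + 2) (s' c)" using s(3) c by (metis add_diff_cancel_left')
        then have "D (M + 1) (c - s (D (M + 1) c)) = 0" using D_D[OF s'c] by (simp add: add.commute)
        then show ?thesis using c sC[OF Dc] lam_0[OF W_in[OF j]] by (simp add: D_diff)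
      qed
      then show "\<exists>w. w \<in> \<Lambda> (M - 1) \<and> (\<forall>x\<in>C M. W j (x - D (M + 1) (s x)) = w (D M x))"
        using exact[OF 2] by blast
    qed
    then obtain w where w: "\<And>j. j \<in> J M \<Longrightarrow> w j \<in> \<Lambda> (M - 1)"
      "\<And>j x. j \<in> J M \<Longrightarrow> x \<in> C M \<Longrightarrow> W j (x - D (M + 1) (s x)) = w j (D M x)" by metis
    \<comment> \<open>Reassembled with the dual basis, the factors give id - D s = t D, which is the
      contraction in the next lower degree.\<close>
    define t where "t x = (\<Sum>j\<in>J M. U j (w j x))" for x
    have UC: "U j (w j x) \<in> C M" if "j \<in> J M" "x \<in> C (M - 1)" for j x
      using that w(1)[OF that(1)] lamR by (intro U_in) blast+
    have "good t (M - 1)"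
      unfolding good_def
    proof (intro conjI ballI)
      show "t 0 = 0" unfolding t_def using lam_0 w U_zero by (intro sum.neutral) metis
      show "t x \<in> C (M - 1 + 1)" if "x \<in> C (M - 1)" for x
        unfolding t_def using UC that by (auto intro!: sum_in)
      show "(\<lambda>x. v (t x)) \<in> \<Lambda> (M - 1)" if v: "v \<in> \<Lambda> (M - 1 + 1)" for v
      proof (rule lam_cong[of "\<lambda>x. \<Sum>j\<in>J M. v (U j (w j x))"])
        show "(\<lambda>x. \<Sum>j\<in>J M. v (U j (w j x))) \<in> \<Lambda> (M - 1)"
          using v w by (intro lam_sum lamU) auto
        show "v (t x) = (\<Sum>j\<in>J M. v (U j (w j x)))" if "x \<in> C (M - 1)" for x
          unfolding t_def using v UC that by (intro lam_s) auto
      qed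
    qed
    moreover have "c = t (D M c) + D (M + 1) (s c)" if c: "c \<in> C M" for c
    proof -
      have "c - D (M + 1) (s c) = (\<Sum>j\<in>J M. U j (W j (c - D (M + 1) (s c))))"
        using c DsC by (intro UW diff) auto
      also have "\<dots> = t (D M c)" unfolding t_def by (intro sum.cong) (auto simp: w(2)[OF _ c])
      finally show ?thesis by (simp add: algebra_simps)
    qed
    ultimately show ?case using s(1)
      by (rule_tac exI[of _ t], rule_tac exI[of _ s]) (auto simp: M_def add.commute)
  qed
  show ?thesis unfolding exact_cpx_def
  proof (intro allI ballI impI)
    fix m x assume x: "x \<in> C m" "D m x = 0"
    show "\<exists>y\<in>C (m + 1). D (m + 1) y = x"
    proof (cases "m > N")
      case True
      then show ?thesis using x bounded zero[of "m + 1"] by (intro bexI[of _ 0]) auto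
    next
      case False
      then have "m - 1 = N - int (nat (N - (m - 1)))" by simp
      from main[OF this] obtain s s' where "good s (m - 1)" "good s' (m - 1 + 1)"
        "\<forall>c\<in>C (m - 1 + 1). c = s (D (m - 1 + 1) c) + D (m - 1 + 2) (s' c)" by blast
      moreover have "m - 1 + 1 = m" "m - 1 + 2 = m + 1" by simp_all
      ultimately have "good s (m - 1)" "good s' m" "\<forall>c\<in>C m. c = s (D m c) + D (m + 1) (s' c)"
        by metis+
      then show ?thesis using x by (intro bexI[of _ "s' x"]) (auto simp: good_def)
    qed
  qed
qed

text \<open>Induction on J: on the kernel of one functional f i the others suffice, and the missing
  coefficient is read off at a vector w with f i w = 1. The operation \<open>sc\<close> is seen only
  through the functionals, so that W can be a set of cycles with \<open>gscale\<close>.\<close>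

lemma functional_in_span:
  fixes f :: "'j \<Rightarrow> 'a::ab_group_add \<Rightarrow> 'k::field" and sc :: "'k \<Rightarrow> 'a \<Rightarrow> 'a"
  assumes "finite J"
    and "\<And>x y. x \<in> W \<Longrightarrow> y \<in> W \<Longrightarrow> x + y \<in> W" "\<And>c x. x \<in> W \<Longrightarrow> sc c x \<in> W"
    and "\<And>j x y. j \<in> J \<Longrightarrow> x \<in> W \<Longrightarrow> y \<in> W \<Longrightarrow> f j (x + y) = f j x + f j y"
    and "\<And>j c x. j \<in> J \<Longrightarrow> x \<in> W \<Longrightarrow> f j (sc c x) = c * f j x"
    and "\<And>x y. x \<in> W \<Longrightarrow> y \<in> W \<Longrightarrow> g (x + y) = g x + g y"
    and "\<And>c x. x \<in> W \<Longrightarrow> g (sc c x) = c * g x"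
    and "\<And>x. x \<in> W \<Longrightarrow> (\<And>j. j \<in> J \<Longrightarrow> f j x = 0) \<Longrightarrow> g x = 0"
  shows "\<exists>c. \<forall>x\<in>W. g x = (\<Sum>j\<in>J. c j * f j x)"
  using assms
proof (induction J arbitrary: W rule: finite_induct)
  case empty
  then show ?case by auto
next
  case (insert i J)
  define W' where "W' = {x \<in> W. f i x = 0}"
  have "\<exists>c. \<forall>x\<in>W'. g x = (\<Sum>j\<in>J. c j * f j x)"
    using insert.prems(1-6) by (intro insert.IH) (auto simp: W'_def intro!: insert.prems(7))
  then obtain c where c: "\<And>x. x \<in> W' \<Longrightarrow> g x = (\<Sum>j\<in>J. c j * f j x)" by blast
  show ?case
  proof (cases "\<exists>w\<in>W. f i w \<noteq> 0")
    case False
    then have "W' = W" by (auto simp: W'_def)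
    then show ?thesis using c insert(1,2)
      by (intro exI[of _ "c(i := 0)"]) (auto intro!: sum.cong)
  next
    case True
    then obtain w1 where w1: "w1 \<in> W" "f i w1 \<noteq> 0" by auto
    define w where "w = sc (inverse (f i w1)) w1"
    have w: "w \<in> W" "f i w = 1" using w1 insert.prems by (auto simp: w_def)
    define b where "b = g w - (\<Sum>j\<in>J. c j * f j w)"
    show ?thesis
    proof (intro exI[of _ "c(i := b)"] ballI)
      fix x assume x: "x \<in> W"
      define y where "y = x + sc (- f i x) w"
      have s: "sc (- f i x) w \<in> W" using w insert.prems(2) by auto
      have fy: "f j y = f j x - f i x * f j w" if "j \<in> insert i J" for j
        unfolding y_def using insert.prems(3)[OF that x s] insert.prems(4)[OF that w(1)] by simp
      have gy: "g y = g x - f i x * g w"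
        unfolding y_def using insert.prems(5)[OF x s] insert.prems(6)[OF w(1)] by simp
      have "y \<in> W'" using fy[of i] w(2) x s insert.prems(1) by (auto simp: W'_def y_def)
      from c[OF this] have "g x = f i x * g w + (\<Sum>j\<in>J. c j * (f j x - f i x * f j w))"
        using gy fy by (simp cong: sum.cong add: diff_eq_eq add.commute)
      also have "\<dots> = b * f i x + (\<Sum>j\<in>J. c j * f j x)"
        by (simp add: b_def sum_subtractf algebra_simps sum_distrib_left)
      also have "\<dots> = (\<Sum>j\<in>insert i J. (c(i := b)) j * f j x)"
        using insert(1,2) by (auto intro!: sum.cong)
      finally show "g x = (\<Sum>j\<in>insert i J. (c(i := b)) j * f j x)" .
    qed
  qed
qed

section \<open>Finitely supported functions, Koszul signs and linear extension\<close>

abbreviation lk :: "('a \<Rightarrow>\<^sub>0 'k::zero) \<Rightarrow> 'a \<Rightarrow> 'k" where "lk \<equiv> Poly_Mapping.lookup"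
abbreviation sg :: "'a \<Rightarrow> 'k \<Rightarrow> 'a \<Rightarrow>\<^sub>0 'k::zero" where "sg \<equiv> Poly_Mapping.single"
abbreviation ks :: "('a \<Rightarrow>\<^sub>0 'k::zero) \<Rightarrow> 'a set" where "ks \<equiv> Poly_Mapping.keys"

lemma lk_sum: "lk (sum f I) a = (\<Sum>i\<in>I. lk (f i) a)"
  by (induction I rule: infinite_finite_induct) (auto simp: lookup_add)

lemma pscale_single: "c \<odot> sg p b = sg p (c * b)"
  by (intro poly_mapping_eqI) (auto simp: lookup_pscale lookup_single when_def)

lemma keys_pscale: "ks (c \<odot> x) \<subseteq> ks x"
  by (auto simp: in_keys_iff lookup_pscale)

lemma pscale_diff: "c \<odot> (x - y) = c \<odot> x - c \<odot> (y :: 'a \<Rightarrow>\<^sub>0 'k::field)"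
  by (rule pscale.scale_right_diff_distrib)

lemma koszul_simps [simp]: "koszul m (0::'a::ab_group_add) = 0" "koszul 0 x = x" "koszul 1 x = - x"
  by (auto simp: koszul_def)

lemma koszul_add: "koszul m (x + y) = koszul m x + koszul m (y::'a::ab_group_add)"
  and koszul_diff: "koszul m (x - y) = koszul m x - koszul m (y::'a::ab_group_add)"
  and koszul_uminus: "koszul m (- x) = - koszul m (x::'a::ab_group_add)"
  and koszul_koszul: "koszul m (koszul n x) = koszul (m + n) (x::'a::ab_group_add)"
  by (auto simp: koszul_def)

lemma koszul_pred: "koszul (m - 1) x = - koszul m (x::'a::ab_group_add)"
  by (auto simp: koszul_def)

lemma koszul_sum: "koszul m (sum f I) = (\<Sum>i\<in>I. koszul m (f i :: 'a::ab_group_add))"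
  by (induction I rule: infinite_finite_induct) (auto simp: koszul_add)

lemma koszul_pscale: "koszul m (c \<odot> x) = c \<odot> koszul m (x :: 'a \<Rightarrow>\<^sub>0 'k::field)"
  by (auto simp: koszul_def)

lemma koszul_twice [simp]: "koszul m (koszul m x) = (x::'a::ab_group_add)"
  by (auto simp: koszul_def)

lemma pm_induct [case_names zero single add]:
  assumes "P 0" "\<And>p c. p \<in> ks x \<Longrightarrow> P (sg p c)" "\<And>x y. P x \<Longrightarrow> P y \<Longrightarrow> P (x + y)"
  shows "P (x :: 'a \<Rightarrow>\<^sub>0 'k::field)"
proof -
  have "P (\<Sum>p\<in>S. sg p (lk x p))" if "finite S" "S \<subseteq> ks x" for S
    using that by (induction rule: finite_induct) (auto intro: assms)
  moreover have "x = (\<Sum>p\<in>ks x. sg p (lk x p))"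
    by (intro poly_mapping_eqI) (auto simp: lk_sum lookup_single when_def sum.delta' in_keys_iff)
  ultimately show ?thesis by (metis finite_keys order_refl)
qed

text \<open>The linear map with prescribed values on a basis. The product of a path algebra, the
  Ginzburg differential and the comparison map are all of this form, so their linearity is settled
  by the laws of \<open>lext\<close>.\<close>

definition lext :: "('a \<Rightarrow> 'b \<Rightarrow>\<^sub>0 'k) \<Rightarrow> ('a \<Rightarrow>\<^sub>0 'k) \<Rightarrow> ('b \<Rightarrow>\<^sub>0 'k::field)" where
  "lext f x = (\<Sum>p\<in>ks x. lk x p \<odot> f p)"

lemma lext_superset: "finite S \<Longrightarrow> ks x \<subseteq> S \<Longrightarrow> lext f x = (\<Sum>p\<in>S. lk x p \<odot> f p)"
  unfolding lext_def by (rule sum.mono_neutral_left) (auto simp: in_keys_iff)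

lemma lext_zero [simp]: "lext f 0 = 0"
  by (simp add: lext_def)

lemma lext_single [simp]: "lext f (sg p c) = c \<odot> f p"
  using lext_superset[of "{p}" "sg p c" f] by auto

lemma lext_add: "lext f (x + y) = lext f x + lext f y"
proof -
  have "ks (x + y) \<subseteq> ks x \<union> ks y" by (rule keys_add)
  then show ?thesis
    by (simp add: lext_superset[of "ks x \<union> ks y"] lookup_add pscale.scale_left_distrib sum.distrib)
qed

lemma lext_scale: "lext f (c \<odot> x) = c \<odot> lext f x"
  using lext_superset[where f = f, OF finite_keys[of x] keys_pscale[of c x]]
  by (simp add: lookup_pscale pscale.scale_sum_right lext_def)

lemma lext_uminus: "lext f (- x) = - lext f x"
  using lext_add[of f x "- x"] by (simp add: eq_neg_iff_add_eq_0 add.commute)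

lemma lext_diff: "lext f (x - y) = lext f x - lext f y"
  using lext_add[of f x "- y"] by (simp add: lext_uminus)

lemma lext_sum: "lext f (sum g I) = (\<Sum>i\<in>I. lext f (g i))"
  by (induction I rule: infinite_finite_induct) (auto simp: lext_add)

lemma lext_koszul: "lext f (koszul m x) = koszul m (lext f x)"
  by (simp add: koszul_def lext_uminus)

lemma lext_fun_add: "lext (\<lambda>p. f p + g p) x = lext f x + lext g x"
  by (simp add: lext_def pscale.scale_right_distrib sum.distrib)

lemma lext_fun_scale: "lext (\<lambda>p. c \<odot> f p) x = c \<odot> lext f x"
  by (simp add: lext_def pscale.scale_sum_right mult.commute)

lemma lext_cong: "(\<And>p. p \<in> ks x \<Longrightarrow> f p = g p) \<Longrightarrow> lext f x = lext g x"
  by (simp add: lext_def)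

lemma lext_single_id: "lext (\<lambda>p. sg p 1) x = x"
  by (induction x rule: pm_induct) (auto simp: lext_add pscale_single)

lemma keys_lext: "ks (lext f x) \<subseteq> (\<Union>p\<in>ks x. ks (f p))"
  unfolding lext_def using keys_sum[of "\<lambda>p. lk x p \<odot> f p" "ks x"] keys_pscale by fastforce

section \<open>The multiplication of path algebras\<close>

definition path_prod :: "('v, 'e) pre_digraph \<Rightarrow> 'v \<times> 'e list \<Rightarrow> 'v \<times> 'e list \<Rightarrow> ('v, 'e, 'k::field) pvec" where
  "path_prod Q p q = (if path_target Q p = fst q then sg (fst p, snd p @ snd q) 1 else 0)"

lemma pmult_lext: "pmult Q x y = lext (\<lambda>p. lext (path_prod Q p) y) x"
  unfolding pmult_def lext_def pscale.scale_sum_right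
  by (intro sum.cong refl) (auto simp: path_prod_def pscale_single)

lemma pmult_add_left: "pmult Q (x + x') y = pmult Q x y + pmult Q x' y"
  and pmult_add_right: "pmult Q x (y + y') = pmult Q x y + pmult Q x y'"
  and pmult_diff_left: "pmult Q (x - x') y = pmult Q x y - pmult Q x' y"
  and pmult_uminus_left: "pmult Q (- x) y = - pmult Q x y"
  and pmult_scale_left: "pmult Q (c \<odot> x) y = c \<odot> pmult Q x y"
  and pmult_scale_right: "pmult Q x (c \<odot> y) = c \<odot> pmult Q x y"
  and pmult_zero_left [simp]: "pmult Q 0 y = 0"
  and pmult_sum_left: "pmult Q (sum f I) y = (\<Sum>i\<in>I. pmult Q (f i) y)"
  by (simp_all add: pmult_lext lext_add lext_fun_add lext_diff lext_uminus lext_scale lext_fun_scale lext_sum)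

lemma pmult_zero_right [simp]: "pmult Q x 0 = 0"
  using pmult_scale_right[of Q x 0 0] by simp

lemma pmult_uminus_right: "pmult Q x (- y) = - pmult Q x y"
  using pmult_add_right[of Q x y "- y"] by (simp add: eq_neg_iff_add_eq_0 add.commute)

lemma pmult_diff_right: "pmult Q x (y - y') = pmult Q x y - pmult Q x y'"
  using pmult_add_right[of Q x y "- y'"] by (simp add: pmult_uminus_right)

lemma pmult_sum_right: "pmult Q x (sum f I) = (\<Sum>i\<in>I. pmult Q x (f i))"
  by (induction I rule: infinite_finite_induct) (auto simp: pmult_add_right)

lemma pmult_koszul_left: "pmult Q (koszul m x) y = koszul m (pmult Q x y)"
  and pmult_koszul_right: "pmult Q x (koszul m y) = koszul m (pmult Q x y)"
  by (auto simp: koszul_def pmult_uminus_left pmult_uminus_right)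

lemma pmult_single: "pmult Q (sg p c) (sg q d) =
    (if path_target Q p = fst q then sg (fst p, snd p @ snd q) (c * d) else 0)"
  by (auto simp: pmult_lext path_prod_def pscale_single)

lemma path_target_append: "path_target Q p = fst q \<Longrightarrow> path_target Q (fst p, snd p @ snd q) = path_target Q q"
  by (cases "snd q") (auto simp: path_target_def)

lemma pmult_assoc: "pmult Q (pmult Q x y) z = pmult Q x (pmult Q y z)"
proof (induction x rule: pm_induct)
  case (single p c)
  show ?case
  proof (induction y rule: pm_induct)
    case (single q d)
    show ?case
    proof (induction z rule: pm_induct)
      case (single r e)
      show ?case
        using path_target_append[of Q p q] by (auto simp: pmult_single mult.assoc)
    qed (auto simp: pmult_add_right)
  qed (auto simp: pmult_add_right pmult_add_left)
qed (auto simp: pmult_add_left)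

lemma path_algebra_iff: "x \<in> path_algebra Q \<longleftrightarrow> (\<forall>p\<in>ks x. is_path Q p)"
  by (simp add: path_algebra_def)

lemma path_algebra_zero [simp]: "0 \<in> path_algebra Q"
  by (simp add: path_algebra_def)

lemma path_algebra_add: "x \<in> path_algebra Q \<Longrightarrow> y \<in> path_algebra Q \<Longrightarrow> x + y \<in> path_algebra Q"
  using keys_add[of x y] by (auto simp: path_algebra_def)

lemma path_algebra_uminus: "x \<in> path_algebra Q \<Longrightarrow> - x \<in> path_algebra Q"
  by (auto simp: path_algebra_def in_keys_iff)

lemma path_algebra_diff: "x \<in> path_algebra Q \<Longrightarrow> y \<in> path_algebra Q \<Longrightarrow> x - y \<in> path_algebra Q"
  using path_algebra_add[of x Q "- y"] by (simp add: path_algebra_uminus)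

lemma path_algebra_scale: "x \<in> path_algebra Q \<Longrightarrow> c \<odot> x \<in> path_algebra Q"
  using keys_pscale[of c x] by (auto simp: path_algebra_def)

lemma path_algebra_sum: "(\<And>i. i \<in> I \<Longrightarrow> f i \<in> path_algebra Q) \<Longrightarrow> sum f I \<in> path_algebra Q"
  by (induction I rule: infinite_finite_induct) (auto simp: path_algebra_add)

lemma path_algebra_single: "is_path Q p \<Longrightarrow> sg p c \<in> path_algebra Q"
  by (auto simp: path_algebra_def split: if_splits)

lemma path_algebra_lext: "(\<And>p. p \<in> ks x \<Longrightarrow> f p \<in> path_algebra Q) \<Longrightarrow> lext f x \<in> path_algebra Q"
  unfolding lext_def by (intro path_algebra_sum path_algebra_scale)

lemma path_algebra_induct [consumes 1, case_names zero single add]: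
  assumes "x \<in> path_algebra Q" "P 0" "\<And>p c. is_path Q p \<Longrightarrow> P (sg p c)" "\<And>x y. P x \<Longrightarrow> P y \<Longrightarrow> P (x + y)"
  shows "P x"
  by (rule pm_induct) (use assms in \<open>auto simp: path_algebra_def\<close>)

context wf_digraph
begin

lemma is_path_Nil [simp]: "is_path G (u, []) \<longleftrightarrow> u \<in> verts G"
  by (auto simp: is_path_def awalk_simps)

lemma is_path_Cons [simp]: "is_path G (u, a # as) \<longleftrightarrow> a \<in> arcs G \<and> u = tail G a \<and> is_path G (head G a, as)"
  by (auto simp: is_path_def awalk_simps)

lemma is_path_verts: "is_path G p \<Longrightarrow> fst p \<in> verts G"
  by (auto simp: is_path_def dest: awalk_hd_in_verts)

lemma path_target_Cons [simp]: "path_target G (u, a # as) = path_target G (head G a, as)"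
  by (auto simp: path_target_def)

lemma path_target_verts: "is_path G p \<Longrightarrow> path_target G p \<in> verts G"
proof (cases p)
  case (Pair u as)
  have "is_path G (u, as) \<Longrightarrow> path_target G (u, as) \<in> verts G"
    by (induction as arbitrary: u) (auto simp: path_target_def)
  then show "is_path G p \<Longrightarrow> ?thesis" using Pair by simp
qed

lemma is_path_append:
  "is_path G (u, as @ bs) \<longleftrightarrow> is_path G (u, as) \<and> is_path G (path_target G (u, as), bs)"
proof (induction as arbitrary: u)
  case Nil
  then show ?case by (auto simp: path_target_def dest: is_path_verts)
qed auto

lemma pmult_closed:
  assumes "x \<in> path_algebra G" "y \<in> path_algebra G"
  shows "pmult G x y \<in> path_algebra G"
  unfolding pmult_lext using assms
  by (intro path_algebra_lext) (auto simp: path_prod_def path_algebra_iff is_path_append intro!: path_algebra_single)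

lemma pmult_single_Nil_left: "(\<And>p. p \<in> ks x \<Longrightarrow> fst p = v) \<Longrightarrow> pmult G (sg (v, []) 1) x = x"
  by (subst (2) lext_single_id[symmetric]) (auto simp: pmult_lext path_prod_def path_target_def intro!: lext_cong)

lemma pmult_single_Nil_right: "(\<And>p. p \<in> ks x \<Longrightarrow> path_target G p = v) \<Longrightarrow> pmult G x (sg (v, []) 1) = x"
  by (subst (2) lext_single_id[symmetric]) (auto simp: pmult_lext path_prod_def intro!: lext_cong)

end

lemma lk_idem_left: "lk (pmult Q (sg (v, []) 1) x) p = (if fst p = v then lk x p else 0)"
proof (induction x rule: pm_induct)
  case (single q c)
  then show ?case by (cases q) (auto simp: pmult_single path_target_def lookup_single when_def)
qed (auto simp: pmult_add_right lookup_add)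

lemma lk_idem_right: "lk (pmult Q x (sg (v, []) 1)) p = (if path_target Q p = v then lk x p else 0)"
proof (induction x rule: pm_induct)
  case (single q c)
  then show ?case by (cases q) (auto simp: pmult_single lookup_single when_def)
qed (auto simp: pmult_add_left lookup_add)

context fin_digraph
begin

lemma punit_closed: "punit G \<in> path_algebra G"
  unfolding punit_def by (intro path_algebra_sum path_algebra_single) auto

lemma pmult_punit_left: "x \<in> path_algebra G \<Longrightarrow> pmult G (punit G) x = x"
  by (intro poly_mapping_eqI)
    (auto simp: punit_def pmult_sum_left lk_sum lk_idem_left path_algebra_def in_keys_iff sum.delta' dest: is_path_verts)

lemma pmult_punit_right: "x \<in> path_algebra G \<Longrightarrow> pmult G x (punit G) = x"
  by (intro poly_mapping_eqI)
    (auto simp: punit_def pmult_sum_right lk_sum lk_idem_right path_algebra_def in_keys_iff sum.delta' dest: path_target_verts)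

end

section \<open>Modules and complexes\<close>

locale quiver = fin_digraph Q for Q :: "('v, 'e) pre_digraph" +
  assumes acyclic: "acyclic_quiver Q"
begin

lemma awalk_distinct: "awalk u p v \<Longrightarrow> distinct (awalk_verts u p)"
proof (rule ccontr)
  assume "awalk u p v" "\<not> distinct (awalk_verts u p)"
  then obtain q r s where "p = q @ r @ s" "\<exists>w. awalk u q w \<and> awalk w r w \<and> awalk w s v" "0 < length r"
    using awalk_not_distinct_decomp[of u p v] by metis
  then have "closed_w r" by (auto simp: closed_w_def)
  then show False using closed_w_imp_cycle acyclic by (simp add: acyclic_quiver_def)
qed

text \<open>A walk that repeats a vertex would contain a cycle. Acyclicity is used only through this
  bound: it makes kQ finite-dimensional and lets inductions run along the length of paths.\<close>

lemma length_path: "is_path Q p \<Longrightarrow> length (snd p) \<le> card (verts Q)"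
  using awalk_distinct length_apath unfolding is_path_def apath_def by blast

definition paths :: "('v \<times> 'e list) set" where
  "paths = {p. is_path Q p}"

lemma finite_paths [simp]: "finite paths"
proof -
  have "paths \<subseteq> verts Q \<times> {es. set es \<subseteq> arcs Q \<and> length es \<le> card (verts Q)}"
    using length_path by (force simp: paths_def is_path_def awalk_def)
  then show ?thesis
    by (rule finite_subset) (intro finite_cartesian_product finite_lists_length_le finite_verts finite_arcs)
qed

abbreviation el :: "('v, 'e, 'k::field) cpx \<Rightarrow> int \<Rightarrow> ('v, 'e, 'k) pvec set" where
  "el X n \<equiv> rcarrier (grade X n)"

abbreviation act :: "('v, 'e, 'k::field) cpx \<Rightarrow> int \<Rightarrow> ('v, 'e, 'k) pvec \<Rightarrow> ('v, 'e, 'k) pvec \<Rightarrow> ('v, 'e, 'k) pvec" where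
  "act X n \<equiv> ract (grade X n)"

abbreviation PA :: "('v, 'e, 'k::field) pvec set" where "PA \<equiv> path_algebra Q"

abbreviation pm :: "('v, 'e, 'k::field) pvec \<Rightarrow> ('v, 'e, 'k) pvec \<Rightarrow> ('v, 'e, 'k) pvec" where "pm \<equiv> pmult Q"

section \<open>Right modules, their homomorphisms and dual bases\<close>

context
  fixes M :: "('v, 'e, 'k::field) rmodule"
  assumes M: "right_module Q M"
begin

lemma rm_zero: "0 \<in> rcarrier M"
  and rm_add: "x \<in> rcarrier M \<Longrightarrow> y \<in> rcarrier M \<Longrightarrow> x + y \<in> rcarrier M"
  and rm_scale: "x \<in> rcarrier M \<Longrightarrow> c \<odot> x \<in> rcarrier M"
  and rm_uminus: "x \<in> rcarrier M \<Longrightarrow> - x \<in> rcarrier M"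
  and rm_diff: "x \<in> rcarrier M \<Longrightarrow> y \<in> rcarrier M \<Longrightarrow> x - y \<in> rcarrier M"
  and rm_sum: "(\<And>i. i \<in> I \<Longrightarrow> f i \<in> rcarrier M) \<Longrightarrow> sum f I \<in> rcarrier M"
  using M by (auto simp: right_module_def pscale.subspace_0 pscale.subspace_add pscale.subspace_scale
    pscale.subspace_neg pscale.subspace_diff pscale.subspace_sum)

lemma rm_act: "x \<in> rcarrier M \<Longrightarrow> a \<in> PA \<Longrightarrow> ract M x a \<in> rcarrier M"
  and rm_act_add_left: "x \<in> rcarrier M \<Longrightarrow> y \<in> rcarrier M \<Longrightarrow> a \<in> PA \<Longrightarrow> ract M (x + y) a = ract M x a + ract M y a"
  and rm_act_scale_left: "x \<in> rcarrier M \<Longrightarrow> a \<in> PA \<Longrightarrow> ract M (c \<odot> x) a = c \<odot> ract M x a"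
  and rm_act_add_right: "x \<in> rcarrier M \<Longrightarrow> a \<in> PA \<Longrightarrow> b \<in> PA \<Longrightarrow> ract M x (a + b) = ract M x a + ract M x b"
  and rm_act_scale_right: "x \<in> rcarrier M \<Longrightarrow> a \<in> PA \<Longrightarrow> ract M x (c \<odot> a) = c \<odot> ract M x a"
  and rm_act_unit: "x \<in> rcarrier M \<Longrightarrow> ract M x (punit Q) = x"
  and rm_act_assoc: "x \<in> rcarrier M \<Longrightarrow> a \<in> PA \<Longrightarrow> b \<in> PA \<Longrightarrow> ract M (ract M x a) b = ract M x (pm a b)"
  using M unfolding right_module_def linear_on_def by simp_all

lemma rm_act_zero_left: "a \<in> PA \<Longrightarrow> ract M 0 a = 0"
  using rm_act_scale_left[OF rm_zero, of a 0] by simp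

lemma rm_act_zero_right: "x \<in> rcarrier M \<Longrightarrow> ract M x 0 = 0"
  using rm_act_scale_right[of x 0 0] by simp

lemma rm_act_uminus_left: "x \<in> rcarrier M \<Longrightarrow> a \<in> PA \<Longrightarrow> ract M (- x) a = - ract M x a"
  using rm_act_scale_left[of x a "- 1"] by simp

lemma rm_act_diff_left: "x \<in> rcarrier M \<Longrightarrow> y \<in> rcarrier M \<Longrightarrow> a \<in> PA \<Longrightarrow> ract M (x - y) a = ract M x a - ract M y a"
  using rm_act_add_left[of x "- y" a] by (simp add: rm_uminus rm_act_uminus_left)

lemma rm_act_sum_left:
  "a \<in> PA \<Longrightarrow> (\<And>i. i \<in> I \<Longrightarrow> f i \<in> rcarrier M) \<Longrightarrow> ract M (sum f I) a = (\<Sum>i\<in>I. ract M (f i) a)"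
  by (induction I rule: infinite_finite_induct) (auto simp: rm_act_zero_left rm_act_add_left rm_sum)

lemma rm_act_sum_right:
  "x \<in> rcarrier M \<Longrightarrow> (\<And>i. i \<in> I \<Longrightarrow> f i \<in> PA) \<Longrightarrow> ract M x (sum f I) = (\<Sum>i\<in>I. ract M x (f i))"
  by (induction I rule: infinite_finite_induct) (auto simp: rm_act_zero_right rm_act_add_right path_algebra_sum)

context
  fixes N f
  assumes f: "f \<in> module_homs Q M N"
begin

lemma mh_closed: "x \<in> rcarrier M \<Longrightarrow> f x \<in> rcarrier N"
  and mh_add: "x \<in> rcarrier M \<Longrightarrow> y \<in> rcarrier M \<Longrightarrow> f (x + y) = f x + f y"
  and mh_scale: "x \<in> rcarrier M \<Longrightarrow> f (c \<odot> x) = c \<odot> f x"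
  and mh_act: "x \<in> rcarrier M \<Longrightarrow> a \<in> PA \<Longrightarrow> f (ract M x a) = ract N (f x) a"
  and mh_outside: "x \<notin> rcarrier M \<Longrightarrow> f x = 0"
  using f by (auto simp: module_homs_def linear_on_def)

lemma mh_zero: "f 0 = 0"
  using mh_scale[OF rm_zero, of 0] by simp

lemma mh_uminus: "x \<in> rcarrier M \<Longrightarrow> f (- x) = - f x"
  using mh_scale[of x "- 1"] by simp

lemma mh_diff: "x \<in> rcarrier M \<Longrightarrow> y \<in> rcarrier M \<Longrightarrow> f (x - y) = f x - f y"
  using mh_add[of x "- y"] by (simp add: mh_uminus rm_uminus)

lemma mh_sum: "(\<And>i. i \<in> I \<Longrightarrow> g i \<in> rcarrier M) \<Longrightarrow> f (sum g I) = (\<Sum>i\<in>I. f (g i))"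
  by (induction I rule: infinite_finite_induct) (auto simp: mh_zero mh_add rm_sum)

end

end

lemma mhI:
  assumes "\<And>x. x \<in> rcarrier M \<Longrightarrow> f x \<in> rcarrier N"
    and "\<And>x y. x \<in> rcarrier M \<Longrightarrow> y \<in> rcarrier M \<Longrightarrow> f (x + y) = f x + f y"
    and "\<And>c x. x \<in> rcarrier M \<Longrightarrow> f (c \<odot> x) = c \<odot> f x"
    and "\<And>x a. x \<in> rcarrier M \<Longrightarrow> a \<in> PA \<Longrightarrow> f (ract M x a) = ract N (f x) a"
    and "\<And>x. x \<notin> rcarrier M \<Longrightarrow> f x = 0"
  shows "f \<in> module_homs Q M N"
  using assms by (auto simp: module_homs_def linear_on_def)

abbreviation reg :: "('v, 'e, 'k::field) rmodule" where
  "reg \<equiv> \<lparr>rcarrier = PA, ract = pm\<rparr>"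

lemma reg_module: "right_module Q reg"
  unfolding right_module_def linear_on_def pscale.subspace_def
  by (auto simp: path_algebra_add path_algebra_scale pmult_closed pmult_add_left pmult_add_right
      pmult_scale_left pmult_scale_right pmult_punit_right pmult_assoc)

lemma reg_projective: "projective_module Q (reg :: ('v, 'e, 'k::field) rmodule)"
  unfolding projective_module_def
proof (intro conjI reg_module allI ballI impI)
  fix M N :: "('v, 'e, 'k) rmodule" and g f
  assume g: "g \<in> module_homs Q M N" and f: "f \<in> module_homs Q reg N"
    and *: "right_module Q M \<and> right_module Q N \<and> g ` rcarrier M = rcarrier N"
  then have M: "right_module Q M" by simp
  have "f (punit Q) \<in> rcarrier N" using mh_closed[OF reg_module f] punit_closed by simp
  with * obtain m where m: "m \<in> rcarrier M" "g m = f (punit Q)" by force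
  let ?h = "\<lambda>a. if a \<in> PA then ract M m a else 0"
  have "?h \<in> module_homs Q reg M"
    using m by (intro mhI) (auto simp: rm_act[OF M] rm_act_add_right[OF M] rm_act_scale_right[OF M]
        rm_act_assoc[OF M] path_algebra_add path_algebra_scale pmult_closed)
  moreover have "g (?h a) = f a" if "a \<in> PA" for a
  proof -
    have "f (ract reg (punit Q) a) = ract N (f (punit Q)) a"
      by (rule mh_act[OF reg_module f]) (auto simp: punit_closed that)
    then show ?thesis using that m mh_act[OF M g m(1) that] by (simp add: pmult_punit_left)
  qed
  ultimately show "\<exists>h\<in>module_homs Q reg M. \<forall>x\<in>rcarrier reg. g (h x) = f x"
    by (intro bexI[of _ ?h]) auto
qed

lemma reg_fg: "finitely_generated Q reg"
  unfolding finitely_generated_def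
  using punit_closed pmult_punit_left by (intro exI[of _ "{punit Q}"]) force

lemma projectiveD: "projective_module Q P \<Longrightarrow> right_module Q P"
  by (simp add: projective_module_def)

text \<open>A surjection from a free module splits. Projectivity is a lifting property against
  modules inside the fixed space \<open>pvec\<close>, so the free module of rank n has to be rebuilt
  there: its basis over k is numbered by an injection \<iota> into the infinite index set of
  \<open>pvec\<close>, and \<open>emb\<close> and \<open>coord\<close> translate between vectors and
  n-tuples over kQ.\<close>

lemma dual_basis:
  fixes P :: "('v, 'e, 'k::field) rmodule"
  assumes P: "projective_module Q P" and fg: "finitely_generated Q P"
  shows "\<exists>(n::nat) u v. (\<forall>j<n. u j \<in> rcarrier P \<and> v j \<in> module_homs Q P reg) \<and>
    (\<forall>x\<in>rcarrier P. x = (\<Sum>j<n. ract P (u j) (v j x)))"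
proof -
  note PM = projectiveD[OF P]
  obtain Gs where Gs: "finite Gs" "Gs \<subseteq> rcarrier P"
    "\<forall>x\<in>rcarrier P. \<exists>c. (\<forall>g\<in>Gs. c g \<in> PA) \<and> x = (\<Sum>g\<in>Gs. ract P g (c g))"
    using fg by (auto simp: finitely_generated_def)
  obtain u n where u: "bij_betw u {..<n::nat} Gs"
    using ex_bij_betw_nat_finite[OF Gs(1)] by (auto simp: atLeast0LessThan)
  have uP: "u j \<in> rcarrier P" if "j < n" for j
    using u Gs(2) that by (auto simp: bij_betw_def)
  have "infinite (UNIV :: ('v \<times> 'e list) set)"
    by (simp add: finite_prod infinite_UNIV_listI)
  then obtain B where B: "finite B" "card B = card ({..<n} \<times> paths)" "B \<subseteq> (UNIV :: ('v \<times> 'e list) set)"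
    using infinite_arbitrarily_large by blast
  obtain \<iota> where "bij_betw \<iota> ({..<n} \<times> paths) B"
    using finite_same_card_bij[of "{..<n} \<times> paths" B] B by auto
  then have inj: "inj_on \<iota> ({..<n} \<times> paths)" by (auto simp: bij_betw_def)
  define coord where "coord j x = (\<Sum>p\<in>paths. sg p (lk x (\<iota> (j, p))))" for j and x :: "('v, 'e, 'k) pvec"
  define emb where "emb c = (\<Sum>j<n. \<Sum>p\<in>paths. sg (\<iota> (j, p)) (lk (c j) p))"
    for c :: "nat \<Rightarrow> ('v, 'e, 'k) pvec"
  define FM where "FM = \<lparr>rcarrier = {x. ks x \<subseteq> \<iota> ` ({..<n} \<times> paths)},
    ract = (\<lambda>x a. emb (\<lambda>j. pm (coord j x) a))\<rparr>"
  have lkc: "lk (coord j x) p = (if p \<in> paths then lk x (\<iota> (j, p)) else 0)" for j x p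
    by (auto simp: coord_def lk_sum lookup_single when_def sum.delta')
  have coordA: "coord j x \<in> PA" for j x
    by (auto simp: path_algebra_iff in_keys_iff lkc paths_def split: if_splits)
  have lke: "lk (emb c) (\<iota> (j, p)) = lk (c j) p" if "j < n" "p \<in> paths" for c j p
  proof -
    have "\<iota> i = \<iota> (j, p) \<longleftrightarrow> i = (j, p)" if "i \<in> {..<n} \<times> paths" for i
      using inj_on_eq_iff[OF inj that, of "(j, p)"] \<open>j < n\<close> \<open>p \<in> paths\<close> by simp
    note \<iota>_iff = this
    have "lk (emb c) (\<iota> (j, p)) = (\<Sum>i\<in>{..<n} \<times> paths. (if i = (j, p) then lk (c j) p else 0))"
      unfolding emb_def sum.cartesian_product lk_sum
    proof (rule sum.cong[OF refl])
      fix i assume "i \<in> {..<n} \<times> paths"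
      from \<iota>_iff[OF this] show "lk (case i of (l, q) \<Rightarrow> sg (\<iota> (l, q)) (lk (c l) q)) (\<iota> (j, p)) =
          (if i = (j, p) then lk (c j) p else 0)"
        by (cases i) (auto simp: lookup_single when_def)
    qed
    then show ?thesis using that by simp
  qed
  have lke': "lk (emb c) q = 0" if "q \<notin> \<iota> ` ({..<n} \<times> paths)" for c q
    using that unfolding emb_def by (auto simp: lk_sum lookup_single when_def intro!: sum.neutral)
  have coord_emb: "coord j (emb c) = c j" if "j < n" "c j \<in> PA" for j c
    using that by (intro poly_mapping_eqI) (auto simp: lkc lke path_algebra_iff paths_def in_keys_iff)
  have emb_in: "emb c \<in> rcarrier FM" for c
  proof -
    have "q \<in> \<iota> ` ({..<n} \<times> paths)" if "q \<in> ks (emb c)" for q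
      using that lke'[of q c] by (metis in_keys_iff)
    then show ?thesis by (simp add: FM_def subset_iff del: split_paired_All)
  qed
  have memF: "x \<in> rcarrier FM \<longleftrightarrow> ks x \<subseteq> \<iota> ` ({..<n} \<times> paths)" for x
    by (simp add: FM_def)
  have emb_eqI: "x = y" if "x \<in> rcarrier FM" "y \<in> rcarrier FM" "\<And>j. j < n \<Longrightarrow> coord j x = coord j y" for x y
  proof (rule poly_mapping_eqI)
    fix q show "lk x q = lk y q"
    proof (cases "q \<in> \<iota> ` ({..<n} \<times> paths)")
      case True
      then obtain j p where "j < n" "p \<in> paths" "q = \<iota> (j, p)" by auto
      then show ?thesis using that(3)[of j] lkc[of j x p] lkc[of j y p] by simp
    next
      case False
      then have "q \<notin> ks x" "q \<notin> ks y" using that(1,2) memF by blast+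
      then show ?thesis by (simp add: in_keys_iff)
    qed
  qed
  have coord_add: "coord j (x + y) = coord j x + coord j y" for j x y
    by (intro poly_mapping_eqI) (auto simp: lkc lookup_add)
  have coord_scale: "coord j (c \<odot> x) = c \<odot> coord j x" for j c x
    by (intro poly_mapping_eqI) (auto simp: lkc lookup_pscale)
  have add_in: "x + y \<in> rcarrier FM" if "x \<in> rcarrier FM" "y \<in> rcarrier FM" for x y
    using that keys_add[of x y] unfolding memF by blast
  have scale_in: "c \<odot> x \<in> rcarrier FM" if "x \<in> rcarrier FM" for x c
    using that keys_pscale[of c x] unfolding memF by blast
  have F_act: "ract FM x a = emb (\<lambda>j. pm (coord j x) a)" for x a by (simp add: FM_def)
  have coord_act: "coord j (ract FM x a) = pm (coord j x) a" if "j < n" "a \<in> PA" for j x a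
    using that by (simp add: F_act coord_emb pmult_closed coordA)
  have act_in: "ract FM x a \<in> rcarrier FM" for x a by (simp add: F_act emb_in)
  have FMM: "right_module Q FM"
    unfolding right_module_def linear_on_def
  proof (intro conjI ballI allI)
    show "pscale.subspace (rcarrier FM)"
      unfolding pscale.subspace_def using add_in scale_in by (simp add: memF)
  qed (rule emb_eqI; simp add: act_in add_in scale_in coord_act coord_add coord_scale pmult_add_left
    pmult_add_right pmult_scale_left pmult_scale_right pmult_assoc pmult_closed coordA pmult_punit_right
    punit_closed path_algebra_add path_algebra_scale | simp add: act_in)+
  define g where "g x = (if x \<in> rcarrier FM then \<Sum>j<n. ract P (u j) (coord j x) else 0)" for x
  have "ract P (\<Sum>j<n. ract P (u j) (coord j x)) a = (\<Sum>j<n. ract P (u j) (pm (coord j x) a))"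
    if "a \<in> PA" for x a
    using that uP by (subst rm_act_sum_left[OF PM]) (auto simp: rm_act[OF PM] coordA rm_act_assoc[OF PM])
  then have g: "g \<in> module_homs Q FM P"
    by (intro mhI)
      (auto simp: g_def add_in scale_in act_in coord_add coord_scale coord_act coordA uP pmult_closed
        rm_act_add_right[OF PM] rm_act_scale_right[OF PM] rm_act[OF PM] sum.distrib pscale.scale_sum_right intro!: rm_sum[OF PM])
  have "rcarrier P \<subseteq> g ` rcarrier FM"
  proof
    fix x assume "x \<in> rcarrier P"
    then obtain c where c: "\<forall>g\<in>Gs. c g \<in> PA" "x = (\<Sum>g\<in>Gs. ract P g (c g))" using Gs(3) by blast
    have "x = (\<Sum>j<n. ract P (u j) (c (u j)))"
      unfolding c(2) using sum.reindex_bij_betw[OF u, of "\<lambda>g. ract P g (c g)"] by simp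
    also have "\<dots> = g (emb (\<lambda>j. c (u j)))"
      using c(1) u by (auto simp: g_def emb_in coord_emb bij_betw_def intro!: sum.cong)
    finally show "x \<in> g ` rcarrier FM" using emb_in by blast
  qed
  then have surj: "g ` rcarrier FM = rcarrier P" using mh_closed[OF FMM g] by auto
  define i where "i x = (if x \<in> rcarrier P then x else 0)" for x
  have "i \<in> module_homs Q P P"
    by (intro mhI) (auto simp: i_def rm_add[OF PM] rm_scale[OF PM] rm_act[OF PM])
  \<comment> \<open>The section h of g has coordinates in kQ; these are the functionals of the dual
    basis, and g h = id is the dual basis identity.\<close>
  then obtain h where h: "h \<in> module_homs Q P FM" "\<forall>x\<in>rcarrier P. g (h x) = i x"
    using P FMM PM g surj unfolding projective_module_def by blast
  have hF: "h x \<in> rcarrier FM" if "x \<in> rcarrier P" for x using mh_closed[OF PM h(1) that] .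
  have "(\<lambda>x. coord j (h x)) \<in> module_homs Q P reg" if "j < n" for j
    using that by (intro mhI)
      (auto simp: coordA mh_add[OF PM h(1)] mh_scale[OF PM h(1)] mh_act[OF PM h(1)] coord_add
        coord_scale coord_act mh_outside[OF PM h(1)] lkc intro!: poly_mapping_eqI)
  moreover have "x = (\<Sum>j<n. ract P (u j) (coord j (h x)))" if "x \<in> rcarrier P" for x
    using h(2) that hF[OF that] by (auto simp: g_def i_def)
  ultimately show ?thesis using uP
    by (intro exI[of _ n] exI[of _ u] exI[of _ "\<lambda>j x. coord j (h x)"]) auto
qed

lemma zero_module:
  defines "Z \<equiv> \<lparr>rcarrier = {0}, ract = (\<lambda>_ _. 0)\<rparr> :: ('v, 'e, 'k::field) rmodule"
  shows "right_module Q Z" "projective_module Q Z" "finitely_generated Q Z"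
proof -
  show 1: "right_module Q Z"
    by (auto simp: Z_def right_module_def linear_on_def pscale.subspace_def)
  show "projective_module Q Z"
    unfolding projective_module_def
  proof (intro conjI 1 allI ballI impI)
    fix M N :: "('v, 'e, 'k) rmodule" and g f
    assume "g \<in> module_homs Q M N" "f \<in> module_homs Q Z N"
      and *: "right_module Q M \<and> right_module Q N \<and> g ` rcarrier M = rcarrier N"
    then have M: "right_module Q M" by simp
    have "(\<lambda>_. 0) \<in> module_homs Q Z M"
      by (intro mhI) (auto simp: rm_zero[OF M] rm_act_zero_left[OF M])
    moreover have "f 0 = 0" using mh_zero[OF 1] \<open>f \<in> module_homs Q Z N\<close> by blast
    moreover have "g 0 = 0" using mh_zero[OF M] \<open>g \<in> module_homs Q M N\<close> by blast
    ultimately show "\<exists>h\<in>module_homs Q Z M. \<forall>x\<in>rcarrier Z. g (h x) = f x"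
      by (intro bexI[of _ "\<lambda>_. 0"]) (auto simp: Z_def)
  qed
  show "finitely_generated Q Z"
    unfolding finitely_generated_def by (intro exI[of _ "{}"]) (auto simp: Z_def)
qed

end

section \<open>Complexes of projectives and their graded morphisms\<close>

context quiver
begin

lemma pc_projective: "proj_complex Q X \<Longrightarrow> projective_module Q (grade X n)"
  and pc_fg: "proj_complex Q X \<Longrightarrow> finitely_generated Q (grade X n)"
  by (auto simp: proj_complex_def)

lemma pc_mod: "proj_complex Q X \<Longrightarrow> right_module Q (grade X n)"
  by (rule projectiveD[OF pc_projective])

lemmas el_zero = rm_zero[OF pc_mod] and el_add = rm_add[OF pc_mod] and el_scale = rm_scale[OF pc_mod]
  and el_uminus = rm_uminus[OF pc_mod] and el_diff = rm_diff[OF pc_mod] and el_sum = rm_sum[OF pc_mod]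
  and el_act = rm_act[OF pc_mod] and act_add_left = rm_act_add_left[OF pc_mod]
  and act_scale_left = rm_act_scale_left[OF pc_mod] and act_add_right = rm_act_add_right[OF pc_mod]
  and act_scale_right = rm_act_scale_right[OF pc_mod] and act_unit = rm_act_unit[OF pc_mod]
  and act_assoc = rm_act_assoc[OF pc_mod] and act_zero_left = rm_act_zero_left[OF pc_mod]
  and act_zero_right = rm_act_zero_right[OF pc_mod] and act_uminus_left = rm_act_uminus_left[OF pc_mod]
  and act_diff_left = rm_act_diff_left[OF pc_mod] and act_sum_left = rm_act_sum_left[OF pc_mod]
  and act_sum_right = rm_act_sum_right[OF pc_mod]

lemma el_koszul: "proj_complex Q X \<Longrightarrow> x \<in> el X n \<Longrightarrow> koszul m x \<in> el X n"
  by (simp add: koszul_def el_uminus)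

lemma act_koszul_left: "proj_complex Q X \<Longrightarrow> x \<in> el X n \<Longrightarrow> a \<in> PA \<Longrightarrow>
    act X n (koszul m x) a = koszul m (act X n x a)"
  by (simp add: koszul_def act_uminus_left)

lemma homD: "f \<in> hom Q X Y m \<Longrightarrow> f n \<in> module_homs Q (grade X n) (grade Y (n + m))"
  by (simp add: hom_def)

lemmas h_in = mh_closed[OF pc_mod homD] and h_add = mh_add[OF pc_mod homD]
  and h_scale = mh_scale[OF pc_mod homD] and h_act = mh_act[OF pc_mod homD]
  and h_outside = mh_outside[OF pc_mod homD] and h_zero = mh_zero[OF pc_mod homD]
  and h_uminus = mh_uminus[OF pc_mod homD] and h_diff = mh_diff[OF pc_mod homD]
  and h_sum = mh_sum[OF pc_mod homD]

lemma h_koszul: "proj_complex Q X \<Longrightarrow> f \<in> hom Q X Y m \<Longrightarrow> x \<in> el X n \<Longrightarrow> f n (koszul k x) = koszul k (f n x)"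
  by (simp add: koszul_def h_uminus)

lemma dif_hom: "proj_complex Q X \<Longrightarrow> dif X \<in> hom Q X X (- 1)"
  by (simp add: proj_complex_def)

lemma d_in: "proj_complex Q X \<Longrightarrow> x \<in> el X n \<Longrightarrow> dif X n x \<in> el X (n - 1)"
  using h_in[OF _ dif_hom] by force

lemma d_act: "proj_complex Q X \<Longrightarrow> x \<in> el X n \<Longrightarrow> a \<in> PA \<Longrightarrow> dif X n (act X n x a) = act X (n - 1) (dif X n x) a"
  using h_act[OF _ dif_hom] by force

lemma d_d: "proj_complex Q X \<Longrightarrow> x \<in> el X n \<Longrightarrow> dif X (n - 1) (dif X n x) = 0"
  by (simp add: proj_complex_def)

context
  fixes X :: "('v, 'e, 'k::field) cpx"
  assumes X: "proj_complex Q X"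
begin

lemmas d_add = h_add[OF X dif_hom[OF X]] and d_zero = h_zero[OF X dif_hom[OF X]]
  and d_diff = h_diff[OF X dif_hom[OF X]] and d_uminus = h_uminus[OF X dif_hom[OF X]]
  and d_scale = h_scale[OF X dif_hom[OF X]] and d_sum = h_sum[OF X dif_hom[OF X]]
  and d_koszul = h_koszul[OF X dif_hom[OF X]] and d_outside = h_outside[OF X dif_hom[OF X]]

end

lemma homI:
  assumes "\<And>n x. x \<in> el X n \<Longrightarrow> f n x \<in> el Y (n + m)"
    and "\<And>n x y. x \<in> el X n \<Longrightarrow> y \<in> el X n \<Longrightarrow> f n (x + y) = f n x + f n y"
    and "\<And>n c x. x \<in> el X n \<Longrightarrow> f n (c \<odot> x) = c \<odot> f n x"
    and "\<And>n x a. x \<in> el X n \<Longrightarrow> a \<in> PA \<Longrightarrow> f n (act X n x a) = act Y (n + m) (f n x) a"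
    and "\<And>n x. x \<notin> el X n \<Longrightarrow> f n x = 0"
  shows "f \<in> hom Q X Y m"
  unfolding hom_def using assms by (auto intro!: mhI)

lemma gcomp_hom: "proj_complex Q X \<Longrightarrow> proj_complex Q Y \<Longrightarrow> f \<in> hom Q X Y m \<Longrightarrow> g \<in> hom Q Y Z n \<Longrightarrow>
    gcomp m g f \<in> hom Q X Z (m + n)"
  by (intro homI)
    (auto simp: gcomp_def h_in h_add h_scale h_act h_outside h_zero simp flip: add.assoc)

lemma koszul_apply: "koszul m f n x = koszul m (f n x)" for f :: "int \<Rightarrow> 'a \<Rightarrow> 'b::ab_group_add"
  by (simp add: koszul_def)

lemma dhom_apply: "dhom X Y m f n x = dif Y (n + m) (f n x) - koszul m (f (n - 1) (dif X n x))"
  by (simp add: dhom_def gcomp_def koszul_apply)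

lemma dif_hom_apply: "dif Y (n + m) (f n x) = dhom X Y m f n x + koszul m (f (n - 1) (dif X n x))"
  by (simp add: dhom_apply)

context
  fixes X Y :: "('v, 'e, 'k::field) cpx"
  assumes X: "proj_complex Q X" and Y: "proj_complex Q Y"
begin

lemma hom_zero: "0 \<in> hom Q X Y m"
  by (intro homI) (auto simp: el_zero[OF Y] act_zero_left[OF Y])

lemma hom_add: "f \<in> hom Q X Y m \<Longrightarrow> g \<in> hom Q X Y m \<Longrightarrow> f + g \<in> hom Q X Y m"
  by (intro homI)
    (auto simp: h_in[OF X] h_add[OF X] h_scale[OF X] h_act[OF X] h_outside[OF X] el_add[OF Y]
      act_add_left[OF Y] pscale.scale_right_distrib)

lemma hom_scale: "f \<in> hom Q X Y m \<Longrightarrow> gscale c f \<in> hom Q X Y m"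
  by (intro homI)
    (auto simp: gscale_def h_in[OF X] h_add[OF X] h_scale[OF X] h_act[OF X] h_outside[OF X] el_scale[OF Y]
      act_scale_left[OF Y] pscale.scale_right_distrib mult.commute)

lemma hom_uminus: "f \<in> hom Q X Y m \<Longrightarrow> - f \<in> hom Q X Y m"
  using hom_scale[of f m "- 1"] by (simp add: gscale_def fun_Compl_def)

lemma hom_diff: "f \<in> hom Q X Y m \<Longrightarrow> g \<in> hom Q X Y m \<Longrightarrow> f - g \<in> hom Q X Y m"
  using hom_add[of f m "- g"] by (simp add: hom_uminus)

lemma hom_sum: "(\<And>i. i \<in> I \<Longrightarrow> f i \<in> hom Q X Y m) \<Longrightarrow> sum f I \<in> hom Q X Y m"
  by (induction I rule: infinite_finite_induct) (auto simp: hom_zero hom_add)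

lemma hom_eqI:
  assumes "f \<in> hom Q X Y m" "g \<in> hom Q X Y m" "\<And>n x. x \<in> el X n \<Longrightarrow> f n x = g n x"
  shows "f = g"
proof (intro ext)
  fix n x show "f n x = g n x"
    using assms(3) h_outside[OF X assms(1)] h_outside[OF X assms(2)] by (cases "x \<in> el X n") auto
qed

lemma gid_hom: "gid X \<in> hom Q X X 0"
  by (intro homI) (auto simp: gid_def el_add[OF X] el_scale[OF X] el_act[OF X])

lemma gcomp_gid_right: "f \<in> hom Q X Y m \<Longrightarrow> gcomp 0 f (gid X) = f"
  by (intro ext) (auto simp: gcomp_def gid_def h_zero[OF X] h_outside[OF X])

lemma gcomp_gid_left: "f \<in> hom Q X Y m \<Longrightarrow> gcomp m (gid Y) f = f"
  using h_in[OF X] h_outside[OF X] by (intro ext, rename_tac n x, case_tac "x \<in> el X n") (auto simp: gcomp_def gid_def)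

lemma dhom_hom: assumes f: "f \<in> hom Q X Y m" shows "dhom X Y m f \<in> hom Q X Y (m - 1)"
proof -
  have "gcomp m (dif Y) f \<in> hom Q X Y (m + - 1)" "gcomp (- 1) f (dif X) \<in> hom Q X Y (- 1 + m)"
    using gcomp_hom[OF X Y f dif_hom[OF Y]] gcomp_hom[OF X X dif_hom[OF X] f] by auto
  then have "koszul m (gcomp (- 1) f (dif X)) \<in> hom Q X Y (m - 1)" "gcomp m (dif Y) f \<in> hom Q X Y (m - 1)"
    by (auto simp: koszul_def hom_uminus)
  then show ?thesis by (simp add: dhom_def hom_diff)
qed

lemma dhom_add: assumes "f \<in> hom Q X Y m" "g \<in> hom Q X Y m"
  shows "dhom X Y m (f + g) = dhom X Y m f + dhom X Y m g"
proof (intro ext)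
  fix n x show "dhom X Y m (f + g) n x = (dhom X Y m f + dhom X Y m g) n x"
    using assms h_in[OF X] by (cases "x \<in> el X n")
      (auto simp: dhom_apply d_add[OF Y] koszul_add h_outside[OF X] h_zero[OF X] d_outside[OF X] d_zero[OF Y])
qed

lemma dhom_scale: assumes "f \<in> hom Q X Y m"
  shows "dhom X Y m (gscale c f) = gscale c (dhom X Y m f)"
proof (intro ext)
  fix n x show "dhom X Y m (gscale c f) n x = (gscale c (dhom X Y m f)) n x"
    using assms h_in[OF X assms] by (cases "x \<in> el X n")
      (auto simp: dhom_apply gscale_def d_scale[OF Y] koszul_pscale h_outside[OF X] h_zero[OF X] d_outside[OF X] d_zero[OF Y]
        pscale_diff)
qed

lemma dhom_zero: "dhom X Y m 0 = 0"
  by (intro ext) (simp add: dhom_apply d_zero[OF Y])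

lemma dhom_dhom: assumes f: "f \<in> hom Q X Y m" shows "dhom X Y (m - 1) (dhom X Y m f) = 0"
proof (rule hom_eqI[OF dhom_hom[OF dhom_hom[OF f]] hom_zero])
  fix n x assume x: "x \<in> el X n"
  have *: "n + (m - 1) = n + m - 1" "n - 1 + m = n + m - 1" by simp_all
  show "dhom X Y (m - 1) (dhom X Y m f) n x = 0 n x"
    using x h_in[OF X f x] h_in[OF X f d_in[OF X x]] d_in[OF Y h_in[OF X f x]]
    unfolding dhom_apply *
    by (simp add: d_diff[OF Y] d_d[OF Y] d_d[OF X] d_koszul[OF Y] el_koszul[OF Y] koszul_pred h_zero[OF X f]
      koszul_diff d_zero[OF Y])
qed

end

lemma dhom_gid: "proj_complex Q X \<Longrightarrow> dhom X X 0 (gid X) = 0"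
  by (intro ext) (auto simp: dhom_apply gid_def d_in d_zero d_outside)

text \<open>The Leibniz rule of the dg category; the sign carries the degree of the outer map g,
  past which d moves to reach f.\<close>

lemma dhom_gcomp:
  assumes X: "proj_complex Q X" and Y: "proj_complex Q Y" and Z: "proj_complex Q Z"
    and f: "f \<in> hom Q X Y m" and g: "g \<in> hom Q Y Z n"
  shows "dhom X Z (m + n) (gcomp m g f) =
    gcomp m (dhom Y Z n g) f + koszul n (gcomp (m - 1) g (dhom X Y m f))"
proof (intro ext)
  fix i x
  have *: "i + (m + n) = i + m + n" "i + (m - 1) = i + m - 1" "i - 1 + m = i + m - 1" by simp_all
  show "dhom X Z (m + n) (gcomp m g f) i x =
    (gcomp m (dhom Y Z n g) f + koszul n (gcomp (m - 1) g (dhom X Y m f))) i x"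
  proof (cases "x \<in> el X i")
    case True
    have "f (i - 1) (dif X i x) \<in> el Y (i + m - 1)" "dif Y (i + m) (f i x) \<in> el Y (i + m - 1)"
      using h_in[OF X f d_in[OF X True]] d_in[OF Y h_in[OF X f True]] by (simp_all add: *)
    then show ?thesis
      by (simp add: dhom_apply gcomp_def koszul_apply * h_diff[OF Y g] el_koszul[OF Y] h_koszul[OF Y g]
        koszul_diff koszul_koszul add.commute[of n m])
  next
    case False
    then show ?thesis
      by (simp add: dhom_apply gcomp_def koszul_apply h_outside[OF X f] h_zero[OF Y g] h_zero[OF X f]
        d_outside[OF X] d_zero[OF Y] d_zero[OF Z])
  qed
qed

lemma gcomp_assoc: "gcomp m (gcomp n h g) f = gcomp (m + n) h (gcomp m g f)"
  by (simp add: gcomp_def add.assoc)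

section \<open>The regular module as a complex and the Yoneda identification\<close>

abbreviation RQ :: "('v, 'e, 'k::field) cpx" where "RQ \<equiv> regular_cpx Q"

lemma el_R: "el RQ n = (if n = 0 then PA else {0})"
  and act_R: "act RQ n = (if n = 0 then pm else (\<lambda>_ _. 0))"
  and dif_R [simp]: "dif RQ n x = 0"
  by (simp_all add: regular_cpx_def)

lemma pcR [simp]: "proj_complex Q (RQ :: ('v, 'e, 'k::field) cpx)"
proof -
  have "projective_module Q (grade RQ i) \<and> finitely_generated Q (grade RQ i)" for i
    by (simp add: regular_cpx_def reg_projective reg_fg zero_module)
  moreover have "dif RQ \<in> hom Q RQ RQ (- 1)"
    by (intro homI) (auto simp: el_R act_R)
  ultimately show ?thesis
    unfolding proj_complex_def by (auto simp: el_R intro!: exI[of _ 0])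
qed

text \<open>The Yoneda isomorphism between elements of X of degree n and morphisms kQ \<rightarrow>
  X of degree n. Its inverse is evaluation at the unit, see \<open>hat_unit\<close> and
  \<open>hat_surj\<close>.\<close>

definition hat :: "('v, 'e, 'k::field) cpx \<Rightarrow> int \<Rightarrow> ('v, 'e, 'k) pvec \<Rightarrow> ('v, 'e, 'k) gmap" where
  "hat X n x = (\<lambda>i a. if i = 0 \<and> a \<in> PA then act X n x a else 0)"

context
  fixes X :: "('v, 'e, 'k::field) cpx"
  assumes X: "proj_complex Q X"
begin

lemma hat_hom: "x \<in> el X n \<Longrightarrow> hat X n x \<in> hom Q RQ X n"
  by (intro homI) (auto simp: hat_def el_R act_R el_act[OF X] act_add_right[OF X] act_scale_right[OF X] act_assoc[OF X]
    act_zero_right[OF X] path_algebra_add path_algebra_scale pmult_closed el_zero[OF X] act_zero_left[OF X] split: if_splits)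

lemma hat_add: "x \<in> el X n \<Longrightarrow> y \<in> el X n \<Longrightarrow> hat X n (x + y) = hat X n x + hat X n y"
  by (intro ext) (auto simp: hat_def act_add_left[OF X])

lemma hat_scale: "x \<in> el X n \<Longrightarrow> hat X n (c \<odot> x) = gscale c (hat X n x)"
  by (intro ext) (auto simp: hat_def gscale_def act_scale_left[OF X])

lemma hat_zero: "hat X n 0 = 0"
  by (intro ext) (auto simp: hat_def act_zero_left[OF X])

lemma hat_unit: "x \<in> el X n \<Longrightarrow> hat X n x 0 (punit Q) = x"
  by (simp add: hat_def punit_closed act_unit[OF X])

lemma hat_surj: assumes f: "f \<in> hom Q RQ X n" shows "hat X n (f 0 (punit Q)) = f"
proof (intro ext)
  fix i a
  have "f 0 (act RQ 0 (punit Q) a) = act X (0 + n) (f 0 (punit Q)) a" if "a \<in> PA"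
    using that by (intro h_act[OF pcR f]) (auto simp: el_R punit_closed)
  moreover have "f i a = 0" if "i \<noteq> 0 \<or> a \<notin> PA"
    using that h_outside[OF pcR f, of a i] h_zero[OF pcR f, of i] by (cases "a = 0") (auto simp: el_R split: if_splits)
  ultimately show "hat X n (f 0 (punit Q)) i a = f i a"
    by (auto simp: hat_def act_R pmult_punit_left)
qed

lemma hom_R_el: "f \<in> hom Q RQ X n \<Longrightarrow> f 0 (punit Q) \<in> el X n"
  using h_in[OF pcR, of f X n "punit Q" 0] by (simp add: el_R punit_closed)

lemma hat_dif: "x \<in> el X n \<Longrightarrow> dhom RQ X n (hat X n x) = hat X (n - 1) (dif X n x)"
  using d_zero[OF X] by (intro ext) (auto simp: dhom_apply hat_def d_act[OF X] act_zero_right[OF X])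

lemma hat_act: "x \<in> el X n \<Longrightarrow> a \<in> PA \<Longrightarrow> hat X n (act X n x a) = gcomp 0 (hat X n x) (hat RQ 0 a)"
  by (intro ext) (auto simp: hat_def gcomp_def act_assoc[OF X] act_R pmult_closed act_zero_right[OF X])

lemma hat_hom_apply:
  assumes f: "f \<in> hom Q X Y m" and x: "x \<in> el X n"
  shows "hat Y (n + m) (f n x) = gcomp n f (hat X n x)"
  using x h_zero[OF X f] by (intro ext) (auto simp: hat_def gcomp_def h_act[OF X f])

text \<open>The functionals of a dual basis of one module of X are extended by zero to graded maps.
  These usually do not commute with the differentials, which is why morphisms that are not closed
  have to be carried along later.\<close>

lemma dual_basis_cpx:
  "\<exists>(N::nat) u v. (\<forall>j<N. u j \<in> el X n \<and> v j \<in> hom Q X RQ (- n)) \<and>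
    (\<forall>x\<in>el X n. x = (\<Sum>j<N. act X n (u j) (v j n x)))"
proof -
  obtain N u v where uv: "\<forall>j<N::nat. u j \<in> el X n \<and> v j \<in> module_homs Q (grade X n) reg"
    "\<forall>x\<in>el X n. x = (\<Sum>j<N. act X n (u j) (v j x))"
    using dual_basis[OF pc_projective[OF X] pc_fg[OF X]] by blast
  define w where "w j i x = (if i = n then v j x else 0)" for j i x
  have "w j \<in> hom Q X RQ (- n)" if "j < N" for j
    unfolding hom_def
  proof (intro CollectI allI)
    fix i show "w j i \<in> module_homs Q (grade X i) (grade RQ (i + - n))"
    proof (cases "i = n")
      case True
      then show ?thesis using uv(1) that by (simp add: w_def[abs_def] regular_cpx_def)
    next
      case False
      then show ?thesis by (intro mhI) (auto simp: w_def regular_cpx_def)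
    qed
  qed
  then show ?thesis using uv by (intro exI[of _ N] exI[of _ u] exI[of _ w]) (auto simp: w_def)
qed

end

lemma hat_R_unit: "hat RQ 0 (punit Q) = gid RQ"
  by (intro ext) (auto simp: hat_def gid_def el_R act_R pmult_punit_left)

lemma hom_to_R: "proj_complex Q X \<Longrightarrow> f \<in> hom Q X RQ d \<Longrightarrow> n + d \<noteq> 0 \<Longrightarrow> f n x = 0"
  using h_in[of X f RQ d x n] h_outside[of X f RQ d x n] by (cases "x \<in> el X n") (auto simp: el_R)

lemma hom_to_R_in: "proj_complex Q X \<Longrightarrow> f \<in> hom Q X RQ d \<Longrightarrow> f n x \<in> PA"
  using h_in[of X f RQ d x n] h_outside[of X f RQ d x n] by (cases "x \<in> el X n") (auto simp: el_R split: if_splits)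

lemma hom_to_R_act: "proj_complex Q X \<Longrightarrow> f \<in> hom Q X RQ d \<Longrightarrow> x \<in> el X n \<Longrightarrow> a \<in> PA \<Longrightarrow>
    f n (act X n x a) = pm (f n x) a"
  using h_act[of X f RQ d x n a] hom_to_R[of X f d n x] hom_to_R[of X f d n "act X n x a"]
  by (cases "n + d = 0") (auto simp: act_R)

end

section \<open>Dg endofunctors\<close>

locale dg_endofunctor = quiver Q for Q :: "('v, 'e) pre_digraph" +
  fixes T :: "('v, 'e, 'k::field) dg_functor"
  assumes dg_functor: "is_dg_functor Q T"
begin

lemma T_pc: "proj_complex Q X \<Longrightarrow> proj_complex Q (fob T X)"
  using dg_functor by (simp add: is_dg_functor_def)

lemma T_gid: "proj_complex Q X \<Longrightarrow> fmor T X X 0 (gid X) = gid (fob T X)"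
  using dg_functor by (simp add: is_dg_functor_def)

lemma T_gcomp: "proj_complex Q X \<Longrightarrow> proj_complex Q Y \<Longrightarrow> proj_complex Q Z \<Longrightarrow> f \<in> hom Q X Y m \<Longrightarrow> g \<in> hom Q Y Z n \<Longrightarrow>
    fmor T X Z (m + n) (gcomp m g f) = gcomp m (fmor T Y Z n g) (fmor T X Y m f)"
  using dg_functor by (simp add: is_dg_functor_def)

context
  fixes X Y :: "('v, 'e, 'k) cpx"
  assumes X: "proj_complex Q X" and Y: "proj_complex Q Y"
begin

lemma T_hom: "f \<in> hom Q X Y m \<Longrightarrow> fmor T X Y m f \<in> hom Q (fob T X) (fob T Y) m"
  and T_add: "f \<in> hom Q X Y m \<Longrightarrow> g \<in> hom Q X Y m \<Longrightarrow> fmor T X Y m (f + g) = fmor T X Y m f + fmor T X Y m g"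
  and T_scale: "f \<in> hom Q X Y m \<Longrightarrow> fmor T X Y m (gscale c f) = gscale c (fmor T X Y m f)"
  and T_dhom: "f \<in> hom Q X Y m \<Longrightarrow> dhom (fob T X) (fob T Y) m (fmor T X Y m f) = fmor T X Y (m - 1) (dhom X Y m f)"
  using dg_functor X Y unfolding is_dg_functor_def by simp_all

lemma T_zero: "fmor T X Y m 0 = 0"
  using T_add[OF hom_zero[OF X Y] hom_zero[OF X Y], of m] by simp

end

abbreviation TR :: "('v, 'e, 'k) cpx" where "TR \<equiv> fob T RQ"

text \<open>The map \<open>X \<otimes> TR \<rightarrow> TX\<close>, \<open>x \<otimes> m \<mapsto> T(x)(m)\<close>, where \<open>x\<close> is read as a morphism \<open>kQ \<rightarrow> X\<close>.\<close>

definition tens :: "('v, 'e, 'k) cpx \<Rightarrow> int \<Rightarrow> ('v, 'e, 'k) pvec \<Rightarrow> int \<Rightarrow> ('v, 'e, 'k) pvec \<Rightarrow> ('v, 'e, 'k) pvec" where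
  "tens X n x k m = fmor T RQ X n (hat X n x) k m"

lemma pcTR [simp]: "proj_complex Q TR"
  by (rule T_pc[OF pcR])

context
  fixes X :: "('v, 'e, 'k) cpx"
  assumes X: "proj_complex Q X"
begin

lemma tens_hom: "x \<in> el X n \<Longrightarrow> tens X n x \<in> hom Q TR (fob T X) n"
  unfolding tens_def[abs_def] by (intro T_hom[OF pcR X] hat_hom[OF X])

lemma tens_in: "x \<in> el X n \<Longrightarrow> m \<in> el TR k \<Longrightarrow> tens X n x k m \<in> el (fob T X) (k + n)"
  by (rule h_in[OF pcTR tens_hom])

lemma tens_add_left: "x \<in> el X n \<Longrightarrow> y \<in> el X n \<Longrightarrow> tens X n (x + y) k m = tens X n x k m + tens X n y k m"
  by (simp add: tens_def hat_add[OF X] T_add[OF pcR X] hat_hom[OF X])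

lemma tens_scale_left: "x \<in> el X n \<Longrightarrow> tens X n (c \<odot> x) k m = c \<odot> tens X n x k m"
  by (simp add: tens_def hat_scale[OF X] T_scale[OF pcR X] hat_hom[OF X]) (simp add: gscale_def)

lemma tens_zero_left: "tens X n 0 k m = 0"
  by (simp add: tens_def hat_zero[OF X] T_zero[OF pcR X])

lemma tens_uminus_left: "x \<in> el X n \<Longrightarrow> tens X n (- x) k m = - tens X n x k m"
  using tens_scale_left[of x n "- 1"] by simp

lemma tens_diff_left: "x \<in> el X n \<Longrightarrow> y \<in> el X n \<Longrightarrow> tens X n (x - y) k m = tens X n x k m - tens X n y k m"
  using tens_add_left[of x n "- y"] by (simp add: tens_uminus_left el_uminus[OF X])

lemma tens_sum_left: "(\<And>i. i \<in> I \<Longrightarrow> f i \<in> el X n) \<Longrightarrow> tens X n (sum f I) k m = (\<Sum>i\<in>I. tens X n (f i) k m)"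
  by (induction I rule: infinite_finite_induct) (auto simp: tens_zero_left tens_add_left el_sum[OF X])

lemma tens_add_right: "x \<in> el X n \<Longrightarrow> m \<in> el TR k \<Longrightarrow> m' \<in> el TR k \<Longrightarrow>
    tens X n x k (m + m') = tens X n x k m + tens X n x k m'"
  by (rule h_add[OF pcTR tens_hom])

lemma tens_scale_right: "x \<in> el X n \<Longrightarrow> m \<in> el TR k \<Longrightarrow> tens X n x k (c \<odot> m) = c \<odot> tens X n x k m"
  by (rule h_scale[OF pcTR tens_hom])

lemma tens_diff_right: "x \<in> el X n \<Longrightarrow> m \<in> el TR k \<Longrightarrow> m' \<in> el TR k \<Longrightarrow>
    tens X n x k (m - m') = tens X n x k m - tens X n x k m'"
  by (rule h_diff[OF pcTR tens_hom])

lemma tens_zero_right: "x \<in> el X n \<Longrightarrow> tens X n x k 0 = 0"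
  by (rule h_zero[OF pcTR tens_hom])

lemma tens_sum_right: "x \<in> el X n \<Longrightarrow> (\<And>i. i \<in> I \<Longrightarrow> f i \<in> el TR k) \<Longrightarrow>
    tens X n x k (sum f I) = (\<Sum>i\<in>I. tens X n x k (f i))"
  by (rule h_sum[OF pcTR tens_hom])

lemma tens_act_right: "x \<in> el X n \<Longrightarrow> m \<in> el TR k \<Longrightarrow> a \<in> PA \<Longrightarrow>
    tens X n x k (act TR k m a) = act (fob T X) (k + n) (tens X n x k m) a"
  by (rule h_act[OF pcTR tens_hom])

text \<open>Functoriality makes \<open>tens\<close> balanced over kQ: the left action of a on TR is
  by definition \<open>T\<close> of left multiplication by a.\<close>

lemma tens_act_left: "x \<in> el X n \<Longrightarrow> a \<in> PA \<Longrightarrow> tens X n (act X n x a) k m = tens X n x k (tens RQ 0 a k m)"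
  using T_gcomp[OF pcR pcR X hat_hom[OF pcR, of a 0] hat_hom[OF X, of x n]]
  by (simp add: tens_def hat_act[OF X] el_R gcomp_def)

text \<open>Naturality of X \<otimes> TR \<rightarrow> TX in X, valid for graded f that need not be
  closed.\<close>

lemma T_tens: "proj_complex Q Y \<Longrightarrow> f \<in> hom Q X Y d \<Longrightarrow> x \<in> el X n \<Longrightarrow>
    fmor T X Y d f (k + n) (tens X n x k m) = tens Y (n + d) (f n x) k m"
  using T_gcomp[OF pcR X _ hat_hom[OF X, of x n], of Y f d]
  by (simp add: tens_def hat_hom_apply[OF X] gcomp_def)

lemma dif_tens: "x \<in> el X n \<Longrightarrow> m \<in> el TR k \<Longrightarrow>
    dif (fob T X) (k + n) (tens X n x k m) =
      tens X (n - 1) (dif X n x) k m + koszul n (tens X n x (k - 1) (dif TR k m))"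
  using dif_hom_apply[of "fob T X" k n "tens X n x" m TR]
  using T_dhom[OF pcR X hat_hom[OF X]]
  by (simp add: tens_def[abs_def] hat_dif[OF X])

end

end

section \<open>The trace form of a Serre functor\<close>

context quiver
begin

lemma chain_mapsI: "f \<in> hom Q X Y 0 \<Longrightarrow> dhom X Y 0 f = 0 \<Longrightarrow> f \<in> chain_maps Q X Y"
  and chain_mapsD1: "f \<in> chain_maps Q X Y \<Longrightarrow> f \<in> hom Q X Y 0"
  and chain_mapsD2: "f \<in> chain_maps Q X Y \<Longrightarrow> dhom X Y 0 f = 0"
  by (auto simp: chain_maps_def)

context
  fixes X Y :: "('v, 'e, 'k::field) cpx"
  assumes X: "proj_complex Q X" and Y: "proj_complex Q Y"
begin

lemma gcomp_add_right: "proj_complex Q Z \<Longrightarrow> g \<in> hom Q Y Z n \<Longrightarrow> f \<in> hom Q X Y m \<Longrightarrow> f' \<in> hom Q X Y m \<Longrightarrow>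
    gcomp m g (f + f') = gcomp m g f + gcomp m g f'"
proof (intro ext)
  fix i x assume *: "proj_complex Q Z" "g \<in> hom Q Y Z n" "f \<in> hom Q X Y m" "f' \<in> hom Q X Y m"
  show "gcomp m g (f + f') i x = (gcomp m g f + gcomp m g f') i x"
    using h_add[OF Y *(2) h_in[OF X *(3)] h_in[OF X *(4)], of x i x] h_outside[OF X *(3)] h_outside[OF X *(4)] h_zero[OF Y *(2)]
    by (cases "x \<in> el X i") (auto simp: gcomp_def)
qed

lemma gcomp_scale_right: "g \<in> hom Q Y Z n \<Longrightarrow> f \<in> hom Q X Y m \<Longrightarrow> gcomp m g (gscale c f) = gscale c (gcomp m g f)"
proof (intro ext)
  fix i x assume *: "g \<in> hom Q Y Z n" "f \<in> hom Q X Y m"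
  show "gcomp m g (gscale c f) i x = gscale c (gcomp m g f) i x"
    using h_scale[OF Y *(1) h_in[OF X *(2)], of x i c] h_outside[OF X *(2)] h_zero[OF Y *(1)]
    by (cases "x \<in> el X i") (auto simp: gcomp_def gscale_def)
qed

lemma chain_zero: "0 \<in> chain_maps Q X Y"
  by (intro chain_mapsI hom_zero[OF X Y] dhom_zero[OF X Y])

lemma chain_gcomp: "proj_complex Q Z \<Longrightarrow> f \<in> chain_maps Q X Y \<Longrightarrow> g \<in> chain_maps Q Y Z \<Longrightarrow> gcomp 0 g f \<in> chain_maps Q X Z"
  using gcomp_hom[OF X Y chain_mapsD1 chain_mapsD1, of f g Z] dhom_gcomp[OF X Y _ chain_mapsD1 chain_mapsD1, of Z f g]
    h_zero[OF Y chain_mapsD1, of g]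
  by (intro chain_mapsI) (auto simp: chain_mapsD2 gcomp_def fun_eq_iff)

lemma dhom_uminus: "f \<in> hom Q X Y m \<Longrightarrow> dhom X Y m (- f) = - dhom X Y m f"
  using dhom_scale[OF X Y, of f m "- 1"] by (simp add: gscale_def fun_Compl_def)

lemma homotopic_sym: "homotopic Q X Y f g \<Longrightarrow> homotopic Q X Y g f"
  unfolding homotopic_def using hom_uminus[OF X Y] dhom_uminus by (metis minus_diff_eq)

lemma homotopic_gcomp_left:
  assumes Z: "proj_complex Q Z" and g: "g \<in> chain_maps Q Y Z" and f: "f \<in> hom Q X Y 0" "f' \<in> hom Q X Y 0"
    and "homotopic Q X Y f f'"
  shows "homotopic Q X Z (gcomp 0 g f) (gcomp 0 g f')"
proof -
  obtain h where h: "h \<in> hom Q X Y 1" "f - f' = dhom X Y 1 h"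
    using assms(5) by (auto simp: homotopic_def)
  have "dhom X Z (1 + 0) (gcomp 1 g h) = gcomp 0 g (dhom X Y 1 h)"
    using dhom_gcomp[OF X Y Z h(1) chain_mapsD1[OF g]] chain_mapsD2[OF g] by (simp add: gcomp_def fun_eq_iff)
  moreover have "gcomp 0 g f = gcomp 0 g f' + gcomp 0 g (dhom X Y 1 h)"
    using gcomp_add_right[OF Z chain_mapsD1[OF g] f(2) dhom_hom[OF X Y h(1), simplified]] h(2)
    by (metis add.commute diff_add_cancel)
  ultimately show ?thesis
    unfolding homotopic_def using gcomp_hom[OF X Y h(1) chain_mapsD1[OF g]]
    by (intro bexI[of _ "gcomp 1 g h"]) auto
qed

lemma homotopic_gcomp_right:
  assumes Z: "proj_complex Q Z" and f: "f \<in> chain_maps Q X Y" and "homotopic Q Y Z g g'"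
  shows "homotopic Q X Z (gcomp 0 g f) (gcomp 0 g' f)"
proof -
  obtain h where h: "h \<in> hom Q Y Z 1" "g - g' = dhom Y Z 1 h"
    using assms(3) by (auto simp: homotopic_def)
  have "dhom X Z (0 + 1) (gcomp 0 h f) = gcomp 0 (dhom Y Z 1 h) f"
    using dhom_gcomp[OF X Y Z chain_mapsD1[OF f] h(1)] chain_mapsD2[OF f] h_zero[OF Y h(1)]
    by (simp add: gcomp_def fun_eq_iff koszul_def)
  also have "\<dots> = gcomp 0 g f - gcomp 0 g' f"
    by (simp add: h(2)[symmetric] gcomp_def fun_eq_iff)
  finally show ?thesis
    unfolding homotopic_def using gcomp_hom[OF X Y chain_mapsD1[OF f] h(1)]
    by (intro bexI[of _ "gcomp 0 h f"]) auto
qed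

end

section \<open>Shifts and stalk complexes\<close>

lemma pc_shift: assumes X: "proj_complex Q X" shows "proj_complex Q (shift_cpx X)"
proof -
  obtain N where N: "\<And>i. \<bar>i\<bar> > N \<Longrightarrow> el X i = {0}"
    using X by (auto simp: proj_complex_def)
  have "\<exists>N. \<forall>i. \<bar>i\<bar> > N \<longrightarrow> el (shift_cpx X) i = {0}"
    using N by (intro exI[of _ "N + 1"]) (auto simp: shift_cpx_def)
  moreover have "dif (shift_cpx X) \<in> hom Q (shift_cpx X) (shift_cpx X) (- 1)"
    using d_in[OF X, of _ "_ - 1", simplified] by (intro homI)
      (auto simp: shift_cpx_def el_uminus[OF X] d_add[OF X] d_scale[OF X] d_act[OF X] act_uminus_left[OF X]
        d_outside[OF X])
  ultimately show ?thesis
    using X d_in[OF X, of _ "_ - 1", simplified] d_d[OF X, of _ "_ - 1", simplified]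
    unfolding proj_complex_def by (auto simp: shift_cpx_def d_uminus[OF X])
qed

lemma shift_hom: "f \<in> hom Q X Y m \<Longrightarrow> shift_map f \<in> hom Q (shift_cpx X) (shift_cpx Y) m"
  unfolding hom_def by (auto simp: shift_map_def shift_cpx_def algebra_simps) (metis add_diff_eq add.commute)

lemma shift_gcomp: "shift_map (gcomp 0 g f) = gcomp 0 (shift_map g) (shift_map f)"
  by (simp add: shift_map_def gcomp_def)

lemma shift_gid: "shift_map (gid X) = gid (shift_cpx X)"
  by (simp add: shift_map_def gid_def shift_cpx_def fun_eq_iff)

lemma shift_dhom: "proj_complex Q X \<Longrightarrow> f \<in> hom Q X Y m \<Longrightarrow> dhom (shift_cpx X) (shift_cpx Y) m (shift_map f) = - shift_map (dhom X Y m f)"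
proof (intro ext)
  fix i x assume X: "proj_complex Q X" and f: "f \<in> hom Q X Y m"
  have *: "i + m - 1 = i - 1 + m" by simp
  show "dhom (shift_cpx X) (shift_cpx Y) m (shift_map f) i x = (- shift_map (dhom X Y m f)) i x"
    using h_uminus[OF X f d_in[OF X, of x "i - 1"]] d_outside[OF X, of x "i - 1"] h_zero[OF X f]
    by (cases "x \<in> el X (i - 1)") (auto simp: shift_map_def shift_cpx_def dhom_apply * koszul_uminus)
qed

lemma shift_chain: "proj_complex Q X \<Longrightarrow> f \<in> chain_maps Q X Y \<Longrightarrow> shift_map f \<in> chain_maps Q (shift_cpx X) (shift_cpx Y)"
  using shift_dhom[of X f Y 0] by (auto simp: chain_maps_def shift_hom) (simp add: shift_map_def fun_eq_iff)

lemma shift_homotopic: assumes X: "proj_complex Q X" and Y: "proj_complex Q Y" and "homotopic Q X Y f g"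
  shows "homotopic Q (shift_cpx X) (shift_cpx Y) (shift_map f) (shift_map g)"
proof -
  obtain h where h: "h \<in> hom Q X Y 1" "f - g = dhom X Y 1 h"
    using assms(3) by (auto simp: homotopic_def)
  have "shift_map f - shift_map g = shift_map (f - g)" by (simp add: shift_map_def fun_eq_iff)
  also have "\<dots> = - dhom (shift_cpx X) (shift_cpx Y) 1 (shift_map h)"
    using shift_dhom[OF X h(1)] h(2) by simp
  also have "\<dots> = dhom (shift_cpx X) (shift_cpx Y) 1 (- shift_map h)"
    using dhom_uminus[OF pc_shift[OF X] pc_shift[OF Y] shift_hom[OF h(1)]] by simp
  finally show ?thesis unfolding homotopic_def
    using hom_uminus[OF pc_shift[OF X] pc_shift[OF Y] shift_hom[OF h(1)]] by blast
qed

text \<open>The shift kQ[n]. Its differential is zero, so a chain map X \<rightarrow> kQ[n] is a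
  cycle of degree -n in Hom(X, kQ) and a null homotopy is an element bounding it. Morphisms of the
  derived category into shifts of kQ thus become homology classes of one complex.\<close>

definition stalk :: "int \<Rightarrow> ('v, 'e, 'k::field) cpx" where
  "stalk n = \<lparr>grade = (\<lambda>i. grade RQ (i - n)), dif = (\<lambda>_ _. 0)\<rparr>"

lemma shift_RQ: "shift_cpx RQ = stalk 1"
  by (simp add: shift_cpx_def stalk_def)

lemma el_stalk: "el (stalk n) i = (if i = n then PA else {0})"
  by (simp add: stalk_def el_R)

lemma dif_stalk [simp]: "dif (stalk n) i x = 0"
  by (simp add: stalk_def)

lemma pc_stalk: "proj_complex Q (stalk n :: ('v, 'e, 'k::field) cpx)"
proof -
  have "proj_complex Q (RQ :: ('v, 'e, 'k) cpx)" by simp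
  then have "projective_module Q (grade (stalk n :: ('v, 'e, 'k) cpx) i)" "finitely_generated Q (grade (stalk n :: ('v, 'e, 'k) cpx) i)" for i
    by (auto simp: stalk_def proj_complex_def)
  moreover have "dif (stalk n :: ('v, 'e, 'k) cpx) \<in> hom Q (stalk n) (stalk n) (- 1)"
    by (intro homI) (auto simp: el_stalk, simp_all add: stalk_def act_zero_left)
  ultimately show ?thesis
    unfolding proj_complex_def by (auto simp: el_stalk intro!: exI[of _ "\<bar>n\<bar>"])
qed

lemma hom_stalk: "hom Q X (stalk n) m = hom Q X RQ (m - n)"
  by (simp add: hom_def stalk_def add_diff_eq)

lemma dhom_stalk: "dhom X (stalk n) m f i x = - koszul m (f (i - 1) (dif X i x))"
  by (simp add: dhom_apply)

lemma dhom_RQ: "dhom X RQ m f i x = - koszul m (f (i - 1) (dif X i x))"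
  by (simp add: dhom_apply)

lemma dhom_stalk_RQ: "dhom X (stalk n) m f = koszul n (dhom X RQ (m - n) f)"
  by (intro ext) (auto simp: dhom_stalk dhom_RQ koszul_def)

lemma chain_stalk: "f \<in> chain_maps Q X (stalk n) \<longleftrightarrow> f \<in> hom Q X RQ (- n) \<and> dhom X RQ (- n) f = 0"
  using hom_stalk[of X n 0] by (auto simp: chain_maps_def dhom_stalk_RQ koszul_def)

lemma homotopic_stalk:
  assumes X: "proj_complex Q X"
  shows "homotopic Q X (stalk n) f 0 \<longleftrightarrow> (\<exists>h\<in>hom Q X RQ (1 - n). f = dhom X RQ (1 - n) h)"
proof -
  have *: "koszul n (dhom X RQ (1 - n) h) = dhom X RQ (1 - n) (koszul n h)" "koszul n h \<in> hom Q X RQ (1 - n)"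
    if "h \<in> hom Q X RQ (1 - n)" for h
    using dhom_uminus[OF X pcR that] hom_uminus[OF X pcR that] that by (auto simp: koszul_def)
  show ?thesis
    unfolding homotopic_def hom_stalk dhom_stalk_RQ using * by (metis diff_zero koszul_twice)
qed

text \<open>Both differentials vanish, so homotopies contribute nothing. Identities that Serre
  duality gives only up to homotopy become strict equalities at this point.\<close>

lemma homotopic_stalk_stalk: "homotopic Q (stalk n) (stalk m) f g \<Longrightarrow> f = g"
proof (intro ext)
  fix i x assume "homotopic Q (stalk n) (stalk m) f g"
  then obtain h where h: "h \<in> hom Q (stalk n) (stalk m) 1" "f - g = dhom (stalk n) (stalk m) 1 h"
    by (auto simp: homotopic_def)
  have "(f - g) i x = 0" unfolding h(2) using h_zero[OF pc_stalk h(1)] by (simp add: dhom_stalk)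
  then show "f i x = g i x" by simp
qed

definition lm :: "('v, 'e, 'k::field) pvec \<Rightarrow> ('v, 'e, 'k) gmap" where
  "lm a = hat RQ 0 a"

lemma lm_hom: "a \<in> PA \<Longrightarrow> lm a \<in> hom Q RQ RQ 0"
  unfolding lm_def by (rule hat_hom[OF pcR]) (simp add: el_R)

lemma lm_apply: "b \<in> PA \<Longrightarrow> lm a 0 b = pm a b"
  by (simp add: lm_def hat_def act_R)

lemma lm_chain: "a \<in> PA \<Longrightarrow> lm a \<in> chain_maps Q RQ RQ"
  using h_zero[OF pcR lm_hom[of a]] by (auto intro!: chain_mapsI lm_hom simp: fun_eq_iff dhom_apply)

text \<open>A module endomorphism of kQ is left multiplication by its value at the unit; this is how
  elements of kQ enter the Serre pairing.\<close>

lemma hom_stalk_stalk: assumes c: "c \<in> hom Q (stalk 1) (stalk 1) 0" shows "c = shift_map (lm (c 1 (punit Q)))" "c 1 (punit Q) \<in> PA"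
proof -
  define c' where "c' = (\<lambda>i. c (i + 1))"
  have "c' \<in> hom Q RQ RQ 0"
    using c unfolding hom_def by (auto simp: c'_def stalk_def) (metis add_diff_cancel_right')
  from hat_surj[OF pcR this] have "c' = lm (c 1 (punit Q))" by (simp add: lm_def c'_def)
  moreover have "c = shift_map c'" by (simp add: shift_map_def c'_def)
  ultimately show "c = shift_map (lm (c 1 (punit Q)))" by simp
  show "c 1 (punit Q) \<in> PA" using h_in[OF pc_stalk c, of "punit Q" 1] by (simp add: el_stalk punit_closed)
qed

lemma hom_stalk_stalk_zero: assumes c: "c \<in> hom Q (stalk m) (stalk 1) 0" and "m \<noteq> 1" shows "c = 0"
proof (intro ext)
  fix i x
  show "c i x = 0 i x"
    using h_in[OF pc_stalk c, of x i] h_outside[OF pc_stalk c, of x i] h_zero[OF pc_stalk c, of i] \<open>m \<noteq> 1\<close>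
    by (cases "x \<in> el (stalk m) i") (auto simp: el_stalk split: if_splits)
qed

end

text \<open>What is kept of Serre duality. With Y = kQ[1] it pairs homology classes u of degree -1
  in Hom(TR, kQ) perfectly with elements a of kQ by the trace of a u, and with the other shifts of
  kQ it gives \<open>dual_exact\<close>. Cyclicity exchanges the action of kQ on the target with its
  action through \<open>T\<close> on the source.\<close>

locale trace_form = dg_endofunctor Q T for Q :: "('v, 'e) pre_digraph" and T :: "('v, 'e, 'k::field) dg_functor" +
  fixes tr :: "('v, 'e, 'k) gmap \<Rightarrow> 'k"
  assumes tr_add: "\<lbrakk>u \<in> hom Q TR RQ (- 1); dhom TR RQ (- 1) u = 0; v \<in> hom Q TR RQ (- 1); dhom TR RQ (- 1) v = 0\<rbrakk> \<Longrightarrow>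
        tr (u + v) = tr u + tr v"
    and tr_scale: "\<lbrakk>u \<in> hom Q TR RQ (- 1); dhom TR RQ (- 1) u = 0\<rbrakk> \<Longrightarrow> tr (gscale c u) = c * tr u"
    and tr_boundary: "h \<in> hom Q TR RQ 0 \<Longrightarrow> tr (dhom TR RQ 0 h) = 0"
    and tr_cyclic: "\<lbrakk>u \<in> hom Q TR RQ (- 1); dhom TR RQ (- 1) u = 0; a \<in> PA\<rbrakk> \<Longrightarrow>
        tr (gcomp 0 u (fmor T RQ RQ 0 (lm a))) = tr (gcomp (- 1) (lm a) u)"
    and tr_nondegenerate: "\<lbrakk>u \<in> hom Q TR RQ (- 1); dhom TR RQ (- 1) u = 0; \<And>a. a \<in> PA \<Longrightarrow> tr (gcomp (- 1) (lm a) u) = 0\<rbrakk> \<Longrightarrow>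
        \<exists>h\<in>hom Q TR RQ 0. u = dhom TR RQ 0 h"
    and tr_surj: "\<lbrakk>\<And>a b. a \<in> PA \<Longrightarrow> b \<in> PA \<Longrightarrow> l (a + b) = l a + l b; \<And>c a. a \<in> PA \<Longrightarrow> l (c \<odot> a) = c * l a\<rbrakk> \<Longrightarrow>
        \<exists>u\<in>hom Q TR RQ (- 1). dhom TR RQ (- 1) u = 0 \<and> (\<forall>a\<in>PA. tr (gcomp (- 1) (lm a) u) = l a)"
    and dual_exact: "\<lbrakk>u \<in> hom Q TR RQ n; dhom TR RQ n u = 0; n \<noteq> - 1\<rbrakk> \<Longrightarrow>
        \<exists>h\<in>hom Q TR RQ (n + 1). u = dhom TR RQ (n + 1) h"

text \<open>The trace is the Serre functional of the identity of TR, transported along \<tau>TR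
  \<cong> kQ. With S for \<tau>TR[1], naturality of the pairing in Y reduces all its values at TR to
  this functional, and naturality in X makes it cyclic.\<close>

lemma (in dg_endofunctor) trace_form_exists:
  assumes "inverse_translate_lift Q T"
  shows "\<exists>tr. trace_form Q T tr"
proof -
  obtain \<tau> where AR: "AR_translate Q \<tau>" and iso: "hnat_isomorphic Q (hfunctor_comp \<tau> (H0_functor T)) hfunctor_id"
    using assms by (auto simp: inverse_translate_lift_def)
  have hf: "is_hfunctor Q \<tau>" using AR by (simp add: AR_translate_def)
  have pct: "proj_complex Q (hob \<tau> TR)" using hf pcTR by (auto simp: is_hfunctor_def)
  let ?S = "shift_cpx (hob \<tau> TR)"
  have pcS: "proj_complex Q ?S" by (rule pc_shift[OF pct])
  \<comment> \<open>Of the natural isomorphism \<tau>T \<cong> id only the component at kQ enters,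
    together with its naturality along the endomorphisms of kQ.\<close>
  obtain \<eta> \<theta> where \<eta>: "\<eta> \<in> chain_maps Q (hob \<tau> TR) RQ" and \<theta>: "\<theta> \<in> chain_maps Q RQ (hob \<tau> TR)"
    and \<theta>\<eta>: "homotopic Q (hob \<tau> TR) (hob \<tau> TR) (gcomp 0 \<theta> \<eta>) (gid (hob \<tau> TR))"
    and \<eta>\<theta>: "homotopic Q RQ RQ (gcomp 0 \<eta> \<theta>) (gid RQ)"
    and nat: "\<And>f. f \<in> chain_maps Q RQ RQ \<Longrightarrow> homotopic Q (hob \<tau> TR) RQ
        (gcomp 0 \<eta> (hmor \<tau> TR TR (fmor T RQ RQ 0 f))) (gcomp 0 f \<eta>)"
  proof -
    from iso[unfolded hnat_isomorphic_def hfunctor_comp_def hfunctor_id_def H0_functor_def hfunctor.simps]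
    obtain H where H: "\<forall>X. proj_complex Q X \<longrightarrow>
           H X \<in> chain_maps Q (hob \<tau> (fob T X)) X \<and>
           (\<exists>\<theta>\<in>chain_maps Q X (hob \<tau> (fob T X)).
              homotopic Q (hob \<tau> (fob T X)) (hob \<tau> (fob T X)) (gcomp 0 \<theta> (H X)) (gid (hob \<tau> (fob T X))) \<and>
              homotopic Q X X (gcomp 0 (H X) \<theta>) (gid X))"
      "\<forall>X Y. proj_complex Q X \<and> proj_complex Q Y \<longrightarrow> (\<forall>f\<in>chain_maps Q X Y.
         homotopic Q (hob \<tau> (fob T X)) Y (gcomp 0 (H Y) (hmor \<tau> (fob T X) (fob T Y) (fmor T X Y 0 f))) (gcomp 0 f (H X)))"
      by (elim exE conjE) (rule that; assumption)
    have "homotopic Q (hob \<tau> TR) RQ (gcomp 0 (H RQ) (hmor \<tau> TR TR (fmor T RQ RQ 0 f))) (gcomp 0 f (H RQ))"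
      if "f \<in> chain_maps Q RQ RQ" for f
      using H(2) pcR that by blast
    moreover obtain \<theta> where "\<theta> \<in> chain_maps Q RQ (hob \<tau> TR)"
      "homotopic Q (hob \<tau> TR) (hob \<tau> TR) (gcomp 0 \<theta> (H RQ)) (gid (hob \<tau> TR))"
      "homotopic Q RQ RQ (gcomp 0 (H RQ) \<theta>) (gid RQ)" "H RQ \<in> chain_maps Q (hob \<tau> TR) RQ"
      using H(1) pcR by blast
    ultimately show ?thesis using that by blast
  qed
  from AR[unfolded AR_translate_def Let_def]
  obtain \<beta> where \<beta>1: "(\<forall>X Y. proj_complex Q X \<and> proj_complex Q Y \<longrightarrow>
           (
              (\<forall>f\<in>chain_maps Q X Y. hom_functional Q Y (shift_cpx (hob \<tau> X)) (\<beta> X Y f)) \<and>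
              (\<forall>f\<in>chain_maps Q X Y. \<forall>g\<in>chain_maps Q X Y.
                 homotopic Q X Y f g \<longleftrightarrow> (\<forall>u\<in>chain_maps Q Y (shift_cpx (hob \<tau> X)). \<beta> X Y f u = \<beta> X Y g u)) \<and>
              (\<forall>f\<in>chain_maps Q X Y. \<forall>g\<in>chain_maps Q X Y. \<forall>u\<in>chain_maps Q Y (shift_cpx (hob \<tau> X)).
                 \<beta> X Y (f + g) u = \<beta> X Y f u + \<beta> X Y g u) \<and>
              (\<forall>c. \<forall>f\<in>chain_maps Q X Y. \<forall>u\<in>chain_maps Q Y (shift_cpx (hob \<tau> X)).
                 \<beta> X Y (gscale c f) u = c * \<beta> X Y f u) \<and>
              (\<forall>l. hom_functional Q Y (shift_cpx (hob \<tau> X)) l \<longrightarrow>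
                 (\<exists>f\<in>chain_maps Q X Y. \<forall>u\<in>chain_maps Q Y (shift_cpx (hob \<tau> X)). \<beta> X Y f u = l u))))"
    and \<beta>2: "(\<forall>X Y Y'. proj_complex Q X \<and> proj_complex Q Y \<and> proj_complex Q Y' \<longrightarrow>
           (\<forall>f\<in>chain_maps Q X Y. \<forall>g\<in>chain_maps Q Y Y'.
              \<forall>u\<in>chain_maps Q Y' (shift_cpx (hob \<tau> X)).
                \<beta> X Y' (gcomp 0 g f) u = \<beta> X Y f (gcomp 0 u g)))"
    and \<beta>3: "(\<forall>X' X Y. proj_complex Q X' \<and> proj_complex Q X \<and> proj_complex Q Y \<longrightarrow>
           (\<forall>e\<in>chain_maps Q X' X. \<forall>f\<in>chain_maps Q X Y.
              \<forall>u\<in>chain_maps Q Y (shift_cpx (hob \<tau> X')).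
                \<beta> X' Y (gcomp 0 f e) u =
                \<beta> X Y f (gcomp 0 (shift_map (hmor \<tau> X' X e)) u)))"
    by (elim exE conjE) (rule that; assumption)
  have val: "\<And>Y f. proj_complex Q Y \<Longrightarrow> f \<in> chain_maps Q TR Y \<Longrightarrow> hom_functional Q Y ?S (\<beta> TR Y f)"
    and inj: "\<And>Y f g. proj_complex Q Y \<Longrightarrow> f \<in> chain_maps Q TR Y \<Longrightarrow> g \<in> chain_maps Q TR Y \<Longrightarrow>
         homotopic Q TR Y f g \<longleftrightarrow> (\<forall>u\<in>chain_maps Q Y ?S. \<beta> TR Y f u = \<beta> TR Y g u)"
    and add: "\<And>Y f g u. proj_complex Q Y \<Longrightarrow> f \<in> chain_maps Q TR Y \<Longrightarrow> g \<in> chain_maps Q TR Y \<Longrightarrow> u \<in> chain_maps Q Y ?S \<Longrightarrow>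
         \<beta> TR Y (f + g) u = \<beta> TR Y f u + \<beta> TR Y g u"
    and surj: "\<And>Y l. proj_complex Q Y \<Longrightarrow> hom_functional Q Y ?S l \<Longrightarrow>
         \<exists>f\<in>chain_maps Q TR Y. \<forall>u\<in>chain_maps Q Y ?S. \<beta> TR Y f u = l u"
    using \<beta>1[rule_format, OF conjI, OF pcTR] by blast+
  have nat1: "\<beta> TR Y' (gcomp 0 g f) u = \<beta> TR Y f (gcomp 0 u g)"
    if "proj_complex Q Y" "proj_complex Q Y'" "f \<in> chain_maps Q TR Y" "g \<in> chain_maps Q Y Y'"
      "u \<in> chain_maps Q Y' ?S" for Y Y' f g u
    using \<beta>2[THEN spec, THEN spec, THEN spec, of TR Y Y'] that pcTR by blast
  have nat2: "\<beta> TR Y (gcomp 0 f e) u = \<beta> TR Y f (gcomp 0 (shift_map (hmor \<tau> TR TR e)) u)"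
    if "proj_complex Q Y" "e \<in> chain_maps Q TR TR" "f \<in> chain_maps Q TR Y" "u \<in> chain_maps Q Y ?S" for Y e f u
    using \<beta>3[THEN spec, THEN spec, THEN spec, of TR TR Y] that pcTR by blast
  have gidc: "gid TR \<in> chain_maps Q TR TR"
    by (intro chain_mapsI gid_hom[OF pcTR pcTR] dhom_gid[OF pcTR])
  define E where "E = \<beta> TR TR (gid TR)"
  have E: "hom_functional Q TR ?S E" unfolding E_def by (rule val[OF pcTR gidc])
  have Eadd: "E (f + g) = E f + E g" and Escale: "E (gscale c f) = c * E f"
    if "f \<in> chain_maps Q TR ?S" "g \<in> chain_maps Q TR ?S" for f g c
    using E that by (auto simp: hom_functional_def)
  have Ehom: "E f = E g" if "homotopic Q TR ?S f g" "f \<in> chain_maps Q TR ?S" "g \<in> chain_maps Q TR ?S" for f g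
    using E that by (auto simp: hom_functional_def)
  have E0: "E 0 = 0" using Eadd[OF chain_zero[OF pcTR pcS] chain_zero[OF pcTR pcS]]
    by (metis add_0 add_cancel_right_right)
  have \<beta>E: "\<beta> TR Y f u = E (gcomp 0 u f)" if "proj_complex Q Y" "f \<in> chain_maps Q TR Y" "u \<in> chain_maps Q Y ?S" for Y f u
    using nat1[OF pcTR that(1) gidc that(2,3)] gcomp_gid_right[OF pcTR that(1) chain_mapsD1[OF that(2)]]
    by (simp add: E_def)
  have Ecyc: "E (gcomp 0 u e) = E (gcomp 0 (shift_map (hmor \<tau> TR TR e)) u)" if "e \<in> chain_maps Q TR TR" "u \<in> chain_maps Q TR ?S" for e u
    using nat2[OF pcTR that(1) gidc that(2)] \<beta>E[OF pcTR that] gcomp_gid_left[OF pcTR pcTR chain_mapsD1[OF that(1)]]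
    by (simp add: E_def)
  have pc1: "proj_complex Q (stalk 1 :: ('v, 'e, 'k) cpx)" by (rule pc_stalk)
  let ?s\<eta> = "shift_map \<eta>" and ?s\<theta> = "shift_map \<theta>"
  have s\<eta>: "?s\<eta> \<in> chain_maps Q ?S (stalk 1)" using shift_chain[OF pct \<eta>] by (simp add: shift_RQ)
  have s\<theta>: "?s\<theta> \<in> chain_maps Q (stalk 1) ?S" using shift_chain[OF pcR \<theta>] by (simp add: shift_RQ)
  have s\<theta>\<eta>: "homotopic Q ?S ?S (gcomp 0 ?s\<theta> ?s\<eta>) (gid ?S)"
    using shift_homotopic[OF pct pct \<theta>\<eta>] by (simp add: shift_gcomp shift_gid)
  \<comment> \<open>A homotopy between endomorphisms of a stalk complex is an equality. In the other
    order the composite is the identity of S only up to homotopy.\<close>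
  have s\<eta>\<theta>: "gcomp 0 ?s\<eta> ?s\<theta> = gid (stalk 1)"
    using homotopic_stalk_stalk[of 1 1] shift_homotopic[OF pcR pcR \<eta>\<theta>] by (simp add: shift_gcomp shift_gid shift_RQ)
  define tr where "tr v = E (gcomp 0 ?s\<theta> v)" for v
  have Z: "u \<in> chain_maps Q TR (stalk 1)" if "u \<in> hom Q TR RQ (- 1)" "dhom TR RQ (- 1) u = 0" for u
    using that by (simp add: chain_stalk)
  have s\<theta>c: "gcomp 0 ?s\<theta> v \<in> chain_maps Q TR ?S" if "v \<in> chain_maps Q TR (stalk 1)" for v
    by (rule chain_gcomp[OF pcTR pc1 pcS that s\<theta>])
  have slm: "shift_map (lm a) \<in> chain_maps Q (stalk 1) (stalk 1)" if "a \<in> PA" for a :: "('v, 'e, 'k) pvec"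
    using shift_chain[OF pcR lm_chain[OF that]] by (simp add: shift_RQ)
  have slmv: "gcomp 0 (shift_map (lm a)) v = gcomp (- 1) (lm a) v" for a and v :: "('v, 'e, 'k) gmap"
    by (simp add: gcomp_def shift_map_def)
  have w_split: "homotopic Q Y ?S w (gcomp 0 ?s\<theta> (gcomp 0 ?s\<eta> w))" if "proj_complex Q Y" "w \<in> chain_maps Q Y ?S" for Y w
    using homotopic_gcomp_right[OF that(1) pcS pcS that(2) homotopic_sym[OF pcS pcS s\<theta>\<eta>]]
      gcomp_gid_left[OF that(1) pcS chain_mapsD1[OF that(2)]]
    by (simp add: gcomp_assoc[of 0 0, simplified])
  \<comment> \<open>E is invariant under homotopy, so w : Y \<rightarrow> S matters only through its
    composite with \<open>?s\<eta>\<close>, a map into kQ[1]. For Y a shift of kQ this composite is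
    an element of kQ or zero.\<close>
  have Ew: "E (gcomp 0 w f) = E (gcomp 0 ?s\<theta> (gcomp 0 (gcomp 0 ?s\<eta> w) f))"
    if "proj_complex Q Y" "w \<in> chain_maps Q Y ?S" "f \<in> chain_maps Q TR Y" for Y w f
  proof -
    have "gcomp 0 ?s\<eta> w \<in> chain_maps Q Y (stalk 1)" by (rule chain_gcomp[OF that(1) pcS pc1 that(2) s\<eta>])
    then have "gcomp 0 ?s\<theta> (gcomp 0 ?s\<eta> w) \<in> chain_maps Q Y ?S" by (rule chain_gcomp[OF that(1) pc1 pcS _ s\<theta>])
    then have "E (gcomp 0 w f) = E (gcomp 0 (gcomp 0 ?s\<theta> (gcomp 0 ?s\<eta> w)) f)"
      using w_split[OF that(1,2)] that by (intro Ehom homotopic_gcomp_right[OF pcTR that(1) pcS] chain_gcomp[OF pcTR that(1) pcS]) auto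
    then show ?thesis by (simp add: gcomp_assoc[of 0 0, simplified])
  qed
  have "trace_form Q T tr"
  proof (unfold_locales, goal_cases)
    case (1 u v)
    then show ?case
      unfolding tr_def using s\<theta>c Z
      by (subst gcomp_add_right[OF pcTR pc1 pcS chain_mapsD1[OF s\<theta>] chain_mapsD1[OF Z] chain_mapsD1[OF Z]]) (auto intro!: Eadd)
  next
    case (2 u c)
    then show ?case
      unfolding tr_def using s\<theta>c Z
      by (subst gcomp_scale_right[OF pcTR pc1 chain_mapsD1[OF s\<theta>] chain_mapsD1[OF Z]]) (auto intro!: Escale)
  next
    case (3 h)
    have c: "dhom TR RQ 0 h \<in> chain_maps Q TR (stalk 1)"
      using 3 dhom_hom[OF pcTR pcR 3] dhom_dhom[OF pcTR pcR 3] by (simp add: chain_stalk)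
    have "homotopic Q TR (stalk 1) (dhom TR RQ 0 h) 0"
      using 3 homotopic_stalk[OF pcTR, of 1] by auto
    then have "homotopic Q TR ?S (gcomp 0 ?s\<theta> (dhom TR RQ 0 h)) (gcomp 0 ?s\<theta> 0)"
      by (intro homotopic_gcomp_left[OF pcTR pc1 pcS s\<theta>] chain_mapsD1[OF c] hom_zero[OF pcTR pc1])
    moreover have "gcomp 0 ?s\<theta> 0 = 0" using h_zero[OF pc1 chain_mapsD1[OF s\<theta>]] by (simp add: gcomp_def fun_eq_iff)
    ultimately show ?case
      unfolding tr_def using E0 Ehom[OF _ s\<theta>c[OF c] chain_zero[OF pcTR pcS]] by simp
  next
    case (4 u a)
    let ?Ta = "fmor T RQ RQ 0 (lm a)"
    have Ta: "?Ta \<in> chain_maps Q TR TR"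
      using T_hom[OF pcR pcR lm_hom[OF 4(3)]] T_dhom[OF pcR pcR lm_hom[OF 4(3)]] chain_mapsD2[OF lm_chain[OF 4(3)]]
      by (auto intro!: chain_mapsI simp: T_zero)
    let ?\<tau>a = "hmor \<tau> TR TR ?Ta"
    have \<tau>a: "?\<tau>a \<in> chain_maps Q (hob \<tau> TR) (hob \<tau> TR)" using hf Ta pcTR by (auto simp: is_hfunctor_def)
    have u: "u \<in> chain_maps Q TR (stalk 1)" using 4 by (intro Z)
    have s\<tau>a: "shift_map ?\<tau>a \<in> chain_maps Q ?S ?S" by (rule shift_chain[OF pct \<tau>a])
    \<comment> \<open>The Serre pairing moves T(a) from the right of u to \<tau>T(a)[1] on its left,
      and naturality of \<eta> turns that map into a.\<close>
    have "tr (gcomp 0 u ?Ta) = E (gcomp 0 (gcomp 0 ?s\<theta> u) ?Ta)"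
      by (simp add: tr_def gcomp_assoc[of 0 0, simplified])
    also have "\<dots> = E (gcomp 0 (shift_map ?\<tau>a) (gcomp 0 ?s\<theta> u))"
      by (rule Ecyc[OF Ta s\<theta>c[OF u]])
    also have "\<dots> = E (gcomp 0 ?s\<theta> (gcomp 0 (gcomp 0 ?s\<eta> (gcomp 0 (shift_map ?\<tau>a) ?s\<theta>)) u))"
      using Ew[OF pc1 chain_gcomp[OF pc1 pcS pcS s\<theta> s\<tau>a] u] by (simp add: gcomp_assoc[of 0 0, simplified])
    also have "gcomp 0 ?s\<eta> (gcomp 0 (shift_map ?\<tau>a) ?s\<theta>) = shift_map (lm a)"
    proof -
      have "homotopic Q ?S (stalk 1) (gcomp 0 ?s\<eta> (shift_map ?\<tau>a)) (gcomp 0 (shift_map (lm a)) ?s\<eta>)"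
        using shift_homotopic[OF pct pcR nat[OF lm_chain[OF 4(3)]]] by (simp add: shift_gcomp shift_RQ)
      from homotopic_stalk_stalk[OF homotopic_gcomp_right[OF pc1 pcS pc1 s\<theta> this]]
      have "gcomp 0 (gcomp 0 ?s\<eta> (shift_map ?\<tau>a)) ?s\<theta> = gcomp 0 (gcomp 0 (shift_map (lm a)) ?s\<eta>) ?s\<theta>" .
      then have "gcomp 0 ?s\<eta> (gcomp 0 (shift_map ?\<tau>a) ?s\<theta>) = gcomp 0 (shift_map (lm a)) (gcomp 0 ?s\<eta> ?s\<theta>)"
        by (simp add: gcomp_assoc[of 0 0, simplified])
      then show ?thesis using s\<eta>\<theta> gcomp_gid_right[OF pc1 pc1 chain_mapsD1[OF slm[OF 4(3)]]] by simp
    qed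
    finally show ?case by (simp add: tr_def slmv)
  next
    case (5 u)
    have u: "u \<in> chain_maps Q TR (stalk 1)" using 5 by (intro Z)
    \<comment> \<open>Since w counts only through an element a of kQ, the vanishing of all traces of
      a u makes the Serre functional of u zero; injectivity of \<beta> then makes u
      null-homotopic.\<close>
    have "\<beta> TR (stalk 1) u w = \<beta> TR (stalk 1) 0 w" if w: "w \<in> chain_maps Q (stalk 1) ?S" for w
    proof -
      let ?c = "gcomp 0 ?s\<eta> w"
      have "?c \<in> chain_maps Q (stalk 1) (stalk 1)" by (rule chain_gcomp[OF pc1 pcS pc1 w s\<eta>])
      note c = hom_stalk_stalk[OF chain_mapsD1[OF this]]
      have "\<beta> TR (stalk 1) u w = E (gcomp 0 ?s\<theta> (gcomp 0 ?c u))"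
        by (simp add: \<beta>E[OF pc1 u w] Ew[OF pc1 w u])
      also have "\<dots> = tr (gcomp (- 1) (lm (?c 1 (punit Q))) u)"
        by (subst c(1)) (simp add: tr_def slmv)
      also have "\<dots> = 0" using 5(3) c(2) by blast
      also have "\<dots> = \<beta> TR (stalk 1) 0 w"
        using add[OF pc1 chain_zero[OF pcTR pc1] chain_zero[OF pcTR pc1] w]
          by (metis add_0 add_cancel_right_right)
      finally show ?thesis .
    qed
    then have "homotopic Q TR (stalk 1) u 0" using inj[OF pc1 u chain_zero[OF pcTR pc1]] by blast
    then show ?case using homotopic_stalk[OF pcTR, of 1 u] by simp
  next
    case (6 l)
    \<comment> \<open>The functional l, pulled back to maps w : kQ[1] \<rightarrow> S along their
      composite with \<open>?s\<eta>\<close>. Surjectivity of \<beta> represents it by some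
      u.\<close>
    define l' where "l' w = l (gcomp 0 ?s\<eta> w 1 (punit Q))" for w
    have cin: "gcomp 0 ?s\<eta> w 1 (punit Q) \<in> PA" if "w \<in> chain_maps Q (stalk 1) ?S" for w
      using hom_stalk_stalk(2)[OF chain_mapsD1[OF chain_gcomp[OF pc1 pcS pc1 that s\<eta>]]] .
    have "hom_functional Q (stalk 1) ?S l'"
      unfolding hom_functional_def
    proof (intro conjI ballI allI impI)
      fix f g assume fg: "f \<in> chain_maps Q (stalk 1) ?S" "g \<in> chain_maps Q (stalk 1) ?S"
      show "l' (f + g) = l' f + l' g"
        unfolding l'_def gcomp_add_right[OF pc1 pcS pc1 chain_mapsD1[OF s\<eta>] chain_mapsD1[OF fg(1)] chain_mapsD1[OF fg(2)]]
        using 6(1)[OF cin[OF fg(1)] cin[OF fg(2)]] by simp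
      assume "homotopic Q (stalk 1) ?S f g"
      then have "gcomp 0 ?s\<eta> f = gcomp 0 ?s\<eta> g"
        by (intro homotopic_stalk_stalk[OF homotopic_gcomp_left[OF pc1 pcS pc1 s\<eta>]] chain_mapsD1 fg)
      then show "l' f = l' g" by (simp add: l'_def)
    next
      fix c f assume f: "f \<in> chain_maps Q (stalk 1) ?S"
      show "l' (gscale c f) = c * l' f"
        unfolding l'_def gcomp_scale_right[OF pc1 pcS chain_mapsD1[OF s\<eta>] chain_mapsD1[OF f]]
        using 6(2)[OF cin[OF f]] by (simp add: gscale_def)
    qed
    from surj[OF pc1 this] obtain u where u: "u \<in> chain_maps Q TR (stalk 1)"
      "\<And>w. w \<in> chain_maps Q (stalk 1) ?S \<Longrightarrow> \<beta> TR (stalk 1) u w = l' w" by blast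
    have "tr (gcomp (- 1) (lm a) u) = l a" if a: "a \<in> PA" for a
    proof -
      let ?w = "gcomp 0 ?s\<theta> (shift_map (lm a))"
      have w: "?w \<in> chain_maps Q (stalk 1) ?S" by (rule chain_gcomp[OF pc1 pc1 pcS slm[OF a] s\<theta>])
      have "tr (gcomp (- 1) (lm a) u) = \<beta> TR (stalk 1) u ?w"
        by (simp add: \<beta>E[OF pc1 u(1) w] tr_def slmv[symmetric] gcomp_assoc[of 0 0, simplified])
      also have "\<dots> = l' ?w" by (rule u(2)[OF w])
      also have "gcomp 0 ?s\<eta> ?w = shift_map (lm a)"
        using s\<eta>\<theta> gcomp_gid_left[OF pc1 pc1 chain_mapsD1[OF slm[OF a]]] gcomp_assoc[of 0 0 ?s\<eta> ?s\<theta> "shift_map (lm a)"] by simp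
      then have "l' ?w = l a" by (simp add: l'_def shift_map_def lm_apply punit_closed pmult_punit_right a)
      finally show ?thesis .
    qed
    then show ?case using u(1) by (auto simp: chain_stalk)
  next
    case (7 u n)
    have pcn: "proj_complex Q (stalk (- n) :: ('v, 'e, 'k) cpx)" by (rule pc_stalk)
    have u: "u \<in> chain_maps Q TR (stalk (- n))" using 7 by (simp add: chain_stalk)
    have "\<beta> TR (stalk (- n)) u w = \<beta> TR (stalk (- n)) 0 w" if w: "w \<in> chain_maps Q (stalk (- n)) ?S" for w
    proof -
      \<comment> \<open>A map kQ[-n] \<rightarrow> kQ[1] is zero unless n = -1, which is why that
        degree is excluded.\<close>
      have "gcomp 0 ?s\<eta> w = 0"
        using 7(3) by (intro hom_stalk_stalk_zero[OF chain_mapsD1[OF chain_gcomp[OF pcn pcS pc1 w s\<eta>]]]) auto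
      then have "\<beta> TR (stalk (- n)) u w = E (gcomp 0 ?s\<theta> (gcomp 0 0 u))"
        by (simp add: \<beta>E[OF pcn u w] Ew[OF pcn w u])
      also have "gcomp 0 ?s\<theta> (gcomp 0 0 u) = 0"
        using h_zero[OF pc1 chain_mapsD1[OF s\<theta>]] by (simp add: gcomp_def fun_eq_iff)
      also have "E 0 = \<beta> TR (stalk (- n)) 0 w"
        using add[OF pcn chain_zero[OF pcTR pcn] chain_zero[OF pcTR pcn] w] E0
          by (metis add_0 add_cancel_right_right)
      finally show ?thesis .
    qed
    then have "homotopic Q TR (stalk (- n)) u 0" using inj[OF pcn u chain_zero[OF pcTR pcn]] by blast
    then show ?case using homotopic_stalk[OF pcTR, of "- n" u] by (simp add: add.commute)
  qed
  then show ?thesis by blast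
qed

section \<open>Quotients of paths\<close>

context quiver
begin

abbreviation tgt :: "'v \<times> 'e list \<Rightarrow> 'v" where "tgt \<equiv> path_target Q"
abbreviation outs :: "'v \<Rightarrow> 'e set" where "outs v \<equiv> {\<alpha> \<in> arcs Q. tail Q \<alpha> = v}"
abbreviation ins :: "'v \<Rightarrow> 'e set" where "ins v \<equiv> {\<beta> \<in> arcs Q. head Q \<beta> = v}"
abbreviation frm :: "'v \<Rightarrow> ('v \<times> 'e list) set" where "frm v \<equiv> {p \<in> paths. fst p = v}"
abbreviation ev :: "'v \<Rightarrow> ('v, 'e, 'k::field) pvec" where "ev v \<equiv> sg (v, []) 1"
abbreviation pt :: "'v \<times> 'e list \<Rightarrow> ('v, 'e, 'k::field) pvec" where "pt p \<equiv> sg p 1"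
abbreviation ar :: "'e \<Rightarrow> ('v, 'e, 'k::field) pvec" where "ar \<alpha> \<equiv> sg (tail Q \<alpha>, [\<alpha>]) 1"
abbreviation ap :: "'e \<Rightarrow> 'v \<times> 'e list" where "ap \<alpha> \<equiv> (tail Q \<alpha>, [\<alpha>])"

definition pcat :: "'v \<times> 'e list \<Rightarrow> 'v \<times> 'e list \<Rightarrow> 'v \<times> 'e list" where
  "pcat p q = (fst p, snd p @ snd q)"

lemma fst_pcat [simp]: "fst (pcat p q) = fst p"
  and snd_pcat [simp]: "snd (pcat p q) = snd p @ snd q"
  by (simp_all add: pcat_def)

lemma tgt_Nil [simp]: "tgt (v, []) = v"
  and tgt_ap [simp]: "tgt (ap \<alpha>) = head Q \<alpha>"
  by (simp_all add: path_target_def)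

lemma tgt_pcat: "tgt p = fst q \<Longrightarrow> tgt (pcat p q) = tgt q"
  by (simp add: pcat_def path_target_append)

lemma pcat_assoc: "pcat (pcat p q) r = pcat p (pcat q r)"
  by (simp add: pcat_def)

lemma pcat_Nil_right [simp]: "pcat p (v, []) = p"
  by (simp add: pcat_def)

lemma pcat_Nil_left: "fst p = v \<Longrightarrow> pcat (v, []) p = p"
  by (auto simp: pcat_def)

lemma paths_iff: "p \<in> paths \<longleftrightarrow> is_path Q p"
  by (simp add: paths_def)

lemma Nil_paths [simp]: "(v, []) \<in> paths \<longleftrightarrow> v \<in> verts Q"
  and ap_paths [simp]: "\<alpha> \<in> arcs Q \<Longrightarrow> ap \<alpha> \<in> paths"
  and Cons_paths [simp]: "(u, \<alpha> # as) \<in> paths \<longleftrightarrow> \<alpha> \<in> arcs Q \<and> u = tail Q \<alpha> \<and> (head Q \<alpha>, as) \<in> paths"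
  by (auto simp: paths_iff)

lemma pcat_paths: "tgt p = fst q \<Longrightarrow> pcat p q \<in> paths \<longleftrightarrow> p \<in> paths \<and> q \<in> paths"
  by (cases p; cases q) (auto simp: paths_iff pcat_def is_path_append)

lemma fst_paths: "p \<in> paths \<Longrightarrow> fst p \<in> verts Q"
  and tgt_paths: "p \<in> paths \<Longrightarrow> tgt p \<in> verts Q"
  by (auto simp: paths_iff is_path_verts path_target_verts)

lemma pt_PA [simp]: "p \<in> paths \<Longrightarrow> pt p \<in> PA"
  by (simp add: paths_iff path_algebra_single)

lemma pm_pt: "tgt p = fst q \<Longrightarrow> pm (pt p) (pt q) = pt (pcat p q)"
  by (simp add: pmult_single pcat_def)

lemma pm_pt_0: "tgt p \<noteq> fst q \<Longrightarrow> pm (pt p) (pt q) = 0"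
  by (simp add: pmult_single)

lemma PA_lk: "x \<in> PA \<Longrightarrow> p \<notin> paths \<Longrightarrow> lk x p = 0"
  by (auto simp: path_algebra_iff paths_iff in_keys_iff)

lemma PA_eq_sum: "x \<in> PA \<Longrightarrow> x = (\<Sum>p\<in>paths. lk x p \<odot> pt p)"
  by (intro poly_mapping_eqI) (auto simp: lk_sum pscale_single lookup_single when_def PA_lk)

lemma PA_I: "(\<And>p. lk x p \<noteq> 0 \<Longrightarrow> p \<in> paths) \<Longrightarrow> x \<in> PA"
  by (auto simp: path_algebra_iff paths_iff in_keys_iff)

lemma lk_pm_pt_right:
  "x \<in> PA \<Longrightarrow> p \<in> paths \<Longrightarrow> tgt p = fst q \<Longrightarrow> lk (pm x (pt q)) (pcat p q) = lk x p"
proof (induction x rule: path_algebra_induct)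
  case (single r c)
  then show ?case by (cases p; cases r) (auto simp: pmult_single lookup_single when_def pcat_def)
qed (auto simp: pmult_add_left lookup_add)

lemma lk_pm_pt_right_0:
  "\<not> (\<exists>p. r = pcat p q \<and> tgt p = fst q) \<Longrightarrow> lk (pm x (pt q)) r = 0"
proof (induction x rule: pm_induct)
  case (single s c)
  then show ?case by (auto simp: pmult_single lookup_single when_def pcat_def)
qed (auto simp: pmult_add_left lookup_add)

lemma lk_pm_pt_left:
  "tgt q = fst p \<Longrightarrow> lk (pm (pt q) x) (pcat q p) = lk x p"
proof (induction x rule: pm_induct)
  case (single r c)
  then show ?case by (cases p; cases r) (auto simp: pmult_single lookup_single when_def pcat_def)
qed (auto simp: pmult_add_right lookup_add)

lemma lk_pm_pt_left_0:
  "\<not> (\<exists>p. r = pcat q p \<and> tgt q = fst p) \<Longrightarrow> lk (pm (pt q) x) r = 0"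
proof (induction x rule: pm_induct)
  case (single s c)
  then show ?case by (auto simp: pmult_single lookup_single when_def pcat_def)
qed (auto simp: pmult_add_right lookup_add)

text \<open>Cancels q at the right end: a path p q becomes p, and a path not ending in q becomes 0.
  \<open>lq\<close> does the same at the left end.\<close>

definition rq :: "'v \<times> 'e list \<Rightarrow> ('v, 'e, 'k::field) pvec \<Rightarrow> ('v, 'e, 'k) pvec" where
  "rq q x = (\<Sum>p | p \<in> paths \<and> tgt p = fst q. sg p (lk x (pcat p q)))"

definition lq :: "'v \<times> 'e list \<Rightarrow> ('v, 'e, 'k::field) pvec \<Rightarrow> ('v, 'e, 'k) pvec" where
  "lq q x = (\<Sum>p | p \<in> paths \<and> tgt q = fst p. sg p (lk x (pcat q p)))"

lemma lk_rq: "lk (rq q x) p = (if p \<in> paths \<and> tgt p = fst q then lk x (pcat p q) else 0)"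
  by (auto simp: rq_def lk_sum lookup_single when_def sum.delta' intro!: sum.neutral)

lemma lk_lq: "lk (lq q x) p = (if p \<in> paths \<and> tgt q = fst p then lk x (pcat q p) else 0)"
  by (auto simp: lq_def lk_sum lookup_single when_def sum.delta' intro!: sum.neutral)

lemma rq_PA: "rq q x \<in> PA" and lq_PA: "lq q x \<in> PA"
  by (auto intro!: PA_I simp: lk_rq lk_lq split: if_splits)

lemma rq_zero [simp]: "rq q 0 = 0" and lq_zero [simp]: "lq q 0 = 0"
  and rq_add: "rq q (x + y) = rq q x + rq q y" and lq_add: "lq q (x + y) = lq q x + lq q y"
  and rq_scale: "rq q (c \<odot> x) = c \<odot> rq q x" and lq_scale: "lq q (c \<odot> x) = c \<odot> lq q x"
  by (auto intro!: poly_mapping_eqI simp: lk_rq lk_lq lookup_add lookup_pscale)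

lemma rq_sum: "rq q (sum f I) = (\<Sum>i\<in>I. rq q (f i))" and lq_sum: "lq q (sum f I) = (\<Sum>i\<in>I. lq q (f i))"
  by (induction I rule: infinite_finite_induct) (auto simp: rq_add lq_add)

lemma rq_rq: "q \<in> paths \<Longrightarrow> tgt q = fst r \<Longrightarrow> rq q (rq r x) = rq (pcat q r) x"
  by (intro poly_mapping_eqI) (auto simp: lk_rq pcat_paths tgt_pcat pcat_assoc)

lemma lq_lq: "q \<in> paths \<Longrightarrow> tgt r = fst q \<Longrightarrow> lq q (lq r x) = lq (pcat r q) x"
  by (intro poly_mapping_eqI) (auto simp: lk_lq pcat_paths tgt_pcat pcat_assoc)

lemma sum_paths_from:
  assumes "v \<in> verts Q"
  shows "(\<Sum>a\<in>frm v. f a) =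
    f (v, []) + (\<Sum>\<alpha>\<in>outs v. \<Sum>b\<in>frm (head Q \<alpha>). f (pcat (ap \<alpha>) b))"
    (is "_ = _ + (\<Sum>\<alpha>\<in>?S. \<Sum>b\<in>?B \<alpha>. _)")
proof -
  let ?c = "\<lambda>(\<alpha>, b). pcat (ap \<alpha>) b"
  have eq: "frm v = insert (v, []) (?c ` (SIGMA \<alpha>:?S. ?B \<alpha>))"
  proof (intro equalityI subsetI)
    fix a assume a: "a \<in> frm v"
    obtain u as where [simp]: "a = (u, as)" by (cases a)
    show "a \<in> insert (v, []) (?c ` (SIGMA \<alpha>:?S. ?B \<alpha>))"
    proof (cases as)
      case (Cons \<alpha> bs)
      then show ?thesis using a
        by (auto simp: pcat_def intro!: image_eqI[of _ _ "(\<alpha>, (head Q \<alpha>, bs))"])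
    qed (use a in auto)
  qed (use assms in \<open>auto simp: pcat_def\<close>)
  have inj: "inj_on ?c (SIGMA \<alpha>:?S. ?B \<alpha>)"
    by (auto simp: inj_on_def pcat_def)
  have fin: "finite (SIGMA \<alpha>:?S. ?B \<alpha>)"
    by (intro finite_SigmaI) auto
  have "(\<Sum>a\<in>frm v. f a) = f (v, []) + sum f (?c ` (SIGMA \<alpha>:?S. ?B \<alpha>))"
    unfolding eq using fin by (subst sum.insert) (auto simp: pcat_def)
  also have "sum f (?c ` (SIGMA \<alpha>:?S. ?B \<alpha>)) = (\<Sum>\<alpha>\<in>?S. \<Sum>b\<in>?B \<alpha>. f (pcat (ap \<alpha>) b))"
    using inj by (subst sum.reindex) (auto simp: sum.Sigma case_prod_beta intro!: sum.cong)
  finally show ?thesis .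
qed

lemma path_snoc_cases:
  assumes "a \<in> paths"
  obtains "a = (fst a, [])" | b \<alpha> where "b \<in> paths" "\<alpha> \<in> arcs Q" "tgt b = tail Q \<alpha>" "a = pcat b (ap \<alpha>)"
proof (cases "snd a" rule: rev_cases)
  case Nil
  then show ?thesis using that(1) by (metis prod.collapse)
next
  case (snoc bs \<alpha>)
  then have "a = pcat (fst a, bs) (ap \<alpha>)" by (cases a) (simp add: pcat_def)
  moreover have "is_path Q (fst a, bs @ [\<alpha>])" using assms snoc by (metis paths_iff prod.collapse)
  ultimately show ?thesis using that(2)[of "(fst a, bs)" \<alpha>] by (simp add: is_path_append paths_iff)
qed

lemma sum_paths_to:
  assumes "v \<in> verts Q"
  shows "(\<Sum>a | a \<in> paths \<and> tgt a = v. f a) =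
    f (v, []) + (\<Sum>\<alpha>\<in>ins v. \<Sum>b | b \<in> paths \<and> tgt b = tail Q \<alpha>. f (pcat b (ap \<alpha>)))"
    (is "_ = _ + (\<Sum>\<alpha>\<in>?S. \<Sum>b\<in>?B \<alpha>. _)")
proof -
  let ?c = "\<lambda>(\<alpha>, b). pcat b (ap \<alpha>)"
  have eq: "{a \<in> paths. tgt a = v} = insert (v, []) (?c ` (SIGMA \<alpha>:?S. ?B \<alpha>))"
  proof (intro equalityI subsetI)
    fix a assume a: "a \<in> {a \<in> paths. tgt a = v}"
    then have "a \<in> paths" by simp
    then show "a \<in> insert (v, []) (?c ` (SIGMA \<alpha>:?S. ?B \<alpha>))"
    proof (cases rule: path_snoc_cases)
      case 1
      then show ?thesis using a by (metis (mono_tags, lifting) insertI1 mem_Collect_eq tgt_Nil)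
    next
      case (2 b \<alpha>)
      then have "head Q \<alpha> = v" using a by (simp add: tgt_pcat)
      then show ?thesis using 2 by (intro insertI2 image_eqI[of _ _ "(\<alpha>, b)"]) auto
    qed
  qed (use assms in \<open>auto simp: pcat_paths tgt_pcat\<close>)
  have inj: "inj_on ?c (SIGMA \<alpha>:?S. ?B \<alpha>)"
    by (auto simp: inj_on_def pcat_def)
  have fin: "finite (SIGMA \<alpha>:?S. ?B \<alpha>)"
    by (intro finite_SigmaI) auto
  have "(\<Sum>a\<in>{a \<in> paths. tgt a = v}. f a) = f (v, []) + sum f (?c ` (SIGMA \<alpha>:?S. ?B \<alpha>))"
    unfolding eq using fin by (subst sum.insert) (auto simp: pcat_def)
  also have "sum f (?c ` (SIGMA \<alpha>:?S. ?B \<alpha>)) = (\<Sum>\<alpha>\<in>?S. \<Sum>b\<in>?B \<alpha>. f (pcat b (ap \<alpha>)))"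
    using inj by (subst sum.reindex) (auto simp: sum.Sigma case_prod_beta)
  finally show ?thesis .
qed

lemma lk_pm_ar_right_other:
  "b \<in> paths \<Longrightarrow> \<alpha> \<noteq> \<beta> \<Longrightarrow> lk (pm x (ar \<beta>)) (pcat b (ap \<alpha>)) = 0"
  by (rule lk_pm_pt_right_0) (auto simp: pcat_def)

text \<open>Every nontrivial path has exactly one last arrow, so an element without trivial paths is
  recovered from its right quotients by arrows.\<close>

lemma PA_right_decomp:
  assumes x: "x \<in> PA" and top: "\<And>v. v \<in> verts Q \<Longrightarrow> lk x (v, []) = 0"
  shows "x = (\<Sum>\<beta>\<in>arcs Q. pm (rq (ap \<beta>) x) (ar \<beta>))"
proof (rule poly_mapping_eqI)
  fix p
  show "lk x p = lk (\<Sum>\<beta>\<in>arcs Q. pm (rq (ap \<beta>) x) (ar \<beta>)) p"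
  proof (cases "p \<in> paths")
    case False
    then show ?thesis
      by (simp add: PA_lk x path_algebra_sum pmult_closed rq_PA)
  next
    case True
    then show ?thesis
    proof (cases rule: path_snoc_cases)
      case 1
      then have "lk x p = 0" using True top by (metis Nil_paths)
      moreover have "lk (pm (rq (ap \<beta>) x) (ar \<beta>)) p = 0" for \<beta>
        by (rule lk_pm_pt_right_0) (use 1 in \<open>auto simp: pcat_def\<close>)
      ultimately show ?thesis by (simp add: lk_sum)
    next
      case (2 b \<alpha>)
      have "lk (pm (rq (ap \<beta>) x) (ar \<beta>)) p = (if \<beta> = \<alpha> then lk x p else 0)" for \<beta>
        using 2 by (auto simp: lk_pm_pt_right rq_PA lk_rq lk_pm_ar_right_other)
      then show ?thesis using 2 by (simp add: lk_sum)
    qed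
  qed
qed

lemma PA_left_decomp:
  assumes x: "x \<in> PA" and src: "\<And>p. lk x p \<noteq> 0 \<Longrightarrow> fst p = v" and top: "lk x (v, []) = 0"
  shows "x = (\<Sum>\<alpha>\<in>outs v. pm (ar \<alpha>) (lq (ap \<alpha>) x))"
proof (rule poly_mapping_eqI)
  fix p :: "'v \<times> 'e list"
  obtain u as where p [simp]: "p = (u, as)" by (cases p)
  show "lk x p = lk (\<Sum>\<alpha>\<in>outs v. pm (ar \<alpha>) (lq (ap \<alpha>) x)) p"
  proof (cases as)
    case Nil
    then have "lk x p = 0" using src[of p] top by auto
    moreover have "lk (pm (ar \<beta>) (lq (ap \<beta>) x)) p = 0" for \<beta>
      by (rule lk_pm_pt_left_0) (use Nil in \<open>auto simp: pcat_def\<close>)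
    ultimately show ?thesis by (auto simp: lk_sum intro!: sum.neutral)
  next
    case (Cons \<alpha> bs)
    have *: "lk (pm (ar \<beta>) (lq (ap \<beta>) x)) p = (if \<beta> = \<alpha> \<and> u = tail Q \<alpha> \<and> p \<in> paths then lk x p else 0)" for \<beta>
    proof (cases "\<beta> = \<alpha> \<and> u = tail Q \<alpha>")
      case True
      then have "p = pcat (ap \<alpha>) (head Q \<alpha>, bs)" using Cons by (simp add: pcat_def)
      then show ?thesis using True lk_pm_pt_left[of "ap \<alpha>" "(head Q \<alpha>, bs)" "lq (ap \<alpha>) x"] Cons
          PA_lk[OF x, of p]
        by (auto simp: lk_lq pcat_paths)
    next
      case False
      then show ?thesis by (subst lk_pm_pt_left_0) (use Cons in \<open>auto simp: pcat_def\<close>)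
    qed
    show ?thesis
    proof (cases "lk x p = 0")
      case True
      have "lk (\<Sum>\<alpha>\<in>outs v. pm (ar \<alpha>) (lq (ap \<alpha>) x)) p = 0"
        unfolding lk_sum by (rule sum.neutral) (simp only: * True, simp)
      with True show ?thesis by simp
    next
      case False
      then have pu: "p \<in> paths" "u = v" using PA_lk[OF x] src[of p] by auto
      have "lk (\<Sum>\<alpha>\<in>outs v. pm (ar \<alpha>) (lq (ap \<alpha>) x)) p =
          (\<Sum>\<beta>\<in>outs v. if \<beta> = \<alpha> then lk x p else 0)"
        unfolding lk_sum by (rule sum.cong[OF refl], subst *) (use pu Cons in auto)
      also have "\<dots> = lk x p" using pu Cons by simp
      finally show ?thesis by simp
    qed
  qed
qed

text \<open>The first arrow of a nontrivial path is untouched by multiplication on the right. A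
  trivial path e would break this: its left quotient by an arrow is 0, while that of e a need not
  be. Hence left quotients of kQ-linear maps are kQ-linear only in the absence of trivial
  paths.\<close>

lemma lq_pm:
  assumes x: "x \<in> PA" and a: "a \<in> PA" and top: "\<And>v. lk x (v, []) = 0"
  shows "lq (ap \<alpha>) (pm x a) = pm (lq (ap \<alpha>) x) a"
proof -
  have 1: "lq (ap \<alpha>) (pm (c \<odot> pt p) a) = pm (lq (ap \<alpha>) (c \<odot> pt p)) a" if p: "p \<in> paths" "snd p \<noteq> []" for c p
  proof -
    obtain \<beta> bs where [simp]: "p = (tail Q \<beta>, \<beta> # bs)" "\<beta> \<in> arcs Q" "(head Q \<beta>, bs) \<in> paths"
      using p by (cases p; cases "snd p") auto
    then have [simp]: "is_path Q (head Q \<beta>, bs)" by (simp add: paths_iff)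
    have 1: "lq (ap \<alpha>) (pt p) = (if \<alpha> = \<beta> then pt (head Q \<beta>, bs) else 0)"
      by (intro poly_mapping_eqI) (auto simp: lk_lq lookup_single when_def pcat_def)
    have "lq (ap \<alpha>) (pm (pt p) (sg q d)) = pm (lq (ap \<alpha>) (pt p)) (sg q d)" if "is_path Q q" for q d
      using that unfolding 1
      by (intro poly_mapping_eqI)
        (auto simp: lk_lq pmult_single lookup_single when_def pcat_def is_path_append paths_iff)
    note sg = this
    have "lq (ap \<alpha>) (pm (pt p) a) = pm (lq (ap \<alpha>) (pt p)) a"
      using a
    proof (induction a rule: path_algebra_induct)
      case (single q c)
      then show ?case using sg[of q c] by simp
    qed (auto simp: pmult_add_right lq_add)
    then show ?thesis by (simp add: pmult_scale_left lq_scale)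
  qed
  have 2: "lk x p \<odot> pt p = 0" if "snd p = []" for p
    using top[of "fst p"] that by (metis prod.collapse pscale.scale_zero_left)
  have *: "lq (ap \<alpha>) (pm (lk x p \<odot> pt p) a) = pm (lq (ap \<alpha>) (lk x p \<odot> pt p)) a" if "p \<in> paths" for p
  proof (cases "snd p = []")
    case True
    from 2[OF this] show ?thesis by (simp only: pmult_zero_left lq_zero)
  qed (rule 1[OF that])
  show ?thesis
    by (subst (1 2) PA_eq_sum[OF x]) (auto simp: pmult_sum_left lq_sum * intro!: sum.cong)
qed

section \<open>The resolution of the dual of the path algebra\<close>

text \<open>
  For families \<open>y\<close> indexed by paths \<open>z\<close> with \<open>y z \<in> A e\<^sub>t\<^sub>(\<^sub>z\<^sub>)\<close> this is the differential
  of \<open>A \<otimes> V \<otimes> DA \<rightarrow> A \<otimes> DA\<close>, where \<open>V\<close> is spanned by the arrows.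
\<close>

definition res_diff :: "('v \<times> 'e list \<Rightarrow> 'e \<Rightarrow> ('v, 'e, 'k::field) pvec) \<Rightarrow> 'v \<times> 'e list \<Rightarrow> ('v, 'e, 'k) pvec" where
  "res_diff y z = (\<Sum>\<alpha>\<in>outs (tgt z). y (pcat z (ap \<alpha>)) \<alpha>) -
    (\<Sum>\<beta>\<in>ins (tgt z). pm (y z \<beta>) (ar \<beta>))"

text \<open>Its coefficients at the trivial paths form the augmentation A \<otimes> DA \<rightarrow>
  DA, the family read as the sum of the y z tensored with the dual basis element of z. The other
  coefficients hold the partial quotients from which \<open>res_lift\<close> reads off a
  preimage.\<close>

definition res_tot :: "('v \<times> 'e list \<Rightarrow> ('v, 'e, 'k::field) pvec) \<Rightarrow> 'v \<times> 'e list \<Rightarrow> ('v, 'e, 'k) pvec" where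
  "res_tot y z = (\<Sum>a\<in>frm (tgt z). rq a (y (pcat z a)))"

definition res_lift :: "('v \<times> 'e list \<Rightarrow> ('v, 'e, 'k::field) pvec) \<Rightarrow> 'v \<times> 'e list \<Rightarrow> 'e \<Rightarrow> ('v, 'e, 'k) pvec" where
  "res_lift y z \<beta> = - rq (ap \<beta>) (res_tot y z)"

lemma lk_res_tot: "lk (res_tot y z) p = (if p \<in> paths \<and> tgt p = tgt z then
    (\<Sum>a\<in>frm (tgt z). lk (y (pcat z a)) (pcat p a)) else 0)"
  by (auto simp: res_tot_def lk_sum lk_rq intro!: sum.cong sum.neutral)

lemma res_lift_PA: "res_lift y z \<beta> \<in> PA"
  by (simp add: res_lift_def path_algebra_uminus rq_PA)

lemma lk_res_lift: "lk (res_lift y z \<beta>) p \<noteq> 0 \<Longrightarrow> tgt p = tail Q \<beta>"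
  by (auto simp: res_lift_def lk_rq split: if_splits)

text \<open>Exactness of the resolution at A \<otimes> DA. Let x/\<alpha> be the right quotient and
  tot the family \<open>res_tot y\<close>. Splitting off the first arrow of a gives tot z = y z +
  \<Sum> tot(z \<alpha>)/\<alpha>, and as tot z has no trivial paths it also equals \<Sum> (tot
  z/\<beta>) \<beta>. Comparing the two expressions gives the claim.\<close>

lemma res_diff_lift:
  assumes z: "z \<in> paths" and y: "y z \<in> PA" "\<And>p. lk (y z) p \<noteq> 0 \<Longrightarrow> tgt p = tgt z"
    and tot: "(\<Sum>a\<in>frm (tgt z). lk (y (pcat z a)) a) = 0"
  shows "res_diff (res_lift y) z = y z"
proof -
  let ?v = "tgt z"
  have v: "?v \<in> verts Q" using z by (rule tgt_paths)
  have 1: "res_tot y z = rq (?v, []) (y z) + (\<Sum>\<alpha>\<in>outs (?v). rq (ap \<alpha>) (res_tot y (pcat z (ap \<alpha>))))"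
    unfolding res_tot_def sum_paths_from[OF v]
    by (auto simp: rq_sum rq_rq tgt_pcat pcat_assoc intro!: sum.cong)
  have 2: "rq (?v, []) (y z) = y z"
    using y PA_lk by (intro poly_mapping_eqI) (auto simp: lk_rq)
  have tot0: "lk (res_tot y z) (u, []) = 0" for u
    using tot by (auto simp: lk_res_tot pcat_Nil_left cong: conj_cong)
  have "res_tot y z \<in> PA" by (auto simp: res_tot_def intro!: path_algebra_sum rq_PA)
  from PA_right_decomp[OF this tot0]
  have "res_tot y z = (\<Sum>\<beta>\<in>arcs Q. pm (rq (ap \<beta>) (res_tot y z)) (ar \<beta>))" .
  also have "\<dots> = (\<Sum>\<beta>\<in>ins (?v). pm (rq (ap \<beta>) (res_tot y z)) (ar \<beta>))"
  proof (rule sum.mono_neutral_right)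
    have "rq (ap \<beta>) (res_tot y z) = 0" if "head Q \<beta> \<noteq> ?v" for \<beta>
      using that by (intro poly_mapping_eqI) (auto simp: lk_rq lk_res_tot tgt_pcat)
    then show "\<forall>\<beta>\<in>arcs Q - ins (?v). pm (rq (ap \<beta>) (res_tot y z)) (ar \<beta>) = 0" by auto
  qed auto
  finally show ?thesis
    using 1 2 by (simp add: res_diff_def res_lift_def pmult_uminus_left sum_negf)
qed

text \<open>Exactness at A \<otimes> V \<otimes> DA. The induction descends from the longest paths
  z, so the values at z \<alpha> are already known to vanish; what remains is a sum of multiples of
  distinct last arrows \<beta>, whose terms are separated by these arrows.\<close>

lemma res_diff_inj:
  assumes y: "\<And>z \<beta>. z \<in> paths \<Longrightarrow> \<beta> \<in> arcs Q \<Longrightarrow> head Q \<beta> = tgt z \<Longrightarrow> y z \<beta> \<in> PA"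
    "\<And>z \<beta> p. z \<in> paths \<Longrightarrow> \<beta> \<in> arcs Q \<Longrightarrow> head Q \<beta> = tgt z \<Longrightarrow> lk (y z \<beta>) p \<noteq> 0 \<Longrightarrow> tgt p = tail Q \<beta>"
    and zero: "\<And>z. z \<in> paths \<Longrightarrow> res_diff y z = 0"
    and z: "z \<in> paths" "\<beta> \<in> arcs Q" "head Q \<beta> = tgt z"
  shows "y z \<beta> = 0"
  using z
proof (induction "Suc (card (verts Q)) - length (snd z)" arbitrary: z \<beta> rule: less_induct)
  case less
  have len: "length (snd z) \<le> card (verts Q)" using less.prems(1) length_path by (simp add: paths_iff)
  have "y (pcat z (ap \<alpha>)) \<alpha> = 0" if "\<alpha> \<in> arcs Q" "tail Q \<alpha> = tgt z" for \<alpha>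
    using that len less.prems by (intro less.hyps) (auto simp: pcat_paths tgt_pcat)
  then have 0: "(\<Sum>\<beta>\<in>ins (tgt z). pm (y z \<beta>) (ar \<beta>)) = 0"
    using zero[OF less.prems(1)] by (simp add: res_diff_def)
  show ?case
  proof (rule poly_mapping_eqI)
    fix p
    show "lk (y z \<beta>) p = lk 0 p"
    proof (cases "p \<in> paths \<and> tgt p = tail Q \<beta>")
      case False
      then show ?thesis using y(1)[OF less.prems] y(2)[OF less.prems, of p] PA_lk[of "y z \<beta>" p] by auto
    next
      case True
      have "lk (pm (y z \<gamma>) (ar \<gamma>)) (pcat p (ap \<beta>)) = (if \<gamma> = \<beta> then lk (y z \<beta>) p else 0)" for \<gamma>
        using True y(1)[OF less.prems] by (auto simp: lk_pm_pt_right lk_pm_ar_right_other)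
      then have "lk (y z \<beta>) p = lk (\<Sum>\<beta>\<in>ins (tgt z). pm (y z \<beta>) (ar \<beta>)) (pcat p (ap \<beta>))"
        using less.prems by (simp add: lk_sum)
      then show ?thesis by (simp add: 0)
    qed
  qed
qed

end

section \<open>Generators in weight one\<close>

context dg_endofunctor
begin

abbreviation lact :: "('v, 'e, 'k) pvec \<Rightarrow> int \<Rightarrow> ('v, 'e, 'k) pvec \<Rightarrow> ('v, 'e, 'k) pvec" where
  "lact a \<equiv> tens RQ 0 a"

lemma lact_in: "a \<in> PA \<Longrightarrow> m \<in> el TR k \<Longrightarrow> lact a k m \<in> el TR k"
  using tens_in[OF pcR, of a 0 m k] by (simp add: el_R)

lemma lact_lact: "a \<in> PA \<Longrightarrow> b \<in> PA \<Longrightarrow> lact a k (lact b k m) = lact (pm a b) k m"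
  using tens_act_left[OF pcR, of a 0 b k m] by (simp add: el_R act_R)

lemma lact_act: "a \<in> PA \<Longrightarrow> b \<in> PA \<Longrightarrow> m \<in> el TR k \<Longrightarrow> lact a k (act TR k m b) = act TR k (lact a k m) b"
  using tens_act_right[OF pcR, of a 0 m k b] by (simp add: el_R)

lemma lact_dif: "a \<in> PA \<Longrightarrow> m \<in> el TR k \<Longrightarrow> dif TR k (lact a k m) = lact a (k - 1) (dif TR k m)"
  using dif_tens[OF pcR, of a 0 m k] by (simp add: el_R tens_zero_left)

lemma lact_add: "a \<in> PA \<Longrightarrow> m \<in> el TR k \<Longrightarrow> m' \<in> el TR k \<Longrightarrow> lact a k (m + m') = lact a k m + lact a k m'"
  and lact_scale: "a \<in> PA \<Longrightarrow> m \<in> el TR k \<Longrightarrow> lact a k (c \<odot> m) = c \<odot> lact a k m"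
  by (simp_all add: tens_add_right[OF pcR] tens_scale_right[OF pcR] el_R)

text \<open>The right action of kQ on Hom(TR, kQ) induced by the left action on TR. The left action,
  by composition with \<open>lm a\<close>, comes from the target.\<close>

definition rpre :: "('v, 'e, 'k) gmap \<Rightarrow> ('v, 'e, 'k) pvec \<Rightarrow> ('v, 'e, 'k) gmap" where
  "rpre u a = gcomp 0 u (fmor T RQ RQ 0 (lm a))"

lemma rpre_apply: "rpre u a n x = u n (lact a n x)"
  by (simp add: rpre_def gcomp_def tens_def lm_def)

lemma rpre_hom: "u \<in> hom Q TR RQ d \<Longrightarrow> a \<in> PA \<Longrightarrow> rpre u a \<in> hom Q TR RQ d"
  unfolding rpre_def using gcomp_hom[OF pcTR pcTR T_hom[OF pcR pcR lm_hom], of a u RQ d] by simp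

lemma lpost_apply: "u \<in> hom Q TR RQ d \<Longrightarrow> a \<in> PA \<Longrightarrow> gcomp d (lm a) u n x = pm a (u n x)"
  using hom_to_R[OF pcTR, of u d n x] hom_to_R_in[OF pcTR, of u d n x]
  by (cases "n + d = 0") (auto simp: gcomp_def lm_apply lm_def hat_def act_R)

lemma lpost_hom: "u \<in> hom Q TR RQ d \<Longrightarrow> a \<in> PA \<Longrightarrow> gcomp d (lm a) u \<in> hom Q TR RQ d"
  using gcomp_hom[OF pcTR pcR _ lm_hom, of u d a] by simp

lemma hom_TR_zero: "u \<in> hom Q TR RQ d \<Longrightarrow> u n 0 = 0"
  by (rule h_zero[OF pcTR])

lemma dhom_zero_iff: assumes u: "u \<in> hom Q TR RQ d"
  shows "dhom TR RQ d u = 0 \<longleftrightarrow> (\<forall>n. \<forall>x\<in>el TR n. u (n - 1) (dif TR n x) = 0)"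
proof
  assume L: "dhom TR RQ d u = 0"
  show "\<forall>n. \<forall>x\<in>el TR n. u (n - 1) (dif TR n x) = 0"
  proof (intro allI ballI)
    fix n x
    have "dhom TR RQ d u n x = 0" by (simp add: L)
    then show "u (n - 1) (dif TR n x) = 0" by (auto simp: dhom_RQ koszul_def split: if_splits)
  qed
next
  assume R: "\<forall>n. \<forall>x\<in>el TR n. u (n - 1) (dif TR n x) = 0"
  show "dhom TR RQ d u = 0"
  proof (intro ext)
    fix n x show "dhom TR RQ d u n x = 0 n x"
      using R d_outside[OF pcTR, of x n] hom_TR_zero[OF u] by (cases "x \<in> el TR n") (auto simp: dhom_RQ)
  qed
qed

text \<open>The coordinates in a dual basis are maps of this kind. All equations between chosen
  elements of TR are verified by such tests.\<close>

lemma TR_separated: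
  assumes x: "x \<in> el TR n" and y: "y \<in> el TR n" and eq: "\<And>f. f \<in> hom Q TR RQ (- n) \<Longrightarrow> f n x = f n y"
  shows "x = y"
proof -
  obtain N :: nat and u v where uv: "\<forall>j<N. u j \<in> el TR n \<and> v j \<in> hom Q TR RQ (- n)"
    "\<forall>x\<in>el TR n. x = (\<Sum>j<N. act TR n (u j) (v j n x))"
    using dual_basis_cpx[OF pcTR] by blast
  have "x = (\<Sum>j<N. act TR n (u j) (v j n x))" "y = (\<Sum>j<N. act TR n (u j) (v j n y))" using uv(2) x y by blast+
  then show ?thesis using uv(1) eq by (metis (no_types, lifting) lessThan_iff sum.cong)
qed

lemma hom_lq:
  assumes f: "f \<in> hom Q TR RQ d" and top: "\<And>n x v. lk (f n x) (v, []) = 0"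
  shows "(\<lambda>n x. lq (ap \<alpha>) (f n x)) \<in> hom Q TR RQ d"
  using h_add[OF pcTR f] h_scale[OF pcTR f] hom_to_R[OF pcTR f] h_outside[OF pcTR f]
  by (intro homI)
    (auto simp: el_R act_R lq_PA lq_add lq_scale hom_to_R_act[OF pcTR f] lq_pm[OF hom_to_R_in[OF pcTR f] _ top])

lemma PA_ev_right: "c \<in> PA \<Longrightarrow> pm c (ev v) = c \<longleftrightarrow> (\<forall>p. lk c p \<noteq> 0 \<longrightarrow> tgt p = v)"
  by (auto simp: poly_mapping_eq_iff fun_eq_iff lk_idem_right)

end

section \<open>Representation of the trace by elements of TR: the images of the loops\<close>

context trace_form
begin

definition Zc :: "('v, 'e, 'k) gmap set" where
  "Zc = {u \<in> hom Q TR RQ (- 1). dhom TR RQ (- 1) u = 0}"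

lemma Zc_hom: "u \<in> Zc \<Longrightarrow> u \<in> hom Q TR RQ (- 1)"
  by (simp add: Zc_def)

lemma Zc_I: "u \<in> hom Q TR RQ (- 1) \<Longrightarrow> (\<And>n x. x \<in> el TR n \<Longrightarrow> u (n - 1) (dif TR n x) = 0) \<Longrightarrow> u \<in> Zc"
  by (simp add: Zc_def dhom_zero_iff)

lemma Zc_D: "u \<in> Zc \<Longrightarrow> x \<in> el TR n \<Longrightarrow> u (n - 1) (dif TR n x) = 0"
  using dhom_zero_iff[of u "- 1"] by (auto simp: Zc_def)

lemma Zc_add: "u \<in> Zc \<Longrightarrow> v \<in> Zc \<Longrightarrow> u + v \<in> Zc"
  by (rule Zc_I) (auto simp: Zc_hom Zc_D hom_add[OF pcTR pcR])

lemma Zc_scale: "u \<in> Zc \<Longrightarrow> gscale c u \<in> Zc"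
  by (rule Zc_I) (auto simp: Zc_hom hom_scale[OF pcTR pcR], simp add: gscale_def Zc_D)

lemma Zc_uminus: "u \<in> Zc \<Longrightarrow> - u \<in> Zc"
  using Zc_scale[of u "- 1"] by (simp add: gscale_def fun_Compl_def)

lemma Zc_diff: "u \<in> Zc \<Longrightarrow> v \<in> Zc \<Longrightarrow> u - v \<in> Zc"
  using Zc_add[of u "- v"] by (simp add: Zc_uminus)

lemma Zc_zero: "0 \<in> Zc"
  by (rule Zc_I) (auto simp: hom_zero[OF pcTR pcR])

lemma Zc_sum: "(\<And>i. i \<in> I \<Longrightarrow> f i \<in> Zc) \<Longrightarrow> sum f I \<in> Zc"
  by (induction I rule: infinite_finite_induct) (auto simp: Zc_zero Zc_add)

lemma Zc_rpre: "u \<in> Zc \<Longrightarrow> a \<in> PA \<Longrightarrow> rpre u a \<in> Zc"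
  by (rule Zc_I) (auto simp: rpre_hom Zc_hom rpre_apply lact_dif[symmetric] Zc_D lact_in)

lemma Zc_lpost: "u \<in> Zc \<Longrightarrow> a \<in> PA \<Longrightarrow> gcomp (- 1) (lm a) u \<in> Zc"
  by (rule Zc_I) (auto simp: lpost_hom Zc_hom lpost_apply Zc_D)

lemma tr_plus: "u \<in> Zc \<Longrightarrow> v \<in> Zc \<Longrightarrow> tr (u + v) = tr u + tr v"
  and tr_gscale: "u \<in> Zc \<Longrightarrow> tr (gscale c u) = c * tr u"
  and tr_cyc: "u \<in> Zc \<Longrightarrow> a \<in> PA \<Longrightarrow> tr (rpre u a) = tr (gcomp (- 1) (lm a) u)"
  by (auto simp: Zc_def rpre_def intro: tr_add tr_scale tr_cyclic)

lemma tr_zero: "tr 0 = 0"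
  using tr_gscale[OF Zc_zero, of 0] by (simp add: gscale_def zero_fun_def)

lemma tr_uminus: "u \<in> Zc \<Longrightarrow> tr (- u) = - tr u"
  using tr_gscale[of u "- 1"] by (simp add: gscale_def fun_Compl_def)

lemma tr_diff: "u \<in> Zc \<Longrightarrow> v \<in> Zc \<Longrightarrow> tr (u - v) = tr u - tr v"
  using tr_plus[of u "- v"] by (simp add: Zc_uminus tr_uminus)

lemma tr_sum: "(\<And>i. i \<in> I \<Longrightarrow> f i \<in> Zc) \<Longrightarrow> tr (sum f I) = (\<Sum>i\<in>I. tr (f i))"
  by (induction I rule: infinite_finite_induct) (auto simp: tr_zero tr_plus Zc_sum)

text \<open>The sum of the diagonal coefficients of the linear map a \<mapsto> u(a m) on A e_i in
  the basis of paths. These are the functionals of u that an element m of TR of degree 1 can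
  produce.\<close>

definition chi :: "'v \<Rightarrow> ('v, 'e, 'k) gmap \<Rightarrow> ('v, 'e, 'k) pvec \<Rightarrow> 'k" where
  "chi i u m = (\<Sum>a | a \<in> paths \<and> tgt a = i. lk (u 1 (lact (pt a) 1 m)) a)"

text \<open>
  If all the functionals \<open>chi i \<hyphen> m\<close> vanish on a cycle \<open>u\<close>, then the diagonal part of \<open>u\<close>
  is the sum of the commutators of the arrows with the cycles \<open>u\<^sub>\<alpha>\<close>, the left quotient by \<open>\<alpha>\<close>
  of the sum of \<open>(a\<^sup>-\<^sup>1 u) T(a)\<close> over the paths \<open>a\<close> ending at the source of \<open>\<alpha>\<close>.
\<close>

lemma tr_eq_zero:
  assumes u: "u \<in> Zc" and chi0: "\<And>i m. i \<in> verts Q \<Longrightarrow> m \<in> el TR 1 \<Longrightarrow> chi i u m = 0"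
  shows "tr u = 0"
proof -
  note uh = Zc_hom[OF u]
  define W where "W i n x = (if x \<in> el TR n then \<Sum>a | a \<in> paths \<and> tgt a = i. lq a (u n (lact (pt a) n x)) else 0)"
    for i n x
  have u_n: "u n x = 0" if "n \<noteq> 1" for n x using that hom_to_R[OF pcTR uh] by simp
  have W_top: "lk (W i n x) (v, []) = 0" if i: "i \<in> verts Q" for i n x v
  proof (cases "x \<in> el TR n \<and> n = 1 \<and> v = i")
    case True
    then have "lk (W i n x) (v, []) = chi i u x"
      using i by (auto simp: W_def chi_def lk_sum lk_lq intro!: sum.cong)
    then show ?thesis using chi0[OF i, of x] True by auto
  next
    case False
    then show ?thesis
    proof (cases "n = 1")
      case True
      with False have "x \<notin> el TR n \<or> v \<noteq> i" by simp
      then show ?thesis by (auto simp: W_def lk_sum lk_lq intro!: sum.neutral)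
    qed (simp add: W_def u_n)
  qed
  have W_src: "fst p = i" if "lk (W i n x) p \<noteq> 0" for i n x p
  proof (rule ccontr)
    assume "fst p \<noteq> i"
    then have "lk (W i n x) p = 0" by (auto simp: W_def lk_sum lk_lq intro!: sum.neutral)
    then show False using that by simp
  qed
  have W_PA: "W i n x \<in> PA" for i n x
    by (auto simp: W_def intro!: path_algebra_sum lq_PA)
  have lq_ev: "lq (i, []) c = pm (ev i) c" if "c \<in> PA" for i and c :: "('v, 'e, 'k) pvec"
    using that by (intro poly_mapping_eqI) (auto simp: lk_lq lk_idem_left pcat_Nil_left PA_lk)
  have W_rec: "W i n x = pm (ev i) (u n (lact (ev i) n x)) +
      (\<Sum>\<alpha>\<in>ins i. lq (ap \<alpha>) (W (tail Q \<alpha>) n (lact (ar \<alpha>) n x)))"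
    if i: "i \<in> verts Q" and x: "x \<in> el TR n" for i n x
  proof -
    have "W i n x = lq (i, []) (u n (lact (ev i) n x)) + (\<Sum>\<alpha>\<in>ins i.
        \<Sum>b | b \<in> paths \<and> tgt b = tail Q \<alpha>. lq (pcat b (ap \<alpha>)) (u n (lact (pt (pcat b (ap \<alpha>))) n x)))"
      using x sum_paths_to[OF i, of "\<lambda>a. lq a (u n (lact (pt a) n x))"] by (simp add: W_def)
    also have "lq (i, []) (u n (lact (ev i) n x)) = pm (ev i) (u n (lact (ev i) n x))"
      by (rule lq_ev[OF hom_to_R_in[OF pcTR uh]])
    also have "(\<Sum>\<alpha>\<in>ins i. \<Sum>b | b \<in> paths \<and> tgt b = tail Q \<alpha>.
        lq (pcat b (ap \<alpha>)) (u n (lact (pt (pcat b (ap \<alpha>))) n x))) =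
      (\<Sum>\<alpha>\<in>ins i. lq (ap \<alpha>) (W (tail Q \<alpha>) n (lact (ar \<alpha>) n x)))"
    proof (rule sum.cong[OF refl])
      fix \<alpha> assume \<alpha>: "\<alpha> \<in> ins i"
      have *: "lact (ar \<alpha>) n x \<in> el TR n" using \<alpha> x by (intro lact_in) auto
      have "lq (ap \<alpha>) (W (tail Q \<alpha>) n (lact (ar \<alpha>) n x)) =
          (\<Sum>b | b \<in> paths \<and> tgt b = tail Q \<alpha>. lq (ap \<alpha>) (lq b (u n (lact (pt b) n (lact (ar \<alpha>) n x)))))"
        using * by (simp add: W_def lq_sum)
      also have "\<dots> = (\<Sum>b | b \<in> paths \<and> tgt b = tail Q \<alpha>. lq (pcat b (ap \<alpha>)) (u n (lact (pt (pcat b (ap \<alpha>))) n x)))"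
        using \<alpha> by (intro sum.cong) (auto simp: lq_lq lact_lact pm_pt)
      finally show "(\<Sum>b | b \<in> paths \<and> tgt b = tail Q \<alpha>. lq (pcat b (ap \<alpha>)) (u n (lact (pt (pcat b (ap \<alpha>))) n x))) =
          lq (ap \<alpha>) (W (tail Q \<alpha>) n (lact (ar \<alpha>) n x))" by simp
    qed
    finally show ?thesis .
  qed
  \<comment> \<open>Linearity is propagated along \<open>W_rec\<close>; the bound on the length of
    the paths ending at i drops when an arrow into i is cut off. Each left quotient stays linear
    because of \<open>W_top\<close>, and that is exactly the vanishing of all
    \<open>chi\<close>.\<close>
  have W_hom: "W i \<in> hom Q TR RQ (- 1)" if "i \<in> verts Q" "\<And>a. a \<in> paths \<Longrightarrow> tgt a = i \<Longrightarrow> length (snd a) < N" for i N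
    using that
  proof (induction N arbitrary: i)
    case 0
    from 0(2)[of "(i, [])"] 0(1) show ?case by simp
  next
    case (Suc N)
    have ei: "(ev i :: ('v, 'e, 'k) pvec) \<in> PA" using Suc.prems by simp
    define f where "f \<alpha> = rpre (\<lambda>n x. lq (ap \<alpha>) (W (tail Q \<alpha>) n x)) (ar \<alpha>)" for \<alpha>
    have f: "f \<alpha> \<in> hom Q TR RQ (- 1)" if \<alpha>: "\<alpha> \<in> arcs Q" "head Q \<alpha> = i" for \<alpha>
    proof -
      have "length (snd b) < N" if b: "b \<in> paths" "tgt b = tail Q \<alpha>" for b
        using Suc.prems(2)[of "pcat b (ap \<alpha>)"] \<alpha> b by (auto simp: pcat_paths tgt_pcat)
      then have "W (tail Q \<alpha>) \<in> hom Q TR RQ (- 1)" using \<alpha> by (intro Suc.IH) auto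
      then show ?thesis unfolding f_def using \<alpha> W_top by (intro rpre_hom hom_lq) auto
    qed
    have "gcomp (- 1) (lm (ev i)) (rpre u (ev i)) + (\<Sum>\<alpha>\<in>ins i. f \<alpha>) \<in> hom Q TR RQ (- 1)"
      using f ei uh by (intro hom_add[OF pcTR pcR] hom_sum[OF pcTR pcR] lpost_hom rpre_hom) auto
    also have "gcomp (- 1) (lm (ev i)) (rpre u (ev i)) + (\<Sum>\<alpha>\<in>ins i. f \<alpha>) = W i"
    proof (intro ext)
      fix n x
      have s: "(\<Sum>\<alpha>\<in>S. f \<alpha>) n x = (\<Sum>\<alpha>\<in>S. f \<alpha> n x)" for S
        by (induction S rule: infinite_finite_induct) auto
      show "(gcomp (- 1) (lm (ev i)) (rpre u (ev i)) + (\<Sum>\<alpha>\<in>ins i. f \<alpha>)) n x = W i n x"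
      proof (cases "x \<in> el TR n")
        case True
        then show ?thesis
          using W_rec[OF Suc.prems(1) True]
          by (simp add: s lpost_apply[OF rpre_hom[OF uh ei] ei]) (simp add: f_def rpre_apply)
      next
        case False
        have "gcomp (- 1) (lm (ev i)) (rpre u (ev i)) n x = 0" "\<And>\<alpha>. \<alpha> \<in> arcs Q \<Longrightarrow> head Q \<alpha> = i \<Longrightarrow> f \<alpha> n x = 0"
          using h_outside[OF pcTR lpost_hom[OF rpre_hom[OF uh ei] ei] False] h_outside[OF pcTR f False] by auto
        then show ?thesis using False by (simp add: s W_def)
      qed
    qed
    finally show ?case .
  qed
  have W_hom: "W i \<in> hom Q TR RQ (- 1)" if "i \<in> verts Q" for i
    using length_path by (intro W_hom[OF that, of "Suc (card (verts Q))"]) (auto simp: paths_iff le_imp_less_Suc)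
  define V where "V \<alpha> = (\<lambda>n x. lq (ap \<alpha>) (W (tail Q \<alpha>) n x))" for \<alpha>
  have V: "V \<alpha> \<in> Zc" if \<alpha>: "\<alpha> \<in> arcs Q" for \<alpha>
  proof (rule Zc_I)
    show "V \<alpha> \<in> hom Q TR RQ (- 1)"
      unfolding V_def using \<alpha> by (intro hom_lq W_hom W_top) auto
    fix n x assume x: "x \<in> el TR n"
    have "u (n - 1) (lact (pt a) (n - 1) (dif TR n x)) = 0" if "a \<in> paths" for a
      using that x Zc_D[OF u lact_in[OF _ x]] by (simp add: lact_dif[symmetric])
    then have "W (tail Q \<alpha>) (n - 1) (dif TR n x) = 0"
      by (auto simp: W_def intro!: sum.neutral)
    then show "V \<alpha> (n - 1) (dif TR n x) = 0" by (simp add: V_def)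
  qed
  define D where "D i = gcomp (- 1) (lm (ev i)) (rpre u (ev i))" for i
  \<comment> \<open>\<open>W i\<close> is expanded twice: by the first arrows of its values, which
    gives the terms \<alpha> V \<alpha>, and by the last arrows of the paths a in its definition,
    which gives the terms V \<alpha> T(\<alpha>). The difference is the diagonal part of u.\<close>
  have D: "D i = (\<Sum>\<alpha>\<in>outs i. gcomp (- 1) (lm (ar \<alpha>)) (V \<alpha>)) -
      (\<Sum>\<alpha>\<in>ins i. rpre (V \<alpha>) (ar \<alpha>))" (is "_ = ?R") if i: "i \<in> verts Q" for i
  proof (rule hom_eqI[OF pcTR pcR])
    have ei: "(ev i :: ('v, 'e, 'k) pvec) \<in> PA" using i by simp
    show "D i \<in> hom Q TR RQ (- 1)" unfolding D_def by (intro lpost_hom rpre_hom uh ei)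
    show "?R \<in> hom Q TR RQ (- 1)"
      by (intro Zc_hom Zc_diff Zc_sum Zc_lpost Zc_rpre) (auto intro: V)
    fix n x assume x: "x \<in> el TR n"
    have s: "(\<Sum>\<alpha>\<in>S. f \<alpha>) n x = (\<Sum>\<alpha>\<in>S. f \<alpha> n x)" for S and f :: "'e \<Rightarrow> ('v, 'e, 'k) gmap"
      by (induction S rule: infinite_finite_induct) auto
    have "D i n x = W i n x - (\<Sum>\<alpha>\<in>ins i. lq (ap \<alpha>) (W (tail Q \<alpha>) n (lact (ar \<alpha>) n x)))"
      using W_rec[OF i x] by (simp add: D_def lpost_apply[OF rpre_hom[OF uh ei] ei]) (simp add: rpre_apply)
    also have "W i n x = (\<Sum>\<alpha>\<in>outs i. pm (ar \<alpha>) (lq (ap \<alpha>) (W i n x)))"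
      by (rule PA_left_decomp[OF W_PA W_src W_top[OF i]])
    also have "\<dots> = (\<Sum>\<alpha>\<in>outs i. gcomp (- 1) (lm (ar \<alpha>)) (V \<alpha>)) n x"
      unfolding s by (intro sum.cong[OF refl]) (auto simp: lpost_apply Zc_hom V, simp add: V_def)
    finally show "D i n x = ?R n x"
      by (simp add: s rpre_apply) (simp add: V_def)
  qed
  have trD: "tr (D i) = tr (gcomp (- 1) (lm (ev i)) u)" if i: "i \<in> verts Q" for i
  proof -
    have ei: "(ev i :: ('v, 'e, 'k) pvec) \<in> PA" using i by simp
    have "tr (D i) = tr (rpre (rpre u (ev i)) (ev i))"
      unfolding D_def by (rule tr_cyc[symmetric, OF Zc_rpre[OF u ei] ei])
    also have "rpre (rpre u (ev i)) (ev i) = rpre u (ev i)"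
      using ei by (auto simp: fun_eq_iff rpre_apply lact_lact pm_pt pcat_def)
    finally show ?thesis using tr_cyc[OF u ei] by simp
  qed
  have "u = (\<Sum>i\<in>verts Q. gcomp (- 1) (lm (ev i)) u)"
  proof (intro ext)
    fix n x
    have s: "(\<Sum>i\<in>S. f i) n x = (\<Sum>i\<in>S. f i n x)" for S and f :: "'v \<Rightarrow> ('v, 'e, 'k) gmap"
      by (induction S rule: infinite_finite_induct) auto
    have "u n x = pm (punit Q) (u n x)" by (rule pmult_punit_left[OF hom_to_R_in[OF pcTR uh], symmetric])
    also have "\<dots> = (\<Sum>i\<in>verts Q. pm (ev i) (u n x))" by (simp add: punit_def pmult_sum_left)
    finally show "u n x = (\<Sum>i\<in>verts Q. gcomp (- 1) (lm (ev i)) u) n x"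
      using uh by (simp add: s lpost_apply)
  qed
  then have "tr u = (\<Sum>i\<in>verts Q. tr (D i))"
    using tr_sum[of "verts Q" "\<lambda>i. gcomp (- 1) (lm (ev i)) u"] u by (simp add: Zc_lpost trD)
  also have "\<dots> = (\<Sum>i\<in>verts Q. (\<Sum>\<alpha>\<in>outs i. tr (gcomp (- 1) (lm (ar \<alpha>)) (V \<alpha>))) -
      (\<Sum>\<alpha>\<in>ins i. tr (rpre (V \<alpha>) (ar \<alpha>))))"
  proof (rule sum.cong[OF refl])
    fix i assume i: "i \<in> verts Q"
    have 1: "gcomp (- 1) (lm (ar \<alpha>)) (V \<alpha>) \<in> Zc" "rpre (V \<alpha>) (ar \<alpha>) \<in> Zc" if "\<alpha> \<in> arcs Q" for \<alpha>
      using that V by (auto intro: Zc_lpost Zc_rpre)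
    show "tr (D i) = (\<Sum>\<alpha>\<in>outs i. tr (gcomp (- 1) (lm (ar \<alpha>)) (V \<alpha>))) -
        (\<Sum>\<alpha>\<in>ins i. tr (rpre (V \<alpha>) (ar \<alpha>)))"
      unfolding D[OF i] using 1 by (subst tr_diff) (auto intro!: Zc_sum arg_cong2[of _ _ _ _ "(-)"] tr_sum)
  qed
  \<comment> \<open>Every arrow leaves one vertex and enters one, so each V \<alpha> occurs once in
    either sum, and cyclicity equates the two traces.\<close>
  also have "\<dots> = (\<Sum>\<alpha>\<in>arcs Q. tr (gcomp (- 1) (lm (ar \<alpha>)) (V \<alpha>))) - (\<Sum>\<alpha>\<in>arcs Q. tr (rpre (V \<alpha>) (ar \<alpha>)))"
    unfolding sum_subtractf
    by (intro arg_cong2[of _ _ _ _ "(-)"] sum.group) auto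
  also have "\<dots> = 0" using V by (simp add: tr_cyc)
  finally show ?thesis .
qed

lemma chi_linear:
  assumes u: "u \<in> Zc"
  shows "m \<in> el TR 1 \<Longrightarrow> m' \<in> el TR 1 \<Longrightarrow> chi i u (m + m') = chi i u m + chi i u m'"
    and "m \<in> el TR 1 \<Longrightarrow> chi i u (c \<odot> m) = c * chi i u m"
  using h_add[OF pcTR Zc_hom[OF u]] h_scale[OF pcTR Zc_hom[OF u]]
  by (auto simp: chi_def lact_add lact_scale lookup_add lookup_pscale lact_in sum.distrib sum_distrib_left
      intro!: sum.cong)

lemma chi_sum: "u \<in> Zc \<Longrightarrow> (\<And>j. j \<in> J \<Longrightarrow> f j \<in> el TR 1) \<Longrightarrow> chi i u (sum f J) = (\<Sum>j\<in>J. chi i u (f j))"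
  using chi_linear(2)[OF _ el_zero[OF pcTR], of u i 0]
  by (induction J rule: infinite_finite_induct) (auto simp: chi_linear(1) el_sum[OF pcTR])

text \<open>By \<open>tr_eq_zero\<close> the trace vanishes wherever the functionals
  \<open>chi i _ m\<close> do, so it is a combination of them, with m in the finite spanning set
  given by \<open>w\<close>. The coefficients add up to one element of TR for each vertex, and
  cutting this element down by idempotents on both sides does not affect the coefficients that are
  read.\<close>

lemma loop_generators_exist:
  "\<exists>mL. (\<forall>i\<in>verts Q. mL i \<in> el TR 1 \<and> lact (ev i) 1 (mL i) = mL i \<and> act TR 1 (mL i) (ev i) = mL i) \<and>
    (\<forall>u\<in>Zc. tr u = (\<Sum>a\<in>paths. lk (u 1 (lact (pt a) 1 (mL (tgt a)))) a))"
proof -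
  obtain N :: nat and b v where bv: "\<forall>j<N. b j \<in> el TR 1 \<and> v j \<in> hom Q TR RQ (- 1)"
    "\<forall>x\<in>el TR 1. x = (\<Sum>j<N. act TR 1 (b j) (v j 1 x))"
    using dual_basis_cpx[OF pcTR, of 1] by blast
  define w where "w = (\<lambda>(j, p). act TR 1 (b j) (pt p))"
  have w_in: "w (j, p) \<in> el TR 1" if "j < N" "p \<in> paths" for j p
    using that bv by (auto simp: w_def intro!: el_act[OF pcTR])
  let ?J = "verts Q \<times> {..<N} \<times> paths"
  have "\<exists>c. \<forall>u\<in>Zc. tr u = (\<Sum>(i, k)\<in>?J. c (i, k) * chi i u (w k))"
    unfolding case_prod_beta prod.collapse
  proof (rule functional_in_span[where sc = gscale])
    fix u assume u: "u \<in> Zc" and 0: "\<And>j. j \<in> ?J \<Longrightarrow> chi (fst j) u (w (snd j)) = 0"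
    show "tr u = 0"
    proof (rule tr_eq_zero[OF u])
      fix i m assume i: "i \<in> verts Q" and m: "m \<in> el TR 1"
      have "m = (\<Sum>j<N. \<Sum>p\<in>paths. lk (v j 1 m) p \<odot> w (j, p))"
      proof -
        have "act TR 1 (b j) (v j 1 m) = (\<Sum>p\<in>paths. lk (v j 1 m) p \<odot> w (j, p))" if j: "j < N" for j
        proof -
          have "v j 1 m = (\<Sum>p\<in>paths. lk (v j 1 m) p \<odot> pt p)"
            using bv j by (intro PA_eq_sum hom_to_R_in[OF pcTR]) auto
          then have "act TR 1 (b j) (v j 1 m) = act TR 1 (b j) (\<Sum>p\<in>paths. lk (v j 1 m) p \<odot> pt p)" by simp
          also have "\<dots> = (\<Sum>p\<in>paths. lk (v j 1 m) p \<odot> w (j, p))"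
            using bv j by (subst act_sum_right[OF pcTR]) (auto simp: w_def act_scale_right[OF pcTR] path_algebra_scale)
          finally show ?thesis .
        qed
        then show ?thesis using bv(2) m by (metis (no_types, lifting) lessThan_iff sum.cong)
      qed
      then have "chi i u m = chi i u (\<Sum>j<N. \<Sum>p\<in>paths. lk (v j 1 m) p \<odot> w (j, p))"
        by (rule arg_cong)
      also have "\<dots> = (\<Sum>j<N. \<Sum>p\<in>paths. lk (v j 1 m) p * chi i u (w (j, p)))"
      proof -
        have in1: "lk (v j 1 m) p \<odot> w (j, p) \<in> el TR 1" if "j < N" "p \<in> paths" for j p
          using w_in[OF that] by (rule el_scale[OF pcTR])
        have "chi i u (\<Sum>j<N. \<Sum>p\<in>paths. lk (v j 1 m) p \<odot> w (j, p)) =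
            (\<Sum>j<N. chi i u (\<Sum>p\<in>paths. lk (v j 1 m) p \<odot> w (j, p)))"
          using in1 by (intro chi_sum[OF u] el_sum[OF pcTR]) auto
        also have "\<dots> = (\<Sum>j<N. \<Sum>p\<in>paths. lk (v j 1 m) p * chi i u (w (j, p)))"
          using in1 w_in by (intro sum.cong[OF refl]) (subst chi_sum[OF u], auto simp: chi_linear(2)[OF u])
        finally show ?thesis .
      qed
      also have "\<dots> = 0"
      proof -
        have "chi i u (w (j, p)) = 0" if "j < N" "p \<in> paths" for j p
          using 0[of "(i, j, p)"] i that by simp
        then show ?thesis by simp
      qed
      finally show "chi i u m = 0" .
    qed
  qed (auto simp: Zc_add Zc_scale tr_plus tr_gscale chi_def lookup_add sum.distrib,
      auto simp: gscale_def lookup_pscale sum_distrib_left)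
  then obtain c where c: "\<And>u. u \<in> Zc \<Longrightarrow> tr u = (\<Sum>(i, k)\<in>?J. c (i, k) * chi i u (w k))" by blast
  define m where "m i = (\<Sum>k\<in>{..<N} \<times> paths. c (i, k) \<odot> w k)" for i
  define mL where "mL i = lact (ev i) 1 (act TR 1 (m i) (ev i))" for i
  have m: "m i \<in> el TR 1" for i
    unfolding m_def using w_in by (intro el_sum[OF pcTR] el_scale[OF pcTR]) auto
  have mL: "mL i \<in> el TR 1" "lact (ev i) 1 (mL i) = mL i" "act TR 1 (mL i) (ev i) = mL i" if i: "i \<in> verts Q" for i
  proof -
    have ei: "(ev i :: ('v, 'e, 'k) pvec) \<in> PA" "pm (ev i) (ev i) = (ev i :: ('v, 'e, 'k) pvec)" using i by (auto simp: pm_pt pcat_def)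
    show "mL i \<in> el TR 1" "lact (ev i) 1 (mL i) = mL i"
      unfolding mL_def by (auto simp: ei lact_lact intro!: lact_in el_act[OF pcTR] m)
    show "act TR 1 (mL i) (ev i) = mL i"
      unfolding mL_def using ei m by (simp add: lact_act[symmetric] act_assoc[OF pcTR] el_act[OF pcTR])
  qed
  have "tr u = (\<Sum>a\<in>paths. lk (u 1 (lact (pt a) 1 (mL (tgt a)))) a)" if u: "u \<in> Zc" for u
  proof -
    have "tr u = (\<Sum>i\<in>verts Q. \<Sum>k\<in>{..<N} \<times> paths. c (i, k) * chi i u (w k))"
      unfolding c[OF u] by (simp add: sum.cartesian_product)
    also have "\<dots> = (\<Sum>i\<in>verts Q. chi i u (m i))"
    proof (intro sum.cong[OF refl])
      fix i
      have w': "w k \<in> el TR 1" if "k \<in> {..<N} \<times> paths" for k using w_in that by (cases k) auto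
      show "(\<Sum>k\<in>{..<N} \<times> paths. c (i, k) * chi i u (w k)) = chi i u (m i)"
        unfolding m_def
        by (subst chi_sum[OF u]) (auto simp: chi_linear(2)[OF u w'] intro!: el_scale[OF pcTR] w')
    qed
    also have "\<dots> = (\<Sum>i\<in>verts Q. \<Sum>a | a \<in> paths \<and> tgt a = i. lk (u 1 (lact (pt a) 1 (mL (tgt a)))) a)"
    proof (intro sum.cong[OF refl])
      fix i assume i: "i \<in> verts Q"
      have ei: "(ev i :: ('v, 'e, 'k) pvec) \<in> PA" using i by simp
      show "chi i u (m i) = (\<Sum>a | a \<in> paths \<and> tgt a = i. lk (u 1 (lact (pt a) 1 (mL (tgt a)))) a)"
        unfolding chi_def
      proof (intro sum.cong[OF refl])
        fix a assume a: "a \<in> {a \<in> paths. tgt a = i}"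
        have "lact (pt a) 1 (mL i) = lact (pt a) 1 (act TR 1 (m i) (ev i))"
          unfolding mL_def using a ei by (simp add: lact_lact pm_pt)
        also have "\<dots> = act TR 1 (lact (pt a) 1 (m i)) (ev i)"
          using a ei m by (intro lact_act) auto
        finally have "u 1 (lact (pt a) 1 (mL i)) = pm (u 1 (lact (pt a) 1 (m i))) (ev i)"
          using a ei m by (simp add: hom_to_R_act[OF pcTR Zc_hom[OF u]] lact_in)
        then show "lk (u 1 (lact (pt a) 1 (m i))) a = lk (u 1 (lact (pt a) 1 (mL (tgt a)))) a"
          using a by (simp add: lk_idem_right)
      qed
    qed
    also have "\<dots> = (\<Sum>a\<in>paths. lk (u 1 (lact (pt a) 1 (mL (tgt a)))) a)"
      by (rule sum.group) (auto simp: tgt_paths)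
    finally show ?thesis .
  qed
  then show ?thesis using mL by blast
qed

end

section \<open>Lifting along the resolution: the images of the reversed arrows\<close>

locale loop_generators = trace_form Q T tr
  for Q :: "('v, 'e) pre_digraph" and T :: "('v, 'e, 'k::field) dg_functor" and tr +
  fixes mL :: "'v \<Rightarrow> ('v, 'e, 'k) pvec"
  assumes mL_in: "i \<in> verts Q \<Longrightarrow> mL i \<in> el TR 1"
    and mL_left: "i \<in> verts Q \<Longrightarrow> lact (ev i) 1 (mL i) = mL i"
    and mL_right: "i \<in> verts Q \<Longrightarrow> act TR 1 (mL i) (ev i) = mL i"
    and tr_formula: "u \<in> Zc \<Longrightarrow> tr u = (\<Sum>a\<in>paths. lk (u 1 (lact (pt a) 1 (mL (tgt a)))) a)"
begin

text \<open>The paths of the form z a are those that contribute to the trace after multiplication by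
  z. The right side is the augmentation, at z, of the family of values of u at the elements z
  \<open>mL\<close>; this links the trace to the resolution of DA.\<close>

lemma tr_formula_rpre:
  assumes u: "u \<in> Zc" and z: "z \<in> paths"
  shows "tr (rpre u (pt z)) = (\<Sum>a\<in>frm (tgt z). lk (u 1 (lact (pt (pcat z a)) 1 (mL (tgt (pcat z a))))) a)"
proof -
  have "tr (rpre u (pt z)) = (\<Sum>a\<in>paths. lk (u 1 (lact (pm (pt z) (pt a)) 1 (mL (tgt a)))) a)"
    using z by (simp add: tr_formula Zc_rpre u rpre_apply lact_lact)
  also have "\<dots> = (\<Sum>a\<in>frm (tgt z). lk (u 1 (lact (pt (pcat z a)) 1 (mL (tgt (pcat z a))))) a)"
  proof (rule sum.mono_neutral_cong_right)
    show "\<forall>a\<in>paths - frm (tgt z). lk (u 1 (lact (pm (pt z) (pt a)) 1 (mL (tgt a)))) a = 0"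
    proof
      fix a assume "a \<in> paths - frm (tgt z)"
      then have "tgt z \<noteq> fst a" by auto
      then show "lk (u 1 (lact (pm (pt z) (pt a)) 1 (mL (tgt a)))) a = 0"
        using hom_TR_zero[OF Zc_hom[OF u]] by (simp add: pm_pt_0 tens_zero_left[OF pcR])
    qed
  qed (auto simp: pm_pt tgt_pcat)
  finally show ?thesis .
qed

text \<open>The boundary of \<open>mL\<close>, tested against f after multiplication by every path
  z: an element of A \<otimes> DA in the encoding of \<open>res_diff\<close>. The required
  expression for this boundary amounts to a lift of this element that is natural in f.\<close>

definition yf :: "('v, 'e, 'k) gmap \<Rightarrow> 'v \<times> 'e list \<Rightarrow> ('v, 'e, 'k) pvec" where
  "yf f z = f 0 (lact (pt z) 0 (dif TR 1 (mL (tgt z))))"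

lemma dmL_in: "i \<in> verts Q \<Longrightarrow> dif TR 1 (mL i) \<in> el TR 0"
  using d_in[OF pcTR mL_in, of i] by simp

lemma yf_arg: "z \<in> paths \<Longrightarrow> lact (pt z) 0 (dif TR 1 (mL (tgt z))) \<in> el TR 0"
  by (intro lact_in dmL_in) (auto simp: tgt_paths)

lemma yf_PA: "f \<in> hom Q TR RQ 0 \<Longrightarrow> yf f z \<in> PA"
  by (simp add: yf_def hom_to_R_in[OF pcTR])

lemma yf_tgt:
  assumes f: "f \<in> hom Q TR RQ 0" and z: "z \<in> paths" and p: "lk (yf f z) p \<noteq> 0" shows "tgt p = tgt z"
proof -
  let ?v = "tgt z"
  have v: "?v \<in> verts Q" using z by (rule tgt_paths)
  have "dif TR 1 (mL ?v) = act TR 0 (dif TR 1 (mL ?v)) (ev ?v)"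
    using d_act[OF pcTR mL_in[OF v], of "ev ?v"] v by (simp add: mL_right)
  then have "yf f z = f 0 (act TR 0 (lact (pt z) 0 (dif TR 1 (mL ?v))) (ev ?v))"
    using z v dmL_in[OF v] unfolding yf_def by (subst (asm) eq_commute) (simp add: lact_act[symmetric])
  also have "\<dots> = pm (yf f z) (ev ?v)"
    unfolding yf_def using v yf_arg[OF z] by (intro hom_to_R_act[OF pcTR f]) auto
  finally show ?thesis using p by (metis lk_idem_right)
qed

text \<open>The trace of a boundary is zero, also after multiplication by z. Applied to the boundary
  of f this is the vanishing of the augmentation, the condition under which
  \<open>res_diff_lift\<close> applies.\<close>

lemma yf_tot:
  assumes f: "f \<in> hom Q TR RQ 0" and z: "z \<in> paths"
  shows "(\<Sum>a\<in>frm (tgt z). lk (yf f (pcat z a)) a) = 0"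
proof -
  let ?g = "dhom TR RQ 0 f"
  have g: "?g \<in> Zc"
    using dhom_hom[OF pcTR pcR f] dhom_dhom[OF pcTR pcR f] by (simp add: Zc_def)
  have "rpre ?g (pt z) = dhom TR RQ 0 (rpre f (pt z))"
  proof (rule hom_eqI[OF pcTR pcR])
    show "rpre ?g (pt z) \<in> hom Q TR RQ (- 1)" using z by (intro rpre_hom Zc_hom[OF g]) simp
    show "dhom TR RQ 0 (rpre f (pt z)) \<in> hom Q TR RQ (- 1)"
      using dhom_hom[OF pcTR pcR rpre_hom[OF f, of "pt z"]] z by simp
    fix n x assume "x \<in> el TR n"
    then show "rpre ?g (pt z) n x = dhom TR RQ 0 (rpre f (pt z)) n x"
      using z by (simp add: rpre_apply dhom_RQ lact_dif)
  qed
  then have "tr (rpre ?g (pt z)) = 0" using tr_boundary[OF rpre_hom[OF f, of "pt z"]] z by simp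
  moreover have "?g 1 (lact (pt c) 1 (mL (tgt c))) = - yf f c" if "c \<in> paths" for c
    using that by (simp add: dhom_RQ yf_def lact_dif mL_in tgt_paths)
  ultimately have "0 = (\<Sum>a\<in>frm (tgt z). lk (- yf f (pcat z a)) a)"
    using z by (subst (asm) tr_formula_rpre[OF g z]) (auto simp: pcat_paths)
  then show ?thesis by (simp add: sum_negf)
qed

definition Yres :: "('v, 'e, 'k) gmap \<Rightarrow> 'v \<times> 'e list \<Rightarrow> 'e \<Rightarrow> ('v, 'e, 'k) pvec" where
  "Yres f = res_lift (yf f)"

lemma Y_PA: "Yres f z \<beta> \<in> PA"
  and Y_right: "pm (Yres f z \<beta>) (ev (tail Q \<beta>)) = Yres f z \<beta>"
  unfolding Yres_def using lk_res_lift[of "yf f" z \<beta>] by (simp_all add: PA_ev_right res_lift_PA)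

lemma res_diff_Y: "f \<in> hom Q TR RQ 0 \<Longrightarrow> z \<in> paths \<Longrightarrow> res_diff (Yres f) z = yf f z"
  unfolding Yres_def by (intro res_diff_lift yf_PA yf_tgt yf_tot)

text \<open>The lift at any path is the lift at a trivial path for a translated f. This is why one
  element of TR for each arrow \<beta> is enough.\<close>

lemma Y_rpre: "z \<in> paths \<Longrightarrow> z' \<in> paths \<Longrightarrow> tgt z = fst z' \<Longrightarrow> Yres (rpre f (pt z)) z' \<beta> = Yres f (pcat z z') \<beta>"
proof -
  assume z: "z \<in> paths" "z' \<in> paths" "tgt z = fst z'"
  have "yf (rpre f (pt z)) (pcat z' a) = yf f (pcat (pcat z z') a)" if "a \<in> paths" "fst a = tgt z'" for a
    using z that by (simp add: yf_def rpre_apply lact_lact pm_pt pcat_paths pcat_assoc tgt_pcat)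
  then show "Yres (rpre f (pt z)) z' \<beta> = Yres f (pcat z z') \<beta>"
    using z by (auto simp: Yres_def res_lift_def res_tot_def tgt_pcat intro!: arg_cong[where f = "rq _"] sum.cong)
qed

text \<open>Both sides have the same image under the injective \<open>res_diff\<close>, because f =
  \<Sum> f(u j) v j. In this way uniqueness supplies the left linearity of the lift, which its
  formula with right quotients does not show.\<close>

lemma Y_expand:
  assumes f: "f \<in> hom Q TR RQ 0"
    and uv: "\<And>j. j < N \<Longrightarrow> u j \<in> el TR 0 \<and> v j \<in> hom Q TR RQ 0"
    "\<And>x. x \<in> el TR 0 \<Longrightarrow> x = (\<Sum>j<N::nat. act TR 0 (u j) (v j 0 x))"
    and z: "z \<in> paths" "\<beta> \<in> arcs Q" "head Q \<beta> = tgt z"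
  shows "Yres f z \<beta> = (\<Sum>j<N. pm (f 0 (u j)) (Yres (v j) z \<beta>))"
proof -
  define E where "E z \<beta> = Yres f z \<beta> - (\<Sum>j<N. pm (f 0 (u j)) (Yres (v j) z \<beta>))" for z \<beta>
  have fu: "f 0 (u j) \<in> PA" for j by (rule hom_to_R_in[OF pcTR f])
  have EPA: "E z \<beta> \<in> PA" for z \<beta>
    unfolding E_def by (intro path_algebra_diff Y_PA path_algebra_sum pmult_closed fu)
  have Er: "pm (E z \<beta>) (ev (tail Q \<beta>)) = E z \<beta>" for z \<beta>
    by (simp add: E_def pmult_diff_left pmult_sum_left pmult_assoc Y_right)
  have "E z \<beta> = 0"
  proof (rule res_diff_inj[OF EPA _ _ z])
    show "tgt p = tail Q \<beta>" if "lk (E z \<beta>) p \<noteq> 0" for z \<beta> p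
      using that Er[of z \<beta>] PA_ev_right[OF EPA] by blast
    fix z' assume z': "z' \<in> paths"
    have "yf f z' = f 0 (\<Sum>j<N. act TR 0 (u j) (v j 0 (lact (pt z') 0 (dif TR 1 (mL (tgt z'))))))"
      unfolding yf_def using uv(2)[OF yf_arg[OF z']] by simp
    also have "\<dots> = (\<Sum>j<N. pm (f 0 (u j)) (yf (v j) z'))"
      using uv(1)[THEN conjunct1] hom_to_R_in[OF pcTR uv(1)[THEN conjunct2]]
      by (subst h_sum[OF pcTR f]) (auto simp: yf_def hom_to_R_act[OF pcTR f] intro!: el_act[OF pcTR] sum.cong)
    finally have yfe: "yf f z' = (\<Sum>j<N. pm (f 0 (u j)) (yf (v j) z'))" .
    have "res_diff E z' = res_diff (Yres f) z' - (\<Sum>j<N. pm (f 0 (u j)) (res_diff (Yres (v j)) z'))"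
      unfolding res_diff_def E_def sum_subtractf pmult_diff_left pmult_sum_left pmult_diff_right pmult_sum_right
      by (simp add: pmult_assoc sum.swap[of _ "{..<N}" "outs (tgt z')"]
        sum.swap[of _ "{..<N}" "ins (tgt z')"])
    then show "res_diff E z' = 0"
      using z' uv(1) f by (simp add: res_diff_Y yfe)
  qed
  then show ?thesis by (simp add: E_def)
qed

text \<open>A linear functional on the dual of a finitely generated projective module is evaluation
  at an element, and a dual basis writes that element down.\<close>

lemma rev_generators_exist:
  "\<exists>mR. \<forall>\<beta>\<in>arcs Q. mR \<beta> \<in> el TR 0 \<and> act TR 0 (mR \<beta>) (ev (tail Q \<beta>)) = mR \<beta> \<and>
    (\<forall>f\<in>hom Q TR RQ 0. f 0 (mR \<beta>) = Yres f (head Q \<beta>, []) \<beta>)"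
proof -
  obtain N :: nat and u v where uv': "\<forall>j<N. u j \<in> el TR 0 \<and> v j \<in> hom Q TR RQ (- 0)"
    "\<forall>x\<in>el TR 0. x = (\<Sum>j<N. act TR 0 (u j) (v j 0 x))"
    using dual_basis_cpx[OF pcTR, of 0] by blast
  then have uv: "\<And>j. j < N \<Longrightarrow> u j \<in> el TR 0 \<and> v j \<in> hom Q TR RQ 0"
    "\<And>x. x \<in> el TR 0 \<Longrightarrow> x = (\<Sum>j<N. act TR 0 (u j) (v j 0 x))"
    by simp_all
  define mR where "mR \<beta> = (\<Sum>j<N. act TR 0 (u j) (Yres (v j) (head Q \<beta>, []) \<beta>))" for \<beta>
  have "mR \<beta> \<in> el TR 0 \<and> act TR 0 (mR \<beta>) (ev (tail Q \<beta>)) = mR \<beta> \<and>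
    (\<forall>f\<in>hom Q TR RQ 0. f 0 (mR \<beta>) = Yres f (head Q \<beta>, []) \<beta>)" if \<beta>: "\<beta> \<in> arcs Q" for \<beta>
  proof (intro conjI ballI)
    show "mR \<beta> \<in> el TR 0" unfolding mR_def using uv(1) by (auto intro!: el_sum[OF pcTR] el_act[OF pcTR] Y_PA)
    show "act TR 0 (mR \<beta>) (ev (tail Q \<beta>)) = mR \<beta>"
      unfolding mR_def using uv(1) \<beta>
      by (subst act_sum_left[OF pcTR]) (auto simp: act_assoc[OF pcTR] Y_PA Y_right el_act[OF pcTR])
    fix f assume f: "f \<in> hom Q TR RQ 0"
    have "f 0 (mR \<beta>) = (\<Sum>j<N. pm (f 0 (u j)) (Yres (v j) (head Q \<beta>, []) \<beta>))"
      unfolding mR_def using uv(1)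
      by (subst h_sum[OF pcTR f]) (auto simp: hom_to_R_act[OF pcTR f] Y_PA intro!: el_act[OF pcTR])
    also have "\<dots> = Yres f (head Q \<beta>, []) \<beta>"
      using \<beta> by (intro Y_expand[OF f uv, symmetric]) auto
    finally show "f 0 (mR \<beta>) = Yres f (head Q \<beta>, []) \<beta>" .
  qed
  then show ?thesis by blast
qed

end

locale generators = loop_generators Q T tr mL
  for Q :: "('v, 'e) pre_digraph" and T :: "('v, 'e, 'k::field) dg_functor" and tr mL +
  fixes mR :: "'e \<Rightarrow> ('v, 'e, 'k) pvec"
  assumes mR_in: "\<beta> \<in> arcs Q \<Longrightarrow> mR \<beta> \<in> el TR 0"
    and mR_right: "\<beta> \<in> arcs Q \<Longrightarrow> act TR 0 (mR \<beta>) (ev (tail Q \<beta>)) = mR \<beta>"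
    and mR_Y: "\<beta> \<in> arcs Q \<Longrightarrow> f \<in> hom Q TR RQ 0 \<Longrightarrow> f 0 (mR \<beta>) = Yres f (head Q \<beta>, []) \<beta>"
begin

lemma mR_Y_lact:
  assumes "\<beta> \<in> arcs Q" "f \<in> hom Q TR RQ 0" "z \<in> paths" "tgt z = head Q \<beta>"
  shows "f 0 (lact (pt z) 0 (mR \<beta>)) = Yres f z \<beta>"
  using mR_Y[OF assms(1) rpre_hom[OF assms(2), of "pt z"]] Y_rpre[of z "(head Q \<beta>, [])" f \<beta>] assms
  by (simp add: rpre_apply)

lemma mR_left:
  assumes \<beta>: "\<beta> \<in> arcs Q" shows "lact (ev (head Q \<beta>)) 0 (mR \<beta>) = mR \<beta>"
proof (rule TR_separated)
  show "lact (ev (head Q \<beta>)) 0 (mR \<beta>) \<in> el TR 0" "mR \<beta> \<in> el TR 0"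
    using \<beta> by (auto intro!: lact_in mR_in)
  fix f :: "('v, 'e, 'k) gmap" assume f: "f \<in> hom Q TR RQ (- 0)"
  then show "f 0 (lact (ev (head Q \<beta>)) 0 (mR \<beta>)) = f 0 (mR \<beta>)"
    using \<beta> mR_Y_lact[OF \<beta>, of f "(head Q \<beta>, [])"] mR_Y[OF \<beta>, of f] by simp
qed

text \<open>Tested against f, this is \<open>res_diff_Y\<close> at the trivial path:
  \<open>mR\<close> was constructed to solve this equation.\<close>

lemma dif_mL:
  assumes i: "i \<in> verts Q"
  shows "dif TR 1 (mL i) = (\<Sum>\<alpha>\<in>outs i. lact (ar \<alpha>) 0 (mR \<alpha>)) -
    (\<Sum>\<beta>\<in>ins i. act TR 0 (mR \<beta>) (ar \<beta>))" (is "_ = ?A - ?B")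
proof (rule TR_separated)
  show "dif TR 1 (mL i) \<in> el TR 0" by (rule dmL_in[OF i])
  have A: "?A \<in> el TR 0" and B: "?B \<in> el TR 0"
    by (auto intro!: el_sum[OF pcTR] lact_in el_act[OF pcTR] mR_in)
  show "?A - ?B \<in> el TR 0" by (rule el_diff[OF pcTR A B])
  fix f :: "('v, 'e, 'k) gmap" assume "f \<in> hom Q TR RQ (- 0)"
  then have f: "f \<in> hom Q TR RQ 0" by simp
  have "f 0 (dif TR 1 (mL i)) = yf f (i, [])"
    using i lact_dif[OF _ mL_in[OF i], of "ev i"] by (simp add: yf_def mL_left)
  also have "\<dots> = res_diff (Yres f) (i, [])"
    using i by (simp add: res_diff_Y[OF f])
  also have "\<dots> = (\<Sum>\<alpha>\<in>outs i. f 0 (lact (ar \<alpha>) 0 (mR \<alpha>))) -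
      (\<Sum>\<beta>\<in>ins i. f 0 (act TR 0 (mR \<beta>) (ar \<beta>)))"
    unfolding res_diff_def tgt_Nil
  proof (intro arg_cong2[of _ _ _ _ "(-)"] sum.cong[OF refl])
    fix \<alpha> assume "\<alpha> \<in> outs i"
    then show "Yres f (pcat (i, []) (ap \<alpha>)) \<alpha> = f 0 (lact (ar \<alpha>) 0 (mR \<alpha>))"
      using mR_Y_lact[OF _ f, of \<alpha> "ap \<alpha>"] by (auto simp: pcat_def)
  next
    fix \<beta> assume "\<beta> \<in> ins i"
    then show "pm (Yres f (i, []) \<beta>) (ar \<beta>) = f 0 (act TR 0 (mR \<beta>) (ar \<beta>))"
      using mR_Y[OF _ f, of \<beta>] hom_to_R_act[OF pcTR f mR_in, of \<beta> "ar \<beta>"] by auto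
  qed
  also have "\<dots> = f 0 (?A - ?B)"
    by (simp only: h_diff[OF pcTR f A B], subst (1 2) h_sum[OF pcTR f])
      (auto intro!: lact_in el_act[OF pcTR] mR_in)
  finally show "f 0 (dif TR 1 (mL i)) = f 0 (?A - ?B)" .
qed

text \<open>Testing against f of degree 1 means lifting the family of the boundary of f. That family
  applies f to the double boundary of z \<open>mL\<close>, so it is zero.\<close>

lemma dif_mR:
  assumes \<beta>: "\<beta> \<in> arcs Q" shows "dif TR 0 (mR \<beta>) = 0"
proof (rule TR_separated)
  show "dif TR 0 (mR \<beta>) \<in> el TR (- 1)" using d_in[OF pcTR mR_in[OF \<beta>]] by simp
  show "0 \<in> el TR (- 1)" by (rule el_zero[OF pcTR])
  fix f :: "('v, 'e, 'k) gmap" assume "f \<in> hom Q TR RQ (- (- 1))"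
  then have f: "f \<in> hom Q TR RQ 1" by simp
  let ?g = "dhom TR RQ 1 f"
  have g: "?g \<in> hom Q TR RQ 0" using dhom_hom[OF pcTR pcR f] by simp
  have g0: "?g 0 x = f (- 1) (dif TR 0 x)" for x by (simp add: dhom_RQ)
  have "yf ?g z = 0" if z: "z \<in> paths" for z
  proof -
    have "lact (pt z) 0 (dif TR 1 (mL (tgt z))) = dif TR 1 (lact (pt z) 1 (mL (tgt z)))"
      using z lact_dif[OF _ mL_in, of "pt z" "tgt z"] by (simp add: tgt_paths)
    then show ?thesis
      using z d_d[OF pcTR lact_in[OF _ mL_in, of "pt z" "tgt z"]]
      by (simp add: yf_def g0 hom_TR_zero[OF f] tgt_paths)
  qed
  then have "Yres ?g (head Q \<beta>, []) \<beta> = 0"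
    using \<beta> by (auto simp: Yres_def res_lift_def res_tot_def pcat_Nil_left intro!: sum.neutral)
  then show "f (- 1) (dif TR 0 (mR \<beta>)) = f (- 1) 0"
    using mR_Y[OF \<beta> g] by (simp add: g0 hom_TR_zero[OF f])
qed

end

declare split_paired_All [simp del] split_paired_Ex [simp del]

section \<open>Mapping cones\<close>

definition cone_el :: "(int \<Rightarrow> 'a set) \<Rightarrow> (int \<Rightarrow> 'b set) \<Rightarrow> int \<Rightarrow> ('a \<times> 'b) set" where
  "cone_el N N' m = N m \<times> N' (m + 1)"

text \<open>N keeps its degree in this cone and N' is shifted; the minus sign in front of d' makes
  the square vanish.\<close>

definition cone_d :: "(int \<Rightarrow> 'a \<Rightarrow> 'a) \<Rightarrow> (int \<Rightarrow> 'b::ab_group_add \<Rightarrow> 'b) \<Rightarrow> (int \<Rightarrow> 'a \<Rightarrow> 'b) \<Rightarrow> int \<Rightarrow> 'a \<times> 'b \<Rightarrow> 'a \<times> 'b" where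
  "cone_d d d' f m c = (d m (fst c), f m (fst c) - d' (m + 1) (snd c))"

locale chain_map = N: ab_complex N d + N': ab_complex N' d'
  for N :: "int \<Rightarrow> 'a::ab_group_add set" and d and N' :: "int \<Rightarrow> 'b::ab_group_add set" and d' +
  fixes f :: "int \<Rightarrow> 'a \<Rightarrow> 'b"
  assumes f_in: "x \<in> N m \<Longrightarrow> f m x \<in> N' m"
    and f_diff: "x \<in> N m \<Longrightarrow> y \<in> N m \<Longrightarrow> f m (x - y) = f m x - f m y"
    and f_d: "x \<in> N m \<Longrightarrow> d' m (f m x) = f (m - 1) (d m x)"
begin

lemma f_zero: "f m 0 = 0"
  using f_diff[OF N.zero N.zero, of m] by simp

lemma f_uminus: "x \<in> N m \<Longrightarrow> f m (- x) = - f m x"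
  using f_diff[OF N.zero, of x m] by (simp add: f_zero)

lemma f_add: "x \<in> N m \<Longrightarrow> y \<in> N m \<Longrightarrow> f m (x + y) = f m x + f m y"
  using f_diff[of x m "- y"] by (simp add: N.uminus f_uminus)

lemma cone_complex: "ab_complex (cone_el N N') (cone_d d d' f)"
proof
  fix c m assume c: "c \<in> cone_el N N' m"
  show "cone_d d d' f m c \<in> cone_el N N' (m - 1)"
    using c N.D_in[of "fst c" m] N'.D_in[of "snd c" "m + 1"] f_in[of "fst c" m]
    by (auto simp: cone_el_def cone_d_def N'.diff)
  show "cone_d d d' f (m - 1) (cone_d d d' f m c) = 0"
    using c N'.D_in[of "snd c" "m + 1"] N'.D_D[of "snd c" "m + 1"] f_in[of "fst c" m]
    by (auto simp: cone_el_def cone_d_def N.D_D N'.D_diff f_d zero_prod_def)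
qed (auto simp: cone_el_def cone_d_def N.zero N'.zero N.diff N'.diff N.D_diff N'.D_diff f_diff zero_prod_def)

text \<open>With x = 0 this is surjectivity of f in homology; ignoring the condition on y' it is
  injectivity.\<close>

lemma cone_exact_iff:
  "exact_cpx (cone_el N N') (cone_d d d' f) \<longleftrightarrow>
    (\<forall>m. \<forall>x\<in>N m. \<forall>y\<in>N' (m + 1). d m x = 0 \<longrightarrow> f m x = d' (m + 1) y \<longrightarrow>
      (\<exists>x'\<in>N (m + 1). \<exists>y'\<in>N' (m + 2). d (m + 1) x' = x \<and> f (m + 1) x' - d' (m + 2) y' = y))"
  by (auto simp: exact_cpx_def cone_el_def cone_d_def zero_prod_def add.assoc)

end

text \<open>A composite of quasi-isomorphisms is one: a cycle of the composite cone is first bounded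
  in the cone of g and the element found there is then lifted through f.\<close>

lemma cone_exact_comp:
  assumes f: "chain_map N d N' d' f" and g: "chain_map N' d' N'' d'' g"
    and ef: "exact_cpx (cone_el N N') (cone_d d d' f)" and eg: "exact_cpx (cone_el N' N'') (cone_d d' d'' g)"
    and h: "\<And>m x. x \<in> N m \<Longrightarrow> h m x = g m (f m x)"
  shows "exact_cpx (cone_el N N'') (cone_d d d'' h)"
proof -
  interpret f: chain_map N d N' d' f by (rule f)
  interpret g: chain_map N' d' N'' d'' g by (rule g)
  show ?thesis unfolding exact_cpx_def
  proof (intro allI ballI impI)
    fix m c assume c: "c \<in> cone_el N N'' m" "cone_d d d'' h m c = 0"
    obtain x y where xy [simp]: "c = (x, y)" by (cases c)
    have x: "x \<in> N m" "d m x = 0" and y: "y \<in> N'' (m + 1)" "g m (f m x) = d'' (m + 1) y"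
      using c by (auto simp: cone_el_def cone_d_def zero_prod_def h)
    have fm: "f m x \<in> N' m" "d' m (f m x) = 0" using x f.f_in f.f_d f.f_zero by auto
    with y obtain a b where a: "a \<in> N' (m + 1)" "d' (m + 1) a = f m x" and b: "b \<in> N'' (m + 2)" "g (m + 1) a - d'' (m + 2) b = y"
      using eg[unfolded g.cone_exact_iff] by blast
    obtain x' a' where x': "x' \<in> N (m + 1)" "d (m + 1) x' = x" and a': "a' \<in> N' (m + 2)" "f (m + 1) x' - d' (m + 2) a' = a"
      using ef[unfolded f.cone_exact_iff] x a by metis
    have "g (m + 1) a = h (m + 1) x' - d'' (m + 2) (g (m + 2) a')"
    proof -
      have i: "m + 2 - 1 = m + 1" by simp
      have "g (m + 1) (f (m + 1) x' - d' (m + 2) a') = g (m + 1) (f (m + 1) x') - g (m + 1) (d' (m + 2) a')"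
        using f.f_in[OF x'(1)] f.N'.D_in[OF a'(1)] unfolding i by (rule g.f_diff)
      then show ?thesis using a'(2) g.f_d[OF a'(1)] h[OF x'(1)] unfolding i by simp
    qed
    then have "h (m + 1) x' - d'' (m + 2) (g (m + 2) a' + b) = y"
      using b a' g.f_in[OF a'(1)] by (simp add: g.N'.D_add diff_diff_eq)
    then show "\<exists>y\<in>cone_el N N'' (m + 1). cone_d d d'' h (m + 1) y = c"
      using x' b a' g.f_in[OF a'(1)]
      by (intro bexI[of _ "(x', g (m + 2) a' + b)"]) (auto simp: cone_el_def cone_d_def g.N'.add add.assoc)
  qed
qed

section \<open>Tensor products with the weight one part\<close>

context quiver
begin

abbreviation GQ :: "('v, ('v, 'e) garc) pre_digraph" where "GQ \<equiv> ginzburg_quiver Q"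

abbreviation srcW :: "('v, 'e) garc \<Rightarrow> 'v" where "srcW \<equiv> tail GQ"
abbreviation tgtW :: "('v, 'e) garc \<Rightarrow> 'v" where "tgtW \<equiv> head GQ"

lemma GQ_simps [simp]:
  "srcW (Arr \<alpha>) = tail Q \<alpha>" "srcW (Rev \<alpha>) = head Q \<alpha>" "srcW (Loop i) = i"
  "tgtW (Arr \<alpha>) = head Q \<alpha>" "tgtW (Rev \<alpha>) = tail Q \<alpha>" "tgtW (Loop i) = i"
  "verts GQ = verts Q" "arcs GQ = Arr ` arcs Q \<union> Rev ` arcs Q \<union> Loop ` verts Q"
  by (auto simp: ginzburg_quiver_def)

definition WA :: "('v, 'e) garc set" where
  "WA = Rev ` arcs Q \<union> Loop ` verts Q"

text \<open>A path of weight one consists of arrows of Q, one arrow w of weight one and a path p of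
  Q. The initial arrows are absorbed into N, so the pairs (w, p) index the summands of N \<otimes>
  \<Theta>.\<close>

definition Om :: "('v, 'e) wpath set" where
  "Om = {(w, p). w \<in> WA \<and> p \<in> paths \<and> fst p = tgtW w}"

lemma Rev_Om [simp]: "(Rev \<alpha>, p) \<in> Om \<longleftrightarrow> \<alpha> \<in> arcs Q \<and> p \<in> paths \<and> fst p = tail Q \<alpha>"
  and Loop_Om [simp]: "(Loop i, p) \<in> Om \<longleftrightarrow> i \<in> verts Q \<and> p \<in> paths \<and> fst p = i"
  and Arr_Om [simp]: "(Arr \<alpha>, p) \<notin> Om"
  by (auto simp: Om_def WA_def)

lemma finite_Om [simp]: "finite Om"
  by (rule finite_subset[of _ "WA \<times> paths"]) (auto simp: Om_def WA_def)

lemma Om_srcW: "k \<in> Om \<Longrightarrow> srcW (fst k) \<in> verts Q"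
  by (auto simp: Om_def WA_def)

lemma Om_srcW' [simp]: "(w, p) \<in> Om \<Longrightarrow> srcW w \<in> verts Q"
  using Om_srcW[of "(w, p)"] by simp

lemma sum_Om: "(\<Sum>k\<in>Om. F k) =
    (\<Sum>\<alpha>\<in>arcs Q. \<Sum>p\<in>frm (tail Q \<alpha>). F (Rev \<alpha>, p)) +
    (\<Sum>i\<in>verts Q. \<Sum>p\<in>frm i. F (Loop i, p))"
proof -
  let ?A = "SIGMA \<alpha>:arcs Q. frm (tail Q \<alpha>)" and ?B = "SIGMA i:verts Q. frm i"
  have Om: "Om = (\<lambda>(\<alpha>, p). (Rev \<alpha>, p)) ` ?A \<union> (\<lambda>(i, p). (Loop i, p)) ` ?B"
    by (auto simp: Om_def WA_def image_iff)
  have "finite ?A" "finite ?B" by (auto intro!: finite_SigmaI)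
  then have "(\<Sum>k\<in>Om. F k) = sum F ((\<lambda>(\<alpha>, p). (Rev \<alpha>, p)) ` ?A) + sum F ((\<lambda>(i, p). (Loop i, p)) ` ?B)"
    unfolding Om by (intro sum.union_disjoint) auto
  also have "sum F ((\<lambda>(\<alpha>, p). (Rev \<alpha>, p)) ` ?A) = (\<Sum>(\<alpha>, p)\<in>?A. F (Rev \<alpha>, p))"
    by (subst sum.reindex) (auto simp: inj_on_def case_prod_beta)
  also have "sum F ((\<lambda>(i, p). (Loop i, p)) ` ?B) = (\<Sum>(i, p)\<in>?B. F (Loop i, p))"
    by (subst sum.reindex) (auto simp: inj_on_def case_prod_beta)
  finally show ?thesis by (simp add: sum.Sigma)
qed

abbreviation kd :: "('v, 'e) wpath \<Rightarrow> int" where "kd k \<equiv> garc_degree (fst k)"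

lemma Om_cases:
  assumes "k \<in> Om"
  obtains (Rev) \<alpha> p where "k = (Rev \<alpha>, p)" "\<alpha> \<in> arcs Q" "p \<in> paths" "fst p = tail Q \<alpha>"
  | (Loop) i p where "k = (Loop i, p)" "i \<in> verts Q" "p \<in> paths" "fst p = i"
  using assms by (auto simp: Om_def WA_def)

end

text \<open>
  For a right dg module \<open>N\<close> the complex \<open>N \<otimes>\<^sub>A \<Theta>\<close>, \<open>\<Theta>\<close> the weight one part of the
  Ginzburg algebra, is represented by the families \<open>x (w, p) \<in> N e\<^sub>s\<^sub>(\<^sub>w\<^sub>)\<close>, standing for
  the sum of the \<open>x (w, p) w p\<close>.
\<close>

locale right_dg = quiver Q + N: ab_complex N d
  for Q :: "('v, 'e) pre_digraph" and N :: "int \<Rightarrow> 'a::ab_group_add set" and d +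
  fixes r :: "int \<Rightarrow> 'a \<Rightarrow> ('v, 'e, 'k::field) pvec \<Rightarrow> 'a"
  assumes r_in: "x \<in> N m \<Longrightarrow> a \<in> path_algebra Q \<Longrightarrow> r m x a \<in> N m"
    and r_diff: "x \<in> N m \<Longrightarrow> y \<in> N m \<Longrightarrow> a \<in> path_algebra Q \<Longrightarrow> r m (x - y) a = r m x a - r m y a"
    and r_assoc: "x \<in> N m \<Longrightarrow> a \<in> path_algebra Q \<Longrightarrow> b \<in> path_algebra Q \<Longrightarrow> r m (r m x a) b = r m x (pmult Q a b)"
    and d_r: "x \<in> N m \<Longrightarrow> a \<in> path_algebra Q \<Longrightarrow> d m (r m x a) = r (m - 1) (d m x) a"
begin

lemma r_zero: "a \<in> PA \<Longrightarrow> r m 0 a = 0"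
  using r_diff[OF N.zero N.zero, of a m] by simp

lemma r_uminus: "x \<in> N m \<Longrightarrow> a \<in> PA \<Longrightarrow> r m (- x) a = - r m x a"
  using r_diff[OF N.zero, of x m a] by (simp add: r_zero)

lemma koszul_in: "x \<in> N m \<Longrightarrow> koszul n x \<in> N m"
  by (simp add: koszul_def N.uminus)

lemma d_koszul: "x \<in> N m \<Longrightarrow> d m (koszul n x) = koszul n (d m x)"
  by (simp add: koszul_def N.D_uminus)

definition Ecar :: "int \<Rightarrow> (('v, 'e) wpath \<Rightarrow> 'a) set" where
  "Ecar m = {x. \<forall>k. (k \<in> Om \<longrightarrow> x k \<in> N (m - kd k) \<and> r (m - kd k) (x k) (ev (srcW (fst k))) = x k) \<and>
    (k \<notin> Om \<longrightarrow> x k = 0)}"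

text \<open>The part of the differential that hits a loop: x t_i p yields x \<alpha> \<alpha>* p for
  the arrows \<alpha> leaving i, and - x \<beta>* \<beta> p for the arrows \<beta> entering i. Seen
  from the receiving pair of \<alpha>* and p, the second kind arrives from the loop at the head of
  \<alpha>, provided that p begins with \<alpha>. The sign belongs to moving d past x, which has
  degree m - 1 at a loop.\<close>

definition Etw :: "int \<Rightarrow> (('v, 'e) wpath \<Rightarrow> 'a) \<Rightarrow> ('v, 'e) wpath \<Rightarrow> 'a" where
  "Etw m x k = (case k of
      (Rev \<alpha>, p) \<Rightarrow> koszul (m - 1) (r (m - 1) (x (Loop (tail Q \<alpha>), p)) (ar \<alpha>) -
        (if snd p \<noteq> [] \<and> hd (snd p) = \<alpha> then x (Loop (head Q \<alpha>), (head Q \<alpha>, tl (snd p))) else 0))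
    | _ \<Rightarrow> 0)"

definition Ed :: "int \<Rightarrow> (('v, 'e) wpath \<Rightarrow> 'a) \<Rightarrow> ('v, 'e) wpath \<Rightarrow> 'a" where
  "Ed m x = (\<lambda>k. if k \<in> Om then d (m - kd k) (x k) + Etw m x k else 0)"

lemma Ecar_in: "x \<in> Ecar m \<Longrightarrow> k \<in> Om \<Longrightarrow> x k \<in> N (m - kd k)"
  and Ecar_ev: "x \<in> Ecar m \<Longrightarrow> k \<in> Om \<Longrightarrow> r (m - kd k) (x k) (ev (srcW (fst k))) = x k"
  and Ecar_out: "x \<in> Ecar m \<Longrightarrow> k \<notin> Om \<Longrightarrow> x k = 0"
  by (auto simp: Ecar_def)

lemma Ecar_Loop: "x \<in> Ecar m \<Longrightarrow> (Loop i, p) \<in> Om \<Longrightarrow> x (Loop i, p) \<in> N (m - 1)"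
  "x \<in> Ecar m \<Longrightarrow> (Loop i, p) \<in> Om \<Longrightarrow> r (m - 1) (x (Loop i, p)) (ev i) = x (Loop i, p)"
  using Ecar_in[of x m "(Loop i, p)"] Ecar_ev[of x m "(Loop i, p)"] by auto

lemma Om_shift:
  assumes "(Rev \<alpha>, p) \<in> Om"
  shows "(Loop (tail Q \<alpha>), p) \<in> Om"
    and "snd p \<noteq> [] \<and> hd (snd p) = \<alpha> \<Longrightarrow> (Loop (head Q \<alpha>), (head Q \<alpha>, tl (snd p))) \<in> Om"
proof -
  show "(Loop (tail Q \<alpha>), p) \<in> Om" using assms by simp
  assume "snd p \<noteq> [] \<and> hd (snd p) = \<alpha>"
  then obtain u q where "p = (u, \<alpha> # q)" by (cases p) (auto simp: neq_Nil_conv)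
  then show "(Loop (head Q \<alpha>), (head Q \<alpha>, tl (snd p))) \<in> Om" using assms by simp
qed

lemma ar_ev: "\<alpha> \<in> arcs Q \<Longrightarrow> pm (ar \<alpha>) (ev (head Q \<alpha>)) = (ar \<alpha> :: ('v, 'e, 'k) pvec)"
  by (simp add: pm_pt)

lemma Etw_in:
  assumes x: "x \<in> Ecar m" and k: "k \<in> Om"
  shows "Etw m x k \<in> N (m - 1 - kd k)" "r (m - 1 - kd k) (Etw m x k) (ev (srcW (fst k))) = Etw m x k"
proof -
  have "Etw m x k \<in> N (m - 1 - kd k) \<and> r (m - 1 - kd k) (Etw m x k) (ev (srcW (fst k))) = Etw m x k"
    using k
  proof (cases rule: Om_cases)
    case (Rev \<alpha> p)
    have Om: "(Rev \<alpha>, p) \<in> Om" using k Rev by simp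
    let ?y = "r (m - 1) (x (Loop (tail Q \<alpha>), p)) (ar \<alpha>)"
      and ?z = "if snd p \<noteq> [] \<and> hd (snd p) = \<alpha> then x (Loop (head Q \<alpha>), (head Q \<alpha>, tl (snd p))) else 0"
    have hd: "ev (head Q \<alpha>) \<in> PA" "ar \<alpha> \<in> PA" using Rev by auto
    have "?y \<in> N (m - 1)" "r (m - 1) ?y (ev (head Q \<alpha>)) = ?y"
      using Ecar_Loop[OF x Om_shift(1)[OF Om]] Rev by (auto intro!: r_in simp: r_assoc ar_ev)
    moreover have "?z \<in> N (m - 1)" "r (m - 1) ?z (ev (head Q \<alpha>)) = ?z"
      using Ecar_Loop[OF x Om_shift(2)[OF Om]] Rev by (auto simp: N.zero r_zero)
    ultimately show ?thesis
      using Rev by (auto simp: Etw_def koszul_def N.diff N.uminus r_diff r_uminus)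
  qed (auto simp: Etw_def N.zero r_zero)
  then show "Etw m x k \<in> N (m - 1 - kd k)" "r (m - 1 - kd k) (Etw m x k) (ev (srcW (fst k))) = Etw m x k"
    by auto
qed

lemma Etw_diff: "x \<in> Ecar m \<Longrightarrow> y \<in> Ecar m \<Longrightarrow> k \<in> Om \<Longrightarrow> Etw m (x - y) k = Etw m x k - Etw m y k"
  using Ecar_Loop(1) Om_shift
  by (cases k rule: prod.exhaust; rename_tac w p; case_tac w) (auto simp: Etw_def koszul_diff r_diff Ecar_Loop)

lemma E_complex: "ab_complex Ecar Ed"
proof
  show "0 \<in> Ecar m" for m
    by (auto simp: Ecar_def N.zero r_zero Om_srcW)
  show "x - y \<in> Ecar m" if "x \<in> Ecar m" "y \<in> Ecar m" for x y m
    using that by (auto simp: Ecar_def N.diff r_diff Om_srcW)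
  show "Ed m (x - y) = Ed m x - Ed m y" if "x \<in> Ecar m" "y \<in> Ecar m" for x y m
    using that by (auto simp: Ed_def fun_eq_iff Etw_diff N.D_diff Ecar_in)
  show Ed_in: "Ed m x \<in> Ecar (m - 1)" if x: "x \<in> Ecar m" for x m
  proof -
    have "d (m - kd k) (x k) \<in> N (m - 1 - kd k) \<and>
      r (m - 1 - kd k) (d (m - kd k) (x k)) (ev (srcW (fst k))) = d (m - kd k) (x k)" if k: "k \<in> Om" for k
    proof -
      have *: "m - 1 - kd k = m - kd k - 1" by simp
      have "ev (srcW (fst k)) \<in> PA" using Om_srcW[OF k] by simp
      then show ?thesis
        unfolding * using N.D_in[OF Ecar_in[OF x k]] d_r[OF Ecar_in[OF x k]] Ecar_ev[OF x k] by metis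
    qed
    moreover have "r n (a + b) (ev (srcW (fst k))) = r n a (ev (srcW (fst k))) + r n b (ev (srcW (fst k)))"
      if "k \<in> Om" "a \<in> N n" "b \<in> N n" for k n a b
      using r_diff[of a n "- b" "ev (srcW (fst k))"] that Om_srcW[OF that(1)] by (simp add: N.uminus r_uminus)
    ultimately show ?thesis using Etw_in[OF x] by (auto simp: Ecar_def Ed_def intro!: N.add)
  qed
  show "Ed (m - 1) (Ed m x) = 0" if x: "x \<in> Ecar m" for x m
  proof (rule ext)
    fix k
    show "Ed (m - 1) (Ed m x) k = 0 k"
    proof (cases "k \<in> Om")
      case True
      have *: "m - 1 - kd k = m - kd k - 1" by simp
      have "d (m - 1 - kd k) (Ed m x k) = d (m - 1 - kd k) (Etw m x k)"
        using True N.D_D[OF Ecar_in[OF x True]] N.D_in[OF Ecar_in[OF x True]] Etw_in(1)[OF x True]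
        unfolding * by (simp add: Ed_def N.D_add)
      \<comment> \<open>The twist followed by itself vanishes, as it leads from loops to reversed
        arrows. The mixed terms cancel because their signs have the consecutive exponents m - 1 and
        m - 2.\<close>
      moreover have "d (m - 1 - kd k) (Etw m x k) + Etw (m - 1) (Ed m x) k = 0"
        using True
      proof (cases rule: Om_cases)
        case (Rev \<alpha> p)
        have Om: "(Rev \<alpha>, p) \<in> Om" using True Rev by simp
        note L1 = Om_shift(1)[OF Om] and L2 = Om_shift(2)[OF Om]
        have a: "ar \<alpha> \<in> PA" using Rev by simp
        have E1: "Ed m x (Loop i, q) = d (m - 1) (x (Loop i, q))" if "(Loop i, q) \<in> Om" for i q
          using that by (simp add: Ed_def Etw_def)
        have dr: "d (m - 1) (r (m - 1) (x (Loop (tail Q \<alpha>), p)) (ar \<alpha>)) = r (m - 2) (Ed m x (Loop (tail Q \<alpha>), p)) (ar \<alpha>)"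
          using d_r[OF Ecar_Loop(1)[OF x L1] a] E1[OF L1] by simp
        have *: "Etw (m - 1) (Ed m x) k = koszul (m - 2) (d (m - 1) (r (m - 1) (x (Loop (tail Q \<alpha>), p)) (ar \<alpha>)) -
          d (m - 1) (if snd p \<noteq> [] \<and> hd (snd p) = \<alpha> then x (Loop (head Q \<alpha>), (head Q \<alpha>, tl (snd p))) else 0))"
          unfolding dr Rev(1) Etw_def using E1[OF L2] by simp
        have **: "d (m - 1) (Etw m x k) = koszul (m - 1) (d (m - 1) (r (m - 1) (x (Loop (tail Q \<alpha>), p)) (ar \<alpha>)) -
          d (m - 1) (if snd p \<noteq> [] \<and> hd (snd p) = \<alpha> then x (Loop (head Q \<alpha>), (head Q \<alpha>, tl (snd p))) else 0))"
          unfolding Rev(1) Etw_def using r_in[OF Ecar_Loop(1)[OF x L1] a] Ecar_Loop(1)[OF x L2]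
          by (auto simp: d_koszul N.D_diff N.diff)
        have "koszul (m - 2) c = - koszul (m - 1) c" for c :: 'a
          using koszul_pred[of "m - 1" c] by simp
        then have "d (m - 1) (Etw m x k) + Etw (m - 1) (Ed m x) k = 0" unfolding * ** by simp
        then show ?thesis using Rev(1) by simp
      qed (auto simp: Etw_def)
      ultimately show ?thesis using True by (simp add: Ed_def[of "m - 1"])
    next
      case False
      then show ?thesis by (simp add: Ed_def)
    qed
  qed
qed

text \<open>Only a change of indexing: the twist is defined at the reversed arrows that receive it,
  whereas the Leibniz rule produces it at the loops that emit it. Maps out of N \<otimes> \<Theta>
  are compared with the differential in the second form.\<close>

lemma sum_Ed:
  fixes F :: "('v, 'e) wpath \<Rightarrow> 'a \<Rightarrow> 'b::ab_group_add"
  assumes x: "x \<in> Ecar m"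
    and F: "\<And>k a b. k \<in> Om \<Longrightarrow> a \<in> N (m - 1 - kd k) \<Longrightarrow> b \<in> N (m - 1 - kd k) \<Longrightarrow> F k (a - b) = F k a - F k b"
  shows "(\<Sum>k\<in>Om. F k (Ed m x k)) = (\<Sum>k\<in>Om. F k (d (m - kd k) (x k))) +
    (\<Sum>i\<in>verts Q. \<Sum>p\<in>frm i.
      (\<Sum>\<alpha>\<in>outs i. F (Rev \<alpha>, p) (koszul (m - 1) (r (m - 1) (x (Loop i, p)) (ar \<alpha>)))) -
      (\<Sum>\<beta>\<in>ins i. F (Rev \<beta>, pcat (ap \<beta>) p) (koszul (m - 1) (x (Loop i, p)))))"
proof -
  have F0: "F k 0 = 0" if "k \<in> Om" for k
    using F[OF that N.zero N.zero] by simp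
  have Fa: "F k (a + b) = F k a + F k b" if "k \<in> Om" "a \<in> N (m - 1 - kd k)" "b \<in> N (m - 1 - kd k)" for k a b
    using F[OF that(1,2) N.uminus[OF that(3)]] F[OF that(1) N.zero that(3)] F0[OF that(1)] by simp
  have dN: "d (m - kd k) (x k) \<in> N (m - 1 - kd k)" if "k \<in> Om" for k
    using N.D_in[OF Ecar_in[OF x that]] by (simp add: algebra_simps)
  have "(\<Sum>k\<in>Om. F k (Ed m x k)) = (\<Sum>k\<in>Om. F k (d (m - kd k) (x k))) + (\<Sum>k\<in>Om. F k (Etw m x k))"
    unfolding sum.distrib[symmetric] using Fa dN Etw_in(1)[OF x] by (intro sum.cong) (auto simp: Ed_def)
  also have "(\<Sum>k\<in>Om. F k (Etw m x k)) = (\<Sum>\<alpha>\<in>arcs Q. \<Sum>p\<in>frm (tail Q \<alpha>). F (Rev \<alpha>, p) (Etw m x (Rev \<alpha>, p)))"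
    unfolding sum_Om by (simp add: Etw_def F0)
  also have "\<dots> = (\<Sum>\<alpha>\<in>arcs Q. (\<Sum>p\<in>frm (tail Q \<alpha>). F (Rev \<alpha>, p) (koszul (m - 1) (r (m - 1) (x (Loop (tail Q \<alpha>), p)) (ar \<alpha>)))) -
      (\<Sum>p\<in>frm (head Q \<alpha>). F (Rev \<alpha>, pcat (ap \<alpha>) p) (koszul (m - 1) (x (Loop (head Q \<alpha>), p)))))"
  proof (intro sum.cong[OF refl])
    fix \<alpha> assume \<alpha>: "\<alpha> \<in> arcs Q"
    define z where "z p = (if snd p \<noteq> [] \<and> hd (snd p) = \<alpha> then x (Loop (head Q \<alpha>), (head Q \<alpha>, tl (snd p))) else 0)" for p :: "'v \<times> 'e list"
    have "(\<Sum>p\<in>frm (tail Q \<alpha>). F (Rev \<alpha>, p) (Etw m x (Rev \<alpha>, p))) =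
      (\<Sum>p\<in>frm (tail Q \<alpha>). F (Rev \<alpha>, p) (koszul (m - 1) (r (m - 1) (x (Loop (tail Q \<alpha>), p)) (ar \<alpha>))) -
        F (Rev \<alpha>, p) (koszul (m - 1) (z p)))"
    proof (intro sum.cong[OF refl])
      fix p assume p: "p \<in> frm (tail Q \<alpha>)"
      then have Om: "(Rev \<alpha>, p) \<in> Om" using \<alpha> by simp
      have "r (m - 1) (x (Loop (tail Q \<alpha>), p)) (ar \<alpha>) \<in> N (m - 1)"
        using Ecar_Loop(1)[OF x Om_shift(1)[OF Om]] \<alpha> by (intro r_in) auto
      moreover have "z p \<in> N (m - 1)"
        using Ecar_Loop(1)[OF x Om_shift(2)[OF Om]] by (auto simp: z_def N.zero)
      ultimately show "F (Rev \<alpha>, p) (Etw m x (Rev \<alpha>, p)) =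
          F (Rev \<alpha>, p) (koszul (m - 1) (r (m - 1) (x (Loop (tail Q \<alpha>), p)) (ar \<alpha>))) - F (Rev \<alpha>, p) (koszul (m - 1) (z p))"
        using F[OF Om] by (auto simp: Etw_def z_def koszul_diff koszul_in simp del: Rev_Om)
    qed
    also have "\<dots> = (\<Sum>p\<in>frm (tail Q \<alpha>). F (Rev \<alpha>, p) (koszul (m - 1) (r (m - 1) (x (Loop (tail Q \<alpha>), p)) (ar \<alpha>)))) -
        (\<Sum>p\<in>frm (tail Q \<alpha>). F (Rev \<alpha>, p) (koszul (m - 1) (z p)))"
      by (rule sum_subtractf)
    also have "(\<Sum>p\<in>frm (tail Q \<alpha>). F (Rev \<alpha>, p) (koszul (m - 1) (z p))) =
        F (Rev \<alpha>, (tail Q \<alpha>, [])) (koszul (m - 1) (z (tail Q \<alpha>, []))) +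
        (\<Sum>\<gamma>\<in>outs (tail Q \<alpha>). \<Sum>p\<in>frm (head Q \<gamma>). F (Rev \<alpha>, pcat (ap \<gamma>) p) (koszul (m - 1) (z (pcat (ap \<gamma>) p))))"
      using \<alpha> by (intro sum_paths_from) auto
    also have "F (Rev \<alpha>, (tail Q \<alpha>, [])) (koszul (m - 1) (z (tail Q \<alpha>, []))) = 0"
      using \<alpha> by (simp add: z_def F0)
    \<comment> \<open>The terms z are nonzero only on paths that begin with \<alpha>, so among all
      first arrows \<gamma> only \<alpha> remains.\<close>
    also have "(\<Sum>\<gamma>\<in>outs (tail Q \<alpha>). \<Sum>p\<in>frm (head Q \<gamma>). F (Rev \<alpha>, pcat (ap \<gamma>) p) (koszul (m - 1) (z (pcat (ap \<gamma>) p)))) =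
      (\<Sum>\<gamma>\<in>{\<alpha>}. \<Sum>p\<in>frm (head Q \<gamma>). F (Rev \<alpha>, pcat (ap \<gamma>) p) (koszul (m - 1) (z (pcat (ap \<gamma>) p))))"
    proof (rule sum.mono_neutral_right)
      show "\<forall>\<gamma>\<in>outs (tail Q \<alpha>) - {\<alpha>}. (\<Sum>p\<in>frm (head Q \<gamma>).
          F (Rev \<alpha>, pcat (ap \<gamma>) p) (koszul (m - 1) (z (pcat (ap \<gamma>) p)))) = 0"
        using \<alpha> by (auto simp: z_def pcat_paths F0 intro!: sum.neutral)
    qed (use \<alpha> in auto)
    also have "\<dots> = (\<Sum>p\<in>frm (head Q \<alpha>). F (Rev \<alpha>, pcat (ap \<alpha>) p) (koszul (m - 1) (x (Loop (head Q \<alpha>), p))))"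
      by (auto simp: z_def intro!: sum.cong)
    finally show "(\<Sum>p\<in>frm (tail Q \<alpha>). F (Rev \<alpha>, p) (Etw m x (Rev \<alpha>, p))) =
       (\<Sum>p\<in>frm (tail Q \<alpha>). F (Rev \<alpha>, p) (koszul (m - 1) (r (m - 1) (x (Loop (tail Q \<alpha>), p)) (ar \<alpha>)))) -
       (\<Sum>p\<in>frm (head Q \<alpha>). F (Rev \<alpha>, pcat (ap \<alpha>) p) (koszul (m - 1) (x (Loop (head Q \<alpha>), p))))"
      by simp
  qed
  also have "\<dots> = (\<Sum>i\<in>verts Q. \<Sum>\<alpha>\<in>outs i. \<Sum>p\<in>frm (tail Q \<alpha>). F (Rev \<alpha>, p) (koszul (m - 1) (r (m - 1) (x (Loop (tail Q \<alpha>), p)) (ar \<alpha>)))) -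
     (\<Sum>i\<in>verts Q. \<Sum>\<alpha>\<in>ins i. \<Sum>p\<in>frm (head Q \<alpha>). F (Rev \<alpha>, pcat (ap \<alpha>) p) (koszul (m - 1) (x (Loop (head Q \<alpha>), p))))"
    unfolding sum_subtractf by (intro arg_cong2[of _ _ _ _ "(-)"] sum.group[symmetric]) auto
  also have "\<dots> = (\<Sum>i\<in>verts Q. \<Sum>p\<in>frm i.
      (\<Sum>\<alpha>\<in>outs i. F (Rev \<alpha>, p) (koszul (m - 1) (r (m - 1) (x (Loop i, p)) (ar \<alpha>)))) -
      (\<Sum>\<beta>\<in>ins i. F (Rev \<beta>, pcat (ap \<beta>) p) (koszul (m - 1) (x (Loop i, p)))))"
    unfolding sum_subtractf
  proof (intro arg_cong2[of _ _ _ _ "(-)"] sum.cong[OF refl])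
    fix i
    show "(\<Sum>\<alpha>\<in>outs i. \<Sum>p\<in>frm (tail Q \<alpha>). F (Rev \<alpha>, p) (koszul (m - 1) (r (m - 1) (x (Loop (tail Q \<alpha>), p)) (ar \<alpha>)))) =
      (\<Sum>p\<in>frm i. \<Sum>\<alpha>\<in>outs i. F (Rev \<alpha>, p) (koszul (m - 1) (r (m - 1) (x (Loop i, p)) (ar \<alpha>))))"
      by (subst sum.swap) (auto intro!: sum.cong)
    show "(\<Sum>\<alpha>\<in>ins i. \<Sum>p\<in>frm (head Q \<alpha>). F (Rev \<alpha>, pcat (ap \<alpha>) p) (koszul (m - 1) (x (Loop (head Q \<alpha>), p)))) =
      (\<Sum>p\<in>frm i. \<Sum>\<beta>\<in>ins i. F (Rev \<beta>, pcat (ap \<beta>) p) (koszul (m - 1) (x (Loop i, p))))"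
      by (subst sum.swap) (auto intro!: sum.cong)
  qed
  finally show ?thesis .
qed

end

section \<open>The comparison of X \<otimes> \<Theta> with TX and its cone\<close>

context quiver
begin

lemma rdg_X: "proj_complex Q (X :: ('v, 'e, 'k::field) cpx) \<Longrightarrow> right_dg Q (el X) (dif X) (act X)"
  by unfold_locales
    (auto simp: el_zero el_diff d_in d_diff d_d el_act act_diff_left act_assoc d_act)

abbreviation EC :: "('v, 'e, 'k::field) cpx \<Rightarrow> int \<Rightarrow> (('v, 'e) wpath \<Rightarrow> ('v, 'e, 'k) pvec) set" where
  "EC X \<equiv> right_dg.Ecar Q (el X) (act X)"

abbreviation dEC :: "('v, 'e, 'k::field) cpx \<Rightarrow> int \<Rightarrow> (('v, 'e) wpath \<Rightarrow> ('v, 'e, 'k) pvec) \<Rightarrow>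
    (('v, 'e) wpath \<Rightarrow> ('v, 'e, 'k) pvec)" where
  "dEC X \<equiv> right_dg.Ed Q (dif X) (act X)"

lemma cpx_el: "proj_complex Q (X :: ('v, 'e, 'k::field) cpx) \<Longrightarrow> ab_complex (el X) (dif X)"
  using rdg_X[of X] by (simp add: right_dg_def)

lemma hom_RR_zero: assumes "f \<in> hom Q RQ RQ d" "d \<noteq> 0" shows "f = (0 :: ('v, 'e, 'k::field) gmap)"
proof (rule hom_eqI[OF pcR pcR assms(1) hom_zero[OF pcR pcR]])
  fix n x assume "x \<in> el (RQ :: ('v, 'e, 'k) cpx) n"
  then show "f n x = 0 n x"
    using hom_to_R[OF pcR assms(1), of n x] h_zero[OF pcR assms(1), of n] assms(2)
    by (cases "n = 0") (auto simp: el_R)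
qed

end

context generators
begin

definition mw :: "('v, 'e) garc \<Rightarrow> ('v, 'e, 'k) pvec" where
  "mw w = (case w of Arr _ \<Rightarrow> 0 | Rev \<beta> \<Rightarrow> mR \<beta> | Loop i \<Rightarrow> mL i)"

lemma mw_simps [simp]: "mw (Rev \<beta>) = mR \<beta>" "mw (Loop i) = mL i"
  by (simp_all add: mw_def)

lemma mw_in: "k \<in> Om \<Longrightarrow> mw (fst k) \<in> el TR (kd k)"
  by (erule Om_cases) (auto simp: mL_in mR_in)

lemma mw_left: "k \<in> Om \<Longrightarrow> lact (ev (srcW (fst k))) (kd k) (mw (fst k)) = mw (fst k)"
  by (erule Om_cases) (auto simp: mL_left mR_left)

lemma mw_right: "k \<in> Om \<Longrightarrow> act TR (kd k) (mw (fst k)) (ev (tgtW (fst k))) = mw (fst k)"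
  by (erule Om_cases) (auto simp: mL_right mR_right)

lemma pt_Om: "k \<in> Om \<Longrightarrow> pt (snd k) \<in> PA"
  by (erule Om_cases) auto

text \<open>The element x w p goes to T(x)(m) p, where m is the element of TR chosen for w and x is
  read as a morphism kQ \<rightarrow> X.\<close>

definition PhiX :: "('v, 'e, 'k) cpx \<Rightarrow> int \<Rightarrow> (('v, 'e) wpath \<Rightarrow> ('v, 'e, 'k) pvec) \<Rightarrow> ('v, 'e, 'k) pvec" where
  "PhiX X m x = (\<Sum>k\<in>Om. act (fob T X) m (tens X (m - kd k) (x k) (kd k) (mw (fst k))) (pt (snd k)))"

context
  fixes X :: "('v, 'e, 'k) cpx"
  assumes X: "proj_complex Q X"
begin

interpretation E: right_dg Q "el X" "dif X" "act X" by (rule rdg_X[OF X])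

lemma tens_in': "x \<in> el X n \<Longrightarrow> m \<in> el TR k \<Longrightarrow> l = k + n \<Longrightarrow> tens X n x k m \<in> el (fob T X) l"
  using tens_in[OF X] by simp

lemma PhiX_term: "k \<in> Om \<Longrightarrow> a \<in> el X (m - kd k) \<Longrightarrow>
    tens X (m - kd k) a (kd k) (mw (fst k)) \<in> el (fob T X) m"
  by (rule tens_in') (auto intro: mw_in)

text \<open>After the Leibniz rule for \<open>tens\<close>, only the boundaries of the chosen
  elements of TR are left. They vanish for reversed arrows, and for a loop \<open>dif_mL\<close>
  matches them with the twist, \<alpha> being moved across \<open>tens\<close> by balancedness or
  out to the right by linearity.\<close>

lemma PhiX_chain: "chain_map (EC X) (dEC X) (el (fob T X)) (dif (fob T X)) (PhiX X)"
proof (intro chain_map.intro chain_map_axioms.intro E.E_complex cpx_el[OF T_pc[OF X]])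
  note TX = T_pc[OF X]
  fix m x assume x: "x \<in> EC X m"
  note x_in = E.Ecar_in[OF x]
  show "PhiX X m x \<in> el (fob T X) m"
    unfolding PhiX_def using x_in by (intro el_sum[OF TX] el_act[OF TX] PhiX_term pt_Om) auto
  show "PhiX X m (x - y) = PhiX X m x - PhiX X m y" if y: "y \<in> EC X m" for y
    unfolding PhiX_def sum_subtractf[symmetric]
    using x_in E.Ecar_in[OF y]
    by (intro sum.cong refl) (simp add: tens_diff_left[OF X] act_diff_left[OF TX] PhiX_term pt_Om)
  define F where "F k a = act (fob T X) (m - 1) (tens X (m - 1 - kd k) a (kd k) (mw (fst k))) (pt (snd k))" for k a
  have F_diff: "F k (a - b) = F k a - F k b" if "k \<in> Om" "a \<in> el X (m - 1 - kd k)" "b \<in> el X (m - 1 - kd k)" for k a b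
    using that by (simp add: F_def tens_diff_left[OF X] act_diff_left[OF TX] PhiX_term pt_Om)
  \<comment> \<open>F is for the terms in which the differential hits x, G for those in which it
    hits the chosen element of TR.\<close>
  define G where "G k = act (fob T X) (m - 1) (koszul (m - kd k) (tens X (m - kd k) (x k) (kd k - 1) (dif TR (kd k) (mw (fst k))))) (pt (snd k))" for k
  have "dif (fob T X) m (PhiX X m x) = (\<Sum>k\<in>Om. F k (dif X (m - kd k) (x k)) + G k)"
    unfolding PhiX_def
  proof (subst d_sum[OF TX])
    show "act (fob T X) m (tens X (m - kd k) (x k) (kd k) (mw (fst k))) (pt (snd k)) \<in> el (fob T X) m" if "k \<in> Om" for k
      using that x_in by (intro el_act[OF TX] PhiX_term pt_Om) auto
    show "(\<Sum>k\<in>Om. dif (fob T X) m (act (fob T X) m (tens X (m - kd k) (x k) (kd k) (mw (fst k))) (pt (snd k)))) =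
      (\<Sum>k\<in>Om. F k (dif X (m - kd k) (x k)) + G k)"
    proof (intro sum.cong refl)
      fix k assume k: "k \<in> Om"
      have i: "m - kd k - 1 = m - 1 - kd k" "kd k + (m - kd k) = m" "kd k - 1 + (m - kd k) = m - 1" by simp_all
      have d: "dif X (m - kd k) (x k) \<in> el X (m - 1 - kd k)" using d_in[OF X x_in[OF k]] by (simp only: i)
      have d': "dif TR (kd k) (mw (fst k)) \<in> el TR (kd k - 1)" by (rule d_in[OF pcTR mw_in[OF k]])
      have "dif (fob T X) m (tens X (m - kd k) (x k) (kd k) (mw (fst k))) =
          tens X (m - 1 - kd k) (dif X (m - kd k) (x k)) (kd k) (mw (fst k)) +
          koszul (m - kd k) (tens X (m - kd k) (x k) (kd k - 1) (dif TR (kd k) (mw (fst k))))"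
        using dif_tens[OF X x_in[OF k] mw_in[OF k]] by (simp only: i)
      then show "dif (fob T X) m (act (fob T X) m (tens X (m - kd k) (x k) (kd k) (mw (fst k))) (pt (snd k))) =
          F k (dif X (m - kd k) (x k)) + G k"
        unfolding F_def G_def using d d' k x_in[OF k] tens_in'[OF x_in[OF k] d', of "m - 1"]
        by (subst d_act[OF TX PhiX_term pt_Om]) (auto intro!: act_add_left[OF TX] PhiX_term pt_Om el_koszul[OF TX])
    qed
  qed
  also have "\<dots> = (\<Sum>k\<in>Om. F k (dif X (m - kd k) (x k))) + (\<Sum>k\<in>Om. G k)"
    by (rule sum.distrib)
  also have "(\<Sum>k\<in>Om. G k) = (\<Sum>i\<in>verts Q. \<Sum>p\<in>frm i. G (Loop i, p))"
  proof -
    have "G (Rev \<alpha>, p) = 0" if "(Rev \<alpha>, p) \<in> Om" for \<alpha> p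
      using that x_in[OF that] by (simp add: G_def dif_mR tens_zero_right[OF X] act_zero_left[OF TX])
    then have "(\<Sum>\<alpha>\<in>arcs Q. \<Sum>p\<in>frm (tail Q \<alpha>). G (Rev \<alpha>, p)) = 0"
      by (intro sum.neutral ballI) auto
    then show ?thesis unfolding sum_Om by simp
  qed
  also have "\<dots> = (\<Sum>i\<in>verts Q. \<Sum>p\<in>frm i.
      (\<Sum>\<alpha>\<in>outs i. F (Rev \<alpha>, p) (koszul (m - 1) (act X (m - 1) (x (Loop i, p)) (ar \<alpha>)))) -
      (\<Sum>\<beta>\<in>ins i. F (Rev \<beta>, pcat (ap \<beta>) p) (koszul (m - 1) (x (Loop i, p)))))"
  proof (intro sum.cong refl)
    fix i p assume i: "i \<in> verts Q" and "p \<in> frm i"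
    then have p: "p \<in> paths" "fst p = i" by auto
    define y where "y = x (Loop i, p)"
    have y: "y \<in> el X (m - 1)" using x_in[of "(Loop i, p)"] i p by (simp add: y_def)
    have t: "tens X (m - 1) y 0 (mR \<beta>) \<in> el (fob T X) (m - 1)" "tens X (m - 1) (act X (m - 1) y (ar \<beta>)) 0 (mR \<beta>) \<in> el (fob T X) (m - 1)"
      if "\<beta> \<in> arcs Q" for \<beta>
      using that y by (auto intro!: tens_in' mR_in el_act[OF X])
    have kF: "F k (koszul n a) = koszul n (F k a)" if "k \<in> Om" "a \<in> el X (m - 1 - kd k)" for k n a
      using F_diff[OF that(1) el_zero[OF X] that(2)] F_diff[OF that(1) el_zero[OF X] el_zero[OF X]] by (simp add: koszul_def)
    have "tens X (m - 1) y 0 (dif TR 1 (mL i)) =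
      (\<Sum>\<alpha>\<in>outs i. tens X (m - 1) y 0 (lact (ar \<alpha>) 0 (mR \<alpha>))) -
      (\<Sum>\<beta>\<in>ins i. tens X (m - 1) y 0 (act TR 0 (mR \<beta>) (ar \<beta>)))"
      unfolding dif_mL[OF i] using y
      by (subst tens_diff_right[OF X], (auto intro!: el_sum[OF pcTR] lact_in el_act[OF pcTR] mR_in)[3], subst (1 2) tens_sum_right[OF X])
        (auto intro!: lact_in el_act[OF pcTR] mR_in)
    also have "\<dots> = (\<Sum>\<alpha>\<in>outs i. tens X (m - 1) (act X (m - 1) y (ar \<alpha>)) 0 (mR \<alpha>)) -
      (\<Sum>\<beta>\<in>ins i. act (fob T X) (m - 1) (tens X (m - 1) y 0 (mR \<beta>)) (ar \<beta>))"
      using y tens_act_left[OF X y, of "ar _" 0] tens_act_right[OF X y mR_in]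
      by (intro arg_cong2[of _ _ _ _ "(-)"] sum.cong refl) auto
    finally have e: "tens X (m - 1) y 0 (dif TR 1 (mL i)) = \<dots>" .
    have "G (Loop i, p) = koszul (m - 1) (act (fob T X) (m - 1) (tens X (m - 1) y 0 (dif TR 1 (mL i))) (pt p))"
      unfolding G_def using p y dmL_in[OF i] by (auto simp: y_def intro!: act_koszul_left[OF TX] tens_in')
    also have "act (fob T X) (m - 1) (tens X (m - 1) y 0 (dif TR 1 (mL i))) (pt p) =
      (\<Sum>\<alpha>\<in>outs i. F (Rev \<alpha>, p) (act X (m - 1) y (ar \<alpha>))) -
      (\<Sum>\<beta>\<in>ins i. F (Rev \<beta>, pcat (ap \<beta>) p) y)"
    proof -
      have "act (fob T X) (m - 1) (tens X (m - 1) y 0 (dif TR 1 (mL i))) (pt p) =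
        (\<Sum>\<alpha>\<in>outs i. act (fob T X) (m - 1) (tens X (m - 1) (act X (m - 1) y (ar \<alpha>)) 0 (mR \<alpha>)) (pt p)) -
        (\<Sum>\<beta>\<in>ins i. act (fob T X) (m - 1) (act (fob T X) (m - 1) (tens X (m - 1) y 0 (mR \<beta>)) (ar \<beta>)) (pt p))"
      proof -
        have A: "tens X (m - 1) (act X (m - 1) y (ar \<alpha>)) 0 (mR \<alpha>) \<in> el (fob T X) (m - 1)"
          "act (fob T X) (m - 1) (tens X (m - 1) y 0 (mR \<alpha>)) (ar \<alpha>) \<in> el (fob T X) (m - 1)"
          if "\<alpha> \<in> arcs Q" for \<alpha>
          using t[OF that] that by (auto intro!: el_act[OF TX])
        have pp: "pt p \<in> PA" using p by simp
        show ?thesis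
          unfolding e
        proof (subst act_diff_left[OF TX _ _ pp])
          show "(\<Sum>\<alpha>\<in>outs i. tens X (m - 1) (act X (m - 1) y (ar \<alpha>)) 0 (mR \<alpha>)) \<in> el (fob T X) (m - 1)"
            "(\<Sum>\<beta>\<in>ins i. act (fob T X) (m - 1) (tens X (m - 1) y 0 (mR \<beta>)) (ar \<beta>)) \<in> el (fob T X) (m - 1)"
            by (intro el_sum[OF TX], use A in auto)+
        qed (intro arg_cong2[of _ _ _ _ "(-)"] act_sum_left[OF TX pp], use A in auto)
      qed
      also have "\<dots> = (\<Sum>\<alpha>\<in>outs i. F (Rev \<alpha>, p) (act X (m - 1) y (ar \<alpha>))) -
          (\<Sum>\<beta>\<in>ins i. F (Rev \<beta>, pcat (ap \<beta>) p) y)"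
        using t p fst_paths[OF p(1)] by (intro arg_cong2[of _ _ _ _ "(-)"] sum.cong refl) (auto simp: F_def act_assoc[OF TX] pm_pt)
      finally show ?thesis .
    qed
    also have "koszul (m - 1) \<dots> = (\<Sum>\<alpha>\<in>outs i. F (Rev \<alpha>, p) (koszul (m - 1) (act X (m - 1) y (ar \<alpha>)))) -
      (\<Sum>\<beta>\<in>ins i. F (Rev \<beta>, pcat (ap \<beta>) p) (koszul (m - 1) y))"
      unfolding koszul_diff koszul_sum
    proof (intro arg_cong2[of _ _ _ _ "(-)"] sum.cong refl)
      fix \<alpha> assume "\<alpha> \<in> outs i"
      then have "(Rev \<alpha>, p) \<in> Om" "act X (m - 1) y (ar \<alpha>) \<in> el X (m - 1 - kd (Rev \<alpha>, p))"
        using p y by (auto intro!: el_act[OF X])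
      then show "koszul (m - 1) (F (Rev \<alpha>, p) (act X (m - 1) y (ar \<alpha>))) = F (Rev \<alpha>, p) (koszul (m - 1) (act X (m - 1) y (ar \<alpha>)))"
        by (rule kF[symmetric])
    next
      fix \<beta> assume "\<beta> \<in> ins i"
      then have "(Rev \<beta>, pcat (ap \<beta>) p) \<in> Om" "y \<in> el X (m - 1 - kd (Rev \<beta>, pcat (ap \<beta>) p))"
        using p y by (auto simp: pcat_paths fst_paths)
      then show "koszul (m - 1) (F (Rev \<beta>, pcat (ap \<beta>) p) y) = F (Rev \<beta>, pcat (ap \<beta>) p) (koszul (m - 1) y)"
        by (rule kF[symmetric])
    qed
    finally show "G (Loop i, p) =
      (\<Sum>\<alpha>\<in>outs i. F (Rev \<alpha>, p) (koszul (m - 1) (act X (m - 1) (x (Loop i, p)) (ar \<alpha>)))) -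
      (\<Sum>\<beta>\<in>ins i. F (Rev \<beta>, pcat (ap \<beta>) p) (koszul (m - 1) (x (Loop i, p))))"
      by (simp only: y_def)
  qed
  also have "(\<Sum>k\<in>Om. F k (dif X (m - kd k) (x k))) + \<dots> = (\<Sum>k\<in>Om. F k (dEC X m x k))"
    by (rule E.sum_Ed[OF x F_diff, symmetric])
  finally show "dif (fob T X) m (PhiX X m x) = PhiX X (m - 1) (dEC X m x)"
    by (simp add: PhiX_def F_def)
qed

end

abbreviation CX :: "('v, 'e, 'k) cpx \<Rightarrow> int \<Rightarrow> ((('v, 'e) wpath \<Rightarrow> ('v, 'e, 'k) pvec) \<times> ('v, 'e, 'k) pvec) set" where
  "CX X \<equiv> cone_el (EC X) (el (fob T X))"

abbreviation dCX where "dCX X \<equiv> cone_d (dEC X) (dif (fob T X)) (PhiX X)"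

lemma CX_complex: "proj_complex Q X \<Longrightarrow> ab_complex (CX X) (dCX X)"
  by (rule chain_map.cone_complex[OF PhiX_chain])

text \<open>
  Graded morphisms act on the cones whether they are closed or not; this is needed because the
  vectors and functionals of a dual basis of \<open>X\<close> are not closed.
\<close>

definition fs :: "('v, 'e, 'k) cpx \<Rightarrow> ('v, 'e, 'k) cpx \<Rightarrow> int \<Rightarrow> ('v, 'e, 'k) gmap \<Rightarrow> int \<Rightarrow>
    (('v, 'e) wpath \<Rightarrow> ('v, 'e, 'k) pvec) \<times> ('v, 'e, 'k) pvec \<Rightarrow>
    (('v, 'e) wpath \<Rightarrow> ('v, 'e, 'k) pvec) \<times> ('v, 'e, 'k) pvec" where
  "fs X Y \<delta> f m c = ((\<lambda>k. f (m - kd k) (fst c k)), koszul \<delta> (fmor T X Y \<delta> f (m + 1) (snd c)))"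

context
  fixes X Y :: "('v, 'e, 'k) cpx"
  assumes X: "proj_complex Q X" and Y: "proj_complex Q Y"
begin

interpretation EC: right_dg Q "el X" "dif X" "act X" by (rule rdg_X[OF X])
interpretation EY: right_dg Q "el Y" "dif Y" "act Y" by (rule rdg_X[OF Y])

lemma fE_in:
  assumes f: "f \<in> hom Q X Y \<delta>" and x: "x \<in> EC X m" and l: "l = m + \<delta>"
  shows "(\<lambda>k. f (m - kd k) (x k)) \<in> EC Y l"
  unfolding EY.Ecar_def
proof (intro CollectI allI conjI impI)
  fix k
  have i: "m - kd k + \<delta> = l - kd k" using l by simp
  {
    assume k: "k \<in> Om"
    show "f (m - kd k) (x k) \<in> el Y (l - kd k)"
      using h_in[OF X f EC.Ecar_in[OF x k]] by (simp only: i)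
    show "act Y (l - kd k) (f (m - kd k) (x k)) (ev (srcW (fst k))) = f (m - kd k) (x k)"
      using h_act[OF X f EC.Ecar_in[OF x k], of "ev (srcW (fst k))"] EC.Ecar_ev[OF x k] Om_srcW[OF k] by (simp only: i) simp
  }
  show "f (m - kd k) (x k) = 0" if "k \<notin> Om"
    using EC.Ecar_out[OF x that] h_zero[OF X f] by simp
qed

lemma fs_in: "f \<in> hom Q X Y \<delta> \<Longrightarrow> c \<in> CX X m \<Longrightarrow> l = m + \<delta> \<Longrightarrow> fs X Y \<delta> f m c \<in> CX Y l"
  using h_in[OF T_pc[OF X] T_hom[OF X Y], of f \<delta> "snd c" "m + 1"]
  by (auto simp: cone_el_def fs_def fE_in add_ac intro!: el_koszul[OF T_pc[OF Y]])

lemma fs_diff: "f \<in> hom Q X Y \<delta> \<Longrightarrow> c \<in> CX X m \<Longrightarrow> c' \<in> CX X m \<Longrightarrow> fs X Y \<delta> f m (c - c') = fs X Y \<delta> f m c - fs X Y \<delta> f m c'"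
proof -
  assume f: "f \<in> hom Q X Y \<delta>" and c: "c \<in> CX X m" "c' \<in> CX X m"
  have "f (m - kd k) (fst c k - fst c' k) = f (m - kd k) (fst c k) - f (m - kd k) (fst c' k)" for k
    using c h_diff[OF X f EC.Ecar_in EC.Ecar_in, of "fst c" m k "fst c'"] h_zero[OF X f]
      EC.Ecar_out[of "fst c" m k] EC.Ecar_out[of "fst c'" m k]
    by (cases "k \<in> Om") (auto simp: cone_el_def)
  then show ?thesis
    using c h_diff[OF T_pc[OF X] T_hom[OF X Y f], of "snd c" "m + 1" "snd c'"]
    by (auto simp: fs_def fun_eq_iff koszul_diff cone_el_def)
qed

lemma fs_zero: "fs X Y \<delta> 0 m c = 0"
  by (auto simp: fs_def zero_prod_def T_zero[OF X Y] fun_eq_iff)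

lemma fs_add: "f \<in> hom Q X Y \<delta> \<Longrightarrow> g \<in> hom Q X Y \<delta> \<Longrightarrow> fs X Y \<delta> (f + g) m c = fs X Y \<delta> f m c + fs X Y \<delta> g m c"
  by (auto simp: fs_def T_add[OF X Y] fun_eq_iff koszul_add)

lemma fs_sum: "(\<And>i. i \<in> I \<Longrightarrow> f i \<in> hom Q X Y \<delta>) \<Longrightarrow> fs X Y \<delta> (sum f I) m c = (\<Sum>i\<in>I. fs X Y \<delta> (f i) m c)"
  by (induction I rule: infinite_finite_induct) (auto simp: fs_zero fs_add hom_sum[OF X Y])

lemma fs_comp:
  assumes Z: "proj_complex Q Z" and f: "f \<in> hom Q X Y \<delta>" and g: "g \<in> hom Q Y Z \<epsilon>" and c: "c \<in> CX X m" and l: "l = m + \<delta>" "\<zeta> = \<delta> + \<epsilon>"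
  shows "fs Y Z \<epsilon> g l (fs X Y \<delta> f m c) = fs X Z \<zeta> (gcomp \<delta> g f) m c"
proof -
  have "fmor T X Y \<delta> f (m + 1) (snd c) \<in> el (fob T Y) (m + 1 + \<delta>)"
    using c by (intro h_in[OF T_pc[OF X] T_hom[OF X Y f]]) (auto simp: cone_el_def)
  then have "fmor T Y Z \<epsilon> g (m + 1 + \<delta>) (koszul \<delta> (fmor T X Y \<delta> f (m + 1) (snd c))) =
      koszul \<delta> (fmor T Y Z \<epsilon> g (m + 1 + \<delta>) (fmor T X Y \<delta> f (m + 1) (snd c)))"
    by (rule h_koszul[OF T_pc[OF Y] T_hom[OF Y Z g]])
  moreover have i: "m + 1 + \<delta> = l + 1" "m - kd k + \<delta> = l - kd k" for k using l by simp_all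
  ultimately have "koszul \<epsilon> (fmor T Y Z \<epsilon> g (l + 1) (koszul \<delta> (fmor T X Y \<delta> f (m + 1) (snd c)))) =
      koszul \<zeta> (fmor T Y Z \<epsilon> g (l + 1) (fmor T X Y \<delta> f (m + 1) (snd c)))"
    unfolding i by (simp only: koszul_koszul l(2) add.commute)
  also have "\<dots> = koszul \<zeta> (fmor T X Z \<zeta> (gcomp \<delta> g f) (m + 1) (snd c))"
    unfolding l(2) T_gcomp[OF X Y Z f g] unfolding gcomp_def i ..
  finally show ?thesis
    by (simp add: fs_def gcomp_def i)
qed

lemma PhiX_fE:
  assumes f: "f \<in> hom Q X Y \<delta>" and x: "x \<in> EC X m" and l: "l = m + \<delta>"
  shows "PhiX Y l (\<lambda>k. f (m - kd k) (x k)) = fmor T X Y \<delta> f m (PhiX X m x)"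
proof -
  have "fmor T X Y \<delta> f m (PhiX X m x) = (\<Sum>k\<in>Om. fmor T X Y \<delta> f m (act (fob T X) m (tens X (m - kd k) (x k) (kd k) (mw (fst k))) (pt (snd k))))"
    unfolding PhiX_def using EC.Ecar_in[OF x]
    by (intro h_sum[OF T_pc[OF X] T_hom[OF X Y f]] el_act[OF T_pc[OF X]] PhiX_term[OF X] pt_Om)
  also have "\<dots> = (\<Sum>k\<in>Om. act (fob T Y) l (tens Y (l - kd k) (f (m - kd k) (x k)) (kd k) (mw (fst k))) (pt (snd k)))"
  proof (intro sum.cong refl)
    fix k assume k: "k \<in> Om"
    have i: "kd k + (m - kd k) = m" "m - kd k + \<delta> = l - kd k" "m + \<delta> = l" using l by simp_all
    have "fmor T X Y \<delta> f m (tens X (m - kd k) (x k) (kd k) (mw (fst k))) = tens Y (l - kd k) (f (m - kd k) (x k)) (kd k) (mw (fst k))"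
      using T_tens[OF X Y f EC.Ecar_in[OF x k], of "kd k" "mw (fst k)"] by (simp only: i)
    then show "fmor T X Y \<delta> f m (act (fob T X) m (tens X (m - kd k) (x k) (kd k) (mw (fst k))) (pt (snd k))) =
        act (fob T Y) l (tens Y (l - kd k) (f (m - kd k) (x k)) (kd k) (mw (fst k))) (pt (snd k))"
      using h_act[OF T_pc[OF X] T_hom[OF X Y f] PhiX_term[OF X k EC.Ecar_in[OF x k]] pt_Om[OF k]] by (simp only: i)
  qed
  finally show ?thesis by (simp add: PhiX_def)
qed

text \<open>The cone is a dg functor of X: graded maps commute with its differential up to sign and
  up to the term of their own boundary. The sign in the second component of \<open>fs\<close>
  compensates for the shift of TX inside the cone.\<close>

lemma fs_D:
  assumes f: "f \<in> hom Q X Y \<delta>" and c: "c \<in> CX X m" and l: "l = m + \<delta>"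
  shows "dCX Y l (fs X Y \<delta> f m c) = fs X Y (\<delta> - 1) (dhom X Y \<delta> f) m c + koszul \<delta> (fs X Y \<delta> f (m - 1) (dCX X m c))"
proof -
  obtain x y where [simp]: "c = (x, y)" by (cases c)
  have x: "x \<in> EC X m" and y: "y \<in> el (fob T X) (m + 1)" using c by (auto simp: cone_el_def)
  note TX = T_pc[OF X] and TY = T_pc[OF Y] and Tf = T_hom[OF X Y f]
  have 1: "dEC Y l (\<lambda>k. f (m - kd k) (x k)) k = dhom X Y \<delta> f (m - kd k) (x k) + koszul \<delta> (f (m - 1 - kd k) (dEC X m x k))" for k
  proof (cases "k \<in> Om")
    case True
    have i: "m - kd k + \<delta> = l - kd k" "m - kd k - 1 = m - 1 - kd k" using l by simp_all
    have tw: "EY.Etw l (\<lambda>k. f (m - kd k) (x k)) k = koszul \<delta> (f (m - 1 - kd k) (EC.Etw m x k))"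
      using True
    proof (cases rule: Om_cases)
      case (Rev \<alpha> p)
      have Om: "(Rev \<alpha>, p) \<in> Om" using True Rev by simp
      note L1 = EC.Ecar_Loop(1)[OF x EC.Om_shift(1)[OF Om]] and L2 = EC.Ecar_Loop(1)[OF x EC.Om_shift(2)[OF Om]]
      have a: "ar \<alpha> \<in> PA" using Rev by simp
      have i': "m - 1 + \<delta> = l - 1" and l10: "l - 1 = \<delta> + (m - 1)" using l by simp_all
      have 1: "act Y (l - 1) (f (m - 1) (x (Loop (tail Q \<alpha>), p))) (ar \<alpha>) = f (m - 1) (act X (m - 1) (x (Loop (tail Q \<alpha>), p)) (ar \<alpha>))"
        using h_act[OF X f L1 a] by (simp only: i')
      define z where "z = (if snd p \<noteq> [] \<and> hd (snd p) = \<alpha> then x (Loop (head Q \<alpha>), (head Q \<alpha>, tl (snd p))) else 0)"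
      have z: "z \<in> el X (m - 1)" using L2 el_zero[OF X] by (auto simp: z_def)
      have "EY.Etw l (\<lambda>k. f (m - kd k) (x k)) k = koszul (l - 1) (f (m - 1) (act X (m - 1) (x (Loop (tail Q \<alpha>), p)) (ar \<alpha>)) - f (m - 1) z)"
        unfolding Rev(1) EY.Etw_def using h_zero[OF X f] by (simp add: 1 z_def)
      also have "\<dots> = koszul (l - 1) (f (m - 1) (act X (m - 1) (x (Loop (tail Q \<alpha>), p)) (ar \<alpha>) - z))"
        using h_diff[OF X f el_act[OF X L1 a] z] by simp
      also have "\<dots> = koszul \<delta> (f (m - 1) (koszul (m - 1) (act X (m - 1) (x (Loop (tail Q \<alpha>), p)) (ar \<alpha>) - z)))"
        using h_koszul[OF X f el_diff[OF X el_act[OF X L1 a] z]] l10 by (simp only: koszul_koszul)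
      also have "\<dots> = koszul \<delta> (f (m - 1 - kd k) (EC.Etw m x k))"
        unfolding Rev(1) EC.Etw_def by (simp add: z_def)
      finally show ?thesis .
    qed (auto simp: EY.Etw_def EC.Etw_def h_zero[OF X f])
    have "dEC Y l (\<lambda>k. f (m - kd k) (x k)) k = dif Y (l - kd k) (f (m - kd k) (x k)) + koszul \<delta> (f (m - 1 - kd k) (EC.Etw m x k))"
      using True by (simp add: EY.Ed_def tw)
    also have "dif Y (l - kd k) (f (m - kd k) (x k)) = dhom X Y \<delta> f (m - kd k) (x k) + koszul \<delta> (f (m - 1 - kd k) (dif X (m - kd k) (x k)))"
      using dif_hom_apply[of Y "m - kd k" \<delta> f "x k" X] by (simp only: i)
    also have "dhom X Y \<delta> f (m - kd k) (x k) + koszul \<delta> (f (m - 1 - kd k) (dif X (m - kd k) (x k))) + koszul \<delta> (f (m - 1 - kd k) (EC.Etw m x k)) =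
        dhom X Y \<delta> f (m - kd k) (x k) + koszul \<delta> (f (m - 1 - kd k) (dEC X m x k))"
    proof -
      have "dif X (m - kd k) (x k) \<in> el X (m - 1 - kd k)" using d_in[OF X EC.Ecar_in[OF x True]] by (simp only: i)
      then show ?thesis
        using True h_add[OF X f _ EC.Etw_in(1)[OF x True]] by (simp add: EC.Ed_def koszul_add)
    qed
    finally show ?thesis .
  next
    case False
    then show ?thesis
      using EC.Ecar_out[OF x False] h_zero[OF X f] h_zero[OF X dhom_hom[OF X Y f]] by (simp add: EY.Ed_def EC.Ed_def)
  qed
  have 2: "PhiX Y l (\<lambda>k. f (m - kd k) (x k)) - dif (fob T Y) (l + 1) (koszul \<delta> (fmor T X Y \<delta> f (m + 1) y)) =
      koszul (\<delta> - 1) (fmor T X Y (\<delta> - 1) (dhom X Y \<delta> f) (m + 1) y) +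
      koszul \<delta> (koszul \<delta> (fmor T X Y \<delta> f m (PhiX X m x - dif (fob T X) (m + 1) y)))"
  proof -
    have i: "m + 1 + \<delta> = l + 1" using l by simp
    have "dif (fob T Y) (l + 1) (fmor T X Y \<delta> f (m + 1) y) =
        fmor T X Y (\<delta> - 1) (dhom X Y \<delta> f) (m + 1) y + koszul \<delta> (fmor T X Y \<delta> f m (dif (fob T X) (m + 1) y))"
      using dif_hom_apply[of "fob T Y" "m + 1" \<delta> "fmor T X Y \<delta> f" y "fob T X"] T_dhom[OF X Y f] by (simp add: i)
    moreover have "fmor T X Y \<delta> f (m + 1) y \<in> el (fob T Y) (l + 1)" using h_in[OF TX Tf y] by (simp only: i)
    moreover have "fmor T X Y \<delta> f m (PhiX X m x - dif (fob T X) (m + 1) y) = fmor T X Y \<delta> f m (PhiX X m x) - fmor T X Y \<delta> f m (dif (fob T X) (m + 1) y)"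
      using d_in[OF TX y] chain_map.f_in[OF PhiX_chain[OF X] x] by (intro h_diff[OF TX Tf]) auto
    ultimately show ?thesis
      by (simp add: PhiX_fE[OF f x l] d_koszul[OF TY] koszul_add koszul_pred)
  qed
  have k: "koszul n (a, b) = (koszul n a, koszul n b)" for n and a :: "'x::ab_group_add" and b :: "'y::ab_group_add"
    by (simp add: koszul_def)
  have kf: "koszul n h k = koszul n (h k)" for n k and h :: "'x \<Rightarrow> 'y::ab_group_add"
    by (simp add: koszul_def)
  show ?thesis using 1 2 by (auto simp: cone_d_def fs_def k fun_eq_iff kf)
qed

end

lemma fs_gid: assumes X: "proj_complex Q X" and c: "c \<in> CX X m" shows "fs X X 0 (gid X) m c = c"
proof -
  interpret EC: right_dg Q "el X" "dif X" "act X" by (rule rdg_X[OF X])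
  have "gid X (m - kd k) (fst c k) = fst c k" for k
    using c EC.Ecar_in[of "fst c" m k] EC.Ecar_out[of "fst c" m k] by (cases "k \<in> Om") (auto simp: cone_el_def gid_def)
  moreover have "fmor T X X 0 (gid X) (m + 1) (snd c) = snd c"
    using c by (auto simp: T_gid[OF X] cone_el_def) (simp add: gid_def)
  ultimately show ?thesis by (simp add: fs_def)
qed

text \<open>Devissage along the degree of X, with finitely many coordinates because X is bounded.
  Dual bases give maps U from, and V to, shifted copies of the cone of kQ. They are not chain maps,
  but their boundaries have degree one less, and graded maps kQ \<rightarrow> kQ exist in degree 0
  only, so the defects disappear on the graded pieces.\<close>

lemma CX_exact:
  assumes CR: "exact_cpx (CX RQ) (dCX RQ)" and X: "proj_complex Q X"
  shows "exact_cpx (CX X) (dCX X)"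
proof -
  interpret CX: ab_complex "CX X" "dCX X" by (rule CX_complex[OF X])
  interpret CR: ab_complex "CX RQ" "dCX RQ" by (rule CX_complex[OF pcR])
  obtain B where B: "\<And>i. \<bar>i\<bar> > B \<Longrightarrow> el X i = {0}"
    using X by (auto simp: proj_complex_def)
  define P where "P n N u v \<longleftrightarrow> (\<forall>j<N. u j \<in> el X n \<and> v j \<in> hom Q X RQ (- n)) \<and>
      (\<forall>x\<in>el X n. x = (\<Sum>j<N::nat. act X n (u j) (v j n x)))" for n N u v
  have "\<exists>N u v. P n N u v" for n
    unfolding P_def by (rule dual_basis_cpx[OF X])
  then obtain N u v where "\<And>n. P n (N n) (u n) (v n)" by metis
  then have uv: "\<And>n j. j < N n \<Longrightarrow> u n j \<in> el X n" "\<And>n j. j < N n \<Longrightarrow> v n j \<in> hom Q X RQ (- n)"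
    "\<And>n x. x \<in> el X n \<Longrightarrow> x = (\<Sum>j<N n. act X n (u n j) (v n j n x))"
    by (auto simp only: P_def)
  define I where "I = (SIGMA n:{- B..B}. {..<N n})"
  define U where "U k m h = fs RQ X (fst k) (hat X (fst k) (u (fst k) (snd k))) (m - fst k) h" for k m h
  define V where "V k m c = fs X RQ (- fst k) (v (fst k) (snd k)) m c" for k m c
  have hu: "hat X (fst k) (u (fst k) (snd k)) \<in> hom Q RQ X (fst k)" if "k \<in> I" for k
    using that uv(1) by (intro hat_hom[OF X]) (auto simp: I_def)
  have hv: "v (fst k) (snd k) \<in> hom Q X RQ (- fst k)" if "k \<in> I" for k
    using that uv(2) by (auto simp: I_def)
  have V_in: "V k m x \<in> CX RQ (m - fst k)" if "k \<in> I" "x \<in> CX X m" for k m x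
    unfolding V_def using that by (intro fs_in[OF X pcR hv]) auto
  have U_in: "U k m h \<in> CX X m" if "k \<in> I" "h \<in> CX RQ (m - fst k)" for k m h
    unfolding U_def using that by (intro fs_in[OF pcR X hu]) auto
  have UV: "x = (\<Sum>k\<in>I. U k m (V k m x))" if x: "x \<in> CX X m" for m x
  proof -
    have uvh: "gcomp (- fst k) (hat X (fst k) (u (fst k) (snd k))) (v (fst k) (snd k)) \<in> hom Q X X 0" if "k \<in> I" for k
      using gcomp_hom[OF X pcR hv[OF that] hu[OF that]] by simp
    \<comment> \<open>The dual basis identities of all degrees together express the identity of X;
      functoriality of \<open>fs\<close> transfers this decomposition to the cone.\<close>
    have "(\<Sum>k\<in>I. gcomp (- fst k) (hat X (fst k) (u (fst k) (snd k))) (v (fst k) (snd k))) = gid X"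
    proof (rule hom_eqI[OF X X hom_sum[OF X X uvh] gid_hom[OF X X]])
      fix i y assume y: "y \<in> el X i"
      have s: "(\<Sum>k\<in>K. f k) i y = (\<Sum>k\<in>K. f k i y)" for K and f :: "int \<times> nat \<Rightarrow> ('v, 'e, 'k) gmap"
        by (induction K rule: infinite_finite_induct) auto
      have t: "gcomp (- n) (hat X n (u n j)) (v n j) i y = (if n = i then act X n (u n j) (v n j n y) else 0)" if "j < N n" for n j
        using hom_to_R_in[OF X uv(2)[OF that], of n y] by (auto simp: gcomp_def hat_def)
      have "(\<Sum>k\<in>I. gcomp (- fst k) (hat X (fst k) (u (fst k) (snd k))) (v (fst k) (snd k)) i y) =
        (\<Sum>n\<in>{- B..B}. \<Sum>j<N n. if n = i then act X n (u n j) (v n j n y) else 0)"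
        unfolding I_def by (subst sum.Sigma) (auto simp: t intro!: sum.cong)
      also have "\<dots> = (\<Sum>n\<in>{- B..B}. if n = i then (\<Sum>j<N i. act X i (u i j) (v i j i y)) else 0)"
        by (intro sum.cong refl) auto
      also have "\<dots> = y"
      proof (cases "i \<in> {- B..B}")
        case True
        then show ?thesis using uv(3)[OF y] by simp
      next
        case False
        then have "y = 0" using B[of i] y by auto
        then show ?thesis using False by auto
      qed
      finally show "(\<Sum>k\<in>I. gcomp (- fst k) (hat X (fst k) (u (fst k) (snd k))) (v (fst k) (snd k))) i y = gid X i y"
        using y by (simp add: s gid_def)
    qed
    then have "x = fs X X 0 (\<Sum>k\<in>I. gcomp (- fst k) (hat X (fst k) (u (fst k) (snd k))) (v (fst k) (snd k))) m x"
      using fs_gid[OF X x] by simp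
    also have "\<dots> = (\<Sum>k\<in>I. U k m (V k m x))"
      using x by (subst fs_sum[OF X X uvh]) (auto simp: U_def V_def intro!: sum.cong fs_comp[OF X pcR X hv hu, symmetric])
    finally show ?thesis .
  qed
  \<comment> \<open>The composite of g with the Yoneda map of a vector is a graded endomorphism of
    kQ of nonzero degree.\<close>
  have VfU: "fs X RQ \<epsilon> g m (U k m h) = 0"
    if "k \<in> I" "h \<in> CX RQ (m - fst k)" "g \<in> hom Q X RQ \<epsilon>" "fst k + \<epsilon> \<noteq> 0" for k h m g \<epsilon>
  proof -
    have "fs X RQ \<epsilon> g m (U k m h) = fs RQ RQ (fst k + \<epsilon>) (gcomp (fst k) g (hat X (fst k) (u (fst k) (snd k)))) (m - fst k) h"
      unfolding U_def using that by (intro fs_comp[OF pcR X pcR hu]) auto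
    also have "gcomp (fst k) g (hat X (fst k) (u (fst k) (snd k))) = 0"
      using that by (intro hom_RR_zero[OF gcomp_hom[OF pcR X hu]]) auto
    finally show ?thesis by (simp only: fs_zero[OF pcR pcR])
  qed
  show ?thesis
  proof (rule devissage[where I = I and H = "\<lambda>k m. CX RQ (m - fst k)" and DH = "\<lambda>k m h. koszul (fst k) (dCX RQ (m - fst k) h)"
        and U = U and V = V and \<rho> = fst])
    show "ab_complex (CX X) (dCX X)" by (rule CX_complex[OF X])
    show "finite I" by (auto simp: I_def)
    show "exact_cpx (\<lambda>m. CX RQ (m - fst k)) (\<lambda>m h. koszul (fst k) (dCX RQ (m - fst k) h))" if "k \<in> I" for k
      unfolding exact_cpx_def
    proof (intro allI ballI impI)
      fix m h assume h: "h \<in> CX RQ (m - fst k)" "koszul (fst k) (dCX RQ (m - fst k) h) = 0"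
      then have "dCX RQ (m - fst k) h = 0" by (auto simp: koszul_def split: if_splits)
      from exact_cpxD[OF CR h(1) this] obtain h' where h': "h' \<in> CX RQ (m - fst k + 1)" "dCX RQ (m - fst k + 1) h' = h" .
      have i: "m + 1 - fst k = m - fst k + 1" by simp
      show "\<exists>y\<in>CX RQ (m + 1 - fst k). koszul (fst k) (dCX RQ (m + 1 - fst k) y) = h"
        unfolding i using h' by (intro bexI[of _ "koszul (fst k) h'"]) (auto simp: koszul_def CR.uminus CR.D_uminus)
    qed
    show "V k m x \<in> CX RQ (m - fst k)" if "k \<in> I" "x \<in> CX X m" for k m x by (rule V_in[OF that])
    show "V k m (x - y) = V k m x - V k m y" if "k \<in> I" "x \<in> CX X m" "y \<in> CX X m" for k m x y
      unfolding V_def by (rule fs_diff[OF X pcR hv[OF that(1)] that(2,3)])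
    show "U k m h \<in> CX X m" if "k \<in> I" "h \<in> CX RQ (m - fst k)" for k m h by (rule U_in[OF that])
    show "U k m 0 = 0" if "k \<in> I" for k m
      using fs_diff[OF pcR X hu[OF that] CR.zero CR.zero] by (simp add: U_def)
    show "x = (\<Sum>k\<in>I. U k m (V k m x))" if "x \<in> CX X m" for m x by (rule UV[OF that])
    show "V l m (U k m h) = 0" if "k \<in> I" "l \<in> I" "h \<in> CX RQ (m - fst k)" "fst k < fst l" for k l m h
      unfolding V_def using that by (intro VfU hv) auto
    show "V l m (dCX X (m + 1) (U k (m + 1) h)) = V l m (U k m (koszul (fst k) (dCX RQ (m + 1 - fst k) h)))"
      if k: "k \<in> I" and l: "l \<in> I" and h: "h \<in> CX RQ (m + 1 - fst k)" and kl: "fst k \<le> fst l" for k l m h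
    proof -
      let ?u = "hat X (fst k) (u (fst k) (snd k))"
      have i: "m + 1 - fst k - 1 = m - fst k" by simp
      have Dh: "dCX RQ (m + 1 - fst k) h \<in> CX RQ (m - fst k)" using CR.D_in[OF h] by (simp only: i)
      have "dCX X (m + 1) (U k (m + 1) h) = fs RQ X (fst k - 1) (dhom RQ X (fst k) ?u) (m + 1 - fst k) h + koszul (fst k) (U k m (dCX RQ (m + 1 - fst k) h))"
        unfolding U_def using fs_D[OF pcR X hu[OF k] h, of "m + 1"] by (simp add: i)
      also have "koszul (fst k) (U k m (dCX RQ (m + 1 - fst k) h)) = U k m (koszul (fst k) (dCX RQ (m + 1 - fst k) h))"
        unfolding U_def using fs_diff[OF pcR X hu[OF k] CR.zero Dh] fs_diff[OF pcR X hu[OF k] CR.zero CR.zero]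
        by (simp add: koszul_def)
      finally have e: "dCX X (m + 1) (U k (m + 1) h) = fs RQ X (fst k - 1) (dhom RQ X (fst k) ?u) (m + 1 - fst k) h +
          U k m (koszul (fst k) (dCX RQ (m + 1 - fst k) h))" .
      have du: "dhom RQ X (fst k) ?u \<in> hom Q RQ X (fst k - 1)" by (rule dhom_hom[OF pcR X hu[OF k]])
      have a: "fs RQ X (fst k - 1) (dhom RQ X (fst k) ?u) (m + 1 - fst k) h \<in> CX X m"
        by (rule fs_in[OF pcR X du h]) simp
      have b: "U k m (koszul (fst k) (dCX RQ (m + 1 - fst k) h)) \<in> CX X m"
        using Dh CR.uminus[OF Dh] by (intro U_in[OF k]) (simp add: koszul_def)
      have "V l m (fs RQ X (fst k - 1) (dhom RQ X (fst k) ?u) (m + 1 - fst k) h) =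
          fs RQ RQ (fst k - 1 + - fst l) (gcomp (fst k - 1) (v (fst l) (snd l)) (dhom RQ X (fst k) ?u)) (m + 1 - fst k) h"
        unfolding V_def by (rule fs_comp[OF pcR X pcR du hv[OF l] h]) auto
      also have "gcomp (fst k - 1) (v (fst l) (snd l)) (dhom RQ X (fst k) ?u) = 0"
        using kl by (intro hom_RR_zero[OF gcomp_hom[OF pcR X du hv[OF l]]]) auto
      finally have "V l m (fs RQ X (fst k - 1) (dhom RQ X (fst k) ?u) (m + 1 - fst k) h) = 0"
        by (simp only: fs_zero[OF pcR pcR])
      moreover have "V l m (x - y) = V l m x - V l m y" if "x \<in> CX X m" "y \<in> CX X m" for x y
        unfolding V_def by (rule fs_diff[OF X pcR hv[OF l] that])
      from this[OF CX.add[OF a b] b]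
      have "V l m (fs RQ X (fst k - 1) (dhom RQ X (fst k) ?u) (m + 1 - fst k) h + U k m (koszul (fst k) (dCX RQ (m + 1 - fst k) h))) -
          V l m (U k m (koszul (fst k) (dCX RQ (m + 1 - fst k) h))) = V l m (fs RQ X (fst k - 1) (dhom RQ X (fst k) ?u) (m + 1 - fst k) h)"
        by (simp only: add_diff_cancel_right')
      ultimately show ?thesis
        unfolding e by (simp only: right_minus_eq)
    qed
    show "koszul (fst k) (dCX RQ (m - fst k) h) \<in> CX RQ (m - 1 - fst k)" if "k \<in> I" "h \<in> CX RQ (m - fst k)" for k m h
    proof -
      have i: "m - 1 - fst k = m - fst k - 1" by simp
      show ?thesis unfolding i using CR.D_in[OF that(2)] CR.uminus by (simp add: koszul_def)
    qed
    show "koszul (fst k) (dCX RQ (m - fst k) (V k m x)) = 0"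
      if k: "k \<in> I" and x: "x \<in> CX X m" and Dx: "dCX X m x = 0" and Vx: "\<forall>l\<in>I. fst k < fst l \<longrightarrow> V l m x = 0" for k m x
    proof -
      let ?v = "v (fst k) (snd k)"
      have dv: "dhom X RQ (- fst k) ?v \<in> hom Q X RQ (- fst k - 1)" by (rule dhom_hom[OF X pcR hv[OF k]])
      have V0: "fs X RQ (- fst k) ?v (m - 1) 0 = 0"
        using fs_diff[OF X pcR hv[OF k] CX.zero CX.zero] by simp
      \<comment> \<open>As x is a cycle, only the boundary of the functional v contributes. By its
        degree it can meet the coordinates in degree \<open>fst k + 1\<close> only, and those vanish
        by assumption.\<close>
      have "dCX RQ (m - fst k) (V k m x) = fs X RQ (- fst k - 1) (dhom X RQ (- fst k) ?v) m x"
        unfolding V_def using fs_D[OF X pcR hv[OF k] x, of "m - fst k"] by (simp add: Dx V0)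
      also have "\<dots> = (\<Sum>l\<in>I. fs X RQ (- fst k - 1) (dhom X RQ (- fst k) ?v) m (U l m (V l m x)))"
      proof -
        interpret CQ: ab_complex "CX RQ" "dCX RQ" by (rule CX_complex[OF pcR])
        have add: "fs X RQ (- fst k - 1) (dhom X RQ (- fst k) ?v) m (a + b) =
            fs X RQ (- fst k - 1) (dhom X RQ (- fst k) ?v) m a + fs X RQ (- fst k - 1) (dhom X RQ (- fst k) ?v) m b"
          if "a \<in> CX X m" "b \<in> CX X m" for a b
          using fs_diff[OF X pcR dv that(1) CX.uminus[OF that(2)]] fs_diff[OF X pcR dv CX.zero that(2)]
            fs_diff[OF X pcR dv CX.zero CX.zero] by simp
        have "fs X RQ (- fst k - 1) (dhom X RQ (- fst k) ?v) m (\<Sum>l\<in>J. U l m (V l m x)) =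
          (\<Sum>l\<in>J. fs X RQ (- fst k - 1) (dhom X RQ (- fst k) ?v) m (U l m (V l m x)))" if "finite J" "J \<subseteq> I" for J
          using that
        proof (induction rule: finite_induct)
          case empty
          then show ?case using fs_diff[OF X pcR dv CX.zero CX.zero] by simp
        next
          case (insert l J)
          then show ?case using x by (simp add: add CX.sum_in U_in V_in subset_eq)
        qed
        from this[of I] show ?thesis using UV[OF x] by (simp add: I_def)
      qed
      also have "\<dots> = 0"
      proof (intro sum.neutral ballI)
        fix l assume l: "l \<in> I"
        show "fs X RQ (- fst k - 1) (dhom X RQ (- fst k) ?v) m (U l m (V l m x)) = 0"
        proof (cases "fst l = fst k + 1")
          case True
          then have "V l m x = 0" using Vx l by auto
          then show ?thesis
            using fs_diff[OF pcR X hu[OF l] CR.zero CR.zero] fs_diff[OF X pcR dv CX.zero CX.zero] by (simp add: U_def)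
        next
          case False
          then show ?thesis by (intro VfU[OF l V_in[OF l x] dv]) auto
        qed
      qed
      finally show ?thesis by simp
    qed
  qed
qed

end

section \<open>The cone of the regular module\<close>

context quiver
begin

lemma lext_pm_right: "pm (lext f a) c = lext (\<lambda>z. pm (f z) c) a"
  by (simp add: lext_def pmult_sum_left pmult_scale_left)

lemma lext_pm_left: "pm c (lext f a) = lext (\<lambda>z. pm c (f z)) a"
  by (simp add: lext_def pmult_sum_right pmult_scale_right)

lemma lext_fun_diff: "lext (\<lambda>p. f p - g p) x = lext f x - lext g x"
  by (simp add: lext_def pscale_diff sum_subtractf)

lemma PA_keys: "a \<in> PA \<Longrightarrow> z \<in> ks a \<Longrightarrow> z \<in> paths"
  by (simp add: path_algebra_iff paths_iff)

lemma lext_pm_ar: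
  assumes a: "a \<in> PA" "pm a (ev (tail Q \<alpha>)) = a"
  shows "lext f (pm a (ar \<alpha>)) = lext (\<lambda>z. f (pcat z (ap \<alpha>))) a"
proof -
  have t: "tgt z = tail Q \<alpha>" if "z \<in> ks a" for z
    using that a(2) lk_idem_right[of Q a "tail Q \<alpha>" z] by (auto simp: in_keys_iff split: if_splits)
  have "pm a (ar \<alpha>) = lext (\<lambda>z. pm (pt z) (ar \<alpha>)) a"
    using lext_pm_right[of "\<lambda>z. pt z" a "ar \<alpha>"] by (simp add: lext_single_id)
  also have "\<dots> = lext (\<lambda>z. pt (pcat z (ap \<alpha>))) a"
    by (rule lext_cong) (simp add: pm_pt t)
  finally show ?thesis
    by (simp add: lext_def[of "\<lambda>z. pt (pcat z (ap \<alpha>))"] lext_sum lext_scale) (simp add: lext_def)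
qed

lemma res_diff_minus: "res_diff (\<lambda>z \<beta>. y z \<beta> - y' z \<beta>) z = res_diff y z - res_diff y' z"
  by (simp add: res_diff_def sum_subtractf pmult_diff_left)

text \<open>The augmentation kills the image of \<open>res_diff\<close>. Appending the arrow matches
  the pairs of a path and an arrow leaving its end with the pairs of a path and its last arrow, and
  the two kinds of terms cancel along this bijection.\<close>

lemma res_diff_tot:
  assumes y: "\<And>z \<beta>. \<beta> \<in> arcs Q \<Longrightarrow> y z \<beta> \<in> PA" and z: "z \<in> paths"
  shows "(\<Sum>a\<in>frm (tgt z). lk (res_diff y (pcat z a)) a) = 0"
proof -
  define P where "P = frm (tgt z)"
  define O1 where "O1 a = outs (tgt a)" for a
  define I1 where "I1 a = ins (tgt a)" for a
  define c where "c = (\<lambda>(b, \<beta>). (pcat b (ap \<beta>), \<beta>))"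
  define l1 where "l1 a \<alpha> = lk (y (pcat z (pcat a (ap \<alpha>))) \<alpha>) a" for a \<alpha>
  define l2 where "l2 a \<beta> = lk (pm (y (pcat z a) \<beta>) (ar \<beta>)) a" for a \<beta>
  have fin: "finite P" "finite (O1 a)" "finite (I1 a)" for a by (auto simp: P_def O1_def I1_def)
  have "(\<Sum>a\<in>P. lk (res_diff y (pcat z a)) a) = (\<Sum>a\<in>P. (\<Sum>\<alpha>\<in>O1 a. l1 a \<alpha>) - (\<Sum>\<beta>\<in>I1 a. l2 a \<beta>))"
  proof (rule sum.cong[OF refl])
    fix a assume "a \<in> P"
    then have "tgt (pcat z a) = tgt a" by (simp add: P_def tgt_pcat)
    then show "lk (res_diff y (pcat z a)) a = (\<Sum>\<alpha>\<in>O1 a. l1 a \<alpha>) - (\<Sum>\<beta>\<in>I1 a. l2 a \<beta>)"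
      by (simp only: res_diff_def lookup_minus lk_sum O1_def I1_def l1_def l2_def pcat_assoc)
  qed
  also have "\<dots> = (\<Sum>(a, \<alpha>)\<in>Sigma P O1. l1 a \<alpha>) - (\<Sum>(a, \<beta>)\<in>Sigma P I1. l2 a \<beta>)"
    using fin by (simp add: sum_subtractf sum.Sigma)
  also have "(\<Sum>(a, \<beta>)\<in>Sigma P I1. l2 a \<beta>) = (\<Sum>(a, \<beta>)\<in>c ` Sigma P O1. l2 a \<beta>)"
  proof (rule sum.mono_neutral_right)
    show "finite (Sigma P I1)" using fin by (intro finite_SigmaI)
    show "c ` Sigma P O1 \<subseteq> Sigma P I1" by (auto simp: pcat_paths tgt_pcat P_def O1_def I1_def c_def)
    show "\<forall>i\<in>Sigma P I1 - c ` Sigma P O1. (case i of (a, \<beta>) \<Rightarrow> l2 a \<beta>) = 0"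
    proof clarify
      fix a \<beta> assume a: "a \<in> P" "\<beta> \<in> I1 a" "(a, \<beta>) \<notin> c ` Sigma P O1"
      show "l2 a \<beta> = 0" unfolding l2_def
      proof (rule lk_pm_pt_right_0, rule notI)
        assume "\<exists>p. a = pcat p (ap \<beta>) \<and> tgt p = fst (ap \<beta>)"
        then obtain p where p: "a = pcat p (ap \<beta>)" "tgt p = tail Q \<beta>" by auto
        then have "(p, \<beta>) \<in> Sigma P O1" using a by (auto simp: pcat_paths P_def O1_def I1_def)
        then show False using a(3) p(1) by (force simp: c_def)
      qed
    qed
  qed
  also have "\<dots> = (\<Sum>(b, \<beta>)\<in>Sigma P O1. l2 (pcat b (ap \<beta>)) \<beta>)"
  proof (subst sum.reindex)
    show "inj_on c (Sigma P O1)" by (auto simp: inj_on_def pcat_def c_def)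
  qed (auto simp: case_prod_beta c_def)
  also have "\<dots> = (\<Sum>(a, \<alpha>)\<in>Sigma P O1. l1 a \<alpha>)"
  proof (rule sum.cong[OF refl], clarify)
    fix a \<alpha> assume "a \<in> P" "\<alpha> \<in> O1 a"
    then show "l2 (pcat a (ap \<alpha>)) \<alpha> = l1 a \<alpha>"
      unfolding l1_def l2_def P_def O1_def using y by (intro lk_pm_pt_right) auto
  qed
  finally show ?thesis by (simp add: P_def)
qed

lemma EC_RQ:
  assumes x: "x \<in> EC (RQ :: ('v, 'e, 'k::field) cpx) m" and k: "k \<in> Om"
  shows EC_RQ_zero: "kd k \<noteq> m \<Longrightarrow> x k = 0" and EC_RQ_PA: "x k \<in> PA"
    and EC_RQ_ev: "pm (x k) (ev (srcW (fst k))) = x k"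
proof -
  interpret E: right_dg Q "el RQ" "dif RQ" "act RQ :: _ \<Rightarrow> _ \<Rightarrow> ('v, 'e, 'k) pvec \<Rightarrow> _" by (rule rdg_X[OF pcR])
  show z: "kd k \<noteq> m \<Longrightarrow> x k = 0" using E.Ecar_in[OF x k] by (auto simp: el_R)
  show "x k \<in> PA" using E.Ecar_in[OF x k] by (auto simp: el_R split: if_splits)
  show "pm (x k) (ev (srcW (fst k))) = x k" using E.Ecar_ev[OF x k] z by (cases "kd k = m") (auto simp: act_R)
qed

end

section \<open>The dual of the cone of kQ\<close>

context generators
begin

text \<open>The right kQ-linear functionals on kQ \<otimes> \<Theta>, given by their values g w z on
  the generators z w with z a path of Q.\<close>

definition FG :: "(('v, 'e) garc \<Rightarrow> 'v \<times> 'e list \<Rightarrow> ('v, 'e, 'k) pvec) \<Rightarrow>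
    (('v, 'e) wpath \<Rightarrow> ('v, 'e, 'k) pvec) \<Rightarrow> ('v, 'e, 'k) pvec" where
  "FG g x = (\<Sum>k\<in>Om. pm (lext (g (fst k)) (x k)) (pt (snd k)))"

lemma FG_diff: "FG g (x - y) = FG g x - FG g y"
  and FG_zero: "FG g 0 = 0"
  and FG_fun_diff: "FG (\<lambda>w z. g w z - g' w z) x = FG g x - FG g' x"
  and FG_fun_add: "FG (\<lambda>w z. g w z + g' w z) x = FG g x + FG g' x"
  and FG_fun_zero: "FG (\<lambda>_ _. 0) x = 0"
  by (simp_all add: FG_def lext_diff lext_fun_diff lext_fun_add pmult_diff_left pmult_add_left sum_subtractf sum.distrib)
    (simp add: lext_def)

lemma FG_lmult: "FG (\<lambda>w z. pm b (g w z)) x = pm b (FG g x)"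
  by (simp add: FG_def pmult_sum_right lext_pm_left[symmetric] pmult_assoc)

lemma FG_PA: "(\<And>w z. g w z \<in> PA) \<Longrightarrow> FG g x \<in> PA"
  unfolding FG_def by (intro path_algebra_sum pmult_closed path_algebra_lext pt_Om)

text \<open>The generator z w exists only when z ends where w begins, and its values count only
  after multiplication by the idempotent at the target of w. The remaining values of g are
  arbitrary, and this lemma removes that freedom.\<close>

lemma FG_cong:
  assumes x: "x \<in> EC RQ m"
    and eq: "\<And>w z. \<lbrakk>w \<in> WA; garc_degree w = m; z \<in> paths; tgt z = srcW w\<rbrakk> \<Longrightarrow>
      pm (g w z) (ev (tgtW w)) = pm (g' w z) (ev (tgtW w))"
  shows "FG g x = FG g' x"
  unfolding FG_def
proof (intro sum.cong refl)
  fix k assume k: "k \<in> Om"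
  show "pm (lext (g (fst k)) (x k)) (pt (snd k)) = pm (lext (g' (fst k)) (x k)) (pt (snd k))"
  proof (cases "kd k = m")
    case False
    then show ?thesis using EC_RQ_zero[OF x k] by simp
  next
    case True
    have w: "fst k \<in> WA" "fst (snd k) = tgtW (fst k)" using k by (auto simp: Om_def)
    have z: "z \<in> paths \<and> tgt z = srcW (fst k)" if "z \<in> ks (x k)" for z
      using PA_keys[OF EC_RQ_PA[OF x k] that] EC_RQ_ev[OF x k] lk_idem_right[of Q "x k" "srcW (fst k)" z] that
      by (auto simp: in_keys_iff split: if_splits)
    have "pt (snd k) = pm (ev (tgtW (fst k))) (pt (snd k) :: ('v, 'e, 'k) pvec)"
      using w by (simp add: pm_pt pcat_Nil_left)
    then have e: "pm c (pt (snd k)) = pm (pm c (ev (tgtW (fst k)))) (pt (snd k))" for c :: "('v, 'e, 'k) pvec"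
      by (metis pmult_assoc)
    have "lext (\<lambda>z. pm (g (fst k) z) (ev (tgtW (fst k)))) (x k) = lext (\<lambda>z. pm (g' (fst k) z) (ev (tgtW (fst k)))) (x k)"
      using eq[OF w(1) True] z by (intro lext_cong) blast
    then show ?thesis by (subst (1 2) e) (simp add: lext_pm_right)
  qed
qed

lemma lact_lext:
  assumes f: "f \<in> hom Q TR RQ d" and a: "a \<in> PA" and m: "m \<in> el TR n"
  shows "f n (lact a n m) = lext (\<lambda>z. f n (lact (pt z) n m)) a"
proof -
  have pin: "lk a p \<odot> pt p \<in> el RQ 0" if "p \<in> paths" for p
    using that by (simp add: el_R path_algebra_scale)
  have "lact a n m = lact (\<Sum>p\<in>paths. lk a p \<odot> pt p) n m" using PA_eq_sum[OF a] by simp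
  also have "\<dots> = (\<Sum>p\<in>paths. lact (lk a p \<odot> pt p) n m)" using pin by (intro tens_sum_left[OF pcR]) auto
  also have "\<dots> = (\<Sum>p\<in>paths. lk a p \<odot> lact (pt p) n m)"
    by (intro sum.cong refl) (simp add: tens_scale_left[OF pcR] el_R)
  finally have "f n (lact a n m) = (\<Sum>p\<in>paths. f n (lk a p \<odot> lact (pt p) n m))"
    using m by (simp add: h_sum[OF pcTR f] el_scale[OF pcTR] lact_in)
  also have "\<dots> = (\<Sum>p\<in>paths. lk a p \<odot> f n (lact (pt p) n m))"
    using m by (intro sum.cong refl h_scale[OF pcTR f] lact_in) auto
  also have "\<dots> = lext (\<lambda>z. f n (lact (pt z) n m)) a"
    using PA_keys[OF a] by (intro lext_superset[symmetric]) auto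
  finally show ?thesis .
qed

lemma FG_PhiX:
  assumes u: "u \<in> hom Q TR RQ d" and x: "x \<in> EC RQ n"
  shows "FG (\<lambda>w z. u n (lact (pt z) n (mw w))) x = u n (PhiX RQ n x)"
proof -
  interpret E: right_dg Q "el RQ" "dif RQ" "act RQ :: _ \<Rightarrow> _ \<Rightarrow> ('v, 'e, 'k) pvec \<Rightarrow> _" by (rule rdg_X[OF pcR])
  have "u n (PhiX RQ n x) = (\<Sum>k\<in>Om. u n (act TR n (tens RQ (n - kd k) (x k) (kd k) (mw (fst k))) (pt (snd k))))"
    unfolding PhiX_def
    by (intro h_sum[OF pcTR u] el_act[OF pcTR] PhiX_term[OF pcR] pt_Om E.Ecar_in[OF x])
  also have "\<dots> = (\<Sum>k\<in>Om. pm (lext (\<lambda>z. u n (lact (pt z) n (mw (fst k)))) (x k)) (pt (snd k)))"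
  proof (intro sum.cong refl)
    fix k assume k: "k \<in> Om"
    show "u n (act TR n (tens RQ (n - kd k) (x k) (kd k) (mw (fst k))) (pt (snd k))) =
        pm (lext (\<lambda>z. u n (lact (pt z) n (mw (fst k)))) (x k)) (pt (snd k))"
    proof (cases "kd k = n")
      case True
      then show ?thesis
        using mw_in[OF k] lact_lext[OF u EC_RQ_PA[OF x k], of "mw (fst k)" n]
          hom_to_R_act[OF pcTR u lact_in[OF EC_RQ_PA[OF x k]] pt_Om[OF k], of "mw (fst k)" n] by simp
    next
      case False
      then show ?thesis
        using EC_RQ_zero[OF x k] by (simp add: tens_zero_left[OF pcR] act_zero_left[OF pcTR pt_Om[OF k]] hom_TR_zero[OF u])
    qed
  qed
  finally show ?thesis by (simp add: FG_def)
qed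

text \<open>The transpose of the twist. When i is the end of z this is the formula of
  \<open>res_diff\<close> for the values of g on reversed arrows, which identifies the dual of kQ
  \<otimes> \<Theta> with the resolution of DA.\<close>

definition DG :: "(('v, 'e) garc \<Rightarrow> 'v \<times> 'e list \<Rightarrow> ('v, 'e, 'k) pvec) \<Rightarrow> 'v \<Rightarrow> 'v \<times> 'e list \<Rightarrow> ('v, 'e, 'k) pvec" where
  "DG g i z = (\<Sum>\<alpha>\<in>outs i. g (Rev \<alpha>) (pcat z (ap \<alpha>))) -
    (\<Sum>\<beta>\<in>ins i. pm (g (Rev \<beta>) z) (ar \<beta>))"

definition GD :: "(('v, 'e) garc \<Rightarrow> 'v \<times> 'e list \<Rightarrow> ('v, 'e, 'k) pvec) \<Rightarrow> ('v, 'e) garc \<Rightarrow> 'v \<times> 'e list \<Rightarrow> ('v, 'e, 'k) pvec" where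
  "GD g w z = (case w of Loop i \<Rightarrow> DG g i z | _ \<Rightarrow> 0)"

lemma GD_PA:
  assumes g: "\<And>w z. g w z \<in> PA"
  shows "GD g w z \<in> PA"
proof (cases w)
  case (Loop i)
  have "pm (g (Rev \<beta>) z) (ar \<beta>) \<in> PA" if "\<beta> \<in> arcs Q" for \<beta>
    using that by (intro pmult_closed g pt_PA ap_paths)
  then have "DG g i z \<in> PA"
    unfolding DG_def by (intro path_algebra_diff path_algebra_sum g) simp_all
  then show ?thesis by (simp add: GD_def Loop)
qed (simp_all add: GD_def)

lemma lext_sum_fun: "lext (\<lambda>z. \<Sum>i\<in>I. f i z) x = (\<Sum>i\<in>I. lext (f i) x)"
  unfolding lext_def pscale.scale_sum_right by (rule sum.swap)

lemma FG_dEC: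
  assumes x: "x \<in> EC RQ n"
  shows "FG g (dEC RQ n x) = FG (GD g) x"
proof -
  interpret E: right_dg Q "el RQ" "dif RQ" "act RQ :: _ \<Rightarrow> _ \<Rightarrow> ('v, 'e, 'k) pvec \<Rightarrow> _" by (rule rdg_X[OF pcR])
  define F where "F k a = pm (lext (g (fst k)) a) (pt (snd k))" for k a
  have "FG g (dEC RQ n x) = (\<Sum>k\<in>Om. F k (dEC RQ n x k))" by (simp add: FG_def F_def)
  also have "\<dots> = (\<Sum>k\<in>Om. F k (dif RQ (n - kd k) (x k))) +
    (\<Sum>i\<in>verts Q. \<Sum>p\<in>frm i.
      (\<Sum>\<alpha>\<in>outs i. F (Rev \<alpha>, p) (koszul (n - 1) (act RQ (n - 1) (x (Loop i, p)) (ar \<alpha>)))) -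
      (\<Sum>\<beta>\<in>ins i. F (Rev \<beta>, pcat (ap \<beta>) p) (koszul (n - 1) (x (Loop i, p)))))"
    by (rule E.sum_Ed[OF x]) (simp add: F_def lext_diff pmult_diff_left)
  also have "(\<Sum>k\<in>Om. F k (dif RQ (n - kd k) (x k))) = 0" by (simp add: F_def)
  also have "0 + (\<Sum>i\<in>verts Q. \<Sum>p\<in>frm i.
      (\<Sum>\<alpha>\<in>outs i. F (Rev \<alpha>, p) (koszul (n - 1) (act RQ (n - 1) (x (Loop i, p)) (ar \<alpha>)))) -
      (\<Sum>\<beta>\<in>ins i. F (Rev \<beta>, pcat (ap \<beta>) p) (koszul (n - 1) (x (Loop i, p))))) =
    (\<Sum>i\<in>verts Q. \<Sum>p\<in>frm i. pm (lext (DG g i) (x (Loop i, p))) (pt p))"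
    unfolding add_0
  proof (intro sum.cong refl)
    fix i p assume i: "i \<in> verts Q" and "p \<in> frm i"
    then have p: "p \<in> paths" "fst p = i" by auto
    then have Om: "(Loop i, p) \<in> Om" using i by simp
    define a where "a = x (Loop i, p)"
    have a: "a \<in> PA" "pm a (ev i) = a" "n \<noteq> 1 \<Longrightarrow> a = 0"
      using EC_RQ_PA[OF x Om] EC_RQ_ev[OF x Om] EC_RQ_zero[OF x Om] by (auto simp: a_def)
    show "(\<Sum>\<alpha>\<in>outs i. F (Rev \<alpha>, p) (koszul (n - 1) (act RQ (n - 1) (x (Loop i, p)) (ar \<alpha>)))) -
      (\<Sum>\<beta>\<in>ins i. F (Rev \<beta>, pcat (ap \<beta>) p) (koszul (n - 1) (x (Loop i, p)))) =
      pm (lext (DG g i) (x (Loop i, p))) (pt p)"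
    proof (cases "n = 1")
      case False
      then have x0: "x (Loop i, p) = 0" using a(3) by (simp add: a_def)
      have *: "F k (koszul n' (0 :: ('v, 'e, 'k) pvec)) = 0" for k n' by (simp add: F_def lext_zero koszul_def)
      have "F (Rev \<alpha>, p) (koszul (n - 1) (act RQ (n - 1) 0 (ar \<alpha>))) = 0" if "\<alpha> \<in> arcs Q" for \<alpha>
        using that * by (subst act_zero_left[OF pcR]) auto
      then have "(\<Sum>\<alpha>\<in>outs i. F (Rev \<alpha>, p) (koszul (n - 1) (act RQ (n - 1) 0 (ar \<alpha>)))) = 0"
        by (intro sum.neutral) blast
      then show ?thesis unfolding x0 * by (simp add: lext_zero)
    next
      case True
      have "pm (lext (DG g i) a) (pt p) =
          (\<Sum>\<alpha>\<in>outs i. pm (lext (\<lambda>z. g (Rev \<alpha>) (pcat z (ap \<alpha>))) a) (pt p)) -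
          (\<Sum>\<beta>\<in>ins i. pm (pm (lext (g (Rev \<beta>)) a) (ar \<beta>)) (pt p))"
        by (simp add: DG_def[abs_def] lext_fun_diff lext_sum_fun pmult_diff_left pmult_sum_left lext_pm_right[of _ a "ar _"])
      also have "\<dots> = (\<Sum>\<alpha>\<in>outs i. F (Rev \<alpha>, p) (pm a (ar \<alpha>))) -
          (\<Sum>\<beta>\<in>ins i. F (Rev \<beta>, pcat (ap \<beta>) p) a)"
      proof (intro arg_cong2[of _ _ _ _ "(-)"] sum.cong refl)
        fix \<alpha> assume "\<alpha> \<in> outs i"
        then show "pm (lext (\<lambda>z. g (Rev \<alpha>) (pcat z (ap \<alpha>))) a) (pt p) = F (Rev \<alpha>, p) (pm a (ar \<alpha>))"
          using lext_pm_ar[of a \<alpha> "g (Rev \<alpha>)"] a by (auto simp: F_def)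
      next
        fix \<beta> assume "\<beta> \<in> ins i"
        then show "pm (pm (lext (g (Rev \<beta>)) a) (ar \<beta>)) (pt p) = F (Rev \<beta>, pcat (ap \<beta>) p) a"
          using p by (auto simp: F_def pmult_assoc pm_pt)
      qed
      finally show ?thesis using True by (simp add: a_def act_R)
    qed
  qed
  also have "\<dots> = FG (GD g) x"
    unfolding FG_def sum_Om by (simp add: GD_def[abs_def] lext_def[of "\<lambda>_. 0"])
  finally show ?thesis .
qed

text \<open>The dual of the cone in degree m. The values of v are prescribed on the cone only, so
  membership does not depend on the values elsewhere.\<close>

definition Lam :: "int \<Rightarrow> ((('v, 'e) wpath \<Rightarrow> ('v, 'e, 'k) pvec) \<times> ('v, 'e, 'k) pvec \<Rightarrow> ('v, 'e, 'k) pvec) set" where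
  "Lam m = {v. \<exists>g u. (\<forall>w z. g w z \<in> PA) \<and> u \<in> hom Q TR RQ (- (m + 1)) \<and>
    (\<forall>c\<in>CX RQ m. v c = FG g (fst c) + u (m + 1) (snd c))}"

lemma LamI: "(\<And>w z. g w z \<in> PA) \<Longrightarrow> u \<in> hom Q TR RQ (- (m + 1)) \<Longrightarrow>
    (\<And>c. c \<in> CX RQ m \<Longrightarrow> v c = FG g (fst c) + u (m + 1) (snd c)) \<Longrightarrow> v \<in> Lam m"
  unfolding Lam_def by blast

lemma LamE:
  assumes "v \<in> Lam m"
  obtains g u where "\<And>w z. g w z \<in> PA" "u \<in> hom Q TR RQ (- (m + 1))"
    "\<And>c. c \<in> CX RQ m \<Longrightarrow> v c = FG g (fst c) + u (m + 1) (snd c)"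
  using assms unfolding Lam_def by blast

lemma CX_fst: "c \<in> CX RQ m \<Longrightarrow> fst c \<in> EC RQ m" and CX_snd: "c \<in> CX RQ m \<Longrightarrow> snd c \<in> el TR (m + 1)"
  by (auto simp: cone_el_def)

lemma Lam_D_formula:
  assumes u: "u \<in> hom Q TR RQ e" and c: "c \<in> CX RQ m"
  shows "FG g (fst (dCX RQ m c)) + u m (snd (dCX RQ m c)) =
    FG (\<lambda>w z. GD g w z + u m (lact (pt z) m (mw w))) (fst c) - u m (dif TR (m + 1) (snd c))"
proof -
  have "PhiX RQ m (fst c) \<in> el TR m" by (rule chain_map.f_in[OF PhiX_chain[OF pcR] CX_fst[OF c]])
  moreover have "dif TR (m + 1) (snd c) \<in> el TR m"
    using d_in[OF pcTR CX_snd[OF c]] by simp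
  ultimately show ?thesis
    by (simp add: cone_d_def FG_dEC[OF CX_fst[OF c]] FG_fun_add FG_PhiX[OF u CX_fst[OF c]] h_diff[OF pcTR u])
qed

lemma u_mL_right:
  assumes f: "f \<in> hom Q TR RQ e" and z: "z \<in> paths"
  shows "pm (f 1 (lact (pt z) 1 (mL (tgt z)))) (ev (tgt z)) = f 1 (lact (pt z) 1 (mL (tgt z)))"
proof -
  have t: "tgt z \<in> verts Q" by (rule tgt_paths[OF z])
  have "lact (pt z) 1 (mL (tgt z)) = act TR 1 (lact (pt z) 1 (mL (tgt z))) (ev (tgt z))"
    using lact_act[of "pt z" "ev (tgt z)" "mL (tgt z)" 1] t z by (simp add: mL_right mL_in)
  then have "f 1 (lact (pt z) 1 (mL (tgt z))) = f 1 (act TR 1 (lact (pt z) 1 (mL (tgt z))) (ev (tgt z)))" by (rule arg_cong)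
  also have "\<dots> = pm (f 1 (lact (pt z) 1 (mL (tgt z)))) (ev (tgt z))"
    using t z by (intro hom_to_R_act[OF pcTR f] lact_in mL_in) auto
  finally show ?thesis by simp
qed

text \<open>Since kQ sits in degree 0, u is nonzero in a single degree, and closedness is one
  condition there.\<close>

lemma cycle_TR:
  assumes u: "u \<in> hom Q TR RQ (- (m + 1))" and 0: "\<And>y. y \<in> el TR (m + 2) \<Longrightarrow> u (m + 1) (dif TR (m + 2) y) = 0"
  shows "dhom TR RQ (- (m + 1)) u = 0"
  unfolding dhom_zero_iff[OF u]
proof (intro allI ballI)
  fix n x assume x: "x \<in> el TR n"
  show "u (n - 1) (dif TR n x) = 0"
    using 0[of x] x hom_to_R[OF pcTR u, of "n - 1"] by (cases "n = m + 2") (auto simp: algebra_simps)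
qed

text \<open>Closedness at the loops says that g, as a family, lifts the negative of the family of u
  along \<open>res_diff\<close>. So the augmentation of the latter vanishes, all traces of multiples
  of u are zero, and u bounds some h. Then g and \<open>Yres h\<close> have the same image under
  \<open>res_diff\<close>; by injectivity g is h composed with \<open>PhiX\<close>.\<close>

lemma Lam_exact_0:
  assumes g: "\<And>w z. g w z \<in> PA" and u: "u \<in> hom Q TR RQ (- 1)"
    and cyc: "\<And>y. y \<in> el TR 2 \<Longrightarrow> u 1 (dif TR 2 y) = 0"
    and loop: "\<And>z. z \<in> paths \<Longrightarrow> pm (DG g (tgt z) z + u 1 (lact (pt z) 1 (mL (tgt z)))) (ev (tgt z)) = 0"
  obtains h where "h \<in> hom Q TR RQ 0" "\<And>y. u 1 y = - h 0 (dif TR 1 y)"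
    "\<And>x. x \<in> EC (RQ :: ('v, 'e, 'k) cpx) 0 \<Longrightarrow> FG g x = h 0 (PhiX RQ 0 x)"
proof -
  \<comment> \<open>The values of g, normalised to end at the target of the reversed arrow as
    \<open>res_diff_inj\<close> demands.\<close>
  define g0 where "g0 z \<beta> = pm (g (Rev \<beta>) z) (ev (tail Q \<beta>))" for z \<beta>
  have ev_PA: "ev i \<in> (PA :: ('v, 'e, 'k) pvec set)" if "i \<in> verts Q" for i using that by simp
  have g0_ev: "pm (g0 z \<beta>) (ev (tail Q \<beta>)) = g0 z \<beta>" for z \<beta>
    by (simp add: g0_def pmult_assoc pm_pt)
  have rd: "res_diff g0 z = - u 1 (lact (pt z) 1 (mL (tgt z)))" if z: "z \<in> paths" for z
  proof -
    have "pm (DG g (tgt z) z) (ev (tgt z)) = res_diff g0 z"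
      unfolding DG_def res_diff_def g0_def pmult_diff_left pmult_sum_left
      by (intro arg_cong2[of _ _ _ _ "(-)"] sum.cong refl) (auto simp: pmult_assoc pm_pt pcat_def)
    then show ?thesis using loop[OF z] by (simp add: eq_neg_iff_add_eq_0 pmult_add_left u_mL_right[OF u z])
  qed
  have uZ: "u \<in> Zc"
    unfolding Zc_def using u cycle_TR[of u 0] cyc by simp
  have "tr (gcomp (- 1) (lm a) u) = 0" if a: "a \<in> PA" for a
  proof -
    have lin: "gcomp (- 1) (lm a) u = (\<Sum>p\<in>paths. gscale (lk a p) (gcomp (- 1) (lm (pt p)) u))"
    proof (intro ext)
      fix n x
      have s: "(\<Sum>p\<in>S. f p) n x = (\<Sum>p\<in>S. f p n x)" for S and f :: "'v \<times> 'e list \<Rightarrow> ('v, 'e, 'k) gmap"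
        by (induction S rule: infinite_finite_induct) auto
      have "gcomp (- 1) (lm a) u n x = pm (\<Sum>p\<in>paths. lk a p \<odot> pt p) (u n x)"
        using PA_eq_sum[OF a] a by (simp add: lpost_apply[OF u])
      then show "gcomp (- 1) (lm a) u n x = (\<Sum>p\<in>paths. gscale (lk a p) (gcomp (- 1) (lm (pt p)) u)) n x"
        by (simp add: s gscale_def lpost_apply[OF u] pmult_sum_left pmult_scale_left)
    qed
    have "tr (gcomp (- 1) (lm (pt z)) u) = 0" if z: "z \<in> paths" for z
    proof -
      have "tr (gcomp (- 1) (lm (pt z)) u) = (\<Sum>a\<in>frm (tgt z). - lk (res_diff g0 (pcat z a)) a)"
        using tr_cyc[OF uZ, of "pt z"] z
        by (simp add: tr_formula_rpre[OF uZ z] rd pcat_paths cong: conj_cong)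
      also have "\<dots> = 0"
      proof -
        have "g0 z \<beta> \<in> PA" if "\<beta> \<in> arcs Q" for z \<beta>
          unfolding g0_def using that by (intro pmult_closed g) simp
        from res_diff_tot[of g0 z, OF this z] show ?thesis by (simp add: sum_negf)
      qed
      finally show ?thesis .
    qed
    then show ?thesis
      unfolding lin using uZ by (subst tr_sum) (auto simp: Zc_scale Zc_lpost tr_gscale)
  qed
  from tr_nondegenerate[OF u _ this] uZ obtain h where h: "h \<in> hom Q TR RQ 0" "u = dhom TR RQ 0 h"
    by (auto simp: Zc_def)
  have uh: "u 1 y = - h 0 (dif TR 1 y)" for y
    unfolding h(2) by (simp add: dhom_RQ)
  show ?thesis
  proof (rule that[OF h(1) uh])
    fix x assume x: "x \<in> EC (RQ :: ('v, 'e, 'k) cpx) 0"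
    have "FG g x = FG (\<lambda>w z. h 0 (lact (pt z) 0 (mw w))) x"
    proof (rule FG_cong[OF x])
      fix w z assume w: "w \<in> WA" "garc_degree w = 0" and z: "z \<in> paths" "tgt z = srcW w"
      then obtain \<beta> where \<beta>: "w = Rev \<beta>" "\<beta> \<in> arcs Q" "head Q \<beta> = tgt z" by (auto simp: WA_def)
      have "g0 z \<beta> - Yres h z \<beta> = 0"
      proof (rule res_diff_inj[of "\<lambda>z \<beta>. g0 z \<beta> - Yres h z \<beta>", OF _ _ _ z(1) \<beta>(2,3)])
        fix z \<beta> assume zb: "z \<in> paths" "\<beta> \<in> arcs Q" "head Q \<beta> = tgt z"
        show PA: "g0 z \<beta> - Yres h z \<beta> \<in> PA"
          unfolding g0_def using zb by (intro path_algebra_diff pmult_closed Y_PA g) simp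
        have "pm (g0 z \<beta> - Yres h z \<beta>) (ev (tail Q \<beta>)) = g0 z \<beta> - Yres h z \<beta>"
          by (simp add: pmult_diff_left g0_ev Y_right)
        then show "lk (g0 z \<beta> - Yres h z \<beta>) p \<noteq> 0 \<Longrightarrow> tgt p = tail Q \<beta>" for p
          using PA_ev_right[OF PA] by blast
      next
        fix z assume z: "z \<in> paths"
        have "res_diff (Yres h) z = h 0 (lact (pt z) 0 (dif TR 1 (mL (tgt z))))"
          by (simp add: res_diff_Y[OF h(1) z] yf_def)
        also have "\<dots> = h 0 (dif TR 1 (lact (pt z) 1 (mL (tgt z))))"
          using z lact_dif[OF _ mL_in, of "pt z" "tgt z"] by (simp add: tgt_paths)
        finally show "res_diff (\<lambda>z \<beta>. g0 z \<beta> - Yres h z \<beta>) z = 0"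
          by (simp add: res_diff_minus rd[OF z] uh)
      qed
      then have "g0 z \<beta> = h 0 (lact (pt z) 0 (mR \<beta>))"
        using mR_Y_lact[OF \<beta>(2) h(1) z(1)] \<beta>(3) by simp
      then show "pm (g w z) (ev (tgtW w)) = pm (h 0 (lact (pt z) 0 (mw w))) (ev (tgtW w))"
        using \<beta>(1) g0_ev[of z \<beta>] by (simp add: g0_def)
    qed
    also have "\<dots> = h 0 (PhiX RQ 0 x)" by (rule FG_PhiX[OF h(1) x])
    finally show "FG g x = h 0 (PhiX RQ 0 x)" .
  qed
qed

text \<open>By \<open>dual_exact\<close> u bounds some h, and h modifies g to \<open>yfam\<close>.
  What prevents \<open>yfam\<close> from lifting along \<open>res_diff\<close> is its augmentation
  \<open>eps\<close>. Surjectivity of the trace pairing provides a cycle c with the same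
  augmentation, so \<open>yfam\<close> minus the family of c lifts; c - h is the second component of
  the solution.\<close>

lemma Lam_exact_1:
  assumes g: "\<And>w z. g w z \<in> PA" and u: "u \<in> hom Q TR RQ (- 2)"
    and cyc: "\<And>y. y \<in> el TR 3 \<Longrightarrow> u 2 (dif TR 3 y) = 0"
  obtains g' u' where "\<And>w z. g' w z \<in> PA" "u' \<in> hom Q TR RQ (- 1)" "\<And>y. y \<in> el TR 2 \<Longrightarrow> u 2 y = - u' 1 (dif TR 2 y)"
    "\<And>x. x \<in> EC (RQ :: ('v, 'e, 'k) cpx) 1 \<Longrightarrow> FG g x = FG (\<lambda>w z. GD g' w z + u' 1 (lact (pt z) 1 (mw w))) x"
proof -
  have "dhom TR RQ (- 2) u = 0" using cycle_TR[of u 1] u cyc by simp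
  from dual_exact[OF u this] obtain h where h: "h \<in> hom Q TR RQ (- 1)" "u = dhom TR RQ (- 1) h" by auto
  have uh: "u 2 y = h 1 (dif TR 2 y)" for y
    unfolding h(2) by (simp add: dhom_RQ koszul_def)
  have hP: "h 1 x \<in> PA" for x by (rule hom_to_R_in[OF pcTR h(1)])
  define yfam where "yfam z = pm (g (Loop (tgt z)) z) (ev (tgt z)) + h 1 (lact (pt z) 1 (mL (tgt z)))" for z
  define eps where "eps z = (\<Sum>a\<in>frm (tgt z). lk (yfam (pcat z a)) a)" for z
  \<comment> \<open>The augmentation \<open>eps\<close>, an element of DA, as a functional on kQ:
    the one that c has to represent.\<close>
  define l where "l a = (\<Sum>z\<in>paths. lk a z * eps z)" for a
  have "\<exists>u\<in>hom Q TR RQ (- 1). dhom TR RQ (- 1) u = 0 \<and> (\<forall>a\<in>PA. tr (gcomp (- 1) (lm a) u) = l a)"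
    by (rule tr_surj) (auto simp: l_def lookup_add lookup_pscale sum.distrib algebra_simps sum_distrib_left)
  then obtain c where c: "c \<in> Zc" and trc: "\<And>a. a \<in> PA \<Longrightarrow> tr (gcomp (- 1) (lm a) c) = l a"
    by (auto simp: Zc_def)
  note ch = Zc_hom[OF c]
  define y2 where "y2 z = yfam z - c 1 (lact (pt z) 1 (mL (tgt z)))" for z
  have y2_PA: "y2 z \<in> PA" and y2_ev: "pm (y2 z) (ev (tgt z)) = y2 z" if z: "z \<in> paths" for z
  proof -
    have t: "ev (tgt z) \<in> (PA :: ('v, 'e, 'k) pvec set)" using tgt_paths[OF z] by simp
    show "y2 z \<in> PA"
      unfolding y2_def yfam_def
      using g t hP hom_to_R_in[OF pcTR ch] by (intro path_algebra_diff path_algebra_add pmult_closed) auto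
    show "pm (y2 z) (ev (tgt z)) = y2 z"
      by (simp add: y2_def yfam_def pmult_diff_left pmult_add_left u_mL_right[OF h(1) z] u_mL_right[OF ch z] pmult_assoc pm_pt)
  qed
  have rd: "res_diff (res_lift y2) z = y2 z" if z: "z \<in> paths" for z
  proof (rule res_diff_lift[of z y2, OF z y2_PA[OF z]])
    show "lk (y2 z) p \<noteq> 0 \<Longrightarrow> tgt p = tgt z" for p
      using PA_ev_right[OF y2_PA[OF z]] y2_ev[OF z] by blast
    have "(\<Sum>a\<in>frm (tgt z). lk (y2 (pcat z a)) a) = eps z - tr (rpre c (pt z))"
      by (simp add: tr_formula_rpre[OF c z] y2_def eps_def lookup_minus sum_subtractf)
    also have "tr (rpre c (pt z)) = l (pt z)" using z by (simp add: tr_cyc[OF c] trc)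
    also have "l (pt z) = eps z" using z by (simp add: l_def lookup_single when_def sum.delta' if_distrib[of "\<lambda>x. x * _"] cong: if_cong)
    finally show "(\<Sum>a\<in>frm (tgt z). lk (y2 (pcat z a)) a) = 0" by simp
  qed
  define g' where "g' w z = (case w of Rev \<beta> \<Rightarrow> res_lift y2 z \<beta> | _ \<Rightarrow> 0)" for w :: "('v, 'e) garc" and z
  have g'_PA: "g' w z \<in> PA" for w z by (auto simp: g'_def res_lift_PA split: garc.split)
  have u': "c - h \<in> hom Q TR RQ (- 1)" by (rule hom_diff[OF pcTR pcR ch h(1)])
  show ?thesis
  proof (rule that[OF g'_PA u'])
    show "u 2 y = - (c - h) 1 (dif TR 2 y)" if "y \<in> el TR 2" for y
      using Zc_D[OF c that] by (simp add: uh)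
    fix x assume x: "x \<in> EC (RQ :: ('v, 'e, 'k) cpx) 1"
    show "FG g x = FG (\<lambda>w z. GD g' w z + (c - h) 1 (lact (pt z) 1 (mw w))) x"
    proof (rule FG_cong[OF x])
      fix w z assume w: "w \<in> WA" "garc_degree w = 1" and z: "z \<in> paths" "tgt z = srcW w"
      then have w: "w = Loop (tgt z)" by (auto simp: WA_def)
      have "DG g' (tgt z) z = res_diff (res_lift y2) z" by (simp add: DG_def res_diff_def g'_def)
      then have "GD g' w z + (c - h) 1 (lact (pt z) 1 (mw w)) = pm (g w z) (ev (tgt z))"
        using rd[OF z(1)] by (simp add: w GD_def y2_def yfam_def)
      then show "pm (g w z) (ev (tgtW w)) = pm (GD g' w z + (c - h) 1 (lact (pt z) 1 (mw w))) (ev (tgtW w))"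
        by (simp add: w pmult_assoc pm_pt)
    qed
  qed
qed


text \<open>The coordinate at the generator z w. Its value there is an idempotent instead of the
  unit because z w spans a copy of e kQ, with e the idempotent at the target of w.\<close>

definition FGd :: "('v, 'e) garc \<Rightarrow> 'v \<times> 'e list \<Rightarrow> ('v, 'e) garc \<Rightarrow> 'v \<times> 'e list \<Rightarrow> ('v, 'e, 'k) pvec" where
  "FGd w z = (\<lambda>w' z'. if w' = w \<and> z' = z then ev (tgtW w) else 0)"

lemma lk_FGd:
  assumes w: "w \<in> WA"
  shows "lk (FG (FGd w z) x) p = (if (w, p) \<in> Om then lk (x (w, p)) z else 0)"
proof -
  have "pm (lext (FGd w z (fst k)) (x k)) (pt (snd k)) = (if fst k = w then lk (x k) z \<odot> pt (snd k) else 0)"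
    if k: "k \<in> Om" for k
  proof (cases "fst k = w")
    case True
    have "lext (FGd w z w) (x k) = lk (x k) z \<odot> ev (tgtW w)"
    proof (cases "z \<in> ks (x k)")
      case True
      then show ?thesis by (simp add: lext_def FGd_def if_distrib[of "\<lambda>y. _ \<odot> y"] cong: if_cong)
    qed (auto simp: lext_def FGd_def in_keys_iff intro!: sum.neutral)
    moreover have "fst (snd k) = tgtW w" using k True by (auto simp: Om_def)
    ultimately show ?thesis using True by (simp add: pmult_scale_left pm_pt pcat_Nil_left)
  next
    case False
    then show ?thesis by (simp add: FGd_def lext_def)
  qed
  then have "lk (FG (FGd w z) x) p = (\<Sum>k\<in>Om. if k = (w, p) then lk (x k) z else 0)"
    unfolding FG_def lk_sum
    by (intro sum.cong refl) (auto simp: lookup_pscale lookup_single when_def prod_eq_iff)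
  then show ?thesis by simp
qed

text \<open>The element z w a of kQ \<otimes> \<Theta>; \<open>Ud\<close> and \<open>FGd\<close>
  form a dual basis.\<close>

definition Ud :: "('v, 'e) garc \<Rightarrow> 'v \<times> 'e list \<Rightarrow> ('v, 'e, 'k) pvec \<Rightarrow> ('v, 'e) wpath \<Rightarrow> ('v, 'e, 'k) pvec" where
  "Ud w z a = (\<lambda>k. if k \<in> Om \<and> fst k = w then lk a (snd k) \<odot> pt z else 0)"

lemma Ud_EC:
  assumes "z \<in> paths" "tgt z = srcW w"
  shows "Ud w z a \<in> EC RQ (garc_degree w)"
proof -
  interpret E: right_dg Q "el RQ" "dif RQ" "act RQ :: _ \<Rightarrow> _ \<Rightarrow> ('v, 'e, 'k) pvec \<Rightarrow> _" by (rule rdg_X[OF pcR])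
  have "ev (srcW (fst k)) \<in> (PA :: ('v, 'e, 'k) pvec set)" if "k \<in> Om" for k
    using Om_srcW[OF that] by simp
  then show ?thesis
    unfolding E.Ecar_def
    using assms by (auto simp: Ud_def el_R act_R path_algebra_scale path_algebra_zero pmult_scale_left pm_pt)
qed

lemma FG_Ud:
  assumes w: "w \<in> WA" and a: "a \<in> PA"
  shows "FG g (Ud w z a) = pm (pm (g w z) (ev (tgtW w))) a"
proof -
  define h where "h p = (if fst p = tgtW w then lk a p \<odot> pm (g w z) (pt p) else 0)" for p
  have "FG g (Ud w z a) = (\<Sum>k\<in>Om. if fst k = w then h (snd k) else 0)"
    unfolding FG_def
    by (intro sum.cong refl) (auto simp: Ud_def h_def lext_scale pmult_scale_left lext_zero Om_def lext_single)
  also have "\<dots> = (\<Sum>k\<in>Pair w ` paths. h (snd k))"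
  proof (rule sum.mono_neutral_cong[OF _ finite_Om])
  qed (use w in \<open>auto simp: h_def Om_def\<close>)
  also have "\<dots> = (\<Sum>p\<in>paths. h p)" by (subst sum.reindex) (auto simp: inj_on_def)
  also have "\<dots> = (\<Sum>p\<in>paths. lk a p \<odot> pm (pm (g w z) (ev (tgtW w))) (pt p))"
  proof (rule sum.cong[OF refl])
    fix p
    show "h p = lk a p \<odot> pm (pm (g w z) (ev (tgtW w))) (pt p)"
      by (cases "fst p = tgtW w") (simp_all add: h_def pmult_assoc pm_pt pm_pt_0 pcat_Nil_left)
  qed
  also have "\<dots> = pm (pm (g w z) (ev (tgtW w))) (\<Sum>p\<in>paths. lk a p \<odot> pt p)"
    by (simp add: pmult_sum_right pmult_scale_right)
  also have "(\<Sum>p\<in>paths. lk a p \<odot> pt p) = a" by (rule PA_eq_sum[OF a, symmetric])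
  finally show ?thesis .
qed

lemma EC_RQ_eq_sum:
  assumes x: "x \<in> EC RQ m"
  shows "x = (\<Sum>(w, z) | w \<in> WA \<and> z \<in> paths \<and> tgt z = srcW w \<and> garc_degree w = m. Ud w z (FG (FGd w z) x))"
    (is "_ = sum _ ?I")
proof (rule ext)
  fix k :: "('v, 'e) wpath"
  interpret E: right_dg Q "el RQ" "dif RQ" "act RQ :: _ \<Rightarrow> _ \<Rightarrow> ('v, 'e, 'k) pvec \<Rightarrow> _" by (rule rdg_X[OF pcR])
  have fin: "finite ?I" by (rule finite_subset[of _ "WA \<times> paths"]) (auto simp: WA_def)
  have s: "(\<Sum>i\<in>S. f i) k = (\<Sum>i\<in>S. f i k)" for S and f :: "_ \<Rightarrow> _ \<Rightarrow> ('v, 'e, 'k) pvec"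
    by (induction S rule: infinite_finite_induct) auto
  show "x k = (\<Sum>(w, z)\<in>?I. Ud w z (FG (FGd w z) x)) k"
  proof (cases "k \<in> Om")
    case False
    then show ?thesis using E.Ecar_out[OF x] by (simp add: s Ud_def case_prod_beta)
  next
    case True
    define h where "h j = (if fst j = fst k then lk (x k) (snd j) \<odot> pt (snd j) else 0)" for j
    have nz: "tgt z = srcW (fst k) \<and> kd k = m" if "lk (x k) z \<noteq> 0" for z
    proof
      show "kd k = m" using that EC_RQ_zero[OF x True] by (metis lookup_zero)
      show "tgt z = srcW (fst k)"
        using that EC_RQ_ev[OF x True] lk_idem_right[of Q "x k" "srcW (fst k)" z] by (auto split: if_splits)
    qed
    have "(\<Sum>(w, z)\<in>?I. Ud w z (FG (FGd w z) x)) k = (\<Sum>j\<in>?I. h j)"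
      unfolding s by (rule sum.cong[OF refl]) (use True in \<open>auto simp: Ud_def h_def lk_FGd\<close>)
    also have "\<dots> = (\<Sum>j\<in>Pair (fst k) ` paths. h j)"
    proof (rule sum.mono_neutral_cong[OF _ fin])
      show "h j = 0" if "j \<in> Pair (fst k) ` paths - ?I" for j
      proof -
        have "fst k \<in> WA" using True by (auto simp: Om_def)
        then have "lk (x k) (snd j) = 0" using that nz[of "snd j"] by auto
        then show ?thesis by (simp add: h_def)
      qed
    qed (auto simp: h_def)
    also have "\<dots> = (\<Sum>z\<in>paths. lk (x k) z \<odot> pt z)" by (subst sum.reindex) (auto simp: inj_on_def h_def)
    also have "\<dots> = x k" by (rule PA_eq_sum[OF EC_RQ_PA[OF x True], symmetric])
    finally show ?thesis by simp
  qed
qed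

text \<open>The cases follow the degrees of \<Theta>. In degree 0 the trace has to be nondegenerate,
  in degree 1 it has to represent all functionals, and in every other degree the functional lives on
  TR alone, where \<open>dual_exact\<close> decides.\<close>

lemma Lam_exact:
  assumes v: "v \<in> Lam m" and cyc: "\<forall>x\<in>CX RQ (m + 1). v (dCX RQ (m + 1) x) = 0"
  shows "\<exists>w\<in>Lam (m - 1). \<forall>x\<in>CX RQ m. v x = w (dCX RQ m x)"
proof -
  interpret E: right_dg Q "el RQ" "dif RQ" "act RQ :: _ \<Rightarrow> _ \<Rightarrow> ('v, 'e, 'k) pvec \<Rightarrow> _" by (rule rdg_X[OF pcR])
  interpret EE: ab_complex "EC (RQ :: ('v, 'e, 'k) cpx)" "dEC RQ" by (rule E.E_complex)
  interpret C: ab_complex "CX RQ" "dCX RQ" by (rule CX_complex[OF pcR])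
  obtain g u where g: "\<And>w z. g w z \<in> PA" and u: "u \<in> hom Q TR RQ (- (m + 1))"
    and vg: "\<And>c. c \<in> CX RQ m \<Longrightarrow> v c = FG g (fst c) + u (m + 1) (snd c)"
    using v by (elim LamE) blast
  have vD: "FG (\<lambda>w z. GD g w z + u (m + 1) (lact (pt z) (m + 1) (mw w))) (fst c) = u (m + 1) (dif TR (m + 2) (snd c))"
    if c: "c \<in> CX RQ (m + 1)" for c
    using Lam_D_formula[OF u c, of g] cyc[rule_format, OF c] C.D_in[OF c] vg by (simp add: add.assoc)
  have cy: "u (m + 1) (dif TR (m + 2) y) = 0" if "y \<in> el TR (m + 2)" for y
  proof -
    have "(0, y) \<in> CX RQ (m + 1)" using that EE.zero by (simp add: cone_el_def add.assoc)
    from vD[OF this] show ?thesis by (simp add: FG_zero)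
  qed
  have G0: "GD (\<lambda>_ _. 0) w z = 0" for w z by (cases w) (simp_all add: GD_def DG_def)
  have "\<exists>g' u'. (\<forall>w z. g' w z \<in> PA) \<and> u' \<in> hom Q TR RQ (- m) \<and> (\<forall>y\<in>el TR (m + 1). u (m + 1) y = - u' m (dif TR (m + 1) y)) \<and>
      (\<forall>x\<in>EC RQ m. FG g x = FG (\<lambda>w z. GD g' w z + u' m (lact (pt z) m (mw w))) x)"
  proof -
    consider "m = 0" | "m = 1" | "m \<noteq> 0" "m \<noteq> 1" by blast
    then show ?thesis
    proof cases
      case 1
      have "pm (DG g (tgt z) z + u 1 (lact (pt z) 1 (mL (tgt z)))) (ev (tgt z)) = 0" if z: "z \<in> paths" for z
      proof -
        let ?w = "Loop (tgt z) :: ('v, 'e) garc"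
        have t: "tgt z \<in> verts Q" "?w \<in> WA" using tgt_paths[OF z] by (auto simp: WA_def)
        \<comment> \<open>Closedness is evaluated at the generator z t, with t the loop at the end
          of z.\<close>
        have "Ud ?w z (ev (tgt z)) \<in> EC RQ 1" using Ud_EC[of z ?w "ev (tgt z)"] z by simp
        then have "(Ud ?w z (ev (tgt z)), 0) \<in> CX RQ (m + 1)" using 1 by (simp add: cone_el_def el_zero[OF pcTR])
        from vD[OF this] have "FG (\<lambda>w z. GD g w z + u 1 (lact (pt z) 1 (mw w))) (Ud ?w z (ev (tgt z))) = 0"
          using 1 by (simp add: d_zero[OF pcTR] hom_TR_zero[OF u])
        then show ?thesis using t by (simp add: FG_Ud GD_def pmult_assoc pm_pt)
      qed
      with 1 u cy obtain h where "h \<in> hom Q TR RQ 0" "\<And>y. u 1 y = - h 0 (dif TR 1 y)"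
        "\<And>x. x \<in> EC RQ 0 \<Longrightarrow> FG g x = h 0 (PhiX RQ 0 x)"
        using Lam_exact_0[of g u] g by (metis add_0 uminus_add_conv_diff add.inverse_neutral diff_0)
      then show ?thesis using 1
        by (rule_tac exI[of _ "\<lambda>_ _. 0"], rule_tac exI[of _ h]) (auto simp: path_algebra_zero G0 FG_PhiX)
    next
      case 2
      have u2: "u \<in> hom Q TR RQ (- 2)" and cy2: "\<And>y. y \<in> el TR 3 \<Longrightarrow> u 2 (dif TR 3 y) = 0"
        using u cy 2 by simp_all
      show ?thesis
      proof (rule Lam_exact_1[of g u, OF g u2 cy2])
        fix g' u'
        assume "\<And>w z. g' w z \<in> PA" "u' \<in> hom Q TR RQ (- 1)" "\<And>y. y \<in> el TR 2 \<Longrightarrow> u 2 y = - u' 1 (dif TR 2 y)"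
          "\<And>x. x \<in> EC RQ 1 \<Longrightarrow> FG g x = FG (\<lambda>w z. GD g' w z + u' 1 (lact (pt z) 1 (mw w))) x"
        then show ?thesis using 2
          by (rule_tac exI[of _ g'], rule_tac exI[of _ u']) simp
      qed
    next
      case 3
      have "dhom TR RQ (- (m + 1)) u = 0" by (rule cycle_TR[OF u cy])
      from dual_exact[OF u this] 3 obtain h where h: "h \<in> hom Q TR RQ (- m)" "u = dhom TR RQ (- m) h" by auto
      have k: "koszul m h \<in> hom Q TR RQ (- m)" using h(1) by (simp add: koszul_def hom_uminus[OF pcTR pcR])
      show ?thesis
      proof (rule exI[of _ "\<lambda>_ _. 0"], rule exI[of _ "koszul m h"], intro conjI ballI allI k)
        show "u (m + 1) y = - koszul m h m (dif TR (m + 1) y)" for y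
          by (simp add: h(2) dhom_RQ koszul_apply) (simp add: koszul_def)
        show "FG g x = FG (\<lambda>w z. GD (\<lambda>_ _. 0) w z + koszul m h m (lact (pt z) m (mw w))) x" if x: "x \<in> EC RQ m" for x
          by (rule FG_cong[OF x]) (use 3 in \<open>auto simp: WA_def\<close>)
      qed (simp add: path_algebra_zero)
    qed
  qed
  then obtain g' u' where g': "\<And>w z. g' w z \<in> PA" and u': "u' \<in> hom Q TR RQ (- m)"
    and uu: "\<And>y. y \<in> el TR (m + 1) \<Longrightarrow> u (m + 1) y = - u' m (dif TR (m + 1) y)"
    and gg: "\<And>x. x \<in> EC RQ m \<Longrightarrow> FG g x = FG (\<lambda>w z. GD g' w z + u' m (lact (pt z) m (mw w))) x"
    by blast
  show ?thesis
  proof (intro bexI[of _ "\<lambda>c. FG g' (fst c) + u' m (snd c)"] ballI)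
    fix c assume c: "c \<in> CX RQ m"
    show "v c = FG g' (fst (dCX RQ m c)) + u' m (snd (dCX RQ m c))"
      using Lam_D_formula[OF u' c, of g'] vg[OF c] uu[OF CX_snd[OF c]] gg[OF CX_fst[OF c]] by simp
  qed (rule LamI[of g' u'], use g' u' in auto)
qed

text \<open>The dual basis of the cone joins the generators z w of kQ \<otimes> \<Theta> with dual
  bases of the modules of TR, and the exactness of the dual complex is
  \<open>Lam_exact\<close>.\<close>

lemma CX_RQ_exact: "exact_cpx (CX RQ) (dCX RQ)"
proof -
  define B where "B n N u v \<longleftrightarrow> (\<forall>j<N. u j \<in> el TR n \<and> v j \<in> hom Q TR RQ (- n)) \<and>
    (\<forall>x\<in>el TR n. x = (\<Sum>j<N. act TR n (u j) (v j n x)))" for n and N :: nat and u v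
  have "\<forall>n. \<exists>N u v. B n N u v" using dual_basis_cpx[OF pcTR] by (simp add: B_def)
  then obtain N u v where B: "\<And>n. B n (N n) (u n) (v n)" by metis
  have u_in: "j < N n \<Longrightarrow> u n j \<in> el TR n" and v_in: "j < N n \<Longrightarrow> v n j \<in> hom Q TR RQ (- n)"
    and uv: "x \<in> el TR n \<Longrightarrow> x = (\<Sum>j<N n. act TR n (u n j) (v n j n x))" for n j x
    using B[of n] by (auto simp: B_def)
  define I where "I m = {(w, z). w \<in> WA \<and> z \<in> paths \<and> tgt z = srcW w \<and> garc_degree w = m}" for m
  \<comment> \<open>The indices on the right carry m themselves, because \<open>U\<close> and
    \<open>W\<close> take no degree as argument.\<close>
  define J where "J m = Inl ` I m \<union> Inr ` ({m} \<times> {..<N (m + 1)})" for m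
  define U where "U j a = (case j of Inl (w, z) \<Rightarrow> (Ud w z a, 0) | Inr (m, i) \<Rightarrow> (0, act TR (m + 1) (u (m + 1) i) a))"
    for j and a :: "('v, 'e, 'k) pvec"
  define W where "W j c = (case j of Inl (w, z) \<Rightarrow> FG (FGd w z) (fst c) | Inr (m, i) \<Rightarrow> v (m + 1) i (m + 1) (snd c))"
    for j and c :: "(('v, 'e) wpath \<Rightarrow> ('v, 'e, 'k) pvec) \<times> ('v, 'e, 'k) pvec"
  have Jc: "(\<exists>w z. j = Inl (w, z) \<and> (w, z) \<in> I m) \<or> (\<exists>i. j = Inr (m, i) \<and> i < N (m + 1))" if "j \<in> J m" for j m
  proof (cases j)
    case (Inl x)
    then show ?thesis using that by (cases x) (auto simp: J_def)
  qed (use that in \<open>auto simp: J_def\<close>)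
  interpret E: right_dg Q "el RQ" "dif RQ" "act RQ :: _ \<Rightarrow> _ \<Rightarrow> ('v, 'e, 'k) pvec \<Rightarrow> _" by (rule rdg_X[OF pcR])
  interpret EE: ab_complex "EC (RQ :: ('v, 'e, 'k) cpx)" "dEC RQ" by (rule E.E_complex)
  have finI: "finite (I m)" for m by (rule finite_subset[of _ "WA \<times> paths"]) (auto simp: I_def WA_def)
  obtain N0 where N0: "\<And>i. \<bar>i\<bar> > N0 \<Longrightarrow> el TR i = {0}" using pcTR unfolding proj_complex_def by blast
  show ?thesis
  \<comment> \<open>Above degree 1 nothing of kQ \<otimes> \<Theta> is left, and above N0 nothing of
    TR.\<close>
  proof (rule exact_if_dual_exact[where \<Lambda> = Lam and Rg = PA and J = J and W = W and U = U and N = "max N0 1"])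
    show "ab_complex (CX RQ) (dCX RQ)" by (rule CX_complex[OF pcR])
  next
    fix m w x y assume w: "w \<in> Lam m" and x: "x \<in> CX RQ m" and y: "y \<in> CX RQ m"
    have "x - y \<in> CX RQ m" by (rule ab_complex.diff[OF CX_complex[OF pcR] x y])
    with w x y show "w (x - y) = w x - w y"
      by (elim LamE) (simp add: FG_diff h_diff[OF pcTR] CX_snd)
  next
    show "(\<lambda>_. 0) \<in> Lam m" for m
      by (rule LamI[of "\<lambda>_ _. 0" 0]) (auto simp: path_algebra_zero hom_zero[OF pcTR pcR] FG_fun_zero)
  next
    fix m v w assume "v \<in> Lam m" "w \<in> Lam m"
    then obtain g u g' u' where *: "\<And>w z. g w z \<in> PA" "u \<in> hom Q TR RQ (- (m + 1))"
      "\<And>c. c \<in> CX RQ m \<Longrightarrow> v c = FG g (fst c) + u (m + 1) (snd c)"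
      "\<And>w z. g' w z \<in> PA" "u' \<in> hom Q TR RQ (- (m + 1))"
      "\<And>c. c \<in> CX RQ m \<Longrightarrow> w c = FG g' (fst c) + u' (m + 1) (snd c)"
      by (elim LamE) blast
    show "(\<lambda>x. v x - w x) \<in> Lam m"
      by (rule LamI[of "\<lambda>w z. g w z - g' w z" "u - u'"])
        (use * in \<open>auto simp: path_algebra_diff hom_diff[OF pcTR pcR] FG_fun_diff\<close>)
  next
    fix m v w assume "v \<in> Lam m" and *: "\<And>x. x \<in> CX RQ m \<Longrightarrow> w x = v x"
    then obtain g u where "\<And>w z. g w z \<in> PA" "u \<in> hom Q TR RQ (- (m + 1))"
      "\<And>c. c \<in> CX RQ m \<Longrightarrow> v c = FG g (fst c) + u (m + 1) (snd c)" by (elim LamE) blast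
    then show "w \<in> Lam m" using * by (intro LamI[of g u]) auto
  next
    fix m v assume "v \<in> Lam m"
    then obtain g u where g: "\<And>w z. g w z \<in> PA" and u: "u \<in> hom Q TR RQ (- (m + 1))"
      and vg: "\<And>c. c \<in> CX RQ m \<Longrightarrow> v c = FG g (fst c) + u (m + 1) (snd c)" by (elim LamE) blast
    show "(\<lambda>x. v (dCX RQ (m + 1) x)) \<in> Lam (m + 1)"
    proof (rule LamI[of "\<lambda>w z. GD g w z + u (m + 1) (lact (pt z) (m + 1) (mw w))" "- gcomp (- 1) u (dif TR)"])
      show "GD g w z + u (m + 1) (lact (pt z) (m + 1) (mw w)) \<in> PA" for w z
        using g GD_PA hom_to_R_in[OF pcTR u] by (intro path_algebra_add) auto
      have "gcomp (- 1) u (dif TR) \<in> hom Q TR RQ (- 1 + - (m + 1))"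
        by (rule gcomp_hom[OF pcTR pcTR dif_hom[OF pcTR] u])
      moreover have "- 1 + - (m + 1) = - (m + 1 + 1)" by simp
      moreover have i: "m + 1 + 1 = m + 2" "m + 2 + - 1 = m + 1" by simp_all
      have e: "gcomp (- 1) u (dif TR) (m + 2) y = u (m + 1) (dif TR (m + 2) y)" for y
        by (simp only: gcomp_def i)
      ultimately show "- gcomp (- 1) u (dif TR) \<in> hom Q TR RQ (- (m + 1 + 1))"
        using hom_uminus[OF pcTR pcR] by metis
      fix c assume c: "c \<in> CX RQ (m + 1)"
      then have "dCX RQ (m + 1) c \<in> CX RQ m" using ab_complex.D_in[OF CX_complex[OF pcR] c] by simp
      then show "v (dCX RQ (m + 1) c) = FG (\<lambda>w z. GD g w z + u (m + 1) (lact (pt z) (m + 1) (mw w))) (fst c) +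
          (- gcomp (- 1) u (dif TR)) (m + 1 + 1) (snd c)"
        using Lam_D_formula[OF u c, of g] unfolding i by (simp add: vg e)
    qed
  next
    show "finite (J m)" for m using finI by (simp add: J_def)
  next
    fix m j assume "j \<in> J m"
    then consider w z where "j = Inl (w, z)" "(w, z) \<in> I m" | i where "j = Inr (m, i)" "i < N (m + 1)"
      using Jc[of j m] by blast
    then show "W j \<in> Lam m"
    proof cases
      case 1
      then have "tgtW w \<in> verts Q" by (auto simp: I_def WA_def)
      then show ?thesis using 1
        by (intro LamI[of "FGd w z" 0]) (auto simp: W_def hom_zero[OF pcTR pcR] FGd_def path_algebra_zero)
    next
      case 2
      then show ?thesis
        by (intro LamI[of "\<lambda>_ _. 0" "v (m + 1) i"]) (use v_in[of i "m + 1"] in \<open>auto simp: W_def FG_fun_zero path_algebra_zero\<close>)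
    qed
  next
    fix m v x assume "v \<in> Lam m" and x: "x \<in> CX RQ m"
    then show "v x \<in> PA" by (elim LamE) (auto intro!: path_algebra_add FG_PA intro: hom_to_R_in[OF pcTR])
  next
    fix m j and a :: "('v, 'e, 'k) pvec" assume "j \<in> J m" and a: "a \<in> PA"
    then consider w z where "j = Inl (w, z)" "(w, z) \<in> I m" | i where "j = Inr (m, i)" "i < N (m + 1)"
      using Jc[of j m] by blast
    then show "U j a \<in> CX RQ m"
    proof cases
      case 1
      then show ?thesis using Ud_EC[of z w a] by (auto simp: U_def I_def cone_el_def el_zero[OF pcTR])
    next
      case 2
      then show ?thesis using el_act[OF pcTR u_in a] EE.zero by (auto simp: U_def cone_el_def)
    qed
  next
    fix m j assume "j \<in> J m"
    then consider w z where "j = Inl (w, z)" "(w, z) \<in> I m" | i where "j = Inr (m, i)" "i < N (m + 1)"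
      using Jc[of j m] by blast
    then show "U j 0 = 0"
      by cases (auto simp: U_def Ud_def zero_prod_def fun_eq_iff act_zero_right[OF pcTR] u_in)
  next
    fix m x assume x: "x \<in> CX RQ m"
    have "(\<Sum>j\<in>J m. U j (W j x)) = (\<Sum>j\<in>I m. (case j of (w, z) \<Rightarrow> (Ud w z (FG (FGd w z) (fst x)), 0))) +
        (\<Sum>i<N (m + 1). (0, act TR (m + 1) (u (m + 1) i) (v (m + 1) i (m + 1) (snd x))))"
      unfolding J_def
      by (subst sum.union_disjoint)
        (auto simp: finI sum.reindex sum.cartesian_product' U_def W_def case_prod_beta)
    also have "\<dots> = (\<Sum>(w, z)\<in>I m. Ud w z (FG (FGd w z) (fst x)), \<Sum>i<N (m + 1). act TR (m + 1) (u (m + 1) i) (v (m + 1) i (m + 1) (snd x)))"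
      by (simp add: sum_prod case_prod_beta)
    also have "\<dots> = x"
      using EC_RQ_eq_sum[OF CX_fst[OF x]] uv[OF CX_snd[OF x]] by (auto simp: I_def intro: prod_eqI)
    finally show "x = (\<Sum>j\<in>J m. U j (W j x))" by simp
  next
    fix m m' j v' w assume j: "j \<in> J m" and v': "v' \<in> Lam m" and w: "w \<in> Lam m'"
    obtain g u' where g: "\<And>w z. g w z \<in> PA" and u': "u' \<in> hom Q TR RQ (- (m + 1))"
      and vg: "\<And>c. c \<in> CX RQ m \<Longrightarrow> v' c = FG g (fst c) + u' (m + 1) (snd c)" using v' by (elim LamE) blast
    obtain h t where h: "\<And>w z. h w z \<in> PA" and t: "t \<in> hom Q TR RQ (- (m' + 1))"
      and wh: "\<And>c. c \<in> CX RQ m' \<Longrightarrow> w c = FG h (fst c) + t (m' + 1) (snd c)" using w by (elim LamE) blast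
    \<comment> \<open>The composite of a functional with \<open>U j\<close> is a kQ-linear
      endomorphism of kQ, hence left multiplication by some b, and such multiplications preserve
      \<open>Lam\<close>.\<close>
    have "\<exists>b\<in>PA. \<forall>a\<in>PA. v' (U j a) = pm b a"
    proof -
      consider w z where "j = Inl (w, z)" "(w, z) \<in> I m" | i where "j = Inr (m, i)" "i < N (m + 1)"
        using Jc[OF j] by blast
      then show ?thesis
      proof cases
        case 1
        then have w: "w \<in> WA" "tgtW w \<in> verts Q" by (auto simp: I_def WA_def)
        have "U j a \<in> CX RQ m" for a
          using 1 Ud_EC[of z w a] by (auto simp: U_def I_def cone_el_def el_zero[OF pcTR])
        then show ?thesis using 1 w g
          by (intro bexI[of _ "pm (g w z) (ev (tgtW w))"] pmult_closed g)
            (auto simp: vg U_def FG_Ud hom_TR_zero[OF u'])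
      next
        case 2
        have "U j a \<in> CX RQ m" if "a \<in> PA" for a
          using 2 el_act[OF pcTR u_in that] EE.zero by (auto simp: U_def cone_el_def)
        then show ?thesis using 2 hom_to_R_in[OF pcTR u'] u_in
          by (intro bexI[of _ "u' (m + 1) (u (m + 1) i)"]) (auto simp: vg U_def FG_zero hom_to_R_act[OF pcTR u'])
      qed
    qed
    then obtain b where b: "b \<in> PA" "\<And>a. a \<in> PA \<Longrightarrow> v' (U j a) = pm b a" by blast
    show "(\<lambda>x. v' (U j (w x))) \<in> Lam m'"
    proof (rule LamI[of "\<lambda>w z. pm b (h w z)" "gcomp (- (m' + 1)) (lm b) t"])
      show "pm b (h w z) \<in> PA" for w z using b h by (intro pmult_closed)
      show "gcomp (- (m' + 1)) (lm b) t \<in> hom Q TR RQ (- (m' + 1))" using t b by (intro lpost_hom)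
      fix c assume c: "c \<in> CX RQ m'"
      have "w c \<in> PA" using wh[OF c] h hom_to_R_in[OF pcTR t] by (auto intro!: path_algebra_add FG_PA)
      then show "v' (U j (w c)) = FG (\<lambda>w z. pm b (h w z)) (fst c) + gcomp (- (m' + 1)) (lm b) t (m' + 1) (snd c)"
        using b wh[OF c] lpost_apply[OF t b(1), of "m' + 1" "snd c"] by (simp add: FG_lmult pmult_add_right)
    qed
  next
    show "\<lbrakk>v \<in> Lam m; \<forall>x\<in>CX RQ (m + 1). v (dCX RQ (m + 1) x) = 0\<rbrakk> \<Longrightarrow> \<exists>w\<in>Lam (m - 1). \<forall>x\<in>CX RQ m. v x = w (dCX RQ m x)" for m v
      by (rule Lam_exact)
  next
    fix m :: int assume m: "m > max N0 1"
    have "x k = 0" if x: "x \<in> EC RQ m" for x :: "_ \<Rightarrow> ('v, 'e, 'k) pvec" and k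
    proof (cases "k \<in> Om")
      case True
      then have "kd k \<le> 1" by (erule_tac Om_cases) auto
      then show ?thesis using EC_RQ_zero[OF x True] m by auto
    qed (rule E.Ecar_out[OF x])
    then have "EC RQ m = {0 :: _ \<Rightarrow> ('v, 'e, 'k) pvec}" using EE.zero by (auto simp: fun_eq_iff)
    moreover have "el TR (m + 1) = {0}" using N0 m by auto
    ultimately show "CX RQ m = {0}" by (auto simp: cone_el_def zero_prod_def)
  qed
qed

lemma CX_is_exact: "proj_complex Q X \<Longrightarrow> exact_cpx (CX X) (dCX X)"
  by (rule CX_exact[OF CX_RQ_exact])

end

section \<open>The Ginzburg algebra\<close>

text \<open>The weight in the bigrading of the Ginzburg algebra; it will be the index n of the
  summand of the orbit algebra.\<close>

primrec awt :: "('v, 'e) garc \<Rightarrow> nat" where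
  "awt (Arr \<alpha>) = 0" | "awt (Rev \<alpha>) = 1" | "awt (Loop i) = 1"

definition gwt :: "'v \<times> ('v, 'e) garc list \<Rightarrow> nat" where
  "gwt p = sum_list (map awt (snd p))"

lemma gwt_simps [simp]: "gwt (u, []) = 0" "gwt (u, a # as) = awt a + gwt (v, as)" "gwt (u, as @ bs) = gwt (u, as) + gwt (v, bs)"
  by (simp_all add: gwt_def)

lemma gdeg_simps [simp]: "gpath_degree (u, []) = 0" "gpath_degree (u, a # as) = garc_degree a + gpath_degree (v, as)"
    "gpath_degree (u, as @ bs) = gpath_degree (u, as) + gpath_degree (v, bs)"
  by (simp_all add: gpath_degree_def)

lemma keys_pmult:
  assumes "r \<in> ks (pmult G x y)"
  obtains p q where "p \<in> ks x" "q \<in> ks y" "path_target G p = fst q" "r = (fst p, snd p @ snd q)"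
  using assms keys_lext[of "\<lambda>p. lext (path_prod G p) y" x] keys_lext[of "path_prod G _" y] that
  unfolding pmult_lext by (fastforce simp: path_prod_def split: if_splits)

context quiver
begin

lemma fin_GQ: "fin_digraph GQ"
  by unfold_locales auto

interpretation G: fin_digraph GQ by (rule fin_GQ)

abbreviation gtgt :: "'v \<times> ('v, 'e) garc list \<Rightarrow> 'v" where "gtgt \<equiv> path_target GQ"
abbreviation gm :: "('v, 'e, 'k::field) gvec \<Rightarrow> ('v, 'e, 'k) gvec \<Rightarrow> ('v, 'e, 'k) gvec" where
  "gm \<equiv> pmult GQ"

text \<open>Homogeneous for weight and degree and with fixed end points. The end points are recorded
  so that products of pieces that do not meet are known to vanish, as the Leibniz rule requires for
  paths that cannot be composed.\<close>

definition GH :: "nat \<Rightarrow> int \<Rightarrow> 'v \<Rightarrow> 'v \<Rightarrow> ('v, 'e, 'k::field) gvec set" where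
  "GH n m u v = {x. \<forall>q\<in>ks x. is_path GQ q \<and> gwt q = n \<and> gpath_degree q = m \<and> fst q = u \<and> gtgt q = v}"

lemma GH_zero: "0 \<in> GH n m u v"
  by (simp add: GH_def)

lemma GH_add: "x \<in> GH n m u v \<Longrightarrow> y \<in> GH n m u v \<Longrightarrow> x + y \<in> GH n m u v"
  using keys_add[of x y] unfolding GH_def by blast

lemma GH_uminus: "x \<in> GH n m u v \<Longrightarrow> - x \<in> GH n m u v"
  by (simp add: GH_def in_keys_iff)

lemma GH_diff: "x \<in> GH n m u v \<Longrightarrow> y \<in> GH n m u v \<Longrightarrow> x - y \<in> GH n m u v"
  using GH_add[of x n m u v "- y"] by (simp add: GH_uminus)

lemma GH_koszul: "x \<in> GH n m u v \<Longrightarrow> koszul i x \<in> GH n m u v"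
  by (simp add: koszul_def GH_uminus)

lemma GH_sum: "(\<And>i. i \<in> I \<Longrightarrow> f i \<in> GH n m u v) \<Longrightarrow> sum f I \<in> GH n m u v"
  by (induction I rule: infinite_finite_induct) (auto simp: GH_zero GH_add)

lemma GH_single: "is_path GQ p \<Longrightarrow> gwt p = n \<Longrightarrow> gpath_degree p = m \<Longrightarrow> fst p = u \<Longrightarrow> gtgt p = v \<Longrightarrow> sg p c \<in> GH n m u v"
  by (simp add: GH_def)

lemma gtgt_Nil [simp]: "gtgt (u, []) = u"
  by (simp add: path_target_def)

lemma GH_mult:
  assumes x: "x \<in> GH n m u v" and y: "y \<in> GH n' m' v w"
  shows "gm x y \<in> GH (n + n') (m + m') u w"
  unfolding GH_def
proof (intro CollectI ballI)
  fix r assume "r \<in> ks (gm x y)"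
  then obtain p q where pq: "p \<in> ks x" "q \<in> ks y" "gtgt p = fst q" "r = (fst p, snd p @ snd q)" by (rule keys_pmult)
  then show "is_path GQ r \<and> gwt r = n + n' \<and> gpath_degree r = m + m' \<and> fst r = u \<and> gtgt r = w"
    using x y path_target_append[OF pq(3)]
    by (cases p; cases q) (fastforce simp: GH_def G.is_path_append gwt_def gpath_degree_def)
qed

lemma GH_mult_zero: "x \<in> GH n m u v \<Longrightarrow> y \<in> GH n' m' v' w \<Longrightarrow> v \<noteq> v' \<Longrightarrow> gm x y = 0"
proof -
  assume "x \<in> GH n m u v" "y \<in> GH n' m' v' w" "v \<noteq> v'"
  then have "ks (gm x y) = {}" by (fastforce simp: GH_def elim!: keys_pmult)
  then show ?thesis by simp
qed

lemma GH_left_unit: "x \<in> GH n m u v \<Longrightarrow> gm (sg (u, []) 1) x = x"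
  and GH_right_unit: "x \<in> GH n m u v \<Longrightarrow> gm x (sg (v, []) 1) = x"
  by (auto simp: GH_def intro!: G.pmult_single_Nil_left G.pmult_single_Nil_right)

definition gdd :: "('v, 'e, 'k::field) gvec \<Rightarrow> ('v, 'e, 'k) gvec" where
  "gdd x = lext (\<lambda>p. gpath_diff Q (fst p) (snd p)) x"

lemma gdd_add: "gdd (x + y) = gdd x + gdd y"
  and gdd_scale: "gdd (c \<odot> x) = c \<odot> gdd x"
  and gdd_diff: "gdd (x - y) = gdd x - gdd y"
  and gdd_zero: "gdd 0 = 0"
  and gdd_sum: "gdd (sum f I) = (\<Sum>i\<in>I. gdd (f i))"
  and gdd_koszul: "gdd (koszul m x) = koszul m (gdd x)"
  and gdd_single: "gdd (sg p c) = c \<odot> gpath_diff Q (fst p) (snd p)"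
  by (simp_all add: gdd_def lext_add lext_scale lext_diff lext_sum lext_koszul)

lemma garc_diff_GH: "a \<in> arcs GQ \<Longrightarrow> garc_diff Q a \<in> GH (awt a) (garc_degree a - 1) (tail GQ a) (head GQ a)"
  by (cases a) (auto intro!: GH_zero GH_diff GH_sum GH_single simp: gwt_def gpath_degree_def)

lemma gpath_diff_GH: "is_path GQ (u, as) \<Longrightarrow> (gpath_diff Q u as :: _ \<Rightarrow>\<^sub>0 'k::field) \<in> GH (gwt (u, as)) (gpath_degree (u, as) - 1) u (gtgt (u, as))"
proof (induction as arbitrary: u)
  case (Cons a as)
  then have a: "a \<in> arcs GQ" "u = tail GQ a" and p: "is_path GQ (head GQ a, as)" by auto
  let ?v = "head GQ a" and ?w = "gtgt (head GQ a, as)"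
  have s: "sg (?v, as) (1::'k) \<in> GH (gwt (?v, as)) (gpath_degree (?v, as)) ?v ?w" using p by (intro GH_single) auto
  have t: "sg (u, [a]) (1::'k) \<in> GH (awt a) (garc_degree a) u ?v"
    using a by (intro GH_single) (auto simp: gwt_def gpath_degree_def G.path_target_verts path_target_def)
  have i: "gwt (u, a # as) = awt a + gwt (?v, as)" "gpath_degree (u, a # as) - 1 = garc_degree a - 1 + gpath_degree (?v, as)"
    "gpath_degree (u, a # as) - 1 = garc_degree a + (gpath_degree (?v, as) - 1)" "gtgt (u, a # as) = ?w"
    by (simp_all add: gwt_def gpath_degree_def)
  have "gm (garc_diff Q a) (sg (?v, as) (1::'k)) \<in> GH (gwt (u, a # as)) (gpath_degree (u, a # as) - 1) u ?w"
    unfolding i(1,2) using GH_mult[OF garc_diff_GH[OF a(1)] s] a(2) by simp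
  moreover have "gm (sg (u, [a]) (1::'k)) (gpath_diff Q ?v as) \<in> GH (gwt (u, a # as)) (gpath_degree (u, a # as) - 1) u ?w"
    unfolding i(1,3) by (rule GH_mult[OF t Cons.IH[OF p]])
  ultimately show ?case
    unfolding i(4) by (simp add: Let_def GH_add GH_koszul del: gwt_simps gdeg_simps)
qed (simp add: GH_zero)

lemma sg_append: "gtgt (u, as) = v \<Longrightarrow> sg (u, as @ bs) (1::'k::field) = gm (sg (u, as) 1) (sg (v, bs) (1::'k::field))"
  by (simp add: pmult_single)

text \<open>The differential of a path is defined by splitting off its first arrow; induction on the
  left factor extends the Leibniz rule to a cut at any place.\<close>

lemma gpath_diff_append:
  assumes "is_path GQ (u, as)" "is_path GQ (gtgt (u, as), bs)"
  shows "(gpath_diff Q u (as @ bs) :: _ \<Rightarrow>\<^sub>0 'k::field) = gm (gpath_diff Q u as) (sg (gtgt (u, as), bs) 1) +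
    koszul (gpath_degree (u, as)) (gm (sg (u, as) 1) (gpath_diff Q (gtgt (u, as)) bs))"
  using assms
proof (induction as arbitrary: u)
  case Nil
  then show ?case by (simp add: GH_left_unit[OF gpath_diff_GH])
next
  case (Cons a as)
  let ?v = "head GQ a" and ?q = "(gtgt (head GQ a, as), bs)"
  have p: "is_path GQ (?v, as)" "is_path GQ ?q" using Cons.prems by auto
  have t: "gtgt (u, a # as) = fst ?q" "gtgt (u, [a]) = ?v" by (simp_all add: path_target_def)
  have "(gpath_diff Q u ((a # as) @ bs) :: _ \<Rightarrow>\<^sub>0 'k) = gm (garc_diff Q a) (gm (sg (?v, as) 1) (sg ?q 1)) +
      koszul (garc_degree a) (gm (sg (u, [a]) 1) (gm (gpath_diff Q ?v as) (sg ?q 1) +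
        koszul (gpath_degree (?v, as)) (gm (sg (?v, as) 1) (gpath_diff Q (fst ?q) bs))))"
    using Cons.IH[OF p] sg_append[of ?v as "fst ?q" bs, where 'k = 'k] by (simp add: Let_def)
  also have "\<dots> = gm (gpath_diff Q u (a # as)) (sg ?q 1) +
      koszul (garc_degree a + gpath_degree (?v, as)) (gm (gm (sg (u, [a]) 1) (sg (?v, as) 1)) (gpath_diff Q (fst ?q) bs))"
    by (simp add: Let_def pmult_add_left pmult_add_right pmult_koszul_left pmult_koszul_right koszul_add koszul_koszul pmult_assoc add.assoc)
  also have "gm (sg (u, [a]) 1) (sg (?v, as) 1) = sg (u, a # as) (1::'k)"
    using sg_append[of u "[a]" ?v as, where 'k = 'k] t(2) by simp
  finally show ?case unfolding t(1) gdeg_simps(2)[of u a as ?v] by simp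
qed

definition GA :: "int \<Rightarrow> ('v, 'e, 'k::field) gvec set" where
  "GA m = {x \<in> path_algebra GQ. \<forall>p\<in>ks x. gpath_degree p = m}"

lemma GA_iff: "x \<in> GA m \<longleftrightarrow> (\<forall>p\<in>ks x. is_path GQ p \<and> gpath_degree p = m)"
  by (auto simp: GA_def path_algebra_def)

lemma GA_induct [consumes 1, case_names zero single add]:
  assumes "x \<in> GA m" "P 0" "\<And>p c. is_path GQ p \<Longrightarrow> gpath_degree p = m \<Longrightarrow> P (sg p c)" "\<And>x y. P x \<Longrightarrow> P y \<Longrightarrow> P (x + y)"
  shows "P x"
  by (rule pm_induct) (use assms in \<open>auto simp: GA_iff\<close>)

lemma GA_zero: "0 \<in> GA m"
  by (simp add: GA_iff)

lemma GA_add: "x \<in> GA m \<Longrightarrow> y \<in> GA m \<Longrightarrow> x + y \<in> GA m"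
  using keys_add[of x y] unfolding GA_iff by blast

lemma GA_scale: "x \<in> GA m \<Longrightarrow> c \<odot> x \<in> GA m"
  using keys_pscale[of c x] unfolding GA_iff by blast

lemma GA_uminus: "x \<in> GA m \<Longrightarrow> - x \<in> GA m"
  by (simp add: GA_iff in_keys_iff)

lemma GA_sum: "(\<And>i. i \<in> I \<Longrightarrow> f i \<in> GA m) \<Longrightarrow> sum f I \<in> GA m"
  by (induction I rule: infinite_finite_induct) (auto simp: GA_zero GA_add)

lemma GA_single: "is_path GQ p \<Longrightarrow> gpath_degree p = m \<Longrightarrow> sg p c \<in> GA m"
  by (simp add: GA_iff)

lemma GH_GA: "x \<in> GH n m u v \<Longrightarrow> x \<in> GA m"
  by (simp add: GH_def GA_iff)

lemma GA_mult:
  assumes x: "x \<in> GA m" and y: "y \<in> GA n"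
  shows "gm x y \<in> GA (m + n)"
  unfolding GA_iff
proof (intro ballI)
  fix r assume "r \<in> ks (gm x y)"
  then obtain p q where pq: "p \<in> ks x" "q \<in> ks y" "gtgt p = fst q" "r = (fst p, snd p @ snd q)" by (rule keys_pmult)
  then show "is_path GQ r \<and> gpath_degree r = m + n"
    using x y by (cases p; cases q) (fastforce simp: GA_iff G.is_path_append gpath_degree_def)
qed

lemma gdd_keys: "p \<in> ks (gdd x) \<Longrightarrow> (\<And>q. q \<in> ks x \<Longrightarrow> is_path GQ q) \<Longrightarrow>
    \<exists>q\<in>ks x. is_path GQ p \<and> gwt p = gwt q \<and> gpath_degree p = gpath_degree q - 1"
  using keys_lext[of "\<lambda>p. gpath_diff Q (fst p) (snd p)" x] gpath_diff_GH
  unfolding gdd_def GH_def by (fastforce simp: split_paired_Ex)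

lemma GA_gdd: "x \<in> GA m \<Longrightarrow> gdd x \<in> GA (m - 1)"
  using gdd_keys[of _ x] by (fastforce simp: GA_iff)

lemma gdd_leibniz:
  fixes x :: "('v, 'e, 'k::field) gvec"
  assumes x: "x \<in> GA m" and y: "y \<in> GA n"
  shows "gdd (gm x y) = gm (gdd x) y + koszul m (gm x (gdd y))"
  using x
proof (induction x rule: GA_induct)
  case (single p c)
  show ?case using y
  proof (induction y rule: GA_induct)
    case (single q c')
    obtain u as v bs where pq: "p = (u, as)" "q = (v, bs)" by (cases p; cases q) auto
    show ?case
    proof (cases "gtgt p = v")
      case True
      then have "(gpath_diff Q u (as @ bs) :: _ \<Rightarrow>\<^sub>0 'k) = gm (gpath_diff Q u as) (sg (v, bs) 1) +
          koszul m (gm (sg (u, as) 1) (gpath_diff Q v bs))"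
        using gpath_diff_append[of u as bs] single \<open>is_path GQ p\<close> \<open>gpath_degree p = m\<close> pq by simp
      moreover have "gdd (gm (sg p c) (sg q c')) = (c * c') \<odot> gpath_diff Q u (as @ bs)"
        "gdd (sg p c) = c \<odot> gpath_diff Q u as" "gdd (sg q c') = c' \<odot> gpath_diff Q v bs"
        "sg p c = c \<odot> sg (u, as) 1" "sg q c' = c' \<odot> sg (v, bs) 1"
        using True pq by (simp_all add: pmult_single gdd_single pscale_single)
      ultimately show ?thesis
        by (simp only: pmult_scale_left pmult_scale_right koszul_pscale pscale.scale_right_distrib pscale.scale_scale)
          (simp add: pscale.scale_right_distrib mult.commute)
    next
      case False
      have "sg p c \<in> GH (gwt p) m u (gtgt p)" "sg q c' \<in> GH (gwt q) n v (gtgt q)"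
        using single \<open>is_path GQ p\<close> \<open>gpath_degree p = m\<close> pq by (auto intro!: GH_single)
      moreover have "gpath_diff Q u as \<in> GH (gwt p) (m - 1) u (gtgt p)" "gpath_diff Q v bs \<in> GH (gwt q) (n - 1) v (gtgt q)"
        using gpath_diff_GH[of u as] gpath_diff_GH[of v bs] single \<open>is_path GQ p\<close> \<open>gpath_degree p = m\<close> pq by auto
      ultimately have "gm (sg p c) (sg q c') = 0" "gm (gpath_diff Q u as) (sg q c') = 0" "gm (sg p c) (gpath_diff Q v bs) = 0"
        using False GH_mult_zero by blast+
      then show ?thesis using pq by (simp add: gdd_single gdd_zero pmult_scale_left pmult_scale_right)
    qed
  qed (auto simp: gdd_zero gdd_add pmult_add_right koszul_add)
qed (auto simp: gdd_zero gdd_add pmult_add_left koszul_add)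

lemma gdd_garc_diff: "a \<in> arcs GQ \<Longrightarrow> gdd (garc_diff Q a) = 0"
  by (cases a) (auto simp: gdd_zero gdd_diff gdd_sum gdd_single Let_def)

lemma gdd_arc:
  assumes "a \<in> arcs GQ"
  shows "gpath_diff Q (tail GQ a) [a] = garc_diff Q a"
  using GH_right_unit[OF garc_diff_GH[OF assms]] by (simp add: Let_def)

text \<open>On one arrow the differential is made of arrows with zero differential. For a longer
  path, the two mixed terms of the Leibniz rule have opposite signs.\<close>

lemma gdd_gpath_diff: "is_path GQ (u, as) \<Longrightarrow> gdd (gpath_diff Q u as) = (0 :: _ \<Rightarrow>\<^sub>0 'k::field)"
proof (induction as arbitrary: u)
  case (Cons a as)
  let ?v = "head GQ a" and ?s = "sg (head GQ a, as) (1::'k)" and ?t = "sg (u, [a]) (1::'k)"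
  have a: "a \<in> arcs GQ" "u = tail GQ a" and p: "is_path GQ (?v, as)" using Cons.prems by auto
  have d: "garc_diff Q a \<in> GA (garc_degree a - 1)" using GH_GA[OF garc_diff_GH[OF a(1)]] .
  have s: "?s \<in> GA (gpath_degree (?v, as))" and t: "?t \<in> GA (garc_degree a)"
    using p a G.head_in_verts[of a] by (auto intro!: GA_single simp: gpath_degree_def simp del: GQ_simps)
  have g: "gpath_diff Q ?v as \<in> GA (gpath_degree (?v, as) - 1)" by (rule GH_GA[OF gpath_diff_GH[OF p]])
  have "gdd ?s = gpath_diff Q ?v as" "gdd ?t = garc_diff Q a"
    using gdd_arc[OF a(1)] a(2) by (simp_all add: gdd_single)
  then show ?case
    using gdd_leibniz[OF d s] gdd_leibniz[OF t g] Cons.IH[OF p] gdd_garc_diff[OF a(1), where 'a = 'k]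
    by (simp add: Let_def gdd_add gdd_koszul koszul_add koszul_pred)
qed (simp add: gdd_zero)

lemma gdd_gdd: "x \<in> GA m \<Longrightarrow> gdd (gdd x) = 0"
  by (induction x rule: GA_induct) (auto simp: gdd_zero gdd_add gdd_single gdd_scale gdd_gpath_diff)

abbreviation GZ :: "('k::field, ('v, 'e, 'k) gvec) dga" where "GZ \<equiv> ginzburg_algebra Q"

lemma GZ_simps: "dcomp GZ m = GA m" "dscale GZ = pscale" "dmult GZ m n = gm" "dunit GZ = punit GQ" "ddiff GZ m = gdd"
  by (simp_all add: ginzburg_algebra_def GA_def gdd_def[abs_def] lext_def)

lemma GA_path_algebra: "x \<in> GA m \<Longrightarrow> x \<in> path_algebra GQ"
  by (simp add: GA_def)

lemma ginzburg_dga: "dg_algebra (GZ :: ('k::field, _) dga)"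
proof (rule dg_algebra.intro; unfold GZ_simps)
  show "punit GQ \<in> GA 0"
    unfolding punit_def by (intro GA_sum GA_single) (auto simp: gpath_degree_def)
qed (auto simp: GA_zero GA_add GA_scale pscale.scale_right_distrib pscale.scale_left_distrib GA_mult GA_gdd gdd_add gdd_scale gdd_gdd
    pmult_add_left pmult_add_right pmult_scale_left pmult_scale_right pmult_assoc gdd_leibniz G.pmult_punit_left G.pmult_punit_right
    GA_path_algebra)

end

section \<open>The orbit algebra\<close>

context dg_endofunctor
begin

abbreviation Pn :: "nat \<Rightarrow> ('v, 'e, 'k) cpx \<Rightarrow> ('v, 'e, 'k) cpx" where "Pn \<equiv> pow_ob T"
abbreviation Tn :: "nat \<Rightarrow> ('v, 'e, 'k) cpx \<Rightarrow> ('v, 'e, 'k) cpx \<Rightarrow> int \<Rightarrow> ('v, 'e, 'k) gmap \<Rightarrow> ('v, 'e, 'k) gmap" where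
  "Tn \<equiv> pow_mor T"

lemma Pn_simps [simp]: "Pn 0 X = X" "Pn (Suc n) X = fob T (Pn n X)"
  by (simp_all add: pow_ob_def)

lemma Pn_Pn: "Pn q (Pn p X) = Pn (p + q) X"
  by (simp add: pow_ob_def add.commute[of p] funpow_add)

lemma Pn_T: "Pn n (fob T X) = fob T (Pn n X)"
  by (simp add: pow_ob_def funpow_swap1)

lemma Pn_pc: "proj_complex Q X \<Longrightarrow> proj_complex Q (Pn n X)"
  by (induction n) (auto intro: T_pc)

lemma Tn_Tn: "Tn q (Pn p X) (Pn p Y) m (Tn p X Y m f) = Tn (p + q) X Y m f"
  by (induction q) (simp_all add: Pn_Pn)

lemma Tn_T: "Tn n (fob T X) (fob T Y) m (fmor T X Y m f) = Tn (Suc n) X Y m f"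
  using Tn_Tn[of n 1 X Y m f] by simp

context
  fixes X Y :: "('v, 'e, 'k) cpx"
  assumes X: "proj_complex Q X" and Y: "proj_complex Q Y"
begin

lemma Tn_hom: "f \<in> hom Q X Y m \<Longrightarrow> Tn n X Y m f \<in> hom Q (Pn n X) (Pn n Y) m"
  by (induction n) (auto intro: T_hom Pn_pc X Y)

lemma Tn_add: "f \<in> hom Q X Y m \<Longrightarrow> g \<in> hom Q X Y m \<Longrightarrow> Tn n X Y m (f + g) = Tn n X Y m f + Tn n X Y m g"
  by (induction n) (auto simp: T_add Pn_pc X Y Tn_hom)

lemma Tn_scale: "f \<in> hom Q X Y m \<Longrightarrow> Tn n X Y m (gscale c f) = gscale c (Tn n X Y m f)"
  by (induction n) (auto simp: T_scale Pn_pc X Y Tn_hom)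

lemma Tn_zero: "Tn n X Y m 0 = 0"
  by (induction n) (metis pow_mor.simps(1), metis pow_mor.simps(2) T_zero Pn_pc X Y)

lemma Tn_dhom: "f \<in> hom Q X Y m \<Longrightarrow> dhom (Pn n X) (Pn n Y) m (Tn n X Y m f) = Tn n X Y (m - 1) (dhom X Y m f)"
  by (induction n) (auto simp: T_dhom Pn_pc X Y Tn_hom)

end

lemma Tn_gid: "proj_complex Q X \<Longrightarrow> Tn n X X 0 (gid X) = gid (Pn n X)"
  by (induction n) (auto simp: T_gid Pn_pc)

lemma Tn_gcomp: "proj_complex Q X \<Longrightarrow> proj_complex Q Y \<Longrightarrow> proj_complex Q Z \<Longrightarrow> f \<in> hom Q X Y m \<Longrightarrow> g \<in> hom Q Y Z n \<Longrightarrow>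
    Tn r X Z (m + n) (gcomp m g f) = gcomp m (Tn r Y Z n g) (Tn r X Y m f)"
  by (induction r) (auto simp: T_gcomp Pn_pc Tn_hom)

abbreviation PR :: "nat \<Rightarrow> ('v, 'e, 'k) cpx" where "PR n \<equiv> Pn n RQ"

lemma pcP [simp]: "proj_complex Q (PR n)"
  by (rule Pn_pc[OF pcR])

definition om :: "nat \<Rightarrow> nat \<Rightarrow> int \<Rightarrow> int \<Rightarrow> ('v, 'e, 'k) gmap \<Rightarrow> ('v, 'e, 'k) gmap \<Rightarrow> ('v, 'e, 'k) gmap" where
  "om p q a b f g = gcomp b (Tn q RQ (PR p) a f) g"

lemma om_T_hom: "f \<in> hom Q RQ (PR p) a \<Longrightarrow> Tn q RQ (PR p) a f \<in> hom Q (PR q) (PR (p + q)) a"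
  using Tn_hom[OF pcR pcP, of f p a q] by (simp add: Pn_Pn)

lemma om_hom:
  assumes f: "f \<in> hom Q RQ (PR p) a" and g: "g \<in> hom Q RQ (PR q) b"
  shows "om p q a b f g \<in> hom Q RQ (PR (p + q)) (a + b)"
  using gcomp_hom[OF pcR pcP g om_T_hom[OF f]] by (simp add: om_def add.commute)

lemma om_add_left: "f \<in> hom Q RQ (PR p) a \<Longrightarrow> f' \<in> hom Q RQ (PR p) a \<Longrightarrow> om p q a b (f + f') g = om p q a b f g + om p q a b f' g"
  by (simp add: om_def Tn_add[OF pcR pcP]) (simp add: gcomp_def plus_fun_def)

lemma om_add_right: "f \<in> hom Q RQ (PR p) a \<Longrightarrow> g \<in> hom Q RQ (PR q) b \<Longrightarrow> g' \<in> hom Q RQ (PR q) b \<Longrightarrow>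
    om p q a b f (g + g') = om p q a b f g + om p q a b f g'"
proof (intro ext)
  fix n x assume *: "f \<in> hom Q RQ (PR p) a" "g \<in> hom Q RQ (PR q) b" "g' \<in> hom Q RQ (PR q) b"
  show "om p q a b f (g + g') n x = (om p q a b f g + om p q a b f g') n x"
    using h_in[OF pcR *(2), of x n] h_in[OF pcR *(3), of x n] h_outside[OF pcR *(2), of x n] h_outside[OF pcR *(3), of x n]
    by (cases "x \<in> el RQ n") (auto simp: om_def gcomp_def h_add[OF pcP om_T_hom[OF *(1)]] h_zero[OF pcP om_T_hom[OF *(1)]])
qed

lemma om_scale_left: "f \<in> hom Q RQ (PR p) a \<Longrightarrow> om p q a b (gscale c f) g = gscale c (om p q a b f g)"
  by (simp add: om_def Tn_scale[OF pcR pcP]) (simp add: gcomp_def gscale_def)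

lemma om_scale_right: "f \<in> hom Q RQ (PR p) a \<Longrightarrow> g \<in> hom Q RQ (PR q) b \<Longrightarrow> om p q a b f (gscale c g) = gscale c (om p q a b f g)"
proof (intro ext)
  fix n x assume *: "f \<in> hom Q RQ (PR p) a" "g \<in> hom Q RQ (PR q) b"
  show "om p q a b f (gscale c g) n x = (gscale c (om p q a b f g)) n x"
    using h_in[OF pcR *(2), of x n] h_outside[OF pcR *(2), of x n]
    by (cases "x \<in> el RQ n") (auto simp: om_def gcomp_def gscale_def h_scale[OF pcP om_T_hom[OF *(1)]] h_zero[OF pcP om_T_hom[OF *(1)]])
qed

lemma om_zero_left: "om p q a b 0 g = 0"
  by (simp add: om_def Tn_zero[OF pcR pcP]) (simp add: gcomp_def zero_fun_def)

lemma om_zero_right: "f \<in> hom Q RQ (PR p) a \<Longrightarrow> om p q a b f 0 = 0"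
  by (intro ext) (simp add: om_def gcomp_def h_zero[OF pcP om_T_hom])

text \<open>The product f g places f on the outside of the composition, so the sign of
  \<open>dhom_gcomp\<close> is the degree of the left factor, as the Leibniz rule demands.\<close>

lemma om_dhom:
  assumes f: "f \<in> hom Q RQ (PR p) a" and g: "g \<in> hom Q RQ (PR q) b"
  shows "dhom RQ (PR (p + q)) (a + b) (om p q a b f g) =
    om p q (a - 1) b (dhom RQ (PR p) a f) g + koszul a (om p q a (b - 1) f (dhom RQ (PR q) b g))"
  using dhom_gcomp[OF pcR pcP pcP g om_T_hom[OF f]] Tn_dhom[OF pcR pcP f, of q]
  by (simp add: om_def Pn_Pn add.commute[of a])

text \<open>Iterates of \<open>T\<close> compose strictly and preserve composition, so associativity
  holds without coherence isomorphisms.\<close>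

lemma om_assoc:
  assumes f: "f \<in> hom Q RQ (PR p) a" and g: "g \<in> hom Q RQ (PR q) b" and h: "h \<in> hom Q RQ (PR r) c"
  shows "om (p + q) r (a + b) c (om p q a b f g) h = om p (q + r) a (b + c) f (om q r b c g h)"
proof -
  have "Tn r RQ (PR (p + q)) (a + b) (gcomp b (Tn q RQ (PR p) a f) g) =
      gcomp b (Tn r (PR q) (PR (p + q)) a (Tn q RQ (PR p) a f)) (Tn r RQ (PR q) b g)"
    using Tn_gcomp[OF pcR pcP pcP g om_T_hom[OF f], of r] by (simp add: add.commute[of a])
  also have "Tn r (PR q) (PR (p + q)) a (Tn q RQ (PR p) a f) = Tn (q + r) RQ (PR p) a f"
    using Tn_Tn[of r q RQ "PR p" a f] by (simp add: Pn_Pn)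
  finally show ?thesis by (simp add: om_def gcomp_assoc add.commute[of b])
qed

lemma om_unit_left: "g \<in> hom Q RQ (PR q) b \<Longrightarrow> om 0 q 0 b (gid RQ) g = g"
  using gcomp_gid_left[OF pcR pcP, of g q b] by (simp add: om_def Tn_gid[OF pcR])

lemma om_unit_right: "f \<in> hom Q RQ (PR p) a \<Longrightarrow> om p 0 a 0 f (gid RQ) = f"
  using gcomp_gid_right[OF pcR pcP, of f p a] by (simp add: om_def)

definition OD :: "int \<Rightarrow> (nat \<Rightarrow>\<^sub>0 ('v, 'e, 'k) gmap) set" where
  "OD m = {f. \<forall>n. lk f n \<in> hom Q RQ (PR n) m}"

definition omul :: "int \<Rightarrow> int \<Rightarrow> (nat \<Rightarrow>\<^sub>0 ('v, 'e, 'k) gmap) \<Rightarrow> (nat \<Rightarrow>\<^sub>0 ('v, 'e, 'k) gmap) \<Rightarrow> (nat \<Rightarrow>\<^sub>0 ('v, 'e, 'k) gmap)" where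
  "omul a b f g = (\<Sum>p\<in>ks f. \<Sum>q\<in>ks g. sg (p + q) (om p q a b (lk f p) (lk g q)))"

definition odif :: "int \<Rightarrow> (nat \<Rightarrow>\<^sub>0 ('v, 'e, 'k) gmap) \<Rightarrow> (nat \<Rightarrow>\<^sub>0 ('v, 'e, 'k) gmap)" where
  "odif m f = (\<Sum>n\<in>ks f. sg n (dhom RQ (PR n) m (lk f n)))"

abbreviation OA :: "('k, nat \<Rightarrow>\<^sub>0 ('v, 'e, 'k) gmap) dga" where "OA \<equiv> orbit_algebra Q T"

lemma OA_simps: "dcomp OA m = OD m" "dscale OA c = Poly_Mapping.map (gscale c)" "dmult OA a b = omul a b"
  "dunit OA = sg 0 (gid RQ)" "ddiff OA m = odif m"
  by (simp_all add: orbit_algebra_def Let_def OD_def omul_def[abs_def] odif_def[abs_def] om_def)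

lemma OD_lk: "f \<in> OD m \<Longrightarrow> lk f n \<in> hom Q RQ (PR n) m"
  by (simp add: OD_def)

lemma OD_zero: "0 \<in> OD m"
  by (simp add: OD_def hom_zero)

lemma OD_add: "f \<in> OD m \<Longrightarrow> g \<in> OD m \<Longrightarrow> f + g \<in> OD m"
  by (simp add: OD_def hom_add lookup_add)

lemma OD_sum: "(\<And>i. i \<in> I \<Longrightarrow> f i \<in> OD m) \<Longrightarrow> sum f I \<in> OD m"
  by (induction I rule: infinite_finite_induct) (auto simp: OD_zero OD_add)

lemma OD_single: "f \<in> hom Q RQ (PR n) m \<Longrightarrow> sg n f \<in> OD m"
  by (simp add: OD_def lookup_single when_def hom_zero)

lemma lk_map_gscale: "lk (Poly_Mapping.map (gscale c) f) n = gscale c (lk f n)"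
  by (simp add: Poly_Mapping.map.rep_eq when_def) (simp add: gscale_def zero_fun_def)

lemma OD_scale: "f \<in> OD m \<Longrightarrow> Poly_Mapping.map (gscale c) f \<in> OD m"
  by (simp add: OD_def hom_scale lk_map_gscale)

lemma pm_sum_singles: "f = (\<Sum>n\<in>ks f. sg n (lk f n))"
  by (intro poly_mapping_eqI) (auto simp: lk_sum lookup_single when_def sum.delta' in_keys_iff)

lemma OD_induct [consumes 1, case_names zero single add]:
  assumes f: "f \<in> OD m" and z: "P 0" and s: "\<And>n x. x \<in> hom Q RQ (PR n) m \<Longrightarrow> P (sg n x)"
    and a: "\<And>f g. f \<in> OD m \<Longrightarrow> g \<in> OD m \<Longrightarrow> P f \<Longrightarrow> P g \<Longrightarrow> P (f + g)"
  shows "P f"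
proof -
  have "P (\<Sum>n\<in>S. sg n (lk f n))" if "finite S" for S
    using that
  proof (induction rule: finite_induct)
    case (insert n S)
    have "sg n (lk f n) \<in> OD m" "(\<Sum>n\<in>S. sg n (lk f n)) \<in> OD m"
      by (intro OD_sum OD_single OD_lk[OF f])+
    then have "P (sg n (lk f n) + (\<Sum>n\<in>S. sg n (lk f n)))" using insert s OD_lk[OF f] by (intro a) auto
    then show ?case using insert by simp
  qed (simp add: z)
  then show ?thesis using pm_sum_singles[of f] by (metis finite_keys)
qed

lemma omul_superset:
  assumes f: "f \<in> OD a" and "finite S" "ks f \<subseteq> S" "finite S'" "ks g \<subseteq> S'"
  shows "omul a b f g = (\<Sum>p\<in>S. \<Sum>q\<in>S'. sg (p + q) (om p q a b (lk f p) (lk g q)))"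
proof -
  have "omul a b f g = (\<Sum>p\<in>ks f. \<Sum>q\<in>S'. sg (p + q) (om p q a b (lk f p) (lk g q)))"
    unfolding omul_def using assms
    by (intro sum.cong refl sum.mono_neutral_left) (auto simp: in_keys_iff om_zero_right[OF OD_lk[OF f]])
  also have "\<dots> = (\<Sum>p\<in>S. \<Sum>q\<in>S'. sg (p + q) (om p q a b (lk f p) (lk g q)))"
    using assms by (intro sum.mono_neutral_left) (auto simp: in_keys_iff om_zero_left)
  finally show ?thesis .
qed

lemma omul_add_left:
  assumes f: "f \<in> OD a" and f': "f' \<in> OD a"
  shows "omul a b (f + f') g = omul a b f g + omul a b f' g"
proof -
  let ?S = "ks f \<union> ks f'"
  have "ks (f + f') \<subseteq> ?S" by (rule keys_add)
  then show ?thesis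
    using omul_superset[OF f, of ?S "ks g" g b] omul_superset[OF f', of ?S "ks g" g b] omul_superset[OF OD_add[OF f f'], of ?S "ks g" g b]
    by (simp add: lookup_add om_add_left[OF OD_lk[OF f] OD_lk[OF f']] single_add sum.distrib)
qed

lemma omul_add_right:
  assumes f: "f \<in> OD a" and g: "g \<in> OD b" and g': "g' \<in> OD b"
  shows "omul a b f (g + g') = omul a b f g + omul a b f g'"
proof -
  let ?S = "ks g \<union> ks g'"
  have "ks (g + g') \<subseteq> ?S" by (rule keys_add)
  then show ?thesis
    using omul_superset[OF f, of "ks f" ?S g b] omul_superset[OF f, of "ks f" ?S g' b] omul_superset[OF f, of "ks f" ?S "g + g'" b]
    by (simp add: lookup_add om_add_right[OF OD_lk[OF f] OD_lk[OF g] OD_lk[OF g']] single_add sum.distrib)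
qed

lemma omul_zero_left: "omul a b 0 g = 0" and omul_zero_right: "omul a b f 0 = 0"
  by (simp_all add: omul_def)

lemma omul_single: "x \<in> hom Q RQ (PR p) a \<Longrightarrow> omul a b (sg p x) (sg q y) = sg (p + q) (om p q a b x y)"
  using omul_superset[OF OD_single, of x p a "{p}" "{q}" "sg q y" b] by simp

lemma map_gscale_add: "Poly_Mapping.map (gscale c) (f + g) = Poly_Mapping.map (gscale c) f + Poly_Mapping.map (gscale c) g"
  by (intro poly_mapping_eqI ext) (simp add: lk_map_gscale lookup_add gscale_def pscale.scale_right_distrib)

lemma map_gscale_single: "Poly_Mapping.map (gscale c) (sg n x) = sg n (gscale c x)"
  by (intro poly_mapping_eqI ext) (auto simp: lk_map_gscale lookup_single when_def gscale_def)

lemma map_gscale_zero: "Poly_Mapping.map (gscale c) 0 = 0"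
  by (intro poly_mapping_eqI ext) (simp add: lk_map_gscale gscale_def)

lemma lk_odif:
  assumes f: "f \<in> OD m"
  shows "lk (odif m f) n = dhom RQ (PR n) m (lk f n)"
  by (auto simp: odif_def lk_sum lookup_single when_def sum.delta' in_keys_iff dhom_zero[OF pcR pcP])

lemma odif_add: "f \<in> OD m \<Longrightarrow> g \<in> OD m \<Longrightarrow> odif m (f + g) = odif m f + odif m g"
  by (intro poly_mapping_eqI) (simp add: lk_odif OD_add lookup_add dhom_add OD_lk)

lemma odif_single: "x \<in> hom Q RQ (PR n) m \<Longrightarrow> odif m (sg n x) = sg n (dhom RQ (PR n) m x)"
  by (intro poly_mapping_eqI) (simp add: lk_odif OD_single lookup_single when_def dhom_zero[OF pcR pcP])

lemma odif_zero: "odif m 0 = 0"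
  by (simp add: odif_def)

lemma omul_OD:
  assumes "f \<in> OD a" "g \<in> OD b" shows "omul a b f g \<in> OD (a + b)"
  unfolding omul_def using assms by (intro OD_sum OD_single om_hom OD_lk)

lemma odif_OD: "f \<in> OD m \<Longrightarrow> odif m f \<in> OD (m - 1)"
  unfolding odif_def by (intro OD_sum OD_single dhom_hom OD_lk) simp_all

lemma sg_koszul: "sg n (koszul m x) = koszul m (sg n x)"
  by (simp add: koszul_def single_uminus)

lemma orbit_dga: "dg_algebra OA"
proof (rule dg_algebra.intro; unfold OA_simps)
  fix x y z m n l c assume x: "x \<in> OD m" and y: "y \<in> OD n"
  show "omul m n (Poly_Mapping.map (gscale c) x) y = Poly_Mapping.map (gscale c) (omul m n x y)"
    using x
  proof (induction x rule: OD_induct)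
    case (single p u)
    show ?case using y
    proof (induction y rule: OD_induct)
      case (single q v)
      then show ?case using \<open>u \<in> _\<close> by (simp add: map_gscale_single omul_single hom_scale om_scale_left)
    qed (simp_all add: omul_add_right[OF OD_single] omul_add_right[OF OD_scale[OF OD_single]] single map_gscale_add map_gscale_zero omul_zero_right)
  qed (simp_all add: omul_add_left map_gscale_add OD_scale map_gscale_zero omul_zero_left)
  show "omul m n x (Poly_Mapping.map (gscale c) y) = Poly_Mapping.map (gscale c) (omul m n x y)"
    using x
  proof (induction x rule: OD_induct)
    case (single p u)
    show ?case using y
    proof (induction y rule: OD_induct)
      case (single q v)
      then show ?case using \<open>u \<in> _\<close> by (simp add: map_gscale_single omul_single hom_scale om_scale_right)
    qed (simp_all add: omul_add_right[OF OD_single] single map_gscale_add map_gscale_zero omul_zero_right OD_scale)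
  qed (simp_all add: omul_add_left map_gscale_add map_gscale_zero omul_zero_left)
  show "omul (m + n) l (omul m n x y) z = omul m (n + l) x (omul n l y z)" if z: "z \<in> OD l"
    using x
  proof (induction x rule: OD_induct)
    case (single p u)
    note u = single
    show ?case using y
    proof (induction y rule: OD_induct)
      case (single q v)
      note v = single
      show ?case using z
      proof (induction z rule: OD_induct)
        case (single r w)
        then show ?case using u v by (simp add: omul_single om_hom om_assoc add.assoc)
      next
        case (add f g)
        then show ?case using u v
          by (simp add: omul_add_right[OF OD_single[OF v]] omul_add_right[OF OD_single[OF u]] omul_add_right omul_OD OD_single)
      qed (simp add: omul_zero_right)
    next
      case (add f g)
      then show ?case using u z
        by (simp add: omul_add_right[OF OD_single[OF u]] omul_add_left omul_OD OD_single)
    qed (simp add: omul_zero_right omul_zero_left)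
  next
    case (add f g)
    then show ?case using y z by (simp add: omul_add_left omul_OD)
  qed (simp add: omul_zero_left)
  show "odif (m + n) (omul m n x y) = omul (m - 1) n (odif m x) y + koszul m (omul m (n - 1) x (odif n y))"
    using x
  proof (induction x rule: OD_induct)
    case (single p u)
    note u = single
    show ?case using y
    proof (induction y rule: OD_induct)
      case (single q v)
      then show ?case using u
        by (simp add: omul_single odif_single om_hom om_dhom dhom_hom single_add sg_koszul)
    next
      case (add f g)
      then show ?case using u
        by (simp add: omul_add_right[OF OD_single[OF u]] omul_add_right[OF odif_OD[OF OD_single[OF u]]] odif_add omul_OD OD_single odif_OD koszul_add)
    qed (simp add: omul_zero_right odif_zero)
  next
    case (add f g)
    then show ?case using y by (simp add: omul_add_left odif_add omul_OD odif_OD koszul_add)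
  qed (simp add: omul_zero_left odif_zero)
next
  fix x m assume x: "x \<in> OD m"
  show "omul 0 m (sg 0 (gid RQ)) x = x"
    using x
  proof (induction x rule: OD_induct)
    case (single n u)
    then show ?case using gid_hom[OF pcR pcR] om_unit_left[of u n m] by (subst omul_single) auto
  next
    case (add f g)
    have "sg 0 (gid RQ) \<in> OD 0" using gid_hom[OF pcR pcR] by (intro OD_single) simp
    then show ?case using add by (simp add: omul_add_right)
  qed (simp add: omul_zero_right)
  show "omul m 0 x (sg 0 (gid RQ)) = x"
    using x
  proof (induction x rule: OD_induct)
    case (single n u)
    then show ?case by (simp add: omul_single om_unit_right)
  qed (simp_all add: omul_zero_left omul_add_left)
  show "odif m (Poly_Mapping.map (gscale c) x) = Poly_Mapping.map (gscale c) (odif m x)" for c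
    using x by (intro poly_mapping_eqI) (simp add: lk_odif OD_scale lk_map_gscale dhom_scale OD_lk)
  show "odif (m - 1) (odif m x) = 0"
    using x by (intro poly_mapping_eqI) (simp add: lk_odif odif_OD dhom_dhom OD_lk)
next
  show "sg 0 (gid RQ) \<in> OD 0" using gid_hom[OF pcR pcR] by (intro OD_single) simp
qed (auto simp: OD_zero OD_add OD_scale omul_OD odif_OD omul_add_left omul_add_right odif_add map_gscale_add
    intro!: poly_mapping_eqI ext simp: lk_map_gscale lookup_add gscale_def pscale.scale_left_distrib)

end

section \<open>The comparison map\<close>

declare gwt_simps(2,3) [simp del] gdeg_simps(2,3) [simp del]

context quiver
begin

definition GW :: "nat \<Rightarrow> int \<Rightarrow> ('v, 'e, 'k::field) gvec set" where
  "GW n m = {x. \<forall>p\<in>ks x. is_path GQ p \<and> gwt p = n \<and> gpath_degree p = m}"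

lemma GW_induct [consumes 1, case_names zero single add]:
  fixes x :: "('v, 'e, 'k::field) gvec"
  assumes "x \<in> GW n m" "P 0"
    "\<And>u as c. is_path GQ (u, as) \<Longrightarrow> gwt (u, as) = n \<Longrightarrow> gpath_degree (u, as) = m \<Longrightarrow> P (sg (u, as) c)"
    "\<And>x y. x \<in> GW n m \<Longrightarrow> y \<in> GW n m \<Longrightarrow> P x \<Longrightarrow> P y \<Longrightarrow> P (x + y)"
  shows "P x"
proof -
  have "P (\<Sum>p\<in>S. sg p (lk x p)) \<and> (\<Sum>p\<in>S. sg p (lk x p)) \<in> GW n m" if "finite S" "S \<subseteq> ks x" for S
    using that
  proof (induction rule: finite_induct)
    case (insert p S)
    obtain u as where p: "p = (u, as)" by (cases p)
    have "is_path GQ p" "gwt p = n" "gpath_degree p = m" using insert assms(1) by (auto simp: GW_def)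
    moreover from this have "sg p (lk x p) \<in> GW n m" by (simp add: GW_def)
    moreover have "y + z \<in> GW n m" if "y \<in> GW n m" "z \<in> GW n m" for y z :: "('v, 'e, 'k) gvec"
      using that keys_add[of y z] unfolding GW_def by blast
    ultimately show ?case using insert assms(3)[of u as] assms(4) p by auto
  qed (use assms in \<open>auto simp: GW_def\<close>)
  moreover have "x = (\<Sum>p\<in>ks x. sg p (lk x p))"
    by (intro poly_mapping_eqI) (auto simp: lk_sum lookup_single when_def sum.delta' in_keys_iff)
  ultimately show ?thesis by (metis finite_keys order_refl)
qed

lemma GW_zero: "0 \<in> GW n m"
  by (simp add: GW_def)

lemma GW_add: "x \<in> GW n m \<Longrightarrow> y \<in> GW n m \<Longrightarrow> x + y \<in> GW n m"
  using keys_add[of x y] unfolding GW_def by blast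

lemma GW_uminus: "x \<in> GW n m \<Longrightarrow> - x \<in> GW n m"
  by (simp add: GW_def in_keys_iff)

lemma GW_diff: "x \<in> GW n m \<Longrightarrow> y \<in> GW n m \<Longrightarrow> x - y \<in> GW n m"
  using GW_add[of x n m "- y"] by (simp add: GW_uminus)

lemma GW_sum: "(\<And>i. i \<in> I \<Longrightarrow> f i \<in> GW n m) \<Longrightarrow> sum f I \<in> GW n m"
  by (induction I rule: infinite_finite_induct) (auto simp: GW_zero GW_add)

lemma GW_single: "is_path GQ p \<Longrightarrow> gwt p = n \<Longrightarrow> gpath_degree p = m \<Longrightarrow> sg p c \<in> GW n m"
  by (simp add: GW_def)

lemma GW_GA: "x \<in> GW n m \<Longrightarrow> x \<in> GA m"
  by (simp add: GW_def GA_iff)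

lemma GW_gdd: "x \<in> GW n m \<Longrightarrow> gdd x \<in> GW n (m - 1)"
  using gdd_keys[of _ x] by (fastforce simp: GW_def)

lemma GW_mult:
  assumes x: "x \<in> GW n m" and y: "y \<in> GW n' m'"
  shows "gm x y \<in> GW (n + n') (m + m')"
  unfolding GW_def
proof (intro CollectI ballI)
  interpret G: fin_digraph GQ by (rule fin_GQ)
  fix r assume "r \<in> ks (gm x y)"
  then obtain p q where pq: "p \<in> ks x" "q \<in> ks y" "gtgt p = fst q" "r = (fst p, snd p @ snd q)" by (rule keys_pmult)
  then show "is_path GQ r \<and> gwt r = n + n' \<and> gpath_degree r = m + m'"
    using x y by (cases p; cases q) (fastforce simp: GW_def G.is_path_append gwt_def gpath_degree_def)
qed

section \<open>Weight projections, and kQ as the part of weight 0\<close>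

definition wp :: "nat \<Rightarrow> ('v, 'e, 'k::field) gvec \<Rightarrow> ('v, 'e, 'k) gvec" where
  "wp n x = lext (\<lambda>p. if gwt p = n then sg p 1 else 0) x"

lemma lk_wp: "lk (wp n x) p = (if gwt p = n then lk x p else 0)"
  unfolding wp_def by (induction x rule: pm_induct) (auto simp: lext_add lookup_add lookup_pscale lookup_single when_def)

lemma wp_add: "wp n (x + y) = wp n x + wp n y"
  and wp_scale: "wp n (c \<odot> x) = c \<odot> wp n x"
  and wp_zero [simp]: "wp n 0 = 0"
  by (simp_all add: wp_def lext_add lext_scale)

lemma wp_GW: "x \<in> GA m \<Longrightarrow> wp n x \<in> GW n m"
  by (auto simp: GW_def GA_iff in_keys_iff lk_wp split: if_splits)

lemma wp_id: "x \<in> GW n m \<Longrightarrow> wp n x = x"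
  by (intro poly_mapping_eqI) (auto simp: GW_def in_keys_iff lk_wp)

lemma wp_other: "x \<in> GW n m \<Longrightarrow> n' \<noteq> n \<Longrightarrow> wp n' x = 0"
  by (intro poly_mapping_eqI) (auto simp: GW_def in_keys_iff lk_wp)

lemma wp_out: "n \<notin> gwt ` ks x \<Longrightarrow> wp n x = 0"
  by (intro poly_mapping_eqI) (auto simp: in_keys_iff lk_wp)

lemma sum_wp: "x = (\<Sum>n\<in>gwt ` ks x. wp n x)"
  by (intro poly_mapping_eqI) (auto simp: lk_sum lk_wp in_keys_iff sum.delta')

lemma wp_gdd: "x \<in> GA m \<Longrightarrow> wp n (gdd x) = gdd (wp n x)"
proof (induction x rule: GA_induct)
  case (single p c)
  then have s: "sg p c \<in> GW (gwt p) m" by (simp add: GW_single)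
  show ?case
    using wp_id[OF s] wp_other[OF s] wp_id[OF GW_gdd[OF s]] wp_other[OF GW_gdd[OF s]]
    by (cases "gwt p = n") (auto simp: gdd_zero)
qed (auto simp: gdd_zero gdd_add wp_add)

definition emb :: "('v, 'e, 'k::field) pvec \<Rightarrow> ('v, 'e, 'k) gvec" where
  "emb a = lext (\<lambda>p. sg (fst p, map Arr (snd p)) 1) a"

lemma emb_zero [simp]: "emb 0 = 0" and emb_add: "emb (a + b) = emb a + emb b"
  and emb_single: "emb (sg p c) = sg (fst p, map Arr (snd p)) c"
  by (simp_all add: emb_def lext_add pscale_single)

lemma gtgt_Arr [simp]: "gtgt (u, map Arr as) = tgt (u, as)"
  by (cases as rule: rev_cases) (auto simp: path_target_def)

lemma is_path_Arr [simp]: "is_path GQ (u, map Arr as) \<longleftrightarrow> is_path Q (u, as)"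
proof -
  interpret G: fin_digraph GQ by (rule fin_GQ)
  show ?thesis by (induction as arbitrary: u) auto
qed

lemma gwt_Arr [simp]: "gwt (u, map Arr as) = 0"
  and gdeg_Arr [simp]: "gpath_degree (u, map Arr as) = 0"
  by (induction as arbitrary: u) (auto simp: gwt_def gpath_degree_def)

lemma gpath_diff_Arr [simp]: "gpath_diff Q u (map Arr as) = 0"
  by (induction as arbitrary: u) (auto simp: Let_def)

lemma emb_GW: "a \<in> PA \<Longrightarrow> emb a \<in> GW 0 0"
  by (induction a rule: path_algebra_induct) (auto simp: GW_zero GW_add emb_add emb_single intro!: GW_single)

lemma gdd_emb: "gdd (emb a) = 0"
  by (induction a rule: pm_induct) (auto simp: emb_add emb_single gdd_zero gdd_add gdd_single)

lemma emb_pm: "emb (pm a b) = gm (emb a) (emb b)"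
proof (induction a rule: pm_induct)
  case (single p c)
  show ?case
  proof (induction b rule: pm_induct)
    case (single q d)
    then show ?case by (cases p; cases q) (auto simp: pmult_single emb_single)
  qed (auto simp: emb_add pmult_add_right)
qed (auto simp: emb_add pmult_add_left)

end

section \<open>Evaluation of paths and the comparison map\<close>

context generators
begin

lemma WA_Om: "a \<in> WA \<Longrightarrow> (a, (tgtW a, [])) \<in> Om"
  by (auto simp: WA_def)

lemma WA_mw: assumes "a \<in> WA"
  shows "mw a \<in> el TR (garc_degree a)" "lact (ev (srcW a)) (garc_degree a) (mw a) = mw a"
    "act TR (garc_degree a) (mw a) (ev (tgtW a)) = mw a" "ev (srcW a) \<in> (PA :: ('v, 'e, 'k) pvec set)" "ev (tgtW a) \<in> (PA :: ('v, 'e, 'k) pvec set)"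
    "awt a = 1"
  using mw_in[OF WA_Om[OF assms]] mw_left[OF WA_Om[OF assms]] mw_right[OF WA_Om[OF assms]] assms by (auto simp: WA_def)

lemma arcs_GQ_cases:
  assumes "a \<in> arcs GQ"
  obtains \<alpha> where "a = Arr \<alpha>" "\<alpha> \<in> arcs Q" | "a \<in> WA" "\<nexists>\<alpha>. a = Arr \<alpha>"
  using assms by (auto simp: WA_def)

text \<open>Evaluates a path on an element of X. An arrow of Q acts from the right; an arrow w of
  weight one replaces X by TX and x by T(x)(m), where m is the element of TR chosen for w. Evaluated
  on an idempotent of kQ, a path of weight n gives its image in T^n kQ.\<close>

primrec ph :: "('v, 'e) garc list \<Rightarrow> ('v, 'e, 'k) cpx \<Rightarrow> int \<Rightarrow> ('v, 'e, 'k) pvec \<Rightarrow> ('v, 'e, 'k) pvec" where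
  "ph [] X m x = x"
| "ph (a # as) X m x = (case a of Arr \<alpha> \<Rightarrow> ph as X m (act X m x (ar \<alpha>))
    | _ \<Rightarrow> ph as (fob T X) (garc_degree a + m) (tens X m x (garc_degree a) (mw a)))"

lemma ph_Arr: "ph (Arr \<alpha> # as) X m x = ph as X m (act X m x (ar \<alpha>))"
  and ph_WA: "a \<in> WA \<Longrightarrow> ph (a # as) X m x = ph as (fob T X) (garc_degree a + m) (tens X m x (garc_degree a) (mw a))"
  by (auto simp: WA_def)

lemma ph_Rev: "ph (Rev \<alpha> # as) X m x = ph as (fob T X) m (tens X m x 0 (mR \<alpha>))"
  and ph_Loop: "ph (Loop i # as) X m x = ph as (fob T X) (1 + m) (tens X m x 1 (mL i))"
  by simp_all

declare ph.simps(2) [simp del] ph_Arr [simp] ph_Rev [simp] ph_Loop [simp]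

lemma ph_in:
  assumes "proj_complex Q X" "set as \<subseteq> arcs GQ" "x \<in> el X m"
  shows "ph as X m x \<in> el (Pn (sum_list (map awt as)) X) (sum_list (map garc_degree as) + m)"
  using assms
proof (induction as arbitrary: X m x)
  case (Cons a as)
  then have "a \<in> arcs GQ" by auto
  then show ?case
  proof (cases rule: arcs_GQ_cases)
    case (1 \<alpha>)
    then show ?thesis using Cons by (simp add: el_act[OF Cons.prems(1)])
  next
    case 2
    show ?thesis
      using Cons.IH[OF T_pc[OF Cons.prems(1)], of "tens X m x (garc_degree a) (mw a)" "garc_degree a + m"] Cons.prems
        tens_in[OF Cons.prems(1,3) WA_mw(1)[OF 2(1)]] WA_mw(6)[OF 2(1)]
      by (simp add: ph_WA[OF 2(1)] Pn_T ac_simps)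
  qed
qed simp

lemma ph_scale:
  assumes "proj_complex Q X" "set as \<subseteq> arcs GQ" "x \<in> el X m"
  shows "ph as X m (c \<odot> x) = c \<odot> ph as X m x"
  using assms
proof (induction as arbitrary: X m x)
  case (Cons a as)
  then have "a \<in> arcs GQ" by auto
  then show ?case
  proof (cases rule: arcs_GQ_cases)
    case (1 \<alpha>)
    then show ?thesis using Cons by (simp add: el_act[OF Cons.prems(1)] act_scale_left[OF Cons.prems(1)])
  next
    case 2
    show ?thesis
      using Cons.IH[OF T_pc[OF Cons.prems(1)]] Cons.prems tens_in[OF Cons.prems(1) _ WA_mw(1)[OF 2(1)]]
      by (simp add: ph_WA[OF 2(1)] tens_scale_left[OF Cons.prems(1)])
  qed
qed simp

lemma ph_zero: "proj_complex Q X \<Longrightarrow> set as \<subseteq> arcs GQ \<Longrightarrow> ph as X m 0 = 0"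
  using ph_scale[of X as 0 m 0] el_zero[of X m] by simp

lemma ph_append: "set as \<subseteq> arcs GQ \<Longrightarrow>
    ph (as @ bs) X m x = ph bs (Pn (sum_list (map awt as)) X) (sum_list (map garc_degree as) + m) (ph as X m x)"
proof (induction as arbitrary: X m x)
  case (Cons a as)
  then have "a \<in> arcs GQ" by auto
  then show ?case
  proof (cases rule: arcs_GQ_cases)
    case (1 \<alpha>)
    then show ?thesis using Cons by simp
  next
    case 2
    show ?thesis
      using Cons WA_mw(6)[OF 2(1)] by (simp add: ph_WA[OF 2(1)] Pn_T ac_simps)
  qed
qed simp

text \<open>Each step is natural in X, the steps of weight one by \<open>T_tens\<close>.
  Consequently, applying T^q(f) to the value of a path of weight q amounts to evaluating that path
  on the value of f, which is how the product of the orbit algebra becomes concatenation.\<close>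

lemma ph_natural:
  assumes "proj_complex Q X" "proj_complex Q Y" "f \<in> hom Q X Y d" "set as \<subseteq> arcs GQ" "x \<in> el X m"
  shows "Tn (sum_list (map awt as)) X Y d f (sum_list (map garc_degree as) + m) (ph as X m x) = ph as Y (m + d) (f m x)"
  using assms
proof (induction as arbitrary: X Y m x f)
  case (Cons a as)
  note X = Cons.prems(1) and Y = Cons.prems(2) and f = Cons.prems(3) and x = Cons.prems(5)
  have as: "set as \<subseteq> arcs GQ" and "a \<in> arcs GQ" using Cons.prems by auto
  from this(2) show ?case
  proof (cases rule: arcs_GQ_cases)
    case (1 \<alpha>)
    then have "ar \<alpha> \<in> (PA :: ('v, 'e, 'k) pvec set)" by simp
    then show ?thesis using 1 Cons.IH[OF X Y f as el_act[OF X x]] h_act[OF X f x] by simp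
  next
    case 2
    let ?k = "garc_degree a"
    let ?t = "tens X m x ?k (mw a)"
    have t: "?t \<in> el (fob T X) (?k + m)" by (rule tens_in[OF X x WA_mw(1)[OF 2(1)]])
    have i: "sum_list (map garc_degree (a # as)) + m = sum_list (map garc_degree as) + (?k + m)" by simp
    have w: "sum_list (map awt (a # as)) = Suc (sum_list (map awt as))" using WA_mw(6)[OF 2(1)] by simp
    have "Tn (sum_list (map awt (a # as))) X Y d f (sum_list (map garc_degree (a # as)) + m) (ph (a # as) X m x) =
        Tn (sum_list (map awt as)) (fob T X) (fob T Y) d (fmor T X Y d f) (sum_list (map garc_degree as) + (?k + m))
          (ph as (fob T X) (?k + m) ?t)"
      unfolding i w Tn_T[symmetric] ph_WA[OF 2(1)] ..
    also have "\<dots> = ph as (fob T Y) (?k + m + d) (fmor T X Y d f (?k + m) ?t)"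
      by (rule Cons.IH[OF T_pc[OF X] T_pc[OF Y] T_hom[OF X Y f] as t])
    also have "fmor T X Y d f (?k + m) ?t = tens Y (m + d) (f m x) ?k (mw a)" by (rule T_tens[OF X Y f x])
    finally show ?thesis by (simp add: ph_WA[OF 2(1)] add.assoc)
  qed
qed simp

lemma ph_ev:
  assumes "proj_complex Q X" "is_path GQ (u, as)" "x \<in> el X m" "act X m x (ev u) = x"
  shows "act (Pn (sum_list (map awt as)) X) (sum_list (map garc_degree as) + m) (ph as X m x) (ev (gtgt (u, as))) = ph as X m x"
  using assms
proof (induction as arbitrary: X m x u)
  case (Cons a as)
  interpret G: fin_digraph GQ by (rule fin_GQ)
  note X = Cons.prems(1) and x = Cons.prems(3)
  have as: "is_path GQ (head GQ a, as)" and a: "a \<in> arcs GQ" "u = tail GQ a" using Cons.prems(2) by auto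
  from a(1) show ?case
  proof (cases rule: arcs_GQ_cases)
    case (1 \<alpha>)
    then have *: "ar \<alpha> \<in> (PA :: ('v, 'e, 'k) pvec set)" "ev (head Q \<alpha>) \<in> (PA :: ('v, 'e, 'k) pvec set)" by auto
    have "act X m (act X m x (ar \<alpha>)) (ev (head Q \<alpha>)) = act X m x (ar \<alpha>)"
      by (simp add: act_assoc[OF X x *] pm_pt)
    then show ?thesis using 1 Cons.IH[OF X as el_act[OF X x *(1)]] by simp
  next
    case 2
    let ?k = "garc_degree a"
    let ?t = "tens X m x ?k (mw a)"
    have t: "?t \<in> el (fob T X) (?k + m)" by (rule tens_in[OF X x WA_mw(1)[OF 2(1)]])
    have "act (fob T X) (?k + m) ?t (ev (tgtW a)) = ?t"
      using tens_act_right[OF X x WA_mw(1)[OF 2(1)] WA_mw(5)[OF 2(1)]] WA_mw(3)[OF 2(1)] by simp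
    then show ?thesis
      using Cons.IH[OF T_pc[OF X] as t] WA_mw(6)[OF 2(1)] by (simp add: ph_WA[OF 2(1)] Pn_T ac_simps)
  qed
qed simp

lemma ph_map_Arr:
  assumes X: "proj_complex Q X" and "is_path Q (u, as)" "x \<in> el X m" "act X m x (ev u) = x"
  shows "ph (map Arr as) X m x = act X m x (pt (u, as))"
  using assms(2-)
proof (induction as arbitrary: x u)
  case (Cons \<alpha> as)
  then have \<alpha>: "\<alpha> \<in> arcs Q" "u = tail Q \<alpha>" "is_path Q (head Q \<alpha>, as)" by auto
  then have *: "ar \<alpha> \<in> (PA :: ('v, 'e, 'k) pvec set)" "ev (head Q \<alpha>) \<in> (PA :: ('v, 'e, 'k) pvec set)"
    "pt (head Q \<alpha>, as) \<in> (PA :: ('v, 'e, 'k) pvec set)" by (auto simp: paths_iff path_algebra_single)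
  have "act X m (act X m x (ar \<alpha>)) (ev (head Q \<alpha>)) = act X m x (ar \<alpha>)"
    using Cons.prems(2) by (simp add: act_assoc[OF X _ *(1,2)] pm_pt)
  from Cons.IH[OF \<alpha>(3) el_act[OF X Cons.prems(2) *(1)] this] show ?case
    using Cons.prems(2) \<alpha> by (simp add: act_assoc[OF X _ *(1,3)] pm_pt pcat_def)
qed simp

abbreviation php :: "'v \<times> ('v, 'e) garc list \<Rightarrow> ('v, 'e, 'k) pvec" where
  "php p \<equiv> ph (snd p) RQ 0 (ev (fst p))"

definition phi :: "('v, 'e, 'k) gvec \<Rightarrow> ('v, 'e, 'k) pvec" where
  "phi z = lext php z"

lemma phi_zero [simp]: "phi 0 = 0" and phi_add: "phi (x + y) = phi x + phi y" and phi_diff: "phi (x - y) = phi x - phi y"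
  and phi_scale: "phi (c \<odot> x) = c \<odot> phi x" and phi_single: "phi (sg p c) = c \<odot> php p"
  and phi_sum: "phi (sum f I) = (\<Sum>i\<in>I. phi (f i))"
  by (simp_all add: phi_def lext_add lext_diff lext_scale lext_sum)

lemma path_arcs: "is_path GQ (u, as) \<Longrightarrow> set as \<subseteq> arcs GQ"
proof -
  interpret G: fin_digraph GQ by (rule fin_GQ)
  show "is_path GQ (u, as) \<Longrightarrow> set as \<subseteq> arcs GQ" by (induction as arbitrary: u) auto
qed

lemma path_verts: "is_path GQ (u, as) \<Longrightarrow> u \<in> verts Q \<and> gtgt (u, as) \<in> verts Q"
proof -
  interpret G: fin_digraph GQ by (rule fin_GQ)
  show "is_path GQ (u, as) \<Longrightarrow> u \<in> verts Q \<and> gtgt (u, as) \<in> verts Q"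
    using G.is_path_verts[of "(u, as)"] G.path_target_verts[of "(u, as)"] by simp
qed

lemma php_in:
  assumes p: "is_path GQ (u, as)"
  shows "ph as RQ 0 (ev u) \<in> el (PR (gwt (u, as))) (gpath_degree (u, as))"
    and "act (PR (gwt (u, as))) (gpath_degree (u, as)) (ph as RQ 0 (ev u)) (ev (gtgt (u, as))) = ph as RQ 0 (ev u)"
proof -
  have u: "ev u \<in> el RQ 0" using path_verts[OF p] by (simp add: el_R)
  show "ph as RQ 0 (ev u) \<in> el (PR (gwt (u, as))) (gpath_degree (u, as))"
    using ph_in[OF pcR path_arcs[OF p] u] by (simp add: gwt_def gpath_degree_def)
  show "act (PR (gwt (u, as))) (gpath_degree (u, as)) (ph as RQ 0 (ev u)) (ev (gtgt (u, as))) = ph as RQ 0 (ev u)"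
    using ph_ev[OF pcR p u] by (simp add: gwt_def gpath_degree_def act_R pm_pt)
qed

lemma php_pt:
  assumes p: "is_path GQ (u, as)" and q: "q \<in> paths" "fst q \<noteq> gtgt (u, as)"
  shows "act (PR (gwt (u, as))) (gpath_degree (u, as)) (ph as RQ 0 (ev u)) (pt q) = 0"
proof -
  have *: "ev (gtgt (u, as)) \<in> (PA :: ('v, 'e, 'k) pvec set)" "pt q \<in> (PA :: ('v, 'e, 'k) pvec set)"
    using path_verts[OF p] q by auto
  have "act (PR (gwt (u, as))) (gpath_degree (u, as)) (act (PR (gwt (u, as))) (gpath_degree (u, as)) (ph as RQ 0 (ev u)) (ev (gtgt (u, as)))) (pt q) = 0"
    using q by (simp add: act_assoc[OF pcP php_in(1)[OF p] *] pm_pt_0 act_zero_right[OF pcP php_in(1)[OF p]])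
  then show ?thesis by (simp add: php_in(2)[OF p])
qed

lemma phi_in: "z \<in> GW n m \<Longrightarrow> phi z \<in> el (PR n) m"
proof (induction z rule: GW_induct)
  case (single u as c)
  then show ?case using php_in(1)[of u as] by (simp add: phi_single el_scale[OF pcP])
qed (auto simp: el_zero[OF pcP] phi_add el_add[OF pcP])

text \<open>Naturality of path evaluation, applied to x as a morphism kQ \<rightarrow> T^n kQ. The
  idempotent at v stays behind and kills the product of paths that cannot be composed.\<close>

lemma om_hat:
  assumes x: "x \<in> el (PR n) m" and q: "is_path GQ (v, bs)"
  shows "om n (gwt (v, bs)) m (gpath_degree (v, bs)) (hat (PR n) m x) (hat (PR (gwt (v, bs))) (gpath_degree (v, bs)) (ph bs RQ 0 (ev v))) =
    hat (PR (n + gwt (v, bs))) (m + gpath_degree (v, bs)) (ph bs (PR n) m (act (PR n) m x (ev v)))"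
proof -
  let ?q = "gwt (v, bs)" and ?b = "gpath_degree (v, bs)"
  have v: "ev v \<in> el RQ 0" "ev v \<in> (PA :: ('v, 'e, 'k) pvec set)" using path_verts[OF q] by (auto simp: el_R)
  have f: "hat (PR n) m x \<in> hom Q RQ (PR n) m" by (rule hat_hom[OF pcP x])
  have "Tn ?q RQ (PR n) m (hat (PR n) m x) ?b (ph bs RQ 0 (ev v)) = ph bs (PR n) m (hat (PR n) m x 0 (ev v))"
    using ph_natural[OF pcR pcP f path_arcs[OF q] v(1)] by (simp add: gwt_def gpath_degree_def)
  also have "hat (PR n) m x 0 (ev v) = act (PR n) m x (ev v)" using v by (simp add: hat_def)
  finally show ?thesis
    using hat_hom_apply[OF pcP om_T_hom[OF f, of ?q] php_in(1)[OF q]] by (simp add: om_def add.commute[of m])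
qed

text \<open>The comparison map in degree m: the component of weight n is evaluated in T^n kQ and
  read as a morphism kQ \<rightarrow> T^n kQ by the Yoneda identification.\<close>

definition phO :: "int \<Rightarrow> ('v, 'e, 'k) gvec \<Rightarrow> (nat \<Rightarrow>\<^sub>0 ('v, 'e, 'k) gmap)" where
  "phO m x = (\<Sum>n\<in>gwt ` ks x. sg n (hat (PR n) m (phi (wp n x))))"

lemma lk_phO: "lk (phO m x) n = hat (PR n) m (phi (wp n x))"
  by (auto simp: phO_def lk_sum lookup_single when_def sum.delta' wp_out hat_zero[OF pcP])

lemma phO_OD: "x \<in> GA m \<Longrightarrow> phO m x \<in> OD m"
  by (simp add: OD_def lk_phO hat_hom phi_in wp_GW)

lemma phO_zero: "phO m 0 = 0"
  by (simp add: phO_def)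

lemma phO_add: "x \<in> GA m \<Longrightarrow> y \<in> GA m \<Longrightarrow> phO m (x + y) = phO m x + phO m y"
  by (intro poly_mapping_eqI) (simp add: lk_phO lookup_add wp_add phi_add hat_add phi_in wp_GW)

lemma phO_scale: "x \<in> GA m \<Longrightarrow> phO m (c \<odot> x) = Poly_Mapping.map (gscale c) (phO m x)"
  by (intro poly_mapping_eqI) (simp add: lk_phO lk_map_gscale wp_scale phi_scale hat_scale phi_in wp_GW)

lemma phO_GW: "z \<in> GW n m \<Longrightarrow> phO m z = sg n (hat (PR n) m (phi z))"
proof (intro poly_mapping_eqI)
  fix n' assume z: "z \<in> GW n m"
  show "lk (phO m z) n' = lk (sg n (hat (PR n) m (phi z))) n'"
    using wp_id[OF z] wp_other[OF z, of n'] by (cases "n' = n") (auto simp: lk_phO lookup_single hat_zero[OF pcP])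
qed

lemma phO_single: "is_path GQ (u, as) \<Longrightarrow> gpath_degree (u, as) = m \<Longrightarrow>
    phO m (sg (u, as) 1) = sg (gwt (u, as)) (hat (PR (gwt (u, as))) m (ph as RQ 0 (ev u)))"
  using phO_GW[OF GW_single, of "(u, as)" "gwt (u, as)" m 1] by (simp add: phi_single)

lemma phO_mult:
  assumes x: "x \<in> GA m" and y: "y \<in> GA n"
  shows "phO (m + n) (gm x y) = omul m n (phO m x) (phO n y)"
proof -
  interpret G: fin_digraph GQ by (rule fin_GQ)
  interpret O: dg_algebra OA by (rule orbit_dga)
  note msl = O.mult_scale_left[unfolded OA_simps] and msr = O.mult_scale_right[unfolded OA_simps]
  note al = O.mult_add_left[unfolded OA_simps] and ar' = O.mult_add_right[unfolded OA_simps]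
  have paths: "phO (m + n) (gm (sg (u, as) 1) (sg (v, bs) 1)) = omul m n (phO m (sg (u, as) 1)) (phO n (sg (v, bs) 1))"
    if p: "is_path GQ (u, as)" "gpath_degree (u, as) = m" and q: "is_path GQ (v, bs)" "gpath_degree (v, bs) = n" for u as v bs
  proof -
    let ?p = "gwt (u, as)" and ?q = "gwt (v, bs)"
    have "omul m n (phO m (sg (u, as) 1)) (phO n (sg (v, bs) 1)) =
        sg (?p + ?q) (hat (PR (?p + ?q)) (m + n) (ph bs (PR ?p) m (act (PR ?p) m (ph as RQ 0 (ev u)) (ev v))))"
      using om_hat[OF php_in(1)[OF p(1)] q(1)] p(2) q(2) php_in(1)[OF p(1)]
      by (simp add: phO_single[OF p] phO_single[OF q] omul_single hat_hom)
    also have "\<dots> = phO (m + n) (gm (sg (u, as) 1) (sg (v, bs) 1))"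
    proof (cases "gtgt (u, as) = v")
      case True
      have "ph (as @ bs) RQ 0 (ev u) = ph bs (PR ?p) m (ph as RQ 0 (ev u))"
        using ph_append[OF path_arcs[OF p(1)]] p(2) by (simp add: gwt_def gpath_degree_def)
      moreover have "act (PR ?p) m (ph as RQ 0 (ev u)) (ev v) = ph as RQ 0 (ev u)"
        using php_in(2)[OF p(1)] p(2) True by simp
      moreover have "is_path GQ (u, as @ bs)" "gpath_degree (u, as @ bs) = m + n" "gwt (u, as @ bs) = ?p + ?q"
        using p q True by (simp_all add: G.is_path_append gwt_def gpath_degree_def)
      ultimately show ?thesis using True phO_single[of u "as @ bs" "m + n"] by (simp add: pmult_single)
    next
      case False
      then have "act (PR ?p) m (ph as RQ 0 (ev u)) (ev v) = 0"
        using php_pt[OF p(1), of "(v, [])"] path_verts[OF q(1)] p(2) by simp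
      then show ?thesis using False
        by (simp add: pmult_single phO_zero ph_zero[OF pcP path_arcs[OF q(1)]] hat_zero[OF pcP])
    qed
    finally show ?thesis by simp
  qed
  have sgs: "sg p c = c \<odot> sg p 1" for p :: "'v \<times> ('v, 'e) garc list" and c :: 'k by (simp add: pscale_single)
  \<comment> \<open>\<open>GA_induct\<close> does not say that the summands are homogeneous, so
    membership is carried along in the claim.\<close>
  have "x \<in> GA m \<and> phO (m + n) (gm x (sg (v, bs) d)) = omul m n (phO m x) (phO n (sg (v, bs) d))"
    if q: "is_path GQ (v, bs)" "gpath_degree (v, bs) = n" for v bs d
    using x
  proof (induction x rule: GA_induct)
    case (single p c)
    obtain u as where p: "p = (u, as)" by (cases p)
    have P: "sg (u, as) (1::'k) \<in> GA m" "sg (v, bs) (1::'k) \<in> GA n" using single q p by (auto intro: GA_single)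
    then show ?case
      using paths[OF _ _ q, of u as] single p sgs[of p c] sgs[of "(v, bs)" d] phO_OD[OF P(1)] phO_OD[OF P(2)]
      by (simp add: pmult_scale_left pmult_scale_right phO_scale GA_scale GA_mult msl msr OD_scale
          O.scale_scale[unfolded OA_simps, OF omul_OD[OF phO_OD[OF P(1)] phO_OD[OF P(2)]]])
  next
    case (add f g)
    have "sg (v, bs) d \<in> GA n" using q by (intro GA_single) auto
    with add show ?case by (simp add: pmult_add_left phO_add GA_mult GA_add al phO_OD)
  qed (simp add: phO_zero omul_zero_left GA_zero)
  then have x': "phO (m + n) (gm x (sg p d)) = omul m n (phO m x) (phO n (sg p d))"
    if "is_path GQ p" "gpath_degree p = n" for p d
    using that by (cases p) auto
  have "y \<in> GA n \<and> phO (m + n) (gm x y) = omul m n (phO m x) (phO n y)"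
    using y
  proof (induction y rule: GA_induct)
    case (single p d)
    then show ?case using x' by (simp add: GA_single)
  next
    case (add f g)
    then show ?case using x by (simp add: pmult_add_right phO_add GA_mult GA_add ar' phO_OD)
  qed (simp add: phO_zero omul_zero_right GA_zero)
  then show ?thesis ..
qed

lemma php_arc:
  "\<alpha> \<in> arcs Q \<Longrightarrow> php (tail Q \<alpha>, [Arr \<alpha>]) = ar \<alpha>"
  "\<alpha> \<in> arcs Q \<Longrightarrow> php (head Q \<alpha>, [Rev \<alpha>]) = mR \<alpha>"
  "i \<in> verts Q \<Longrightarrow> php (i, [Loop i]) = mL i"
  "\<alpha> \<in> arcs Q \<Longrightarrow> php (tail Q \<alpha>, [Arr \<alpha>, Rev \<alpha>]) = lact (ar \<alpha>) 0 (mR \<alpha>)"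
  "\<alpha> \<in> arcs Q \<Longrightarrow> php (head Q \<alpha>, [Rev \<alpha>, Arr \<alpha>]) = act TR 0 (mR \<alpha>) (ar \<alpha>)"
  by (simp_all add: act_R pm_pt pcat_def mR_left mL_left)

text \<open>Compatibility with the differentials on generators, that is \<open>dif_mR\<close> for
  reversed arrows and \<open>dif_mL\<close> for loops.\<close>

lemma phO_garc_diff:
  assumes a: "a \<in> arcs GQ"
  shows "phO (garc_degree a - 1) (garc_diff Q a) = odif (garc_degree a) (phO (garc_degree a) (sg (tail GQ a, [a]) 1))"
proof -
  interpret G: fin_digraph GQ by (rule fin_GQ)
  have v: "head GQ a \<in> verts Q" using G.head_in_verts[OF a] by simp
  have p: "is_path GQ (tail GQ a, [a])" using a v by (cases a) auto
  have w: "gwt (tail GQ a, [a]) = awt a" and d: "gpath_degree (tail GQ a, [a]) = garc_degree a"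
    by (simp_all add: gwt_def gpath_degree_def)
  note [simp del] = ph.simps
  have ph1: "php (tail GQ a, [a]) \<in> el (PR (awt a)) (garc_degree a)" using php_in(1)[OF p] w d by simp
  have R: "odif (garc_degree a) (phO (garc_degree a) (sg (tail GQ a, [a]) 1)) =
      sg (awt a) (hat (PR (awt a)) (garc_degree a - 1) (dif (PR (awt a)) (garc_degree a) (php (tail GQ a, [a]))))"
    using phO_single[OF p d] ph1 by (simp add: w odif_single hat_hom hat_dif)
  have "garc_diff Q a \<in> GW (awt a) (garc_degree a - 1)"
    using garc_diff_GH[OF a] by (auto simp: GH_def GW_def)
  then have L: "phO (garc_degree a - 1) (garc_diff Q a) = sg (awt a) (hat (PR (awt a)) (garc_degree a - 1) (phi (garc_diff Q a)))"
    by (rule phO_GW)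
  have "phi (garc_diff Q a) = dif (PR (awt a)) (garc_degree a) (php (tail GQ a, [a]))"
  proof (cases a)
    case (Arr \<alpha>)
    then show ?thesis by simp
  next
    case (Rev \<alpha>)
    then have "\<alpha> \<in> arcs Q" using a by auto
    then show ?thesis using Rev php_arc(2)[of \<alpha>] by (simp add: dif_mR)
  next
    case (Loop i)
    then have i: "i \<in> verts Q" using a by auto
    have "phi (garc_diff Q a) =
        (\<Sum>\<alpha>\<in>outs i. php (i, [Arr \<alpha>, Rev \<alpha>])) - (\<Sum>\<beta>\<in>ins i. php (i, [Rev \<beta>, Arr \<beta>]))"
      unfolding Loop garc_diff.simps phi_diff phi_sum phi_single by simp
    also have "\<dots> = (\<Sum>\<alpha>\<in>outs i. lact (ar \<alpha>) 0 (mR \<alpha>)) - (\<Sum>\<beta>\<in>ins i. act TR 0 (mR \<beta>) (ar \<beta>))"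
      using php_arc(4,5) by (intro arg_cong2[of _ _ _ _ "(-)"] sum.cong refl) auto
    also have "\<dots> = dif TR 1 (mL i)" by (rule dif_mL[OF i, symmetric])
    finally show ?thesis using Loop php_arc(3)[OF i] by simp
  qed
  then show ?thesis by (simp add: L R)
qed

text \<open>Both differentials are derivations and the map is multiplicative, so agreement on arrows
  spreads to paths, one first arrow at a time.\<close>

lemma phO_gpath_diff:
  "is_path GQ (u, as) \<Longrightarrow> phO (gpath_degree (u, as) - 1) (gpath_diff Q u as) =
    odif (gpath_degree (u, as)) (phO (gpath_degree (u, as)) (sg (u, as) 1))"
proof (induction as arbitrary: u)
  case Nil
  then have u: "(ev u :: ('v, 'e, 'k) pvec) \<in> el RQ 0" using path_verts[OF Nil] by (simp add: el_R)
  show ?case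
    using phO_single[OF Nil] hat_hom[OF pcR u] hat_dif[OF pcR u] hat_zero[OF pcR, where 'k = 'k] odif_single[of "hat RQ 0 (ev u)" 0 0]
    by (simp add: phO_zero)
next
  case (Cons a as)
  interpret G: fin_digraph GQ by (rule fin_GQ)
  interpret O: dg_algebra OA by (rule orbit_dga)
  let ?v = "head GQ a" and ?s = "sg (head GQ a, as) (1::'k)" and ?t = "sg (u, [a]) (1::'k)"
  let ?m = "garc_degree a" and ?n = "gpath_degree (head GQ a, as)"
  have a: "a \<in> arcs GQ" "u = tail GQ a" and p: "is_path GQ (?v, as)" using Cons.prems by auto
  have v: "?v \<in> verts Q" using path_verts[OF p] by simp
  have s: "?s \<in> GA ?n" and t: "?t \<in> GA ?m"
    using p a v by (auto intro!: GA_single simp: gpath_degree_def)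
  have gt: "gpath_diff Q u [a] = (garc_diff Q a :: _ \<Rightarrow>\<^sub>0 'k)" using gdd_arc[OF a(1)] a(2) by simp
  have gs: "gdd ?s = gpath_diff Q ?v as" "gdd ?t = garc_diff Q a"
    using gt by (simp_all add: gdd_single)
  have e: "sg (u, a # as) 1 = gm ?t ?s" using sg_append[of u "[a]" ?v as, where 'k = 'k] by (simp add: path_target_def)
  have ds: "gdd ?s \<in> GA (?n - 1)" "gdd ?t \<in> GA (?m - 1)" by (intro GA_gdd s t)+
  have i: "?m + ?n - 1 = ?m - 1 + ?n" "?m + ?n - 1 = ?m + (?n - 1)" by simp_all
  have k: "koszul ?m (gm ?t (gdd ?s)) \<in> GA (?m + ?n - 1)" and l: "gm (gdd ?t) ?s \<in> GA (?m + ?n - 1)"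
    using GA_mult[OF t ds(1)] GA_mult[OF ds(2) s] GA_uminus by (auto simp: koszul_def algebra_simps)
  have ko: "phO (?m + ?n - 1) (koszul ?m z) = koszul ?m (phO (?m + ?n - 1) z)" if "z \<in> GA (?m + ?n - 1)" for z
    using phO_add[OF that GA_uminus[OF that]] by (auto simp: koszul_def phO_zero eq_neg_iff_add_eq_0 add.commute)
  have "phO (?m + ?n - 1) (gpath_diff Q u (a # as)) = phO (?m + ?n - 1) (gm (gdd ?t) ?s + koszul ?m (gm ?t (gdd ?s)))"
    using gdd_leibniz[OF t s] by (simp add: e[symmetric] gdd_single[of "(u, a # as)"] del: gpath_diff.simps)
  also have "\<dots> = phO (?m - 1 + ?n) (gm (gdd ?t) ?s) + koszul ?m (phO (?m + (?n - 1)) (gm ?t (gdd ?s)))"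
  proof -
    have "gm ?t (gdd ?s) \<in> GA (?m + ?n - 1)" using GA_mult[OF t ds(1)] unfolding i(2) .
    from ko[OF this] show ?thesis using phO_add[OF l k] by (simp only: i(1)[symmetric] i(2)[symmetric])
  qed
  also have "\<dots> = omul (?m - 1) ?n (phO (?m - 1) (gdd ?t)) (phO ?n ?s) + koszul ?m (omul ?m (?n - 1) (phO ?m ?t) (phO (?n - 1) (gdd ?s)))"
    by (simp only: phO_mult[OF ds(2) s] phO_mult[OF t ds(1)])
  also have "phO (?m - 1) (gdd ?t) = odif ?m (phO ?m ?t)" using phO_garc_diff[OF a(1)] a(2) gs(2) by simp
  also have "phO (?n - 1) (gdd ?s) = odif ?n (phO ?n ?s)" using Cons.IH[OF p] gs(1) by simp
  also have "omul (?m - 1) ?n (odif ?m (phO ?m ?t)) (phO ?n ?s) + koszul ?m (omul ?m (?n - 1) (phO ?m ?t) (odif ?n (phO ?n ?s))) =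
      odif (?m + ?n) (omul ?m ?n (phO ?m ?t) (phO ?n ?s))"
    using O.leibniz[unfolded OA_simps, OF phO_OD[OF t] phO_OD[OF s]] by simp
  also have "omul ?m ?n (phO ?m ?t) (phO ?n ?s) = phO (?m + ?n) (sg (u, a # as) 1)"
    by (simp only: phO_mult[OF t s] e)
  finally show ?case using gdeg_simps(2)[of u a as ?v] by (simp only:)
qed

lemma phO_gdd: "x \<in> GA m \<Longrightarrow> x \<in> GA m \<and> phO (m - 1) (gdd x) = odif m (phO m x)"
proof (induction x rule: GA_induct)
  case (single p c)
  obtain u as where p: "p = (u, as)" by (cases p)
  interpret O: dg_algebra OA by (rule orbit_dga)
  have P: "sg (u, as) (1::'k) \<in> GA m" and D: "(gpath_diff Q u as :: _ \<Rightarrow>\<^sub>0 'k) \<in> GA (m - 1)"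
    using single p GH_GA[OF gpath_diff_GH, of u as] by (auto intro: GA_single)
  have "sg p c = c \<odot> sg (u, as) 1" by (simp add: p pscale_single)
  moreover have "gdd (sg p c) = c \<odot> gpath_diff Q u as" by (simp add: p gdd_single)
  moreover have "odif m (Poly_Mapping.map (gscale c) (phO m (sg (u, as) 1))) = Poly_Mapping.map (gscale c) (odif m (phO m (sg (u, as) 1)))"
    by (rule O.diff_scale[unfolded OA_simps, OF phO_OD[OF P]])
  ultimately show ?case
    using phO_scale[OF P] phO_scale[OF D] phO_gpath_diff[of u as] single p GA_scale[OF P] by simp
next
  case (add x y)
  then show ?case by (simp add: gdd_add phO_add GA_gdd GA_add odif_add phO_OD)
qed (simp add: gdd_zero phO_zero odif_zero GA_zero)

lemma phO_hom: "dga_hom GZ OA phO"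
  unfolding dga_hom_def GZ_simps OA_simps
proof (intro conjI allI ballI ginzburg_dga orbit_dga phO_OD phO_add phO_scale phO_mult)
  show "phO 0 (punit GQ) = sg 0 (gid RQ)"
  proof -
    have e: "punit GQ = emb (punit Q)" by (simp add: punit_def emb_def lext_sum)
    have "(punit GQ :: _ \<Rightarrow>\<^sub>0 'k) \<in> GW 0 0" unfolding e by (rule emb_GW[OF punit_closed])
    moreover have "phi (punit GQ) = (punit Q :: ('v, 'e, 'k) pvec)"
      by (simp add: punit_def phi_sum phi_single)
    ultimately show ?thesis by (simp add: phO_GW hat_R_unit)
  qed
  show "phO (m - 1) (gdd x) = odif m (phO m x)" if "x \<in> GA m" for x m using phO_gdd[OF that] by simp
qed

lemma phi_gdd:
  assumes z: "z \<in> GW n m"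
  shows "phi (gdd z) = dif (PR n) m (phi z)"
proof -
  have "hat (PR n) (m - 1) (phi (gdd z)) = hat (PR n) (m - 1) (dif (PR n) m (phi z))"
  proof -
    have "lk (phO (m - 1) (gdd z)) n = lk (odif m (phO m z)) n" using phO_gdd[OF GW_GA[OF z]] by simp
    then show ?thesis
      by (simp add: lk_phO wp_id[OF GW_gdd[OF z]] lk_odif[OF phO_OD[OF GW_GA[OF z]]] wp_id[OF z] hat_dif[OF pcP phi_in[OF z]])
  qed
  then show ?thesis
    using hat_unit[OF pcP phi_in[OF GW_gdd[OF z]]] hat_unit[OF pcP d_in[OF pcP phi_in[OF z]]] by metis
qed

end

section \<open>The weight filtration\<close>

lemma sum_list_Arr [simp]: "sum_list (map (awt \<circ> Arr) bs) = 0" "sum_list (map (garc_degree \<circ> Arr) bs) = 0"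
  by (induction bs) auto

text \<open>The twist at k reads only coordinates of larger degree \<open>kd\<close>. This
  triangular shape allows devissage with \<open>kd\<close> as rank.\<close>

lemma (in right_dg) Etw_eq_0:
  assumes k: "k \<in> Om" and x0: "\<And>l. l \<in> Om \<Longrightarrow> kd k < kd l \<Longrightarrow> x l = 0"
  shows "Etw m x k = 0"
  using k
proof (cases rule: Om_cases)
  case (Rev \<alpha> p)
  then have Om: "(Rev \<alpha>, p) \<in> Om" by simp
  have "x (Loop (tail Q \<alpha>), p) = 0"
    by (rule x0[OF Om_shift(1)[OF Om]]) (simp add: Rev)
  moreover have "x (Loop (head Q \<alpha>), (head Q \<alpha>, tl (snd p))) = 0" if "snd p \<noteq> [] \<and> hd (snd p) = \<alpha>"
    by (rule x0[OF Om_shift(2)[OF Om that]]) (simp add: Rev)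
  ultimately show ?thesis using Rev by (auto simp: Etw_def r_zero)
qed (auto simp: Etw_def)

context quiver
begin

context
  fixes N :: "int \<Rightarrow> 'a::ab_group_add set" and d and r :: "int \<Rightarrow> 'a \<Rightarrow> ('v, 'e, 'k::field) pvec \<Rightarrow> 'a"
    and N' :: "int \<Rightarrow> 'b::ab_group_add set" and d' and r' :: "int \<Rightarrow> 'b \<Rightarrow> ('v, 'e, 'k) pvec \<Rightarrow> 'b" and f
  assumes R: "right_dg Q N d r" and R': "right_dg Q N' d' r'" and f: "chain_map N d N' d' f"
    and f_r: "\<And>x m a. x \<in> N m \<Longrightarrow> a \<in> PA \<Longrightarrow> f m (r m x a) = r' m (f m x) a"
begin

interpretation R: right_dg Q N d r by (rule R)
interpretation R': right_dg Q N' d' r' by (rule R')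
interpretation f: chain_map N d N' d' f by (rule f)

lemma f_koszul: "x \<in> N m \<Longrightarrow> f m (koszul i x) = koszul i (f m x)"
  by (simp add: koszul_def f.f_uminus)

text \<open>The map f \<otimes> \<Theta>. Its compatibility with the twist rests on the linearity
  \<open>f_r\<close>.\<close>

lemma Emap_chain: "chain_map R.Ecar R.Ed R'.Ecar R'.Ed (\<lambda>m x k. f (m - kd k) (x k))"
proof (intro chain_map.intro chain_map_axioms.intro R.E_complex R'.E_complex)
  fix m x assume x: "x \<in> R.Ecar m"
  have ev_PA: "ev (srcW (fst k)) \<in> (PA :: ('v, 'e, 'k) pvec set)" if "k \<in> Om" for k
    using Om_srcW[OF that] by simp
  show "(\<lambda>k. f (m - kd k) (x k)) \<in> R'.Ecar m"
    unfolding R'.Ecar_def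
    using R.Ecar_in[OF x] R.Ecar_ev[OF x] R.Ecar_out[OF x] f.f_in f_r[OF R.Ecar_in[OF x] ev_PA, symmetric] by (auto simp: f.f_zero)
  show "(\<lambda>k. f (m - kd k) ((x - y) k)) = (\<lambda>k. f (m - kd k) (x k)) - (\<lambda>k. f (m - kd k) (y k))" if y: "y \<in> R.Ecar m" for y
  proof (rule ext)
    fix k
    show "f (m - kd k) ((x - y) k) = ((\<lambda>k. f (m - kd k) (x k)) - (\<lambda>k. f (m - kd k) (y k))) k"
      using R.Ecar_in[OF x, of k] R.Ecar_in[OF y, of k] R.Ecar_out[OF x, of k] R.Ecar_out[OF y, of k]
      by (cases "k \<in> Om") (auto simp: f.f_diff f.f_zero)
  qed
  show "R'.Ed m (\<lambda>k. f (m - kd k) (x k)) = (\<lambda>k. f (m - 1 - kd k) (R.Ed m x k))"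
  proof (rule ext)
    fix k
    show "R'.Ed m (\<lambda>k. f (m - kd k) (x k)) k = f (m - 1 - kd k) (R.Ed m x k)"
    proof (cases "k \<in> Om")
      case False
      then show ?thesis by (simp add: R.Ed_def R'.Ed_def f.f_zero)
    next
      case True
      have i: "m - 1 - kd k = m - kd k - 1" by simp
      have "R'.Etw m (\<lambda>k. f (m - kd k) (x k)) k = f (m - 1 - kd k) (R.Etw m x k)"
        using True
      proof (cases rule: Om_cases)
        case (Rev \<alpha> p)
        have Om: "(Rev \<alpha>, p) \<in> Om" using True Rev by simp
        have a: "ar \<alpha> \<in> (PA :: ('v, 'e, 'k) pvec set)" using Rev by simp
        note y = R.Ecar_Loop(1)[OF x R.Om_shift(1)[OF Om]]
        define z where "z = (if snd p \<noteq> [] \<and> hd (snd p) = \<alpha> then x (Loop (head Q \<alpha>), (head Q \<alpha>, tl (snd p))) else 0)"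
        have z: "z \<in> N (m - 1)" using R.Ecar_Loop(1)[OF x R.Om_shift(2)[OF Om]] by (auto simp: z_def R.N.zero)
        have "f (m - 1) (koszul (m - 1) (r (m - 1) (x (Loop (tail Q \<alpha>), p)) (ar \<alpha>) - z)) =
            koszul (m - 1) (r' (m - 1) (f (m - 1) (x (Loop (tail Q \<alpha>), p))) (ar \<alpha>) - f (m - 1) z)"
          using R.r_in[OF y a] z by (simp add: f_koszul f.f_diff f_r[OF y a] R.N.diff)
        moreover have "f (m - 1) z = (if snd p \<noteq> [] \<and> hd (snd p) = \<alpha> then f (m - 1) (x (Loop (head Q \<alpha>), (head Q \<alpha>, tl (snd p)))) else 0)"
          by (simp add: z_def f.f_zero)
        ultimately show ?thesis using Rev by (simp add: R.Etw_def R'.Etw_def z_def)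
      qed (auto simp: R.Etw_def R'.Etw_def f.f_zero)
      moreover have "d' (m - kd k) (f (m - kd k) (x k)) = f (m - 1 - kd k) (d (m - kd k) (x k))"
        unfolding i by (rule f.f_d[OF R.Ecar_in[OF x True]])
      moreover have "d (m - kd k) (x k) \<in> N (m - 1 - kd k)" unfolding i by (rule R.N.D_in[OF R.Ecar_in[OF x True]])
      ultimately show ?thesis
        using True R.Etw_in(1)[OF x True] by (simp add: R.Ed_def R'.Ed_def f.f_add)
    qed
  qed
qed

text \<open>The loops form a quotient complex, the reversed arrows a subcomplex.\<close>

lemma Emap_exact:
  assumes exact: "exact_cpx (cone_el N N') (cone_d d d' f)"
  shows "exact_cpx (cone_el R.Ecar R'.Ecar) (cone_d R.Ed R'.Ed (\<lambda>m x k. f (m - kd k) (x k)))"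
proof -
  interpret F: chain_map R.Ecar R.Ed R'.Ecar R'.Ed "\<lambda>m x k. f (m - kd k) (x k)" by (rule Emap_chain)
  define e :: "_ \<Rightarrow> ('v, 'e, 'k) pvec" where "e k = ev (srcW (fst k))" for k :: "('v, 'e) wpath"
  have e: "e k \<in> PA" "pm (e k) (e k) = e k" if "k \<in> Om" for k
    using Om_srcW[OF that] by (auto simp: e_def pm_pt)
  define H where "H k m = {(a, b). a \<in> N (m - kd k) \<and> b \<in> N' (m - kd k + 1) \<and> r (m - kd k) a (e k) = a \<and> r' (m - kd k + 1) b (e k) = b}" for k m
  define DH where "DH k m c = cone_d d d' f (m - kd k) c" for k :: "('v, 'e) wpath" and m c
  define V where "V k m c = (fst c k, snd c k)" for k :: "('v, 'e) wpath" and m :: int and c :: "(_ \<Rightarrow> 'a) \<times> (_ \<Rightarrow> 'b)"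
  define U where "U k m c = ((\<lambda>j. if j = k then fst c else 0), (\<lambda>j. if j = k then snd c else 0))"
    for k :: "('v, 'e) wpath" and m :: int and c :: "'a \<times> 'b"
  have i: "m + 1 - kd k = m - kd k + 1" "m - 1 - kd k = m - kd k - 1" for m and k :: "('v, 'e) wpath" by simp_all
  \<comment> \<open>Once the coordinates of larger \<open>kd\<close> vanish, so does the twist, and
    coordinate k sees only the cone of f.\<close>
  have VD: "V k (m - 1) (cone_d R.Ed R'.Ed (\<lambda>m x k. f (m - kd k) (x k)) m c) = DH k m (V k m c)"
    if k: "k \<in> Om" and V0: "\<And>l. l \<in> Om \<Longrightarrow> kd k < kd l \<Longrightarrow> V l m c = 0" for k m c
  proof -
    have "fst c l = 0 \<and> snd c l = 0" if "l \<in> Om" "kd k < kd l" for l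
      using V0[OF that] by (simp add: V_def zero_prod_def)
    then have "R.Etw m (fst c) k = 0" "R'.Etw (m + 1) (snd c) k = 0"
      using R.Etw_eq_0[OF k] R'.Etw_eq_0[OF k] by blast+
    then show ?thesis using k by (simp add: V_def DH_def cone_d_def R.Ed_def R'.Ed_def i)
  qed
  show ?thesis
  proof (rule devissage[where I = Om and H = H and DH = DH and U = U and V = V and \<rho> = kd])
    show "ab_complex (cone_el R.Ecar R'.Ecar) (cone_d R.Ed R'.Ed (\<lambda>m x k. f (m - kd k) (x k)))"
      by (rule F.cone_complex)
  next
    fix k :: "('v, 'e) wpath" assume k: "k \<in> Om"
    show "exact_cpx (H k) (DH k)"
      unfolding exact_cpx_def
    proof (intro allI ballI impI)
      fix m c assume c: "c \<in> H k m" and D: "DH k m c = 0"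
      have "c \<in> cone_el N N' (m - kd k)" using c by (auto simp: H_def cone_el_def)
      with exact D obtain c' where c': "c' \<in> cone_el N N' (m - kd k + 1)" "cone_d d d' f (m - kd k + 1) c' = c"
        unfolding DH_def exact_cpx_def by blast
      obtain a b where ab: "c' = (a, b)" by (cases c')
      have a: "a \<in> N (m - kd k + 1)" and b: "b \<in> N' (m - kd k + 1 + 1)" using c' ab by (auto simp: cone_el_def)
      have ca: "d (m - kd k + 1) a = fst c" and cb: "f (m - kd k + 1) a - d' (m - kd k + 1 + 1) b = snd c"
        using c'(2) ab by (auto simp: cone_d_def)
      \<comment> \<open>The coordinate at k lives in the summand cut out by the idempotent at the
        source of w. Multiplying by this idempotent commutes with the cone differential and fixes c,
        so it moves the preimage into the summand.\<close>
      let ?a = "r (m - kd k + 1) a (e k)" and ?b = "r' (m - kd k + 1 + 1) b (e k)"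
      have d1: "d (m - kd k + 1) ?a = r (m - kd k) (fst c) (e k)"
        using R.d_r[OF a e(1)[OF k]] ca by simp
      have i2: "m - kd k + 1 + 1 - 1 = m - kd k + 1" by simp
      have db: "d' (m - kd k + 1 + 1) b \<in> N' (m - kd k + 1)" using R'.N.D_in[OF b] unfolding i2 .
      have dr: "d' (m - kd k + 1 + 1) ?b = r' (m - kd k + 1) (d' (m - kd k + 1 + 1) b) (e k)"
        using R'.d_r[OF b e(1)[OF k]] unfolding i2 .
      have "f (m - kd k + 1) ?a - d' (m - kd k + 1 + 1) ?b = r' (m - kd k + 1) (f (m - kd k + 1) a - d' (m - kd k + 1 + 1) b) (e k)"
        by (simp only: dr f_r[OF a e(1)[OF k]] R'.r_diff[OF f.f_in[OF a] db e(1)[OF k]])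
      then have "cone_d d d' f (m - kd k + 1) (?a, ?b) = c"
        using c d1 cb by (cases c) (auto simp: cone_d_def H_def)
      moreover have "(?a, ?b) \<in> H k (m + 1)"
        unfolding H_def i using a b e[OF k] by (simp add: R.r_in R'.r_in R.r_assoc R'.r_assoc)
      ultimately show "\<exists>y\<in>H k (m + 1). DH k (m + 1) y = c"
        unfolding DH_def i by blast
    qed
    show "V k m x \<in> H k m" if "x \<in> cone_el R.Ecar R'.Ecar m" for m x
      using that R.Ecar_in[of "fst x" m k] R.Ecar_ev[of "fst x" m k] R'.Ecar_in[of "snd x" "m + 1" k] R'.Ecar_ev[of "snd x" "m + 1" k] k
      by (auto simp: V_def H_def cone_el_def e_def i)
    show "V k m (x - y) = V k m x - V k m y" for m x y by (simp add: V_def)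
    show "U k m h \<in> cone_el R.Ecar R'.Ecar m" if "h \<in> H k m" for m h
    proof -
      have ePA: "ev (srcW (fst j)) \<in> (PA :: ('v, 'e, 'k) pvec set)" if "j \<in> Om" for j
        using Om_srcW[OF that] by simp
      show ?thesis
        using that k ePA by (auto simp: U_def H_def cone_el_def R.Ecar_def R'.Ecar_def e_def R.N.zero R'.N.zero R.r_zero R'.r_zero i)
    qed
    show "U k m 0 = 0" for m by (simp add: U_def zero_prod_def fun_eq_iff)
    show DHin: "DH k m h \<in> H k (m - 1)" if "h \<in> H k m" for m h
    proof -
      obtain a b where h: "h = (a, b)" by (cases h)
      have a: "a \<in> N (m - kd k)" "r (m - kd k) a (e k) = a" and b: "b \<in> N' (m - kd k + 1)" "r' (m - kd k + 1) b (e k) = b"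
        using that h by (auto simp: H_def)
      have "r' (m - kd k) (f (m - kd k) a - d' (m - kd k + 1) b) (e k) = f (m - kd k) a - d' (m - kd k + 1) b"
        using R'.r_diff[OF f.f_in[OF a(1)] _ e(1)[OF k]] R'.N.D_in[OF b(1)] f_r[OF a(1) e(1)[OF k]] R'.d_r[OF b(1) e(1)[OF k]] a b by simp
      moreover have "r (m - kd k - 1) (d (m - kd k) a) (e k) = d (m - kd k) a"
        using R.d_r[OF a(1) e(1)[OF k]] a(2) by simp
      ultimately show ?thesis
        unfolding H_def i using R.N.D_in[OF a(1)] f.f_in[OF a(1)] R'.N.D_in[OF b(1)] by (simp add: DH_def cone_d_def h R'.N.diff)
    qed
    show "DH k m (V k m x) = 0"
      if "x \<in> cone_el R.Ecar R'.Ecar m" "cone_d R.Ed R'.Ed (\<lambda>m x k. f (m - kd k) (x k)) m x = 0"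
        "\<forall>l\<in>Om. kd k < kd l \<longrightarrow> V l m x = 0" for m x
      using VD[OF k, of m x] that by (simp add: V_def zero_prod_def)
    fix l :: "('v, 'e) wpath" assume l: "l \<in> Om"
    show "V l m (U k m h) = 0" if "kd k < kd l" for m h using that by (auto simp: V_def U_def zero_prod_def)
    show "V l m (cone_d R.Ed R'.Ed (\<lambda>m x k. f (m - kd k) (x k)) (m + 1) (U k (m + 1) h)) = V l m (U k m (DH k (m + 1) h))"
      if "h \<in> H k (m + 1)" "kd k \<le> kd l" for m h
    proof -
      have "V l' (m + 1) (U k (m + 1) h) = 0" if "kd l < kd l'" for l'
        using that \<open>kd k \<le> kd l\<close> by (auto simp: V_def U_def zero_prod_def)
      from VD[OF l, of "m + 1" "U k (m + 1) h", OF this]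
      have "V l m (cone_d R.Ed R'.Ed (\<lambda>m x k. f (m - kd k) (x k)) (m + 1) (U k (m + 1) h)) = DH l (m + 1) (V l (m + 1) (U k (m + 1) h))"
        by simp
      also have "\<dots> = V l m (U k m (DH k (m + 1) h))"
        by (cases "l = k") (auto simp: V_def U_def DH_def cone_d_def f.f_zero)
      finally show ?thesis .
    qed
  next
    fix m x assume x: "x \<in> cone_el R.Ecar R'.Ecar m"
    have s: "(\<Sum>k\<in>S. U k m (V k m x)) = ((\<lambda>j. if j \<in> S then fst x j else 0), (\<lambda>j. if j \<in> S then snd x j else 0))" if "finite S" for S
      using that by (induction S rule: finite_induct) (auto simp: U_def V_def zero_prod_def fun_eq_iff)
    show "x = (\<Sum>k\<in>Om. U k m (V k m x))"
      unfolding s[OF finite_Om] using x R.Ecar_out[of "fst x" m] R'.Ecar_out[of "snd x" "m + 1"]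
      by (cases x) (auto simp: cone_el_def fun_eq_iff)
  qed simp
qed

end

section \<open>Splitting off the last arrow of weight one\<close>

lemma GW_rdg: "right_dg Q (GW n :: int \<Rightarrow> (_ \<Rightarrow>\<^sub>0 'k::field) set) (\<lambda>_. gdd) (\<lambda>_ x a. gm x (emb a))"
proof
  fix m and x :: "('v, 'e, 'k) gvec" and a :: "('v, 'e, 'k) pvec" assume x: "x \<in> GW n m"
  show "gdd (gdd x) = 0" by (rule gdd_gdd[OF GW_GA[OF x]])
  assume a: "a \<in> PA"
  show "gm x (emb a) \<in> GW n m" using GW_mult[OF x emb_GW[OF a]] by simp
  show "gdd (gm x (emb a)) = gm (gdd x) (emb a)"
    using gdd_leibniz[OF GW_GA[OF x] GW_GA[OF emb_GW[OF a]]] by (simp add: gdd_emb)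
qed (auto simp: GW_zero GW_diff GW_gdd gdd_diff pmult_diff_left emb_pm pmult_assoc)

abbreviation EG :: "nat \<Rightarrow> int \<Rightarrow> (('v, 'e) wpath \<Rightarrow> ('v, 'e, 'k::field) gvec) set" where
  "EG n \<equiv> right_dg.Ecar Q (GW n) (\<lambda>_ x a. gm x (emb a))"

abbreviation dEG :: "int \<Rightarrow> (('v, 'e) wpath \<Rightarrow> ('v, 'e, 'k::field) gvec) \<Rightarrow>
    (('v, 'e) wpath \<Rightarrow> ('v, 'e, 'k) gvec)" where
  "dEG \<equiv> right_dg.Ed Q (\<lambda>_. gdd) (\<lambda>_ x a. gm x (emb a))"

definition wkp :: "('v, 'e) wpath \<Rightarrow> 'v \<times> ('v, 'e) garc list" where
  "wkp k = (srcW (fst k), fst k # map Arr (snd (snd k)))"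

abbreviation wk :: "('v, 'e) wpath \<Rightarrow> ('v, 'e, 'k::field) gvec" where "wk k \<equiv> sg (wkp k) 1"

lemma wkp_path:
  assumes "k \<in> Om"
  shows "is_path GQ (wkp k)" "gwt (wkp k) = 1" "gpath_degree (wkp k) = kd k" "fst (wkp k) = srcW (fst k)"
proof -
  interpret G: fin_digraph GQ by (rule fin_GQ)
  show "is_path GQ (wkp k)"
    using assms by (cases rule: Om_cases; cases "snd k") (auto simp: wkp_def paths_iff)
  show "gwt (wkp k) = 1" "gpath_degree (wkp k) = kd k" "fst (wkp k) = srcW (fst k)"
    using assms
    by (cases rule: Om_cases; auto simp: wkp_def gwt_def gpath_degree_def)+
qed

text \<open>Multiplication from the part of weight n tensored with \<Theta> to the part of weight n
  + 1. It is bijective because every path of positive weight can be cut in exactly one way in front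
  of its last arrow of weight one.\<close>

definition bG :: "(('v, 'e) wpath \<Rightarrow> ('v, 'e, 'k::field) gvec) \<Rightarrow> ('v, 'e, 'k) gvec" where
  "bG x = (\<Sum>k\<in>Om. gm (x k) (wk k))"

lemma gdd_wk_Rev: "(Rev \<alpha>, p) \<in> Om \<Longrightarrow> gdd (wk (Rev \<alpha>, p)) = 0"
  by (simp add: gdd_single wkp_def Let_def)

lemma gdd_wk_Loop:
  assumes "(Loop i, p) \<in> Om"
  shows "gdd (wk (Loop i, p)) = (\<Sum>\<alpha>\<in>outs i. gm (emb (ar \<alpha>)) (wk (Rev \<alpha>, p))) -
    (\<Sum>\<beta>\<in>ins i. wk (Rev \<beta>, pcat (ap \<beta>) p) :: _ \<Rightarrow>\<^sub>0 'k::field)"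
proof -
  have "gdd (wk (Loop i, p)) = gm (garc_diff Q (Loop i)) (sg (i, map Arr (snd p)) (1::'k))"
    by (simp add: gdd_single wkp_def Let_def del: garc_diff.simps)
  also have "\<dots> = (\<Sum>\<alpha>\<in>outs i. gm (sg (i, [Arr \<alpha>, Rev \<alpha>]) 1) (sg (i, map Arr (snd p)) (1::'k))) -
      (\<Sum>\<beta>\<in>ins i. gm (sg (i, [Rev \<beta>, Arr \<beta>]) 1) (sg (i, map Arr (snd p)) (1::'k)))"
    by (simp only: garc_diff.simps pmult_diff_left pmult_sum_left)
  also have "\<dots> = (\<Sum>\<alpha>\<in>outs i. gm (emb (ar \<alpha>)) (wk (Rev \<alpha>, p))) -
    (\<Sum>\<beta>\<in>ins i. wk (Rev \<beta>, pcat (ap \<beta>) p) :: _ \<Rightarrow>\<^sub>0 'k)"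
    by (intro arg_cong2[of _ _ _ _ "(-)"] sum.cong refl)
      (auto simp: pmult_single emb_single wkp_def path_target_def)
  finally show ?thesis .
qed

lemma wk_GA: "k \<in> Om \<Longrightarrow> wk k \<in> GW 1 (kd k)"
  using wkp_path[of k] by (intro GW_single) auto

lemma bG_add: "bG (x + y) = bG x + bG y"
  by (simp add: bG_def pmult_add_left sum.distrib)

lemma bG_in: assumes x: "x \<in> EG n m" shows "bG x \<in> GW (Suc n) m"
proof -
  interpret E: right_dg Q "GW n" "\<lambda>_. gdd" "\<lambda>_ x a. gm x (emb a)" by (rule GW_rdg)
  show ?thesis unfolding bG_def
  proof (intro GW_sum)
    fix k assume k: "k \<in> Om"
    show "gm (x k) (wk k) \<in> GW (Suc n) m" using GW_mult[OF E.Ecar_in[OF x k] wk_GA[OF k]] by simp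
  qed
qed

lemma bG_d:
  fixes x :: "('v, 'e) wpath \<Rightarrow> ('v, 'e, 'k::field) gvec"
  assumes x: "x \<in> EG n m"
  shows "bG (dEG m x) = gdd (bG x)"
proof -
  interpret E: right_dg Q "GW n" "\<lambda>_. gdd" "\<lambda>_ x a. gm x (emb a)" by (rule GW_rdg)
  define S1 where "S1 i p = (\<Sum>\<alpha>\<in>outs i. gm (koszul (m - 1) (gm (x (Loop i, p)) (emb (ar \<alpha>)))) (wk (Rev \<alpha>, p)))" for i p
  define S2 where "S2 i p = (\<Sum>\<beta>\<in>ins i. gm (koszul (m - 1) (x (Loop i, p))) (wk (Rev \<beta>, pcat (ap \<beta>) p)))" for i p
  have "gdd (bG x) = (\<Sum>k\<in>Om. gm (gdd (x k)) (wk k) + koszul (m - kd k) (gm (x k) (gdd (wk k))))"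
    unfolding bG_def gdd_sum
  proof (rule sum.cong[OF refl])
    fix k assume k: "k \<in> Om"
    show "gdd (gm (x k) (wk k)) = gm (gdd (x k)) (wk k) + koszul (m - kd k) (gm (x k) (gdd (wk k)))"
      by (rule gdd_leibniz[OF GW_GA[OF E.Ecar_in[OF x k]] GW_GA[OF wk_GA[OF k]]])
  qed
  also have "\<dots> = (\<Sum>k\<in>Om. gm (gdd (x k)) (wk k)) + (\<Sum>k\<in>Om. koszul (m - kd k) (gm (x k) (gdd (wk k))))"
    by (rule sum.distrib)
  also have "(\<Sum>k\<in>Om. koszul (m - kd k) (gm (x k) (gdd (wk k)))) =
      (\<Sum>i\<in>verts Q. \<Sum>p\<in>frm i. koszul (m - 1) (gm (x (Loop i, p)) (gdd (wk (Loop i, p)))))"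
  proof -
    have "(\<Sum>\<alpha>\<in>arcs Q. \<Sum>p\<in>frm (tail Q \<alpha>). koszul (m - kd (Rev \<alpha>, p)) (gm (x (Rev \<alpha>, p)) (gdd (wk (Rev \<alpha>, p))))) = 0"
      by (intro sum.neutral ballI) (auto simp: gdd_wk_Rev)
    then show ?thesis unfolding sum_Om by simp
  qed
  also have "\<dots> = (\<Sum>i\<in>verts Q. \<Sum>p\<in>frm i. S1 i p - S2 i p)"
  proof (intro sum.cong refl)
    fix i p assume i: "i \<in> verts Q" and "p \<in> frm i"
    then have Om: "(Loop i, p) \<in> Om" by simp
    show "koszul (m - 1) (gm (x (Loop i, p)) (gdd (wk (Loop i, p)))) = S1 i p - S2 i p"
      unfolding S1_def S2_def gdd_wk_Loop[OF Om] pmult_diff_right pmult_sum_right koszul_diff koszul_sum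
      by (simp only: pmult_koszul_left pmult_assoc)
  qed
  also have "(\<Sum>k\<in>Om. gm (gdd (x k)) (wk k)) + \<dots> = bG (dEG m x)"
    unfolding bG_def S1_def S2_def by (rule E.sum_Ed[OF x pmult_diff_left, symmetric])
  finally show ?thesis by simp
qed

text \<open>Read from the end, the list is cut at the first letter that is not an arrow of
  Q.\<close>

lemma wk_suffix_unique:
  assumes "xs @ w # map Arr as = ys @ w' # map Arr bs" "\<nexists>\<alpha>. w = Arr \<alpha>" "\<nexists>\<alpha>. w' = Arr \<alpha>"
  shows "xs = ys \<and> w = w' \<and> as = bs"
proof -
  have "takeWhile (\<lambda>a. \<exists>\<alpha>. a = Arr \<alpha>) (rev (zs @ v # map Arr cs)) = rev (map Arr cs)"
    and "dropWhile (\<lambda>a. \<exists>\<alpha>. a = Arr \<alpha>) (rev (zs @ v # map Arr cs)) = v # rev zs"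
    if "\<nexists>\<alpha>. v = Arr \<alpha>" for zs v cs
    using that by (auto simp: takeWhile_append2 dropWhile_append2 rev_map takeWhile_append dropWhile_append)
  from this[of w xs as] this[of w' ys bs] assms show ?thesis
    by (auto simp: inj_map_eq_map inj_def)
qed

lemma Om_not_Arr: "(w, p) \<in> Om \<Longrightarrow> \<nexists>\<alpha>. w = Arr \<alpha>"
  by auto

lemma lk_wk:
  assumes k: "k \<in> Om" and l: "l \<in> Om" and p: "gtgt p = srcW (fst l)"
  shows "lk (gm x (wk k)) (fst p, snd p @ snd (wkp l)) = (if k = l then lk x p else 0)"
proof (induction x rule: pm_induct)
  case (single q c)
  have kl: "fst k = fst l \<and> snd (snd k) = snd (snd l) \<longleftrightarrow> k = l"
    using k l by (auto simp: Om_def prod_eq_iff)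
  have "snd q @ snd (wkp k) = snd p @ snd (wkp l) \<longleftrightarrow> snd q = snd p \<and> k = l"
    using wk_suffix_unique[of "snd q" "fst k" "snd (snd k)" "snd p" "fst l" "snd (snd l)"] kl
      Om_not_Arr[of "fst k" "snd k"] Om_not_Arr[of "fst l" "snd l"] k l
    by (auto simp: wkp_def)
  then have eq: "(fst q, snd q @ snd (wkp k)) = (fst p, snd p @ snd (wkp l)) \<longleftrightarrow> q = p \<and> k = l"
    by (auto simp: prod_eq_iff)
  have g: "gm (sg q c) (wk k) = (if gtgt q = srcW (fst k) then sg (fst q, snd q @ snd (wkp k)) c else 0)"
    by (simp add: pmult_single wkp_path(4)[OF k])
  show ?case
  proof (cases "q = p \<and> k = l")
    case True
    then show ?thesis using p g by simp
  next
    case False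
    then have z: "lk (sg (fst q, snd q @ snd (wkp k)) c) (fst p, snd p @ snd (wkp l)) = 0"
      using eq by (intro lookup_single_not_eq) blast
    have "(if k = l then lk (sg q c) p else 0) = 0" using False by (auto simp: lookup_single_not_eq)
    then show ?thesis using z by (simp add: g)
  qed
qed (auto simp: pmult_add_left lookup_add)

text \<open>The coefficient of \<open>x l\<close> at p reappears in \<open>bG x\<close> at p
  followed by the path of l, by uniqueness of the cut. If p does not end at the source of l, that
  coefficient is zero by the idempotent condition in \<open>Ecar\<close>.\<close>

lemma bG_inj:
  assumes x: "x \<in> EG n m" and 0: "bG x = 0"
  shows "x = 0"
proof (rule ext)
  interpret E: right_dg Q "GW n" "\<lambda>_. gdd" "\<lambda>_ x a. gm x (emb a)" by (rule GW_rdg)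
  fix l
  show "x l = 0 l"
  proof (cases "l \<in> Om")
    case True
    have "lk (x l) p = 0" for p
    proof (cases "gtgt p = srcW (fst l)")
      case True
      have "lk (bG x) (fst p, snd p @ snd (wkp l)) = (\<Sum>k\<in>Om. if k = l then lk (x k) p else 0)"
        unfolding bG_def lk_sum by (intro sum.cong refl lk_wk[OF _ \<open>l \<in> Om\<close> True])
      then show ?thesis using \<open>l \<in> Om\<close> by (simp add: 0)
    next
      case False
      have "gm (x l) (emb (ev (srcW (fst l)))) = x l" using E.Ecar_ev[OF x True] by simp
      then show ?thesis using lk_idem_right[of GQ "x l" "srcW (fst l)" p] False by (simp add: emb_single)
    qed
    then show ?thesis by (intro poly_mapping_eqI) simp
  qed (simp add: E.Ecar_out[OF x])
qed

lemma wt_decomp: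
  assumes "is_path GQ (u, as)" "gwt (u, as) = Suc n"
  obtains cs w bs where "as = cs @ w # map Arr bs" "w \<in> WA" "is_path GQ (u, cs)" "gtgt (u, cs) = srcW w"
    "is_path Q (tgtW w, bs)" "gwt (u, cs) = n"
proof -
  interpret G: fin_digraph GQ by (rule fin_GQ)
  have "\<exists>cs w bs. as = cs @ w # map Arr bs \<and> (\<nexists>\<alpha>. w = Arr \<alpha>)"
    using assms(2)
  proof (induction as rule: rev_induct)
    case (snoc a as)
    show ?case
    proof (cases a)
      case (Arr \<alpha>)
      then have "gwt (u, as) = Suc n" using snoc.prems by (simp add: gwt_def)
      with snoc.IH obtain cs w bs where "as = cs @ w # map Arr bs" "\<nexists>\<alpha>. w = Arr \<alpha>" by blast
      then show ?thesis using Arr by (intro exI[of _ cs] exI[of _ w] exI[of _ "bs @ [\<alpha>]"]) simp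
    qed (rule exI[of _ as], rule exI[of _ a], rule exI[of _ "[]"], simp)+
  qed simp
  then obtain cs w bs where as: "as = cs @ w # map Arr bs" "\<nexists>\<alpha>. w = Arr \<alpha>" by blast
  have p: "is_path GQ (u, cs)" "w \<in> arcs GQ" "gtgt (u, cs) = srcW w" "is_path Q (tgtW w, bs)"
    using assms(1) by (auto simp: as G.is_path_append simp del: GQ_simps)
  have w: "w \<in> WA" using p(2) as(2) by (auto simp: WA_def)
  then have "awt w = 1" by (auto simp: WA_def)
  then have "gwt (u, cs) = n" using assms(2) by (simp add: as gwt_def)
  then show ?thesis using that as p w by blast
qed

lemma bG_surj:
  fixes z :: "('v, 'e, 'k::field) gvec"
  assumes "z \<in> GW (Suc n) m"
  shows "\<exists>x\<in>EG n m. bG x = z"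
proof -
  interpret E: right_dg Q "GW n" "\<lambda>_. gdd" "\<lambda>_ x (a :: ('v, 'e, 'k) pvec). gm x (emb a)" by (rule GW_rdg)
  interpret EE: ab_complex "EG n" "dEG :: _ \<Rightarrow> (_ \<Rightarrow> (_ \<Rightarrow>\<^sub>0 'k)) \<Rightarrow> _" by (rule E.E_complex)
  show ?thesis using assms
  proof (induction z rule: GW_induct)
    case zero
    show ?case using EE.zero by (intro bexI[of _ 0]) (auto simp: bG_def)
  next
    case (single u as c)
    obtain cs w bs where *: "as = cs @ w # map Arr bs" "w \<in> WA" "is_path GQ (u, cs)" "gtgt (u, cs) = srcW w"
      "is_path Q (tgtW w, bs)" "gwt (u, cs) = n"
      using wt_decomp[OF single(1,2)] by metis
    define k where "k = (w, (tgtW w, bs))"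
    have k: "k \<in> Om" using * by (simp add: k_def Om_def paths_iff)
    define x where "x = (\<lambda>j. if j = k then sg (u, cs) c else 0)"
    have deg: "gpath_degree (u, cs) = m - kd k"
      using single(3) by (simp add: *(1) k_def gpath_degree_def)
    have "x \<in> EG n m"
      using * k deg Om_srcW by (auto simp: E.Ecar_def x_def GW_zero emb_single pmult_single k_def intro!: GW_single)
    moreover have "bG x = sg (u, as) c"
    proof -
      have "bG x = (\<Sum>j\<in>Om. if j = k then gm (sg (u, cs) c) (wk k) else 0)"
        unfolding bG_def by (intro sum.cong refl) (simp add: x_def)
      also have "\<dots> = gm (sg (u, cs) c) (wk k)" using k by simp
      also have "\<dots> = sg (u, as) c" using * by (simp add: pmult_single wkp_def k_def)
      finally show ?thesis .
    qed
    ultimately show ?case by blast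
  next
    case (add x y)
    then obtain a b where "a \<in> EG n m" "b \<in> EG n m" "bG a = x" "bG b = y" by blast
    then show ?case using EE.add[of a m b] bG_add[of a b] by metis
  qed
qed

end

context generators
begin

text \<open>Right linearity of \<open>phi\<close> over kQ, the condition under which it can be
  tensored with \<Theta>.\<close>

lemma phi_emb:
  assumes z: "z \<in> GW n m" and a: "a \<in> PA"
  shows "phi (gm z (emb a)) = act (PR n) m (phi z) a"
  using z
proof (induction z rule: GW_induct)
  case (single u as c)
  note x = php_in(1)[OF single(1), unfolded single]
  have "a \<in> PA \<and> phi (gm (sg (u, as) c) (emb a)) = act (PR n) m (phi (sg (u, as) c)) a" using a
  proof (induction a rule: path_algebra_induct)
    case (single q b)
    obtain v bs where q: "q = (v, bs)" by (cases q)
    have qp: "q \<in> paths" using single by (simp add: paths_iff)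
    have "phi (gm (sg (u, as) c) (emb (sg q b))) = (c * b) \<odot> act (PR n) m (php (u, as)) (pt q)"
    proof (cases "gtgt (u, as) = v")
      case True
      have "ph (map Arr bs) (PR n) m (php (u, as)) = act (PR n) m (php (u, as)) (pt (v, bs))"
        using ph_map_Arr[OF pcP, of v bs "php (u, as)" n m] single x php_in(2)[OF \<open>is_path GQ (u, as)\<close>] True q
          \<open>gwt (u, as) = n\<close> \<open>gpath_degree (u, as) = m\<close> by simp
      moreover have "ph (as @ map Arr bs) RQ 0 (ev u) = ph (map Arr bs) (PR n) m (php (u, as))"
        using ph_append[OF path_arcs[OF \<open>is_path GQ (u, as)\<close>], of "map Arr bs" RQ 0 "ev u"]
          \<open>gwt (u, as) = n\<close> \<open>gpath_degree (u, as) = m\<close> by (simp add: gwt_def gpath_degree_def)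
      ultimately show ?thesis using True by (simp add: q emb_single pmult_single phi_single)
    next
      case False
      then show ?thesis
        using php_pt[OF \<open>is_path GQ (u, as)\<close> qp] \<open>gwt (u, as) = n\<close> \<open>gpath_degree (u, as) = m\<close>
        by (simp add: q emb_single pmult_single)
    qed
    moreover have "act (PR n) m (c \<odot> php (u, as)) (b \<odot> pt q) = (c * b) \<odot> act (PR n) m (php (u, as)) (pt q)"
      using x qp by (simp add: act_scale_left[OF pcP] act_scale_right[OF pcP] path_algebra_scale)
    ultimately show ?case using pscale_single[of b q "1::'k"] single by (simp add: phi_single path_algebra_single)
  next
    case zero
    then show ?case using x by (simp add: phi_single act_zero_right[OF pcP el_scale[OF pcP]])
  next
    case (add a b)
    then show ?case using x by (simp add: phi_single emb_add pmult_add_right phi_add act_add_right[OF pcP el_scale[OF pcP]] path_algebra_add)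
  qed
  then show ?case ..
next
  case (add y z)
  then show ?case using a by (simp add: pmult_add_left phi_add act_add_left[OF pcP] phi_in)
qed (simp add: act_zero_left[OF pcP a])

text \<open>If z ends at the source of w, this is evaluation of a concatenated path. Otherwise both
  sides vanish: the element chosen for w is fixed by the idempotent at its source, and balancedness
  of \<open>tens\<close> moves that idempotent onto \<open>phi z\<close>.\<close>

lemma phi_wk:
  assumes z: "z \<in> GW n m" and k: "k \<in> Om"
  shows "phi (gm z (wk k)) = act (PR (Suc n)) (kd k + m) (tens (PR n) m (phi z) (kd k) (mw (fst k))) (pt (snd k))"
  using z
proof (induction z rule: GW_induct)
  case zero
  then show ?case by (simp add: tens_zero_left[OF pcP] act_zero_left[OF T_pc[OF pcP] pt_Om[OF k]])
next
  case (add y z)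
  have "tens (PR n) m (phi y) (kd k) (mw (fst k)) \<in> el (PR (Suc n)) (kd k + m)" if "y \<in> GW n m" for y
    using tens_in[OF pcP phi_in[OF that] mw_in[OF k]] by simp
  with add show ?case
    by (simp add: pmult_add_left phi_add tens_add_left[OF pcP] phi_in act_add_left[OF T_pc[OF pcP] _ _ pt_Om[OF k]])
next
  case (single u as c)
  obtain w v bs where kw: "k = (w, (v, bs))" by (cases k) (metis prod.collapse)
  have w: "w \<in> WA" "v = tgtW w" "is_path Q (v, bs)" using k kw by (auto simp: Om_def paths_iff)
  let ?x = "php (u, as)" and ?k = "garc_degree w"
  have x: "?x \<in> el (PR n) m" "act (PR n) m ?x (ev (gtgt (u, as))) = ?x"
    using php_in[OF single(1)] single by auto
  let ?t = "tens (PR n) m ?x ?k (mw w)"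
  have t: "?t \<in> el (PR (Suc n)) (?k + m)" using tens_in[OF pcP x(1) WA_mw(1)[OF w(1)]] by simp
  have pt: "pt (v, bs) \<in> (PA :: ('v, 'e, 'k) pvec set)" using w(3) by (simp add: path_algebra_single)
  have sc: "act (PR (Suc n)) (?k + m) (tens (PR n) m (c \<odot> ?x) ?k (mw w)) (pt (v, bs)) = c \<odot> act (PR (Suc n)) (?k + m) ?t (pt (v, bs))"
    using x t pt act_scale_left[OF pcP, of ?t "Suc n" "?k + m" "pt (v, bs)" c] by (simp add: tens_scale_left[OF pcP])
  show ?case
  proof (cases "gtgt (u, as) = srcW w")
    case True
    have "act (PR (Suc n)) (?k + m) ?t (ev v) = ?t"
      using tens_act_right[OF pcP x(1) WA_mw(1,5)[OF w(1)]] WA_mw(3)[OF w(1)] w(2) by simp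
    then have "ph (map Arr bs) (PR (Suc n)) (?k + m) ?t = act (PR (Suc n)) (?k + m) ?t (pt (v, bs))"
      by (rule ph_map_Arr[OF pcP w(3) t])
    moreover have "ph (as @ w # map Arr bs) RQ 0 (ev u) = ph (map Arr bs) (PR (Suc n)) (?k + m) ?t"
      using ph_append[OF path_arcs[OF single(1)], of "w # map Arr bs" RQ 0 "ev u"] single
      by (simp add: gwt_def gpath_degree_def ph_WA[OF w(1)])
    ultimately show ?thesis using True sc by (simp add: kw wkp_def pmult_single phi_single)
  next
    case False
    have sv: "srcW w \<in> verts Q" using Om_srcW[OF k] kw by simp
    then have ee: "ev (srcW w) \<in> (PA :: ('v, 'e, 'k) pvec set)" by simp
    have "act (PR n) m ?x (ev (srcW w)) = 0"
      using php_pt[OF single(1), of "(srcW w, [])"] False sv single by simp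
    moreover have "?t = tens (PR n) m (act (PR n) m ?x (ev (srcW w))) ?k (mw w)"
      using tens_act_left[OF pcP x(1) ee, of ?k "mw w"] WA_mw(2)[OF w(1)] by simp
    ultimately have "?t = 0" by (simp add: tens_zero_left[OF pcP])
    then show ?thesis using False sc act_zero_left[OF pcP pt, of "Suc n" "?k + m"]
      by (simp add: kw wkp_def pmult_single phi_single)
  qed
qed

lemma GW_complex: "ab_complex (GW n :: int \<Rightarrow> (_ \<Rightarrow>\<^sub>0 'k) set) (\<lambda>_. gdd)"
  using GW_rdg[of n, where 'k = 'k] by (simp add: right_dg_def)

lemma phi_chain: "chain_map (GW n) (\<lambda>_. gdd) (el (PR n)) (dif (PR n)) (\<lambda>_. phi)"
  by (intro chain_map.intro chain_map_axioms.intro GW_complex cpx_el[OF pcP])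
    (auto simp: phi_in phi_diff phi_gdd)

lemma phi_bG:
  assumes x: "x \<in> EG n m"
  shows "phi (bG x) = PhiX (PR n) m (\<lambda>k. phi (x k))"
proof -
  interpret E: right_dg Q "GW n" "\<lambda>_. gdd" "\<lambda>_ x (a :: ('v, 'e, 'k) pvec). gm x (emb a)" by (rule GW_rdg)
  show ?thesis
    unfolding bG_def phi_sum PhiX_def
  proof (rule sum.cong[OF refl])
    fix k assume k: "k \<in> Om"
    show "phi (gm (x k) (wk k)) = act (fob T (PR n)) m (tens (PR n) (m - kd k) (phi (x k)) (kd k) (mw (fst k))) (pt (snd k))"
      using phi_wk[OF E.Ecar_in[OF x k] k] by simp
  qed
qed

text \<open>A path of weight 0 uses arrows of Q only. Together with \<open>phi_emb_id\<close> this
  makes \<open>phi\<close> an isomorphism in weight 0, the start of the induction.\<close>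

lemma GW_0: "x \<in> GW 0 m \<Longrightarrow> x = emb (phi x)"
proof (induction x rule: GW_induct)
  case (single u as c)
  have "\<exists>bs. as = map Arr bs" using single(2)
  proof (induction as)
    case (Cons a as)
    then show ?case by (cases a) (auto simp: gwt_def intro: exI[of _ "_ # _"])
  qed simp
  then obtain bs where as: "as = map Arr bs" ..
  have p: "is_path Q (u, bs)" and u: "u \<in> verts Q" using single(1) path_verts[OF single(1)] as by auto
  have "ph (map Arr bs) RQ 0 (ev u) = pt (u, bs)"
    using ph_map_Arr[OF pcR p, of "ev u" 0] u by (simp add: el_R act_R pm_pt pcat_def)
  then show ?case by (simp add: as phi_single pscale_single emb_single)
qed (auto simp: phi_add emb_add)

lemma phi_emb_id: "a \<in> PA \<Longrightarrow> phi (emb a) = a"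
proof (induction a rule: path_algebra_induct)
  case (single p c)
  then have "fst p \<in> verts Q" using fst_paths[of p] by (simp add: paths_iff)
  then show ?case
    using ph_map_Arr[OF pcR, of "fst p" "snd p" "ev (fst p)" 0] single
    by (simp add: el_R act_R pm_pt pcat_def phi_single pscale_single emb_single)
qed (auto simp: phi_add emb_add)

text \<open>Composed with \<open>bG\<close>, \<open>phi\<close> in weight n + 1 factors by
  \<open>phi_bG\<close> into \<open>phi \<otimes> \<Theta>\<close> in weight n and the map
  \<open>PhiX\<close> at T^n kQ. The first has an exact cone by \<open>Emap_exact\<close> and the
  induction hypothesis, the second by \<open>CX_is_exact\<close>.\<close>

lemma phi_exact: "exact_cpx (cone_el (GW n) (el (PR n))) (cone_d (\<lambda>_. gdd) (dif (PR n)) (\<lambda>_. phi))"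
proof (induction n)
  case 0
  interpret c: chain_map "GW 0" "\<lambda>_. gdd" "el RQ" "dif RQ" "\<lambda>_. phi" using phi_chain[of 0] by simp
  have "exact_cpx (cone_el (GW 0) (el RQ)) (cone_d (\<lambda>_. gdd) (dif RQ) (\<lambda>_. phi))"
    unfolding c.cone_exact_iff
  proof (intro allI ballI impI)
    fix m and x :: "('v, 'e, 'k) gvec" and y :: "('v, 'e, 'k) pvec"
    assume x: "x \<in> GW 0 m" and y: "y \<in> el RQ (m + 1)" and "phi x = dif RQ (m + 1) y"
    then have "x = 0" using GW_0[OF x] by simp
    moreover have "emb y \<in> GW 0 (m + 1)" "phi (emb y) = y"
      using y emb_GW[of y] phi_emb_id[of y] by (auto simp: el_R GW_zero split: if_splits)
    moreover have "0 \<in> el RQ (m + 2)" by (rule el_zero[OF pcR])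
    ultimately show "\<exists>x'\<in>GW 0 (m + 1). \<exists>y'\<in>el RQ (m + 2). gdd x' = x \<and> phi x' - dif RQ (m + 2) y' = y"
      by (intro bexI[of _ "emb y"] bexI[of _ 0]) (auto simp: gdd_emb)
  qed
  then show ?case by (simp only: Pn_simps)
next
  case (Suc n)
  interpret c: chain_map "GW (Suc n)" "\<lambda>_. gdd" "el (PR (Suc n))" "dif (PR (Suc n))" "\<lambda>_. phi" by (rule phi_chain)
  interpret E: right_dg Q "GW n" "\<lambda>_. gdd" "\<lambda>_ x (a :: ('v, 'e, 'k) pvec). gm x (emb a)" by (rule GW_rdg)
  note Em = Emap_chain[OF GW_rdg rdg_X[OF pcP] phi_chain phi_emb] and
    Ex = Emap_exact[OF GW_rdg rdg_X[OF pcP] phi_chain phi_emb Suc.IH]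
  have ex: "exact_cpx (cone_el (EG n) (el (PR (Suc n)))) (cone_d dEG (dif (PR (Suc n))) (\<lambda>m x. phi (bG x)))"
    using cone_exact_comp[OF Em PhiX_chain[OF pcP] Ex CX_is_exact[OF pcP], of "\<lambda>m x. phi (bG x)"] phi_bG by simp
  show ?case
    unfolding c.cone_exact_iff
  proof (intro allI ballI impI)
    fix m and x :: "('v, 'e, 'k) gvec" and y :: "('v, 'e, 'k) pvec"
    assume x: "x \<in> GW (Suc n) m" and y: "y \<in> el (PR (Suc n)) (m + 1)" and dx: "gdd x = 0" and xy: "phi x = dif (PR (Suc n)) (m + 1) y"
    obtain \<xi> where \<xi>: "\<xi> \<in> EG n m" "bG \<xi> = x" using bG_surj[OF x] by blast
    \<comment> \<open>\<open>bG\<close> is injective and commutes with the differentials, so cycles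
      correspond to cycles and exactness is carried back along it.\<close>
    have "dEG m \<xi> = 0"
      using bG_inj[OF ab_complex.D_in[OF E.E_complex \<xi>(1)]] bG_d[OF \<xi>(1)] \<xi>(2) dx by simp
    then have "cone_d dEG (dif (PR (Suc n))) (\<lambda>m x. phi (bG x)) m (\<xi>, y) = 0"
      using \<xi>(2) xy by (simp add: cone_d_def zero_prod_def)
    moreover have "(\<xi>, y) \<in> cone_el (EG n) (el (PR (Suc n))) m" using \<xi>(1) y by (simp add: cone_el_def)
    ultimately obtain c where c: "c \<in> cone_el (EG n) (el (PR (Suc n))) (m + 1)"
      "cone_d dEG (dif (PR (Suc n))) (\<lambda>m x. phi (bG x)) (m + 1) c = (\<xi>, y)"
      using ex unfolding exact_cpx_def by blast
    have "bG (fst c) \<in> GW (Suc n) (m + 1)" "snd c \<in> el (PR (Suc n)) (m + 2)" "gdd (bG (fst c)) = x"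
      "phi (bG (fst c)) - dif (PR (Suc n)) (m + 2) (snd c) = y"
      using c bG_in[of "fst c" n "m + 1"] bG_d[of "fst c" n "m + 1"] \<xi>(2) by (auto simp: cone_el_def cone_d_def add.assoc)
    then show "\<exists>x'\<in>GW (Suc n) (m + 1). \<exists>y'\<in>el (PR (Suc n)) (m + 2). gdd x' = x \<and> phi x' - dif (PR (Suc n)) (m + 2) y' = y"
      by blast
  qed
qed

section \<open>From single weights to the whole algebra\<close>

lemma phi_exactD:
  assumes "x \<in> GW n m" "y \<in> el (PR n) (m + 1)" "gdd x = 0" "phi x = dif (PR n) (m + 1) y"
  obtains x' y' where "x' \<in> GW n (m + 1)" "y' \<in> el (PR n) (m + 2)" "gdd x' = x" "phi x' - dif (PR n) (m + 2) y' = y"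
  using phi_exact[of n] assms unfolding chain_map.cone_exact_iff[OF phi_chain] by blast

lemma OD_hat:
  assumes "f \<in> OD m"
  shows "lk f n 0 (punit Q) \<in> el (PR n) m" "lk f n = hat (PR n) m (lk f n 0 (punit Q))"
    "lk (odif m f) n = hat (PR n) (m - 1) (dif (PR n) m (lk f n 0 (punit Q)))"
proof -
  show y: "lk f n 0 (punit Q) \<in> el (PR n) m" by (rule hom_R_el[OF pcP OD_lk[OF assms]])
  show h: "lk f n = hat (PR n) m (lk f n 0 (punit Q))" using hat_surj[OF pcP OD_lk[OF assms]] by simp
  show "lk (odif m f) n = hat (PR n) (m - 1) (dif (PR n) m (lk f n 0 (punit Q)))"
    using hat_dif[OF pcP y] lk_odif[OF assms] h by simp
qed

lemma hat_inj: "x \<in> el (PR n) m \<Longrightarrow> y \<in> el (PR n) m \<Longrightarrow> hat (PR n) m x = hat (PR n) m y \<Longrightarrow> x = y"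
  by (metis hat_unit[OF pcP])

text \<open>The differential preserves the weight and x has finitely many weights, so preimages
  found weight by weight can be added up.\<close>

lemma phO_injective:
  assumes x: "x \<in> GA m" and dx: "gdd x = 0" and f: "f \<in> OD (m + 1)" "phO m x = odif (m + 1) f"
  shows "\<exists>x'\<in>GA (m + 1). gdd x' = x"
proof -
  have "\<exists>x'. x' \<in> GW n (m + 1) \<and> gdd x' = wp n x" for n
  proof -
    let ?y = "lk f n 0 (punit Q)"
    have z: "wp n x \<in> GW n m" "gdd (wp n x) = 0" using wp_GW[OF x] wp_gdd[OF x, of n] dx by auto
    have "hat (PR n) m (phi (wp n x)) = hat (PR n) m (dif (PR n) (m + 1) ?y)"
      using lk_phO[of m x n] f(2) OD_hat(3)[OF f(1), of n] by simp
    then have "phi (wp n x) = dif (PR n) (m + 1) ?y"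
      using phi_in[OF z(1)] d_in[OF pcP OD_hat(1)[OF f(1)], of n] by (intro hat_inj) auto
    with z OD_hat(1)[OF f(1)] show ?thesis by (metis phi_exactD)
  qed
  then obtain g where g: "\<And>n. g n \<in> GW n (m + 1)" "\<And>n. gdd (g n) = wp n x" by metis
  show ?thesis
  proof (intro bexI)
    show "gdd (\<Sum>n\<in>gwt ` ks x. g n) = x" using sum_wp[of x] by (simp add: gdd_sum g(2))
    show "(\<Sum>n\<in>gwt ` ks x. g n) \<in> GA (m + 1)" by (intro GA_sum GW_GA[OF g(1)])
  qed
qed

lemma phO_surjective:
  assumes y: "y \<in> OD m" and dy: "odif m y = 0"
  shows "\<exists>x\<in>GA m. gdd x = 0 \<and> (\<exists>f\<in>OD (m + 1). y - phO m x = odif (m + 1) f)"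
proof -
  have "\<exists>x' y'. x' \<in> GW n m \<and> y' \<in> el (PR n) (m + 1) \<and> gdd x' = 0 \<and> phi x' - dif (PR n) (m + 1) y' = lk y n 0 (punit Q)" for n
  proof -
    let ?y = "lk y n 0 (punit Q)"
    have "hat (PR n) (m - 1) (dif (PR n) m ?y) = hat (PR n) (m - 1) 0"
      using OD_hat(3)[OF y, of n] dy by (simp add: hat_zero[OF pcP])
    \<comment> \<open>The pair (0, y) is a cycle of the cone in degree m - 1; bounding it gives the
      surjectivity in degree m.\<close>
    then have "phi 0 = dif (PR n) m ?y"
      using hat_inj[OF d_in[OF pcP OD_hat(1)[OF y]] el_zero[OF pcP]] by simp
    then show ?thesis
      using phi_exactD[of 0 n "m - 1" ?y] OD_hat(1)[OF y, of n] by (simp add: GW_zero gdd_zero) (metis add.commute)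
  qed
  then obtain g h where g: "\<And>n. g n \<in> GW n m" "\<And>n. gdd (g n) = 0" and h: "\<And>n. h n \<in> el (PR n) (m + 1)"
    and gh: "\<And>n. phi (g n) - dif (PR n) (m + 1) (h n) = lk y n 0 (punit Q)" by metis
  \<comment> \<open>The sign in \<open>?f\<close> is that of the cone differential, which gives the
    component of y as phi (g n) minus the boundary of h n. Restricting to the support of y keeps
    both sums finite.\<close>
  let ?x = "\<Sum>n\<in>ks y. g n" and ?f = "\<Sum>n\<in>ks y. sg n (hat (PR n) (m + 1) (- h n))"
  have x: "?x \<in> GA m" by (intro GA_sum GW_GA[OF g(1)])
  have f: "?f \<in> OD (m + 1)" using h by (intro OD_sum OD_single hat_hom[OF pcP]) (auto simp: el_uminus[OF pcP])
  have wx: "wp n ?x = (if n \<in> ks y then g n else 0)" for n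
  proof -
    have "wp n ?x = (\<Sum>i\<in>ks y. wp n (g i))" by (simp add: wp_def lext_sum)
    also have "\<dots> = (\<Sum>i\<in>ks y. if i = n then g n else 0)"
      by (intro sum.cong refl) (auto simp: wp_id[OF g(1)] wp_other[OF g(1)])
    finally show ?thesis by simp
  qed
  have "y - phO m ?x = odif (m + 1) ?f"
  proof (intro poly_mapping_eqI)
    fix n
    have lf: "lk ?f n = (if n \<in> ks y then hat (PR n) (m + 1) (- h n) else 0)"
      by (simp add: lk_sum lookup_single when_def sum.delta')
    show "lk (y - phO m ?x) n = lk (odif (m + 1) ?f) n"
    proof (cases "n \<in> ks y")
      case True
      have d: "dif (PR n) (m + 1) (h n) \<in> el (PR n) m" using d_in[OF pcP h] by simp
      have p: "phi (g n) \<in> el (PR n) m" by (rule phi_in[OF g(1)])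
      have "lk y n = hat (PR n) m (phi (g n) - dif (PR n) (m + 1) (h n))"
        using OD_hat(2)[OF y, of n] gh[of n] by simp
      also have "\<dots> = hat (PR n) m (phi (g n)) + hat (PR n) m (- dif (PR n) (m + 1) (h n))"
        using hat_add[OF pcP p el_uminus[OF pcP d]] by simp
      finally show ?thesis
        using True lk_odif[OF f, of n] hat_dif[OF pcP el_uminus[OF pcP h], of n]
        by (simp add: lookup_minus lk_phO wx lf d_uminus[OF pcP h])
    next
      case False
      then show ?thesis
        using lk_odif[OF f, of n]
        by (simp add: lookup_minus lk_phO wx lf hat_zero[OF pcP] dhom_zero[OF pcR pcP] in_keys_iff)
    qed
  qed
  then show ?thesis using x f g(2) by (intro bexI[of _ ?x]) (auto simp: gdd_sum)
qed

theorem phO_quasi_iso: "dga_quasi_iso GZ OA phO"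
  unfolding dga_quasi_iso_def dcycles_def dboundaries_def GZ_simps OA_simps
proof (intro conjI allI ballI impI phO_hom)
  fix m x assume "x \<in> {x \<in> GA m. gdd x = 0}" "phO m x \<in> odif (m + 1) ` OD (m + 1)"
  then show "x \<in> gdd ` GA (m + 1)" using phO_injective[of x m] by auto
next
  fix m y assume "y \<in> {x \<in> OD m. odif m x = 0}"
  then obtain x f where "x \<in> GA m" "gdd x = 0" "f \<in> OD (m + 1)" "y - phO m x = odif (m + 1) f"
    using phO_surjective[of y m] by auto
  then show "\<exists>x\<in>{x \<in> GA m. gdd x = 0}. y - phO m x \<in> odif (m + 1) ` OD (m + 1)" by auto
qed

end

theorem theoremC:
  fixes Q :: "('v, 'e) pre_digraph"
    and T :: "('v, 'e, 'k::{alg_closed_field, field_char_0}) dg_functor"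
  assumes "fin_digraph Q"
    and "acyclic_quiver Q"
    and "inverse_translate_lift Q T"
  shows "\<exists>\<phi>. dga_quasi_iso (ginzburg_algebra Q) (orbit_algebra Q T) \<phi>"
proof -
  interpret dg_endofunctor Q T
    using assms by (simp add: dg_endofunctor_def quiver_def quiver_axioms_def dg_endofunctor_axioms_def inverse_translate_lift_def)
  obtain tr where "trace_form Q T tr" using trace_form_exists[OF assms(3)] by blast
  then interpret trace_form Q T tr .
  obtain mL where "loop_generators Q T tr mL"
    using loop_generators_exist trace_form_axioms by (auto simp: loop_generators_def loop_generators_axioms_def)
  then interpret loop_generators Q T tr mL .
  obtain mR where "generators Q T tr mL mR"
    using rev_generators_exist loop_generators_axioms by (auto simp: generators_def generators_axioms_def)
  then interpret generators Q T tr mL mR .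
  show ?thesis using phO_quasi_iso by blast
qed

end
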